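(* (1) A lifting attempt of a generic surface with no non-trivial closed double arcs is successful if and only if it does not produce a cyclic height relation at any triple value. (2) A generic surface is liftable if and only if it has no non-trivial closed double arcs and at least one of its lifting attempts does not produce a cyclic height relation at any triple value.
   Context: All manifolds and maps are PL. A generic surface is a proper PL map $i:F\to M$ from a compact surface $F$ to a 3-manifold $M$ such that every $p\in i(F)$ has a neighborhood $N(p)$ in $M$ for which $(N(p),N(p)\cap i(F))$ is homeomorphic to one of: (1) ($D^3$, the union of 1, 2 or 3 of the coordinate planes in $D^3$) (regular, double, triple value); (2) ($D^3$, a cone over a figure-8 curve in $\partial D^3$) (branch value; a PL version of Whitney's umbrella, with a single $i$-preimage); (3) ($D^3\cap\{z\ge0\}$, the union of one or two of the $xz$ and $yz$ planes) (RB, DB value). A lifting of $i$ is a proper one-to-one (locally flat) PL map $k=(i,h):F\to M\times\mathbb{R}$, with $h:F\to\mathbb{R}$ a PL height function. $i$ is liftable if it has a lifting. Double arcs: the double values form curves; a double arc is an immersed 1-manifold obtained by following such a curve, going straight through each triple value it meets. A double arc is open if it ends in DB or branch values at both ends, and closed if it closes into a circle. Locally along a double arc two sheets of surface cross, so a neighborhood of the arc is an immersed image of a bundle with fibre an "X"; the two crossing lines of the X's give two strips of surface. For an open arc the bundle is over an interval and there are two distinct strips. For a closed arc the bundle is over $S^1$; the arc is trivial if going once around the arc returns each of the two strips to itself (two separate closed strips), and non-trivial if going once around interchanges them (one big closed strip). A lifting attempt of a generic surface with no non-trivial closed double arcs is a choice, for each double arc, of which of the two strips that intersect along it is declared higher.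 It is successful if there is a lifting $(i,h)$ realizing it, i.e. along each arc, of the two preimages of each double value, the one in the chosen strip has larger $h$. At a triple value three sheets meet, each two of which cross along a segment of some double arc; a lifting attempt thus decides, for each two of the three sheets, which is higher. It produces a cyclic height relation at the triple value if these decisions are cyclic (for some naming of the sheets, sheet 1 is lower than sheet 2, sheet 2 lower than sheet 3, and sheet 3 lower than sheet 1).
   Formalization: A generic surface is also required to have one embedded sheet over each plane of the local model (so regular, double, triple values have 1, 2, 3 preimages); by the image alone, the double cover of RP² in RP³ by S² would be generic and violate (1) and (2). *)

theory Defs
  imports "HOL-Analysis.Analysis"
begin

section \<open>Piecewise linear maps and manifolds\<close>

text \<open>
  PL spaces are subsets of Euclidean spaces, as in Rourke and Sanderson's textbook: this loses
  nothing, as every (second countable, Hausdorff) PL manifold embeds in some \<open>\<real>\<^sup>N\<close>.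
  A map is PL on \<open>X\<close> if every point of \<open>X\<close> has a neighbourhood in \<open>X\<close> that is a finite union of
  polytopes on each of which the map is affine.  This forces \<open>X\<close> to be a polyhedron (in the sense of
  PL topology, not the convex \<^const>\<open>polyhedron\<close> of the library) and the map to be continuous;
  \<open>X\<close> need not be closed, e.g. it can be an open subset of a polyhedron.
\<close>

definition pl_on :: "('a::euclidean_space \<Rightarrow> 'b::euclidean_space) \<Rightarrow> 'a set \<Rightarrow> bool" where
  "pl_on f X \<longleftrightarrow>
     (\<forall>x\<in>X. \<exists>\<P> U. finite \<P> \<and> open U \<and> x \<in> U \<and> X \<inter> U \<subseteq> \<Union>\<P> \<and>
        (\<forall>P\<in>\<P>. polytope P \<and> P \<subseteq> X \<and> (\<exists>g c. linear g \<and> (\<forall>y\<in>P. f y = g y + c))))"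

definition pl_homeomorphism ::
  "'a::euclidean_space set \<Rightarrow> 'b::euclidean_space set \<Rightarrow> ('a \<Rightarrow> 'b) \<Rightarrow> ('b \<Rightarrow> 'a) \<Rightarrow> bool" where
  "pl_homeomorphism X Y f g \<longleftrightarrow> homeomorphism X Y f g \<and> pl_on f X \<and> pl_on g Y"

definition half_space :: "'n::finite \<Rightarrow> (real^'n) set" where
  "half_space k = {v. 0 \<le> v $ k}"

text \<open>
  The argument \<open>k\<close> only serves to name the coordinate cutting out the model half-space; the dimension
  of the manifold is \<open>CARD('n)\<close>.
\<close>

definition pl_chart ::
  "'n::finite \<Rightarrow> 'a::euclidean_space set \<Rightarrow> 'a set \<Rightarrow> ('a \<Rightarrow> real^'n) \<Rightarrow> (real^'n \<Rightarrow> 'a) \<Rightarrow> bool" where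
  "pl_chart k M U f g \<longleftrightarrow>
     openin (top_of_set M) U \<and> openin (top_of_set (half_space k)) (f ` U) \<and>
     pl_homeomorphism U (f ` U) f g"

definition pl_manifold :: "'n::finite \<Rightarrow> 'a::euclidean_space set \<Rightarrow> bool" where
  "pl_manifold k M \<longleftrightarrow> (\<forall>x\<in>M. \<exists>U f g. x \<in> U \<and> pl_chart k M U f g)"

definition pl_boundary :: "'n::finite \<Rightarrow> 'a::euclidean_space set \<Rightarrow> 'a set" where
  "pl_boundary k M = {x \<in> M. \<exists>U f g. x \<in> U \<and> pl_chart k M U f g \<and> f x $ k = 0}"

abbreviation pl_surface :: "'a::euclidean_space set \<Rightarrow> bool" where
  "pl_surface \<equiv> pl_manifold (2::2)"

abbreviation pl_3manifold :: "'a::euclidean_space set \<Rightarrow> bool" where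
  "pl_3manifold \<equiv> pl_manifold (3::3)"

text \<open>
  Proper means that exactly the boundary is mapped to the boundary.  The domains below are compact,
  so compactness of preimages of compact sets is automatic.
\<close>

definition proper_pl_map ::
  "'m::finite \<Rightarrow> 'b::euclidean_space set \<Rightarrow> 'n::finite \<Rightarrow> 'a::euclidean_space set \<Rightarrow> ('b \<Rightarrow> 'a) \<Rightarrow> bool" where
  "proper_pl_map k F l M i \<longleftrightarrow>
     pl_on i F \<and> i ` F \<subseteq> M \<and> {x \<in> F. i x \<in> pl_boundary l M} = pl_boundary k F"

text \<open>
  Local flatness of a properly embedded surface \<open>S\<close> in a 4-manifold \<open>N\<close>: near each point of \<open>S\<close>, the
  pair is that of a half-space and a half-plane meeting its boundary orthogonally (away from \<open>v $ 4 = 0\<close>,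
  this is the pair of a 4-space and a plane).
\<close>

definition locally_flat :: "'a::euclidean_space set \<Rightarrow> 'a set \<Rightarrow> bool" where
  "locally_flat N S \<longleftrightarrow>
     (\<forall>q\<in>S. \<exists>U f g. q \<in> U \<and> pl_chart (4::4) N U f g \<and>
        f ` (U \<inter> S) = f ` U \<inter> {v. v $ 1 = 0 \<and> v $ 2 = 0})"


section \<open>Generic surfaces\<close>

definition cube :: "(real^3) set" where
  "cube = cbox (-1) 1"

definition half_cube :: "(real^3) set" where
  "half_cube = cube \<inter> half_space 3"

definition coord_plane :: "3 \<Rightarrow> (real^3) set" where
  "coord_plane k = {v. v $ k = 0}"

definition nbhd_in :: "'a::euclidean_space set \<Rightarrow> 'a \<Rightarrow> 'a set \<Rightarrow> bool" where
  "nbhd_in M p N \<longleftrightarrow> N \<subseteq> M \<and> (\<exists>U. openin (top_of_set M) U \<and> p \<in> U \<and> U \<subseteq> N)"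

text \<open>
  A neighbourhood \<open>N\<close> of \<open>p\<close> with \<open>(N, N \<inter> i(F))\<close> homeomorphic to the pair of \<open>B\<close> and the union of the
  coordinate planes with indices in \<open>K\<close>, with \<open>p\<close> at the origin.  The planes are the sheets of the
  surface: the preimage of \<open>N\<close> consists of disjoint pieces \<open>D k\<close>, one embedded onto each plane.  A
  condition on the image alone would also admit multiple coverings, and sheets that
  bend along a double curve and touch there without crossing.
\<close>

definition sheets_at ::
  "'b::euclidean_space set \<Rightarrow> 'a::euclidean_space set \<Rightarrow> ('b \<Rightarrow> 'a) \<Rightarrow> (real^3) set \<Rightarrow> 3 set \<Rightarrow> 'a \<Rightarrow> bool" where
  "sheets_at F M i B K p \<longleftrightarrow>
     (\<exists>N f g D. nbhd_in M p N \<and> pl_homeomorphism N B f g \<and> f p = 0 \<and>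
        f ` (N \<inter> i ` F) = B \<inter> (\<Union>k\<in>K. coord_plane k) \<and>
        {x \<in> F. i x \<in> N} = (\<Union>k\<in>K. D k) \<and> disjoint_family_on D K \<and>
        (\<forall>k\<in>K. \<exists>j. homeomorphism (D k) {q \<in> N. f q \<in> coord_plane k} i j))"

definition regular_value where
  "regular_value F M i p \<longleftrightarrow> (\<exists>K. card K = 1 \<and> sheets_at F M i cube K p)"

definition double_value where
  "double_value F M i p \<longleftrightarrow> (\<exists>K. card K = 2 \<and> sheets_at F M i cube K p)"

definition triple_value where
  "triple_value F M i p \<longleftrightarrow> (\<exists>K. card K = 3 \<and> sheets_at F M i cube K p)"

definition RB_value where
  "RB_value F M i p \<longleftrightarrow> (\<exists>K. K \<subseteq> {1, 2} \<and> card K = 1 \<and> sheets_at F M i half_cube K p)"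

definition DB_value where
  "DB_value F M i p \<longleftrightarrow> (\<exists>K. K \<subseteq> {1, 2} \<and> card K = 2 \<and> sheets_at F M i half_cube K p)"

text \<open>
  A figure-8 curve in the boundary of the cube: two triangles in the top face, with the common vertex
  \<open>(0,0,1)\<close>.  Figure-8 curves on the sphere are all equivalent under PL homeomorphisms of the sphere.
\<close>

definition figure_eight :: "(real^3) set" where
  "figure_eight = {v. v $ 3 = 1 \<and>
     (\<bar>v $ 1\<bar> = \<bar>v $ 2\<bar> \<and> \<bar>v $ 1\<bar> \<le> 1/2 \<or> \<bar>v $ 1\<bar> = 1/2 \<and> \<bar>v $ 2\<bar> \<le> 1/2)}"

definition branch_value ::
  "'b::euclidean_space set \<Rightarrow> 'a::euclidean_space set \<Rightarrow> ('b \<Rightarrow> 'a) \<Rightarrow> 'a \<Rightarrow> bool" where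
  "branch_value F M i p \<longleftrightarrow>
     (\<exists>N f g. nbhd_in M p N \<and> pl_homeomorphism N cube f g \<and> f p = 0 \<and>
        f ` (N \<inter> i ` F) = (\<Union>v\<in>figure_eight. closed_segment 0 v)) \<and>
     (\<exists>x. {x \<in> F. i x = p} = {x})"

definition generic_surface ::
  "'b::euclidean_space set \<Rightarrow> 'a::euclidean_space set \<Rightarrow> ('b \<Rightarrow> 'a) \<Rightarrow> bool" where
  "generic_surface F M i \<longleftrightarrow>
     compact F \<and> pl_surface F \<and> pl_3manifold M \<and> proper_pl_map (2::2) F (3::3) M i \<and>
     (\<forall>p \<in> i ` F. regular_value F M i p \<or> double_value F M i p \<or> triple_value F M i p \<or>
        branch_value F M i p \<or> RB_value F M i p \<or> DB_value F M i p)"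


section \<open>Liftings\<close>

definition lifting ::
  "'b::euclidean_space set \<Rightarrow> 'a::euclidean_space set \<Rightarrow> ('b \<Rightarrow> 'a) \<Rightarrow> ('b \<Rightarrow> real) \<Rightarrow> bool" where
  "lifting F M i h \<longleftrightarrow>
     pl_on h F \<and>
     proper_pl_map (2::2) F (4::4) (M \<times> UNIV) (\<lambda>x. (i x, h x)) \<and>
     inj_on (\<lambda>x. (i x, h x)) F \<and>
     locally_flat (M \<times> UNIV) ((\<lambda>x. (i x, h x)) ` F)"

definition liftable ::
  "'b::euclidean_space set \<Rightarrow> 'a::euclidean_space set \<Rightarrow> ('b \<Rightarrow> 'a) \<Rightarrow> bool" where
  "liftable F M i \<longleftrightarrow> (\<exists>h. lifting F M i h)"


section \<open>Double arcs and lifting attempts\<close>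

text \<open>
  A double arc is given by a parametrization \<open>t \<mapsto> i (a t) = i (b t)\<close>, \<open>0 \<le> t \<le> 1\<close>, together with the
  core curves \<open>a\<close> and \<open>b\<close> in \<open>F\<close> of the two strips that cross along it.  Following the same two strips,
  i.e. continuity of \<open>a\<close> and \<open>b\<close>, is what going straight through a triple value means.  The
  underlying 1-manifold passes through each pair of crossing sheets once, whereas
  \<open>i \<circ> a\<close> may pass through a triple value up to three times; hence injectivity is required of the
  unordered pairs \<open>{a t, b t}\<close>.  At a branch value, the two core curves run into the same point.
\<close>

definition double_track ::
  "'b::euclidean_space set \<Rightarrow> ('b \<Rightarrow> 'a::euclidean_space) \<Rightarrow> (real \<Rightarrow> 'b) \<Rightarrow> (real \<Rightarrow> 'b) \<Rightarrow> bool" where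
  "double_track F i a b \<longleftrightarrow>
     pl_on a {0..1} \<and> pl_on b {0..1} \<and> a ` {0..1} \<subseteq> F \<and> b ` {0..1} \<subseteq> F \<and>
     (\<forall>t\<in>{0..1}. i (a t) = i (b t))"

definition open_double_arc where
  "open_double_arc F M i a b \<longleftrightarrow>
     double_track F i a b \<and> inj_on (\<lambda>t. {a t, b t}) {0..1} \<and>
     (\<forall>t\<in>{0<..<1}. a t \<noteq> b t \<and> (double_value F M i (i (a t)) \<or> triple_value F M i (i (a t)))) \<and>
     (\<forall>t\<in>{0, 1}. branch_value F M i (i (a t)) \<or> a t \<noteq> b t \<and> DB_value F M i (i (a t)))"

definition closed_double_arc where
  "closed_double_arc F M i a b \<longleftrightarrow>
     double_track F i a b \<and> inj_on (\<lambda>t. {a t, b t}) {0..<1} \<and> {a 0, b 0} = {a 1, b 1} \<and>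
     (\<forall>t\<in>{0..1}. a t \<noteq> b t \<and> (double_value F M i (i (a t)) \<or> triple_value F M i (i (a t))))"

definition double_arc where
  "double_arc F M i a b \<longleftrightarrow> open_double_arc F M i a b \<or> closed_double_arc F M i a b"

definition trivial_closed_double_arc where
  "trivial_closed_double_arc F M i a b \<longleftrightarrow>
     closed_double_arc F M i a b \<and> a 1 = a 0 \<and> b 1 = b 0"

definition nontrivial_closed_double_arc where
  "nontrivial_closed_double_arc F M i a b \<longleftrightarrow>
     closed_double_arc F M i a b \<and> a 1 = b 0 \<and> b 1 = a 0"

definition no_nontrivial_closed_double_arcs where
  "no_nontrivial_closed_double_arcs F M i \<longleftrightarrow> (\<nexists>a b. nontrivial_closed_double_arc F M i a b)"

text \<open>
  The strip with core \<open>a\<close> of the double arc \<open>(a, b)\<close>, as the set of pairs of a preimage on this strip and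
  the corresponding preimage on the other strip; the other strip is \<open>strip b a\<close>.  The partner is
  recorded because a core curve can pass twice through a preimage of a triple value.  The set of
  pairs does not depend on the parametrization of an open or trivial closed arc.
\<close>

definition strip :: "(real \<Rightarrow> 'b) \<Rightarrow> (real \<Rightarrow> 'b) \<Rightarrow> ('b \<times> 'b) set" where
  "strip a b = (\<lambda>t. (a t, b t)) ` {0..1}"

text \<open>A lifting attempt is given by the set of the strips declared higher.\<close>

definition lifting_attempt ::
  "'b::euclidean_space set \<Rightarrow> 'a::euclidean_space set \<Rightarrow> ('b \<Rightarrow> 'a) \<Rightarrow> ('b \<times> 'b) set set \<Rightarrow> bool" where
  "lifting_attempt F M i \<A> \<longleftrightarrow>
     \<A> \<subseteq> {strip a b | a b. double_arc F M i a b} \<and>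
     (\<forall>a b. double_arc F M i a b \<longrightarrow> (strip a b \<in> \<A> \<longleftrightarrow> strip b a \<notin> \<A>))"

definition realizes :: "('b \<Rightarrow> real) \<Rightarrow> ('b \<times> 'b) set set \<Rightarrow> bool" where
  "realizes h \<A> \<longleftrightarrow> (\<forall>S\<in>\<A>. \<forall>(x, y)\<in>S. x \<noteq> y \<longrightarrow> h y < h x)"

definition successful ::
  "'b::euclidean_space set \<Rightarrow> 'a::euclidean_space set \<Rightarrow> ('b \<Rightarrow> 'a) \<Rightarrow> ('b \<times> 'b) set set \<Rightarrow> bool" where
  "successful F M i \<A> \<longleftrightarrow> (\<exists>h. lifting F M i h \<and> realizes h \<A>)"

text \<open>The sheets at a triple value are named by their preimages of that value.\<close>

definition declared_higher :: "('b \<times> 'b) set set \<Rightarrow> 'b \<Rightarrow> 'b \<Rightarrow> bool" where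
  "declared_higher \<A> x y \<longleftrightarrow> (\<exists>S\<in>\<A>. (x, y) \<in> S)"

definition cyclic_height_relation ::
  "'b::euclidean_space set \<Rightarrow> 'a::euclidean_space set \<Rightarrow> ('b \<Rightarrow> 'a) \<Rightarrow> ('b \<times> 'b) set set \<Rightarrow> 'a \<Rightarrow> bool" where
  "cyclic_height_relation F M i \<A> p \<longleftrightarrow>
     (\<exists>x\<^sub>1 x\<^sub>2 x\<^sub>3. {x \<in> F. i x = p} = {x\<^sub>1, x\<^sub>2, x\<^sub>3} \<and> distinct [x\<^sub>1, x\<^sub>2, x\<^sub>3] \<and>
        declared_higher \<A> x\<^sub>2 x\<^sub>1 \<and> declared_higher \<A> x\<^sub>3 x\<^sub>2 \<and> declared_higher \<A> x\<^sub>1 x\<^sub>3)"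

end

theory Submission
  imports Defs
begin

text \<open>
  If \<open>h\<close> is the height of a lifting and \<open>(a, b)\<close> a double arc, then \<open>h (a t) - h (b t)\<close> vanishes at most
  where \<open>a t = b t\<close>, so it keeps its sign.  Hence there are no non-trivial closed arcs, and the signs form
  a lifting attempt, which is not cyclic anywhere.

  For the converse, the set of pairs \<open>(x, y)\<close> with \<open>x \<noteq> y\<close> and \<open>i x = i y\<close> is a 1-manifold whose closure is
  a finite union of segments, because a generic map is injective on the simplices where it is affine.
  Maximal paths in this finite graph give a double arc through each pair, and without non-trivial closed
  arcs the strips are, up to end points, the components of the set of pairs; so a lifting attempt is a locally constant
  choice of the higher point in each pair.  An attempt that is not cyclic orders the sheets
  over each value, and a bump function of height proportional to the rank of the sheet is a
  height function near that value; at a branch value, a linear coordinate of the umbrella is one.  Bumps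
  weakly respect the order everywhere, so a finite sum of them separates all pairs correctly.  Near a branch
  point only one bump is non-zero, so that the lifted surface is the graph of a PL map in suitable
  coordinates; as it is also the graph of a function over each sheet, it is locally flat.
\<close>

section \<open>Piecewise linear maps\<close>

text \<open>A branch value is defined by the image of the surface near it and by its single
  preimage; nothing is prescribed about how sheets run over the cone. That exactly two sheets cross
  along the double line, each passing straight through it, has to be derived. The means is
  invariance of domain: two crossing surface patches do not embed in a plane. The same argument
  shows that branch points are limits of double pairs, which makes them finite in number. Double
  pairs are taken ordered, in \<open>F \<times> F\<close>. Exchanging the two points is a free
  involution on them. Arcs have to be injective modulo this involution, whereas strips consist of
  ordered pairs. A non-trivial closed arc is a circle of unordered pairs that closes up in ordered
  pairs only after two turns; its strip is the one kind that is not open among the pairs, and this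
  is how the absence of such arcs enters the second half of the proof. Local flatness at a branch
  point is shown by an explicit change of coordinates. This is why the height is made equal there,
  up to sign, to a parameter of the umbrella.\<close>

definition affine_on :: "('a::euclidean_space \<Rightarrow> 'b::euclidean_space) \<Rightarrow> 'a set \<Rightarrow> bool" where
  "affine_on f P \<longleftrightarrow> (\<exists>g c. linear g \<and> (\<forall>y\<in>P. f y = g y + c))"

lemma affine_on_subset: "affine_on f P \<Longrightarrow> Q \<subseteq> P \<Longrightarrow> affine_on f Q"
  unfolding affine_on_def by blast

lemma affine_on_cong: "affine_on f P \<Longrightarrow> (\<And>x. x \<in> P \<Longrightarrow> f x = g x) \<Longrightarrow> affine_on g P"
  unfolding affine_on_def by metis

lemma affine_on_linear: "linear g \<Longrightarrow> affine_on g P"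
  unfolding affine_on_def by (metis add.right_neutral)

lemma affine_on_const: "affine_on (\<lambda>x. c) P"
  unfolding affine_on_def by (intro exI[of _ "\<lambda>x. 0"] exI[of _ c]) (auto intro: linear_zero)

lemma affine_on_compose:
  assumes "affine_on f P" "affine_on g (f ` P)"
  shows "affine_on (\<lambda>x. g (f x)) P"
proof -
  obtain f' c where f: "linear f'" "\<And>y. y \<in> P \<Longrightarrow> f y = f' y + c"
    using assms(1) unfolding affine_on_def by blast
  obtain g' d where g: "linear g'" "\<And>y. y \<in> f ` P \<Longrightarrow> g y = g' y + d"
    using assms(2) unfolding affine_on_def by blast
  show ?thesis
    unfolding affine_on_def
    by (rule exI[of _ "g' \<circ> f'"], rule exI[of _ "g' c + d"])
       (use f g in \<open>auto simp: linear_compose linear_add\<close>)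
qed

lemma affine_on_Pair:
  assumes "affine_on f P" "affine_on g P"
  shows "affine_on (\<lambda>x. (f x, g x)) P"
proof -
  obtain f' c where f: "linear f'" "\<And>y. y \<in> P \<Longrightarrow> f y = f' y + c"
    using assms(1) unfolding affine_on_def by blast
  obtain g' d where g: "linear g'" "\<And>y. y \<in> P \<Longrightarrow> g y = g' y + d"
    using assms(2) unfolding affine_on_def by blast
  have "linear (\<lambda>x. (f' x, g' x))"
    using f(1) g(1) by (simp add: linear_iff)
  then show ?thesis
    unfolding affine_on_def using f g
    by (intro exI[of _ "\<lambda>x. (f' x, g' x)"] exI[of _ "(c, d)"]) auto
qed

lemma affine_on_continuous: "affine_on f P \<Longrightarrow> continuous_on P f"
proof -
  assume "affine_on f P"
  then obtain g c where g: "linear g" "\<And>y. y \<in> P \<Longrightarrow> f y = g y + c"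
    unfolding affine_on_def by blast
  have "continuous_on P (\<lambda>y. g y + c)"
    using g(1) by (intro continuous_intros linear_continuous_on) (simp add: linear_conv_bounded_linear)
  then show ?thesis using g(2) by (simp cong: continuous_on_cong)
qed

lemma affine_on_convex_comb:
  assumes "affine_on f P" "x \<in> P" "y \<in> P" "(1 - u) *\<^sub>R x + u *\<^sub>R y \<in> P"
  shows "f ((1 - u) *\<^sub>R x + u *\<^sub>R y) = (1 - u) *\<^sub>R f x + u *\<^sub>R f y"
proof -
  obtain f' c where f: "linear f'" "\<And>y. y \<in> P \<Longrightarrow> f y = f' y + c"
    using assms(1) unfolding affine_on_def by blast
  have "f ((1 - u) *\<^sub>R x + u *\<^sub>R y) = (1 - u) *\<^sub>R f' x + u *\<^sub>R f' y + c"
    using f assms(4) by (simp add: linear_add linear_cmul)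
  also have "\<dots> = (1 - u) *\<^sub>R (f' x + c) + u *\<^sub>R (f' y + c)"
    by (simp add: algebra_simps)
  finally show ?thesis using f assms by simp
qed

lemma polytope_affine_on_image:
  assumes "polytope P" "affine_on f P"
  shows "polytope (f ` P)"
proof -
  obtain f' c where f: "linear f'" "\<And>y. y \<in> P \<Longrightarrow> f y = f' y + c"
    using assms(2) unfolding affine_on_def by blast
  have "f ` P = (+) c ` (f' ` P)"
    using f(2) by (auto simp: image_iff add.commute)
  then show ?thesis
    by (simp add: polytope_translation_eq polytope_linear_image assms(1) f(1))
qed

lemma polytope_affine_on_preimage:
  assumes "polytope P" "affine_on f P" "polytope Q"
  shows "polytope {y \<in> P. f y \<in> Q}"
proof -
  obtain f' c where f: "linear f'" "\<And>y. y \<in> P \<Longrightarrow> f y = f' y + c"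
    using assms(2) unfolding affine_on_def by blast
  obtain H where H: "finite H" "Q = \<Inter>H" "\<And>h. h \<in> H \<Longrightarrow> \<exists>a b. a \<noteq> 0 \<and> h = {x. a \<bullet> x \<le> b}"
    using polytope_imp_polyhedron[OF assms(3)] unfolding polyhedron_def by blast
  have "polyhedron {y. f' y + c \<in> h}" if hH: "h \<in> H" for h
  proof -
    obtain a b where h: "h = {x. a \<bullet> x \<le> b}" using H(3)[OF hH] by blast
    \<comment> \<open>The preimage of a half-space has the normal \<open>adjoint f' a\<close>; if
      this is zero, the preimage is empty or everything, which is still a polyhedron.\<close>
    have "{y. f' y + c \<in> h} = {y. adjoint f' a \<bullet> y \<le> b - a \<bullet> c}"
      using adjoint_clauses(2)[OF f(1)] by (auto simp: h inner_add_right)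
    then show ?thesis by (simp add: polyhedron_halfspace_le)
  qed
  then have "polyhedron (\<Inter>h\<in>H. {y. f' y + c \<in> h})"
    using H(1) by (intro polyhedron_Inter) auto
  moreover have "{y \<in> P. f y \<in> Q} = P \<inter> (\<Inter>h\<in>H. {y. f' y + c \<in> h})"
    using f(2) H(2) by auto
  ultimately show ?thesis using assms(1) by (simp add: polytope_Int_polyhedron)
qed

text \<open>The linear part of \<open>f\<close> is injective on the directions of the affine hull of
  \<open>P\<close>, because \<open>P\<close> contains a relative ball. It may have a kernel
  transversal to \<open>P\<close>, so only a left inverse on these directions is available, and this
  suffices to describe \<open>g\<close>.\<close>

lemma affine_on_injective_inverse:
  assumes P: "polytope P" and f: "affine_on f P" and gf: "\<And>y. y \<in> P \<Longrightarrow> g (f y) = y"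
  shows "affine_on g (f ` P)"
proof (cases "P = {}")
  case True
  then show ?thesis unfolding affine_on_def using linear_zero by (intro exI[of _ "\<lambda>x. 0"]) auto
next
  case False
  obtain L c where L: "linear L" "\<And>y. y \<in> P \<Longrightarrow> f y = L y + c"
    using f unfolding affine_on_def by blast
  have "rel_interior P \<noteq> {}"
    using False P by (simp add: polytope_imp_convex rel_interior_eq_empty)
  then obtain y0 e where y0: "y0 \<in> P" "e > 0" "cball y0 e \<inter> affine hull P \<subseteq> P"
    by (metis all_not_in_conv mem_rel_interior_cball)
  define V where "V = span ((\<lambda>x. x - y0) ` P)"
  have hull: "affine hull P = (+) y0 ` V"
    unfolding V_def using affine_hull_span_gen[OF hull_inc[OF y0(1)]] by (simp add: add.commute)
  have ker: "w = 0" if "w \<in> V" "L w = 0" for w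
  proof (rule ccontr)
    assume "w \<noteq> 0"
    \<comment> \<open>Scaled to norm \<open>e\<close>, the vector leads from \<open>y0\<close> to
      another point of \<open>P\<close> with the same value.\<close>
    define w' where "w' = (e / norm w) *\<^sub>R w"
    have w': "w' \<in> V" "norm w' \<le> e" "L w' = 0" "w' \<noteq> 0"
      using that \<open>w \<noteq> 0\<close> y0(2) by (auto simp: w'_def V_def span_scale linear_cmul[OF L(1)])
    have "y0 + w' \<in> cball y0 e \<inter> affine hull P"
      using w' hull by (auto simp: dist_norm)
    then have "y0 + w' \<in> P" using y0(3) by blast
    then have "f (y0 + w') = f y0" using L w' y0(1) by (simp add: linear_add)
    then have "y0 + w' = y0" using gf \<open>y0 + w' \<in> P\<close> y0(1) by metis
    then show False using w'(4) by simp
  qed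
  have "inj_on L V"
  proof (rule inj_onI)
    fix x y assume xy: "x \<in> V" "y \<in> V" "L x = L y"
    then have "x - y \<in> V" by (simp add: V_def span_diff)
    moreover have "L (x - y) = 0" using xy by (simp add: linear_diff[OF L(1)])
    ultimately show "x = y" using ker by fastforce
  qed
  then obtain g' where g': "linear g'" "\<And>v. v \<in> V \<Longrightarrow> g' (L v) = v"
    using linear_exists_left_inverse_on[OF L(1), of V] by (auto simp: V_def)
  have "g z = g' z + (y0 - g' (L y0 + c))" if z: "z \<in> f ` P" for z
  proof -
    obtain y where y: "y \<in> P" "z = f y" using z by blast
    have "y - y0 \<in> V" unfolding V_def using y by (intro span_base) auto
    then have "g' (L (y - y0)) = y - y0" using g' by blast
    then have "g' (L y) - g' (L y0) = y - y0"
      by (simp add: linear_diff[OF L(1)] linear_diff[OF g'(1)])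
    then show ?thesis
      using y gf L(2) by (simp add: linear_add[OF g'(1)] algebra_simps)
  qed
  then show ?thesis unfolding affine_on_def using g'(1) by blast
qed


section \<open>Local structure, composition and inversion of PL maps\<close>

lemma pl_on_iff:
  "pl_on f X \<longleftrightarrow>
     (\<forall>x\<in>X. \<exists>\<P> U. finite \<P> \<and> open U \<and> x \<in> U \<and> X \<inter> U \<subseteq> \<Union>\<P> \<and>
        (\<forall>P\<in>\<P>. polytope P \<and> P \<subseteq> X \<and> affine_on f P))"
  unfolding pl_on_def affine_on_def ..

text \<open>Polytopes cut with a box stay polytopes, so the pieces can be taken inside any
  prescribed neighbourhood of the point.\<close>

lemma pl_on_refine:
  assumes "pl_on f X" "x \<in> X" "open V" "x \<in> V"
  obtains \<P> U where "finite \<P>" "open U" "x \<in> U" "U \<subseteq> V" "X \<inter> U \<subseteq> \<Union>\<P>"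
    "\<And>P. P \<in> \<P> \<Longrightarrow> polytope P \<and> P \<subseteq> X \<inter> V \<and> affine_on f P"
proof -
  obtain \<P> U where U: "finite \<P>" "open U" "x \<in> U" "X \<inter> U \<subseteq> \<Union>\<P>"
    "\<And>P. P \<in> \<P> \<Longrightarrow> polytope P \<and> P \<subseteq> X \<and> affine_on f P"
    using assms(1,2) unfolding pl_on_iff by metis
  obtain a b where ab: "x \<in> box a b" "cbox a b \<subseteq> V"
    using open_contains_cbox[OF assms(3,4)] by metis
  show thesis
  proof (rule that[of "(\<lambda>P. P \<inter> cbox a b) ` \<P>" "U \<inter> box a b"])
    show "X \<inter> (U \<inter> box a b) \<subseteq> \<Union> ((\<lambda>P. P \<inter> cbox a b) ` \<P>)"
      using U(4) box_subset_cbox[of a b] by fastforce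
    show "U \<inter> box a b \<subseteq> V" using ab(2) box_subset_cbox[of a b] by blast
    fix P assume "P \<in> (\<lambda>P. P \<inter> cbox a b) ` \<P>"
    then obtain P' where P': "P' \<in> \<P>" "P = P' \<inter> cbox a b" by blast
    then show "polytope P \<and> P \<subseteq> X \<inter> V \<and> affine_on f P"
      using U(5)[OF P'(1)] ab(2) affine_on_subset[of f P' P]
      by (auto simp: polytope_Int polytope_interval)
  qed (use U ab in auto)
qed

lemma pl_on_open_subset:
  assumes "pl_on f X" "openin (top_of_set X) W"
  shows "pl_on f W"
proof -
  obtain V where V: "open V" "W = X \<inter> V" using assms(2) openin_open by metis
  show ?thesis
    unfolding pl_on_iff
  proof
    fix x assume "x \<in> W"
    then have "x \<in> X" "x \<in> V" using V by auto
    then obtain \<P> U where "finite \<P>" "open U" "x \<in> U" "U \<subseteq> V" "X \<inter> U \<subseteq> \<Union>\<P>"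
      "\<And>P. P \<in> \<P> \<Longrightarrow> polytope P \<and> P \<subseteq> X \<inter> V \<and> affine_on f P"
      using pl_on_refine[OF assms(1) _ V(1)] by metis
    then show "\<exists>\<P> U. finite \<P> \<and> open U \<and> x \<in> U \<and> W \<inter> U \<subseteq> \<Union>\<P> \<and>
        (\<forall>P\<in>\<P>. polytope P \<and> P \<subseteq> W \<and> affine_on f P)"
      using V(2) by (intro exI[of _ \<P>] exI[of _ U]) auto
  qed
qed

lemma pl_on_local:
  assumes "\<And>x. x \<in> X \<Longrightarrow> \<exists>W. openin (top_of_set X) W \<and> x \<in> W \<and> pl_on f W"
  shows "pl_on f X"
  unfolding pl_on_iff
proof
  fix x assume "x \<in> X"
  then obtain W where W: "openin (top_of_set X) W" "x \<in> W" "pl_on f W" using assms by blast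
  obtain V where V: "open V" "W = X \<inter> V" using W(1) openin_open by metis
  obtain \<P> U where U: "finite \<P>" "open U" "x \<in> U" "W \<inter> U \<subseteq> \<Union>\<P>"
    "\<And>P. P \<in> \<P> \<Longrightarrow> polytope P \<and> P \<subseteq> W \<and> affine_on f P"
    using W(2,3) unfolding pl_on_iff by metis
  show "\<exists>\<P> U. finite \<P> \<and> open U \<and> x \<in> U \<and> X \<inter> U \<subseteq> \<Union>\<P> \<and>
        (\<forall>P\<in>\<P>. polytope P \<and> P \<subseteq> X \<and> affine_on f P)"
    using U V W by (intro exI[of _ \<P>] exI[of _ "U \<inter> V"]) auto
qed

lemma pl_on_cong:
  assumes "pl_on f X" "\<And>x. x \<in> X \<Longrightarrow> f x = g x"
  shows "pl_on g X"
  unfolding pl_on_iff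
proof
  fix x assume "x \<in> X"
  then obtain \<P> U where "finite \<P>" "open U" "x \<in> U" "X \<inter> U \<subseteq> \<Union>\<P>"
    "\<forall>P\<in>\<P>. polytope P \<and> P \<subseteq> X \<and> affine_on f P"
    using assms(1) unfolding pl_on_iff by metis
  moreover have "affine_on g P" if "P \<in> \<P>" for P
    using calculation(5) that assms(2) affine_on_cong[of f P g] by blast
  ultimately show "\<exists>\<P> U. finite \<P> \<and> open U \<and> x \<in> U \<and> X \<inter> U \<subseteq> \<Union>\<P> \<and>
        (\<forall>P\<in>\<P>. polytope P \<and> P \<subseteq> X \<and> affine_on g P)"
    by (intro exI[of _ \<P>] exI[of _ U]) auto
qed

lemma pl_on_continuous:
  assumes "pl_on f X"
  shows "continuous_on X f"
  unfolding continuous_on_eq_continuous_within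
proof
  fix x assume "x \<in> X"
  then obtain \<P> U where U: "finite \<P>" "open U" "x \<in> U" "X \<inter> U \<subseteq> \<Union>\<P>"
    "\<And>P. P \<in> \<P> \<Longrightarrow> polytope P \<and> P \<subseteq> X \<and> affine_on f P"
    using assms unfolding pl_on_iff by metis
  have "continuous_on (\<Union>\<P>) f"
    by (rule continuous_on_closed_Union[of \<P> "\<lambda>P. P", simplified])
       (use U in \<open>auto simp: affine_on_continuous polytope_imp_closed\<close>)
  then have "continuous_on (X \<inter> U) f" using U(4) continuous_on_subset by blast
  then have "continuous (at x within (X \<inter> U)) f"
    using U(3) \<open>x \<in> X\<close> by (simp add: continuous_on_eq_continuous_within)
  moreover have "at x within (X \<inter> U) = at x within X"
    by (rule at_within_nhd[OF U(3) U(2)]) auto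
  ultimately show "continuous (at x within X) f" by simp
qed

lemma pl_on_compose:
  assumes f: "pl_on f X" and g: "pl_on g Y" and sub: "f ` X \<subseteq> Y"
  shows "pl_on (\<lambda>x. g (f x)) X"
  unfolding pl_on_iff
proof
  fix x assume x: "x \<in> X"
  then have "f x \<in> Y" using sub by auto
  then obtain \<Q> V where V: "finite \<Q>" "open V" "f x \<in> V" "Y \<inter> V \<subseteq> \<Union>\<Q>"
    "\<And>P. P \<in> \<Q> \<Longrightarrow> polytope P \<and> P \<subseteq> Y \<and> affine_on g P"
    using g unfolding pl_on_iff by metis
  obtain W where W: "open W" "f -` V \<inter> X = W \<inter> X"
    using pl_on_continuous[OF f] V(2) continuous_on_open_invariant[of X f] by metis
  have "x \<in> W" using W(2) x V(3) by blast
  obtain \<P> U where U: "finite \<P>" "open U" "x \<in> U" "U \<subseteq> W" "X \<inter> U \<subseteq> \<Union>\<P>"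
    "\<And>P. P \<in> \<P> \<Longrightarrow> polytope P \<and> P \<subseteq> X \<inter> W \<and> affine_on f P"
    using pl_on_refine[OF f x W(1) \<open>x \<in> W\<close>] by metis
  \<comment> \<open>The pieces of \<open>f\<close> are cut further by the preimages of the pieces of
    \<open>g\<close>; these are polytopes because \<open>f\<close> is affine on each
    \<open>P\<close>.\<close>
  define \<R> where "\<R> = (\<lambda>(P,Q). {y \<in> P. f y \<in> Q}) ` (\<P> \<times> \<Q>)"
  have "finite \<R>" unfolding \<R>_def using U(1) V(1) by blast
  moreover have "X \<inter> U \<subseteq> \<Union>\<R>"
  proof
    fix y assume y: "y \<in> X \<inter> U"
    then obtain P where P: "P \<in> \<P>" "y \<in> P" using U(5) by blast
    have "f y \<in> Y \<inter> V" using y U(4) W(2) sub by blast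
    then obtain Q where Q: "Q \<in> \<Q>" "f y \<in> Q" using V(4) by blast
    then show "y \<in> \<Union>\<R>" using P unfolding \<R>_def by auto
  qed
  moreover have "polytope R \<and> R \<subseteq> X \<and> affine_on (\<lambda>x. g (f x)) R" if "R \<in> \<R>" for R
  proof -
    obtain P Q where PQ: "P \<in> \<P>" "Q \<in> \<Q>" "R = {y \<in> P. f y \<in> Q}"
      using \<open>R \<in> \<R>\<close> unfolding \<R>_def by auto
    have "affine_on f R" using U(6)[OF PQ(1)] PQ(3) affine_on_subset[of f P R] by auto
    moreover have "affine_on g (f ` R)" using V(5)[OF PQ(2)] PQ(3) affine_on_subset[of g Q "f ` R"] by auto
    ultimately show ?thesis
      using PQ U(6)[OF PQ(1)] V(5)[OF PQ(2)]
      by (auto intro: affine_on_compose polytope_affine_on_preimage)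
  qed
  ultimately show "\<exists>\<P> U. finite \<P> \<and> open U \<and> x \<in> U \<and> X \<inter> U \<subseteq> \<Union>\<P> \<and>
        (\<forall>P\<in>\<P>. polytope P \<and> P \<subseteq> X \<and> affine_on (\<lambda>x. g (f x)) P)"
    using U(2,3) by (intro exI[of _ \<R>] exI[of _ U]) auto
qed

lemma pl_on_Pair:
  assumes f: "pl_on f X" and g: "pl_on g X"
  shows "pl_on (\<lambda>x. (f x, g x)) X"
  unfolding pl_on_iff
proof
  fix x assume x: "x \<in> X"
  obtain \<P> U where U: "finite \<P>" "open U" "x \<in> U" "X \<inter> U \<subseteq> \<Union>\<P>"
    "\<And>P. P \<in> \<P> \<Longrightarrow> polytope P \<and> P \<subseteq> X \<and> affine_on f P"
    using f x unfolding pl_on_iff by metis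
  obtain \<Q> V where V: "finite \<Q>" "open V" "x \<in> V" "X \<inter> V \<subseteq> \<Union>\<Q>"
    "\<And>P. P \<in> \<Q> \<Longrightarrow> polytope P \<and> P \<subseteq> X \<and> affine_on g P"
    using g x unfolding pl_on_iff by metis
  define \<R> where "\<R> = (\<lambda>(P,Q). P \<inter> Q) ` (\<P> \<times> \<Q>)"
  have "finite \<R>" unfolding \<R>_def using U(1) V(1) by blast
  moreover have "X \<inter> (U \<inter> V) \<subseteq> \<Union>\<R>"
  proof
    fix y assume y: "y \<in> X \<inter> (U \<inter> V)"
    then obtain P where P: "P \<in> \<P>" "y \<in> P" using U(4) by blast
    obtain Q where Q: "Q \<in> \<Q>" "y \<in> Q" using V(4) y by blast
    then show "y \<in> \<Union>\<R>" using P unfolding \<R>_def by auto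
  qed
  moreover have "polytope R \<and> R \<subseteq> X \<and> affine_on (\<lambda>x. (f x, g x)) R" if "R \<in> \<R>" for R
  proof -
    obtain P Q where PQ: "P \<in> \<P>" "Q \<in> \<Q>" "R = P \<inter> Q"
      using \<open>R \<in> \<R>\<close> unfolding \<R>_def by auto
    have "affine_on f R" using U(5)[OF PQ(1)] PQ(3) affine_on_subset[of f P R] by auto
    moreover have "affine_on g R" using V(5)[OF PQ(2)] PQ(3) affine_on_subset[of g Q R] by auto
    ultimately show ?thesis
      using PQ U(5)[OF PQ(1)] V(5)[OF PQ(2)]
      by (auto intro: affine_on_Pair polytope_Int)
  qed
  ultimately show "\<exists>\<P> U. finite \<P> \<and> open U \<and> x \<in> U \<and> X \<inter> U \<subseteq> \<Union>\<P> \<and>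
        (\<forall>P\<in>\<P>. polytope P \<and> P \<subseteq> X \<and> affine_on (\<lambda>x. (f x, g x)) P)"
    using U(2,3) V(2,3) by (intro exI[of _ \<R>] exI[of _ "U \<inter> V"]) auto
qed

lemma pl_on_UNIV_affine:
  assumes "affine_on f UNIV"
  shows "pl_on f UNIV"
  unfolding pl_on_iff
proof
  fix x :: 'a
  obtain a b where ab: "x \<in> box a b"
    by (rule open_contains_cbox[of UNIV x]) auto
  show "\<exists>\<P> U. finite \<P> \<and> open U \<and> x \<in> U \<and> UNIV \<inter> U \<subseteq> \<Union>\<P> \<and>
        (\<forall>P\<in>\<P>. polytope P \<and> P \<subseteq> UNIV \<and> affine_on f P)"
    using ab affine_on_subset[OF assms] box_subset_cbox[of a b]
    by (intro exI[of _ "{cbox a b}"] exI[of _ "box a b"]) (auto simp: polytope_interval)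
qed

lemma pl_on_compose_UNIV: "pl_on f X \<Longrightarrow> pl_on g UNIV \<Longrightarrow> pl_on (\<lambda>x. g (f x)) X"
  by (rule pl_on_compose) auto

lemma pl_on_linear_compose: "pl_on f X \<Longrightarrow> linear g \<Longrightarrow> pl_on (\<lambda>x. g (f x)) X"
  by (rule pl_on_compose_UNIV) (auto intro: pl_on_UNIV_affine affine_on_linear)

text \<open>Images of the pieces of \<open>f\<close> are pieces for \<open>g\<close>: they are
  polytopes, and an injective affine map has an affine inverse on its image. Continuity of
  \<open>g\<close> supplies the neighbourhoods. PL homeomorphisms therefore need checking in one
  direction only.\<close>

lemma pl_on_inverse:
  assumes hom: "homeomorphism X Y f g" and f: "pl_on f X"
  shows "pl_on g Y"
  unfolding pl_on_iff
proof
  fix y assume y: "y \<in> Y"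
  have g: "continuous_on Y g" and gf: "\<And>x. x \<in> X \<Longrightarrow> g (f x) = x" and fg: "\<And>y. y \<in> Y \<Longrightarrow> f (g y) = y"
    and im: "f ` X = Y" "g ` Y = X"
    using hom by (auto simp: homeomorphism_def)
  have "g y \<in> X" using im y by blast
  then obtain \<P> U where U: "finite \<P>" "open U" "g y \<in> U" "X \<inter> U \<subseteq> \<Union>\<P>"
    "\<And>P. P \<in> \<P> \<Longrightarrow> polytope P \<and> P \<subseteq> X \<and> affine_on f P"
    using f unfolding pl_on_iff by metis
  obtain W where W: "open W" "g -` U \<inter> Y = W \<inter> Y"
    using g U(2) continuous_on_open_invariant[of Y g] by metis
  have "Y \<inter> W \<subseteq> \<Union>((`) f ` \<P>)"
  proof
    fix z assume z: "z \<in> Y \<inter> W"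
    then have "g z \<in> X \<inter> U" using W(2) im by blast
    then obtain P where "P \<in> \<P>" "g z \<in> P" using U(4) by blast
    then show "z \<in> \<Union>((`) f ` \<P>)" using fg z by (metis IntD1 UN_I image_eqI)
  qed
  moreover have "polytope Q \<and> Q \<subseteq> Y \<and> affine_on g Q" if Q: "Q \<in> (`) f ` \<P>" for Q
  proof -
    obtain P where P: "P \<in> \<P>" "Q = f ` P" using Q by blast
    then show ?thesis using U(5)[OF P(1)] im gf
      by (auto intro!: polytope_affine_on_image affine_on_injective_inverse)
  qed
  moreover have "y \<in> W" using W(2) y U(3) by blast
  ultimately show "\<exists>\<P> U. finite \<P> \<and> open U \<and> y \<in> U \<and> Y \<inter> U \<subseteq> \<Union>\<P> \<and>
        (\<forall>P\<in>\<P>. polytope P \<and> P \<subseteq> Y \<and> affine_on g P)"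
    using U(1) W(1) by (intro exI[of _ "(`) f ` \<P>"] exI[of _ W]) auto
qed

text \<open>Intersecting the subdivisions that belong to the individual maps gives one on which all
  of them are affine.\<close>

lemma pl_on_common:
  assumes "finite G" "G \<noteq> {}" "\<And>a. a \<in> G \<Longrightarrow> pl_on a X" "x \<in> X"
  shows "\<exists>\<P> U. finite \<P> \<and> open U \<and> x \<in> U \<and> X \<inter> U \<subseteq> \<Union>\<P> \<and>
        (\<forall>P\<in>\<P>. polytope P \<and> P \<subseteq> X \<and> (\<forall>a\<in>G. affine_on a P))"
  using assms
proof (induction G rule: finite_ne_induct)
  case (singleton a)
  then show ?case unfolding pl_on_iff by (metis singletonD singletonI)
next
  case (insert a G)
  then obtain \<P> U where U: "finite \<P>" "open U" "x \<in> U" "X \<inter> U \<subseteq> \<Union>\<P>"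
    "\<And>P. P \<in> \<P> \<Longrightarrow> polytope P \<and> P \<subseteq> X \<and> (\<forall>a\<in>G. affine_on a P)"
    by (metis insertCI)
  obtain \<Q> V where V: "finite \<Q>" "open V" "x \<in> V" "X \<inter> V \<subseteq> \<Union>\<Q>"
    "\<And>P. P \<in> \<Q> \<Longrightarrow> polytope P \<and> P \<subseteq> X \<and> affine_on a P"
    using insert.prems unfolding pl_on_iff by (metis insertI1)
  define \<R> where "\<R> = (\<lambda>(P,Q). P \<inter> Q) ` (\<P> \<times> \<Q>)"
  have "finite \<R>" unfolding \<R>_def using U(1) V(1) by blast
  moreover have "X \<inter> (U \<inter> V) \<subseteq> \<Union>\<R>"
  proof
    fix y assume y: "y \<in> X \<inter> (U \<inter> V)"
    then obtain P where P: "P \<in> \<P>" "y \<in> P" using U(4) by blast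
    obtain Q where Q: "Q \<in> \<Q>" "y \<in> Q" using V(4) y by blast
    then show "y \<in> \<Union>\<R>" using P unfolding \<R>_def by auto
  qed
  moreover have "polytope R \<and> R \<subseteq> X \<and> (\<forall>b\<in>insert a G. affine_on b R)" if "R \<in> \<R>" for R
  proof -
    obtain P Q where PQ: "P \<in> \<P>" "Q \<in> \<Q>" "R = P \<inter> Q"
      using \<open>R \<in> \<R>\<close> unfolding \<R>_def by auto
    have "affine_on b R" if "b \<in> G" for b using U(5)[OF PQ(1)] PQ(3) affine_on_subset[of b P R] that by auto
    moreover have "affine_on a R" using V(5)[OF PQ(2)] PQ(3) affine_on_subset[of a Q R] by auto
    ultimately show ?thesis
      using PQ U(5)[OF PQ(1)] V(5)[OF PQ(2)]
      by (auto intro: polytope_Int)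
  qed
  ultimately show ?case
    using U(2,3) V(2,3) by (intro exI[of _ \<R>] exI[of _ "U \<inter> V"]) auto
qed

text \<open>
  Cut the polytope along the hyperplanes where two of the given affine functions agree.  On the relative
  interior of a piece, two of them agree everywhere or nowhere, so a continuous selection follows
  one of them.
\<close>

lemma affine_selection_subdivision:
  fixes g :: "'a::euclidean_space \<Rightarrow> 'b::euclidean_space"
  assumes P: "polytope P" and G: "finite G" "\<And>a. a \<in> G \<Longrightarrow> affine_on a P"
    and g: "continuous_on P g" "\<And>y. y \<in> P \<Longrightarrow> \<exists>a\<in>G. g y = a y"
  obtains \<Q> where "finite \<Q>" "\<Union>\<Q> = P" "\<And>Q. Q \<in> \<Q> \<Longrightarrow> polytope Q \<and> affine_on g Q"
proof -
  define T where "T = G \<times> G \<times> (Basis::'b set)"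
  define l where "l = (\<lambda>(a :: 'a \<Rightarrow> 'b, b, e) y. (a y - b y) \<bullet> e)"
  have finT: "finite T" unfolding T_def using G(1) by auto
  have laff: "\<exists>v d. \<forall>y\<in>P. l t y = v \<bullet> y + d" if t: "t \<in> T" for t
  proof -
    obtain a b e where abe: "t = (a,b,e)" "a \<in> G" "b \<in> G" using t unfolding T_def by auto
    obtain a' c where a: "linear a'" "\<And>y. y \<in> P \<Longrightarrow> a y = a' y + c"
      using G(2)[OF abe(2)] unfolding affine_on_def by blast
    obtain b' d where b: "linear b'" "\<And>y. y \<in> P \<Longrightarrow> b y = b' y + d"
      using G(2)[OF abe(3)] unfolding affine_on_def by blast
    have "l t y = (adjoint a' e - adjoint b' e) \<bullet> y + (c - d) \<bullet> e" if "y \<in> P" for y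
      using that a b adjoint_clauses(2)[OF a(1), of e y] adjoint_clauses(2)[OF b(1), of e y]
      by (simp add: abe(1) l_def inner_diff_left inner_diff_right inner_add_right inner_commute[of _ e])
    then show ?thesis by blast
  qed
  then obtain v d where vd: "\<And>t y. t \<in> T \<Longrightarrow> y \<in> P \<Longrightarrow> l t y = v t \<bullet> y + d t"
    by metis
  \<comment> \<open>The cell of a sign pattern: \<open>s\<close> collects the differences that are
    to be at most 0, all others are to be at least 0.\<close>
  define C where "C = (\<lambda>s. P \<inter> (\<Inter>t\<in>T. {y. if t \<in> s then v t \<bullet> y \<le> - d t else v t \<bullet> y \<ge> - d t}))"
  have Ciff: "y \<in> C s \<longleftrightarrow> y \<in> P \<and> (\<forall>t\<in>T. if t \<in> s then l t y \<le> 0 else l t y \<ge> 0)" for s y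
    using vd unfolding C_def by (fastforce split: if_splits)
  have Cpoly: "polytope (C s)" for s
    unfolding C_def
  proof (rule polytope_Int_polyhedron[OF P], rule polyhedron_Inter)
    fix X assume "X \<in> (\<lambda>t. {y. if t \<in> s then v t \<bullet> y \<le> - d t else - d t \<le> v t \<bullet> y}) ` T"
    then obtain t where "X = {y. if t \<in> s then v t \<bullet> y \<le> - d t else - d t \<le> v t \<bullet> y}" by blast
    then show "polyhedron X"
      by (cases "t \<in> s") (simp_all add: polyhedron_halfspace_le polyhedron_halfspace_ge)
  qed (use finT in auto)
  have Caff: "affine_on g (C s)" for s
  proof (cases "C s = {}")
    case True
    then show ?thesis unfolding affine_on_def using linear_zero by (intro exI[of _ "\<lambda>x. 0"]) auto
  next
    case False
    let ?R = "rel_interior (C s)"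
    have conv: "convex (C s)" using Cpoly polytope_imp_convex by blast
    have RC: "?R \<subseteq> C s" by (rule rel_interior_subset)
    have CP: "C s \<subseteq> P" using Ciff by blast
    obtain z where z: "z \<in> ?R" using False conv rel_interior_eq_empty by blast
    have lzero: "l t y = 0" if t: "t \<in> T" and w: "w \<in> ?R" "l t w = 0" and y: "y \<in> C s" for t w y
    proof -
      \<comment> \<open>The segment from \<open>y\<close> to \<open>w\<close> can be prolonged a
        little beyond \<open>w\<close> inside the cell. An affine function that vanishes at
        \<open>w\<close> has opposite signs at \<open>y\<close> and at the new end, unless it
        vanishes at \<open>y\<close>; but the cell allows one sign only.\<close>
      obtain e where e: "e > 1" "(1 - e) *\<^sub>R y + e *\<^sub>R w \<in> C s"
        using bspec[OF convex_rel_interior_if2[OF conv w(1)] hull_inc[OF y]] by metis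
      let ?u = "(1 - e) *\<^sub>R y + e *\<^sub>R w"
      have "l t ?u = (1 - e) * (v t \<bullet> y) + e * (v t \<bullet> w) + d t"
        using vd[OF t] e(2) CP by (simp add: inner_add_right subset_iff)
      also have "\<dots> = (1 - e) * (v t \<bullet> y + d t) + e * (v t \<bullet> w + d t)" by (simp add: algebra_simps)
      also have "\<dots> = (1 - e) * l t y + e * l t w"
        using vd[OF t] y w(1) CP RC by (simp add: subset_iff)
      finally have *: "l t ?u = (1 - e) * l t y" using w(2) by simp
      have A: "if t \<in> s then l t y \<le> 0 else l t y \<ge> 0" using y t Ciff by blast
      have B: "if t \<in> s then l t ?u \<le> 0 else l t ?u \<ge> 0" using e(2) t Ciff by blast
      show ?thesis
        using A B e(1) unfolding * by (auto split: if_splits simp: mult_le_0_iff zero_le_mult_iff)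
    qed
    have agree: "a y = b y" if "a \<in> G" "b \<in> G" "w \<in> ?R" "a w = b w" "y \<in> C s" for a b w y
    proof (rule euclidean_eqI)
      fix e :: 'b assume "e \<in> Basis"
      then have t: "(a,b,e) \<in> T" using that by (simp add: T_def)
      have "l (a,b,e) w = 0" using that by (simp add: l_def)
      then have "l (a,b,e) y = 0" using lzero[OF t] that by blast
      then show "a y \<bullet> e = b y \<bullet> e" by (simp add: l_def inner_diff_left)
    qed
    obtain a where a: "a \<in> G" "g z = a z" using g(2) z RC CP by blast
    define E where "E = (\<lambda>b. {y \<in> ?R. g y - b y = 0})"
    have clE: "closedin (top_of_set ?R) (E b)" if "b \<in> G" for b
      unfolding E_def
      by (intro continuous_closedin_preimage_constant continuous_on_diff)
         (use g(1) affine_on_continuous[OF G(2)[OF that]] RC CP continuous_on_subset in blast)+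
    have "?R = E a"
    proof (rule ccontr)
      assume ne: "?R \<noteq> E a"
      \<comment> \<open>Selections that meet the agreement set of \<open>a\<close> agree with
        \<open>a\<close> throughout. The others cover the rest by finitely many closed sets, and
        connectedness leaves no rest.\<close>
      define D where "D = (\<Union>b\<in>{b\<in>G. E b \<inter> E a = {}}. E b)"
      have "closedin (top_of_set ?R) D" unfolding D_def
        by (intro closedin_Union) (use G(1) clE in auto)
      moreover have "?R \<subseteq> E a \<union> D"
      proof
        fix y assume y: "y \<in> ?R"
        then obtain b where b: "b \<in> G" "g y = b y" using g(2) RC CP by blast
        show "y \<in> E a \<union> D"
        proof (cases "E b \<inter> E a = {}")
          case True then show ?thesis using y b by (auto simp: D_def E_def)
        next
          case False
          then obtain w where "w \<in> ?R" "a w = b w" by (auto simp: E_def)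
          then have "a y = b y" using agree a(1) b(1) y RC by blast
          then show ?thesis using y b by (auto simp: E_def)
        qed
      qed
      moreover have "E a \<inter> D = {}" by (auto simp: D_def)
      moreover have "E a \<noteq> {}" using z a by (auto simp: E_def)
      moreover have "connected ?R" using conv convex_rel_interior convex_connected by blast
      moreover have "E a \<subseteq> ?R" by (auto simp: E_def)
      moreover have "D \<subseteq> ?R" by (auto simp: D_def E_def)
      ultimately show False
        using clE[OF a(1)] ne unfolding connected_closedin_eq by (metis Un_subset_iff Un_empty_right subset_antisym)
    qed
    then have on_R: "g y - a y = 0" if "y \<in> ?R" for y using that by (auto simp: E_def)
    have cl: "closure ?R = C s"
      using convex_closure_rel_interior[OF conv] polytope_imp_closed[OF Cpoly[of s]] by simp
    have "continuous_on (closure ?R) (\<lambda>y. g y - a y)"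
      unfolding cl using g(1) affine_on_continuous[OF G(2)[OF a(1)]] CP
      by (intro continuous_on_diff) (use continuous_on_subset in blast)+
    then have "g y - a y = 0" if "y \<in> C s" for y
      using continuous_constant_on_closure[of ?R "\<lambda>y. g y - a y" 0 y] on_R that cl by auto
    moreover have "affine_on a (C s)" using G(2)[OF a(1)] CP affine_on_subset by blast
    ultimately show ?thesis using affine_on_cong[of a "C s" g] by simp
  qed
  show thesis
  proof (rule that[of "C ` Pow T"])
    show "\<Union> (C ` Pow T) = P"
    proof
      show "P \<subseteq> \<Union> (C ` Pow T)"
      proof
        fix y assume "y \<in> P"
        then have "y \<in> C {t \<in> T. l t y \<le> 0}" by (auto simp: Ciff)
        then show "y \<in> \<Union> (C ` Pow T)" by (rule UN_I[rotated]) auto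
      qed
    qed (auto simp: Ciff)
  qed (use finT Cpoly Caff in auto)
qed

lemma pl_on_selection:
  assumes "finite G" "\<And>a. a \<in> G \<Longrightarrow> pl_on a X" "continuous_on X g" "\<And>y. y \<in> X \<Longrightarrow> \<exists>a\<in>G. g y = a y"
  shows "pl_on g X"
  unfolding pl_on_iff
proof
  fix x assume x: "x \<in> X"
  then have "G \<noteq> {}" using assms(4) by blast
  then obtain \<P> U where U: "finite \<P>" "open U" "x \<in> U" "X \<inter> U \<subseteq> \<Union>\<P>"
    "\<And>P. P \<in> \<P> \<Longrightarrow> polytope P \<and> P \<subseteq> X \<and> (\<forall>a\<in>G. affine_on a P)"
    using pl_on_common[OF assms(1) _ assms(2) x] by metis
  have "\<exists>\<Q>. finite \<Q> \<and> \<Union>\<Q> = P \<and> (\<forall>Q\<in>\<Q>. polytope Q \<and> affine_on g Q)" if "P \<in> \<P>" for P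
  proof -
    have P: "polytope P" "\<And>a. a \<in> G \<Longrightarrow> affine_on a P" "P \<subseteq> X" using U(5)[OF that] by auto
    have sel: "\<exists>a\<in>G. g y = a y" if "y \<in> P" for y using assms(4) P(3) that by (simp add: subset_iff)
    show ?thesis
      by (rule affine_selection_subdivision[OF P(1) assms(1) P(2) continuous_on_subset[OF assms(3) P(3)] sel])
        auto
  qed
  then obtain \<Q> where Q: "\<And>P. P \<in> \<P> \<Longrightarrow> finite (\<Q> P) \<and> \<Union>(\<Q> P) = P \<and> (\<forall>Q\<in>\<Q> P. polytope Q \<and> affine_on g Q)"
    by metis
  have sub: "Q \<subseteq> X" if "P \<in> \<P>" "Q \<in> \<Q> P" for P Q
    using Q[OF that(1)] U(5)[OF that(1)] that(2) by blast
  have cov: "X \<inter> U \<subseteq> \<Union>(\<Union>P\<in>\<P>. \<Q> P)"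
  proof
    fix y assume "y \<in> X \<inter> U"
    then obtain P where P: "P \<in> \<P>" "y \<in> P" using U(4) by blast
    then have "y \<in> \<Union>(\<Q> P)" using Q by blast
    then show "y \<in> \<Union>(\<Union>P\<in>\<P>. \<Q> P)" using P by blast
  qed
  show "\<exists>\<P> U. finite \<P> \<and> open U \<and> x \<in> U \<and> X \<inter> U \<subseteq> \<Union>\<P> \<and>
        (\<forall>P\<in>\<P>. polytope P \<and> P \<subseteq> X \<and> affine_on g P)"
    by (rule exI[of _ "\<Union>P\<in>\<P>. \<Q> P"], rule exI[of _ U]) (use U(1-3) cov Q sub in auto)
qed

section \<open>Arithmetic of PL functions\<close>

lemma pl_on_linear: "linear g \<Longrightarrow> pl_on g UNIV"
  by (simp add: affine_on_linear pl_on_UNIV_affine)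

lemma pl_on_add:
  assumes "pl_on f X" "pl_on g X" shows "pl_on (\<lambda>x. f x + g x) X"
  by (rule pl_on_linear_compose[OF pl_on_Pair[OF assms], of "\<lambda>z. fst z + snd z", simplified])
     (simp add: linear_iff scaleR_add_right)

lemma pl_on_diff:
  assumes "pl_on f X" "pl_on g X" shows "pl_on (\<lambda>x. f x - g x) X"
  by (rule pl_on_linear_compose[OF pl_on_Pair[OF assms], of "\<lambda>z. fst z - snd z", simplified])
     (simp add: linear_iff algebra_simps)

lemma pl_on_minus:
  assumes "pl_on f X" shows "pl_on (\<lambda>x. - f x) X"
  by (rule pl_on_linear_compose[OF assms]) (simp add: linear_iff)

lemma pl_on_scaleR:
  assumes "pl_on f X" shows "pl_on (\<lambda>x. c *\<^sub>R f x) X"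
  by (rule pl_on_linear_compose[OF assms]) (simp add: linear_iff algebra_simps)

lemma pl_on_cmult:
  fixes f :: "'a::euclidean_space \<Rightarrow> real"
  assumes "pl_on f X" shows "pl_on (\<lambda>x. c * f x) X"
  using pl_on_scaleR[OF assms] by simp

text \<open>Being PL on \<open>X\<close> includes that \<open>X\<close> is locally a finite union of
  polytopes; \<open>f\<close> serves as a witness of this.\<close>

lemma pl_on_const:
  assumes "pl_on f X" shows "pl_on (\<lambda>x. c) X"
  by (rule pl_on_compose_UNIV[OF assms, of "\<lambda>x. c"]) (simp add: affine_on_const pl_on_UNIV_affine)

text \<open>A maximum is a continuous selection from two PL functions.\<close>

lemma pl_on_max:
  fixes f :: "'a::euclidean_space \<Rightarrow> real"
  assumes "pl_on f X" "pl_on g X" shows "pl_on (\<lambda>x. max (f x) (g x)) X"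
  by (rule pl_on_selection[of "{f, g}"])
     (use assms pl_on_continuous in \<open>auto simp: max_def intro!: continuous_on_max[unfolded max_def]\<close>)

lemma pl_on_min:
  fixes f :: "'a::euclidean_space \<Rightarrow> real"
  assumes "pl_on f X" "pl_on g X" shows "pl_on (\<lambda>x. min (f x) (g x)) X"
  by (rule pl_on_selection[of "{f, g}"])
     (use assms pl_on_continuous in \<open>auto simp: min_def intro!: continuous_on_min[unfolded min_def]\<close>)

lemma pl_on_abs:
  fixes f :: "'a::euclidean_space \<Rightarrow> real"
  assumes "pl_on f X" shows "pl_on (\<lambda>x. \<bar>f x\<bar>) X"
  using pl_on_max[OF assms pl_on_minus[OF assms]] by (simp add: abs_real_def max_def cong: if_cong)
     (erule pl_on_cong, auto)

lemma pl_on_sum: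
  assumes "finite I" "I \<noteq> {}" "\<And>j. j \<in> I \<Longrightarrow> pl_on (f j) X"
  shows "pl_on (\<lambda>x. \<Sum>j\<in>I. f j x) X"
  using assms by (induction I rule: finite_ne_induct) (auto intro: pl_on_add)

lemma pl_on_vec_nth: "pl_on f X \<Longrightarrow> pl_on (\<lambda>x. f x $ k) X"
  by (rule pl_on_linear_compose) (auto simp: linear_iff)

lemma pl_on_vec:
  fixes f :: "'a::euclidean_space \<Rightarrow> real^'n"
  assumes "\<And>k. pl_on (\<lambda>x. f x $ k) X"
  shows "pl_on f X"
proof -
  have "pl_on (\<lambda>x. \<Sum>k\<in>UNIV. (f x $ k) *\<^sub>R axis k (1::real) :: real^'n) X"
  proof (rule pl_on_sum)
    fix k :: 'n
    show "pl_on (\<lambda>x. (f x $ k) *\<^sub>R axis k (1::real) :: real^'n) X"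
      by (rule pl_on_linear_compose[OF assms]) (simp add: linear_iff algebra_simps)
  qed auto
  moreover have "(\<Sum>k\<in>UNIV. (f x $ k) *\<^sub>R axis k (1::real)) = f x" for x
    using basis_expansion[of "f x"] by (simp add: scalar_mult_eq_scaleR)
  ultimately show ?thesis by simp
qed

lemma pl_on_map_prod:
  assumes f: "pl_on f X" and g: "pl_on g Y"
  shows "pl_on (\<lambda>z. (f (fst z), g (snd z))) (X \<times> Y)"
  unfolding pl_on_iff
proof
  fix z assume "z \<in> X \<times> Y"
  then have z: "fst z \<in> X" "snd z \<in> Y" by auto
  obtain \<P> U where U: "finite \<P>" "open U" "fst z \<in> U" "X \<inter> U \<subseteq> \<Union>\<P>"
    "\<And>P. P \<in> \<P> \<Longrightarrow> polytope P \<and> P \<subseteq> X \<and> affine_on f P"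
    using f z unfolding pl_on_iff by metis
  obtain \<Q> V where V: "finite \<Q>" "open V" "snd z \<in> V" "Y \<inter> V \<subseteq> \<Union>\<Q>"
    "\<And>P. P \<in> \<Q> \<Longrightarrow> polytope P \<and> P \<subseteq> Y \<and> affine_on g P"
    using g z unfolding pl_on_iff by metis
  define \<R> where "\<R> = (\<lambda>(P,Q). P \<times> Q) ` (\<P> \<times> \<Q>)"
  have "finite \<R>" unfolding \<R>_def using U(1) V(1) by blast
  moreover have "X \<times> Y \<inter> (U \<times> V) \<subseteq> \<Union>\<R>"
  proof
    fix y assume y: "y \<in> X \<times> Y \<inter> (U \<times> V)"
    then obtain P where P: "P \<in> \<P>" "fst y \<in> P" using U(4) by (auto simp: mem_Times_iff)
    obtain Q where Q: "Q \<in> \<Q>" "snd y \<in> Q" using V(4) y by (auto simp: mem_Times_iff)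
    then show "y \<in> \<Union>\<R>" using P unfolding \<R>_def by (force simp: mem_Times_iff)
  qed
  moreover have "polytope R \<and> R \<subseteq> X \<times> Y \<and> affine_on (\<lambda>z. (f (fst z), g (snd z))) R" if R: "R \<in> \<R>" for R
  proof -
    obtain P Q where PQ: "P \<in> \<P>" "Q \<in> \<Q>" "R = P \<times> Q"
      using R unfolding \<R>_def by auto
    have f: "affine_on f P" and g: "affine_on g Q" using U(5)[OF PQ(1)] V(5)[OF PQ(2)] by auto
    have "affine_on (\<lambda>z. f (fst z)) R"
      by (rule affine_on_compose[OF affine_on_linear[OF linear_fst]], rule affine_on_subset[OF f])
         (auto simp: PQ)
    moreover have "affine_on (\<lambda>z. g (snd z)) R"
      by (rule affine_on_compose[OF affine_on_linear[OF linear_snd]], rule affine_on_subset[OF g])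
         (auto simp: PQ)
    ultimately have "affine_on (\<lambda>z. (f (fst z), g (snd z))) R" by (rule affine_on_Pair)
    then show ?thesis
      using PQ U(5)[OF PQ(1)] V(5)[OF PQ(2)] by (auto intro: polytope_Times)
  qed
  ultimately show "\<exists>\<P> U. finite \<P> \<and> open U \<and> z \<in> U \<and> X \<times> Y \<inter> U \<subseteq> \<Union>\<P> \<and>
        (\<forall>P\<in>\<P>. polytope P \<and> P \<subseteq> X \<times> Y \<and> affine_on (\<lambda>z. (f (fst z), g (snd z))) P)"
    using U(2,3) V(2,3) by (intro exI[of _ \<R>] exI[of _ "U \<times> V"]) (auto simp: open_Times mem_Times_iff)
qed

text \<open>Compactness replaces the local families of polytopes by a single finite one.\<close>

lemma pl_on_compact:
  assumes f: "pl_on f X" and X: "compact X"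
  obtains \<P> where "finite \<P>" "X = \<Union>\<P>" "\<And>P. P \<in> \<P> \<Longrightarrow> polytope P \<and> affine_on f P"
proof -
  have "\<forall>x\<in>X. \<exists>\<P> U. finite \<P> \<and> open U \<and> x \<in> U \<and> X \<inter> U \<subseteq> \<Union>\<P> \<and>
        (\<forall>P\<in>\<P>. polytope P \<and> P \<subseteq> X \<and> affine_on f P)"
    using f unfolding pl_on_iff .
  then obtain \<P> U where PU: "\<And>x. x \<in> X \<Longrightarrow> finite (\<P> x) \<and> open (U x) \<and> x \<in> U x \<and> X \<inter> U x \<subseteq> \<Union>(\<P> x) \<and>
        (\<forall>P\<in>\<P> x. polytope P \<and> P \<subseteq> X \<and> affine_on f P)"
    by metis
  obtain T where T: "T \<subseteq> X" "finite T" "X \<subseteq> (\<Union>x\<in>T. U x)"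
    by (rule compactE_image[OF X, of X U]) (use PU in auto)
  show thesis
  proof (rule that[of "\<Union>x\<in>T. \<P> x"])
    show "finite (\<Union>x\<in>T. \<P> x)" using T PU by (intro finite_UN_I) auto
    show "X = \<Union>(\<Union>x\<in>T. \<P> x)"
    proof
      show "X \<subseteq> \<Union>(\<Union>x\<in>T. \<P> x)"
      proof
        fix y assume y: "y \<in> X"
        then obtain x where x: "x \<in> T" "y \<in> U x" using T(3) by blast
        then have "y \<in> \<Union>(\<P> x)" using PU[of x] T(1) y by blast
        then show "y \<in> \<Union>(\<Union>x\<in>T. \<P> x)" using x(1) by blast
      qed
      show "\<Union>(\<Union>x\<in>T. \<P> x) \<subseteq> X" using PU T(1) by blast
    qed
    show "polytope P \<and> affine_on f P" if "P \<in> (\<Union>x\<in>T. \<P> x)" for P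
      using that PU T(1) by blast
  qed
qed

section \<open>Sheets of a generic surface\<close>

definition sheet_model :: "(real^3) set \<Rightarrow> 3 set \<Rightarrow> bool" where
  "sheet_model B K \<longleftrightarrow> K \<noteq> {} \<and> (B = cube \<or> B = half_cube \<and> K \<subseteq> {1, 2})"

text \<open>\<open>\<sigma> k\<close> parametrizes the sheet over the coordinate plane \<open>k\<close>.\<close>

definition sheet_chart ::
  "'b::euclidean_space set \<Rightarrow> 'a::euclidean_space set \<Rightarrow> ('b \<Rightarrow> 'a) \<Rightarrow> 'a \<Rightarrow> (real^3) set \<Rightarrow> 3 set \<Rightarrow>
    'a set \<Rightarrow> ('a \<Rightarrow> real^3) \<Rightarrow> (real^3 \<Rightarrow> 'a) \<Rightarrow> (3 \<Rightarrow> real^3 \<Rightarrow> 'b) \<Rightarrow> bool" where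
  "sheet_chart F M i p B K N f g \<sigma> \<longleftrightarrow>
     sheet_model B K \<and> nbhd_in M p N \<and> pl_homeomorphism N B f g \<and> f p = 0 \<and>
     (\<forall>k\<in>K. homeomorphism (B \<inter> coord_plane k) (\<sigma> k ` (B \<inter> coord_plane k)) (\<sigma> k) (\<lambda>x. f (i x))) \<and>
     {x \<in> F. i x \<in> N} = (\<Union>k\<in>K. \<sigma> k ` (B \<inter> coord_plane k)) \<and>
     disjoint_family_on (\<lambda>k. \<sigma> k ` (B \<inter> coord_plane k)) K"

text \<open>Inverting \<open>i\<close> on each piece of the preimage and composing with the inverse
  chart turns the sheets into images of flat model planes.\<close>

lemma sheets_at_imp_chart:
  assumes "sheets_at F M i B K p" "sheet_model B K"
  obtains N f g \<sigma> where "sheet_chart F M i p B K N f g \<sigma>"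
proof -
  obtain N f g D where body: "nbhd_in M p N \<and> pl_homeomorphism N B f g \<and> f p = 0 \<and>
        f ` (N \<inter> i ` F) = B \<inter> (\<Union>k\<in>K. coord_plane k) \<and>
        {x \<in> F. i x \<in> N} = (\<Union>k\<in>K. D k) \<and> disjoint_family_on D K \<and>
        (\<forall>k\<in>K. \<exists>j. homeomorphism (D k) {q \<in> N. f q \<in> coord_plane k} i j)"
    using assms(1) unfolding sheets_at_def by (elim exE)
  then have N: "nbhd_in M p N" "pl_homeomorphism N B f g" "f p = 0"
    "{x \<in> F. i x \<in> N} = (\<Union>k\<in>K. D k)" "disjoint_family_on D K" by simp_all
  from body have "\<forall>k\<in>K. \<exists>j. homeomorphism (D k) {q \<in> N. f q \<in> coord_plane k} i j" by simp
  then obtain J where J: "\<And>k. k\<in>K \<Longrightarrow> homeomorphism (D k) {q \<in> N. f q \<in> coord_plane k} i (J k)"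
    by metis
  have hom: "homeomorphism (B \<inter> coord_plane k) (D k) (J k \<circ> g) (f \<circ> i)" if k: "k \<in> K" for k
  proof -
    have fg: "homeomorphism N B f g" using N(2) unfolding pl_homeomorphism_def by blast
    have im: "f ` {q \<in> N. f q \<in> coord_plane k} = B \<inter> coord_plane k"
      using fg unfolding homeomorphism_def by blast
    have "homeomorphism {q \<in> N. f q \<in> coord_plane k} (B \<inter> coord_plane k) f g"
      by (rule homeomorphism_of_subsets[OF fg _ _ im]) auto
    from homeomorphism_compose[OF J[OF k] this] show ?thesis
      by (rule homeomorphism_symD)
  qed
  have im: "(J k \<circ> g) ` (B \<inter> coord_plane k) = D k" if "k \<in> K" for k
    using hom[OF that] by (rule homeomorphism_image1)
  have "sheet_chart F M i p B K N f g (\<lambda>k. J k \<circ> g)"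
    unfolding sheet_chart_def
  proof (intro conjI ballI assms(2) N(1-3))
    fix k assume k: "k \<in> K"
    show "homeomorphism (B \<inter> coord_plane k) ((J k \<circ> g) ` (B \<inter> coord_plane k)) (J k \<circ> g) (\<lambda>x. f (i x))"
      using hom[OF k] unfolding im[OF k] by (simp add: o_def)
  next
    show "{x \<in> F. i x \<in> N} = (\<Union>k\<in>K. (J k \<circ> g) ` (B \<inter> coord_plane k))" using N(4) im by simp
    show "disjoint_family_on (\<lambda>k. (J k \<circ> g) ` (B \<inter> coord_plane k)) K"
      using N(5) im by (simp add: disjoint_family_on_def)
  qed
  then show thesis using that by blast
qed

lemma sheet_model_props:
  assumes "sheet_model B K"
  shows "compact B" "convex B" "0 \<in> B" "B \<subseteq> cube" "K \<noteq> {}" "finite K"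
proof -
  have c: "compact cube" "convex cube" "0 \<in> cube" unfolding cube_def
    by (auto simp: mem_box_cart)
  have "half_space (3::3) = {v. axis 3 1 \<bullet> v \<ge> (0::real)}"
    unfolding half_space_def by (simp add: inner_axis' )
  then have h: "closed (half_space (3::3))" "convex (half_space (3::3))" "0 \<in> half_space (3::3)"
    by (simp_all add: closed_halfspace_ge convex_halfspace_ge half_space_def)
  show "compact B" "convex B" "0 \<in> B" "B \<subseteq> cube" "K \<noteq> {}"
    using assms c h unfolding sheet_model_def half_cube_def
    by (auto intro: compact_Int_closed convex_Int)
  show "finite K" by simp
qed

lemma coord_plane_props: "closed (coord_plane k)" "convex (coord_plane k)" "0 \<in> coord_plane k"
proof -
  have "coord_plane k = {v. axis k 1 \<bullet> v = (0::real)}"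
    unfolding coord_plane_def by (simp add: inner_axis')
  then show "closed (coord_plane k)" "convex (coord_plane k)" "0 \<in> coord_plane k"
    by (simp_all add: closed_hyperplane convex_hyperplane coord_plane_def)
qed

context
  fixes F :: "'b::euclidean_space set" and M :: "'a::euclidean_space set" and i p B K N f g \<sigma>
  assumes chart: "sheet_chart F M i p B K N f g \<sigma>"
begin

lemma sheet_chart_model: "sheet_model B K" "compact B" "convex B" "0 \<in> B" "B \<subseteq> cube" "K \<noteq> {}"
proof -
  show m: "sheet_model B K" using chart unfolding sheet_chart_def by simp
  show "compact B" "convex B" "0 \<in> B" "B \<subseteq> cube" "K \<noteq> {}" using sheet_model_props[OF m] by simp_all
qed

lemma sheet_chart_hom:
  "k \<in> K \<Longrightarrow> homeomorphism (B \<inter> coord_plane k) (\<sigma> k ` (B \<inter> coord_plane k)) (\<sigma> k) (\<lambda>x. f (i x))"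
  using chart unfolding sheet_chart_def by blast

lemma sheet_chart_inv: "k \<in> K \<Longrightarrow> v \<in> B \<Longrightarrow> v \<in> coord_plane k \<Longrightarrow> f (i (\<sigma> k v)) = v"
  using homeomorphism_apply1[OF sheet_chart_hom[of k]] by simp

lemma sheet_chart_base: "nbhd_in M p N" "pl_homeomorphism N B f g" "f p = 0" "p \<in> N" "p \<in> M" "N \<subseteq> M"
proof -
  show n: "nbhd_in M p N" "pl_homeomorphism N B f g" "f p = 0" using chart unfolding sheet_chart_def by simp_all
  show "p \<in> N" "N \<subseteq> M" using n(1) unfolding nbhd_in_def by auto
  then show "p \<in> M" by auto
qed

lemma sheet_chart_fg: "homeomorphism N B f g" "pl_on f N" "pl_on g B"
  using sheet_chart_base(2) unfolding pl_homeomorphism_def by blast+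

lemma sheet_chart_fgI: "q \<in> N \<Longrightarrow> g (f q) = q" "q \<in> N \<Longrightarrow> f q \<in> B" "v \<in> B \<Longrightarrow> f (g v) = v" "v \<in> B \<Longrightarrow> g v \<in> N"
  using sheet_chart_fg(1) unfolding homeomorphism_def by auto

lemma sheet_chart_preimage: "{x \<in> F. i x \<in> N} = (\<Union>k\<in>K. \<sigma> k ` (B \<inter> coord_plane k))"
  using chart unfolding sheet_chart_def by blast

lemma sheet_chart_disjoint:
  "k \<in> K \<Longrightarrow> l \<in> K \<Longrightarrow> k \<noteq> l \<Longrightarrow> \<sigma> k ` (B \<inter> coord_plane k) \<inter> \<sigma> l ` (B \<inter> coord_plane l) = {}"
  using chart unfolding sheet_chart_def disjoint_family_on_def by blast

lemma sheet_chart_mem: "k \<in> K \<Longrightarrow> v \<in> B \<Longrightarrow> v \<in> coord_plane k \<Longrightarrow> \<sigma> k v \<in> F \<and> i (\<sigma> k v) = g v"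
proof -
  assume a: "k \<in> K" "v \<in> B" "v \<in> coord_plane k"
  then have "\<sigma> k v \<in> {x \<in> F. i x \<in> N}" using sheet_chart_preimage by blast
  then show ?thesis using sheet_chart_inv[OF a] sheet_chart_fgI(1)[of "i (\<sigma> k v)"] by simp
qed

lemma sheet_chart_cases:
  assumes "x \<in> F" "i x \<in> N"
  obtains k where "k \<in> K" "f (i x) \<in> B" "f (i x) \<in> coord_plane k" "x = \<sigma> k (f (i x))"
proof -
  have "x \<in> (\<Union>k\<in>K. \<sigma> k ` (B \<inter> coord_plane k))" using assms sheet_chart_preimage by blast
  then obtain k v where kv: "k \<in> K" "v \<in> B" "v \<in> coord_plane k" "x = \<sigma> k v" by blast
  then have "f (i x) = v" using sheet_chart_inv by blast
  then show thesis using that kv by blast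
qed

lemma sheet_chart_compact: "k \<in> K \<Longrightarrow> compact (\<sigma> k ` (B \<inter> coord_plane k))"
  using sheet_chart_hom[of k] coord_plane_props(1)[of k] sheet_chart_model(2)
  by (intro compact_continuous_image) (auto simp: homeomorphism_def compact_Int_closed)

text \<open>The sheets are compact and disjoint. Hence the other ones can be removed near a point of
  sheet \<open>k\<close>, and a whole neighbourhood in \<open>F\<close> lies in this sheet.\<close>

lemma sheet_chart_open:
  assumes "continuous_on F i" "k \<in> K" "openin (top_of_set M) U" "U \<subseteq> N" "i ` F \<subseteq> M"
    "v \<in> B" "v \<in> coord_plane k" "g v \<in> U"
  obtains W where "open W" "\<sigma> k v \<in> W" "F \<inter> W \<subseteq> \<sigma> k ` (B \<inter> coord_plane k)" "i ` (F \<inter> W) \<subseteq> U"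
proof -
  obtain U' where U': "open U'" "U = M \<inter> U'" using assms(3) openin_open by metis
  obtain V where V: "open V" "i -` U' \<inter> F = V \<inter> F"
    using continuous_on_open_invariant[of F i] assms(1) U'(1) by metis
  define W where "W = V - (\<Union>l\<in>K-{k}. \<sigma> l ` (B \<inter> coord_plane l))"
  have VF: "i x \<in> U" if "x \<in> V" "x \<in> F" for x
    using that V(2) U'(2) assms(5) by blast
  show thesis
  proof (rule that[of W])
    show "open W" unfolding W_def
      by (intro open_Diff V(1) closed_UN ballI compact_imp_closed sheet_chart_compact) auto
    have m: "\<sigma> k v \<in> F" "i (\<sigma> k v) = g v" using sheet_chart_mem assms by auto
    have "\<sigma> k v \<in> V" using m V(2) assms(8) U'(2) by fastforce
    moreover have "\<sigma> k v \<notin> \<sigma> l ` (B \<inter> coord_plane l)" if "l \<in> K - {k}" for l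
      using sheet_chart_disjoint[of k l] that assms(2,6,7) by blast
    ultimately show "\<sigma> k v \<in> W" unfolding W_def by blast
    show "i ` (F \<inter> W) \<subseteq> U" using VF unfolding W_def by blast
    show "F \<inter> W \<subseteq> \<sigma> k ` (B \<inter> coord_plane k)"
    proof
      fix x assume x: "x \<in> F \<inter> W"
      then have "i x \<in> N" using VF assms(4) unfolding W_def by blast
      then have "x \<in> (\<Union>k\<in>K. \<sigma> k ` (B \<inter> coord_plane k))" using sheet_chart_preimage x by blast
      then show "x \<in> \<sigma> k ` (B \<inter> coord_plane k)" using x unfolding W_def by blast
    qed
  qed
qed

text \<open>All model planes pass through the origin, so every sheet contributes one point to the
  fibre.\<close>

lemma sheet_chart_fibre: "{x \<in> F. i x = p} = (\<lambda>k. \<sigma> k 0) ` K"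
proof
  show "{x \<in> F. i x = p} \<subseteq> (\<lambda>k. \<sigma> k 0) ` K"
  proof
    fix x assume x: "x \<in> {x \<in> F. i x = p}"
    then have "i x \<in> N" using sheet_chart_base(4) by simp
    then show "x \<in> (\<lambda>k. \<sigma> k 0) ` K" using sheet_chart_cases[of x] x sheet_chart_base(3) by auto
  qed
  have "g 0 = p" using sheet_chart_fgI(1)[OF sheet_chart_base(4)] sheet_chart_base(3) by simp
  then show "(\<lambda>k. \<sigma> k 0) ` K \<subseteq> {x \<in> F. i x = p}"
    using sheet_chart_mem[of _ 0] sheet_chart_model(4) coord_plane_props(3) by auto
qed

lemma sheet_chart_inj: "inj_on (\<lambda>k. \<sigma> k 0) K"
  by (rule inj_onI) (use sheet_chart_disjoint sheet_chart_model(4) coord_plane_props(3) in blast)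

end

lemma three_other:
  assumes "(k::3) \<noteq> l"
  shows "\<exists>m. m \<noteq> k \<and> m \<noteq> l \<and> (\<forall>j. j = k \<or> j = l \<or> j = m)"
proof -
  have "card (UNIV - {k,l}) = 1" using assms by (subst card_Diff_subset) auto
  then obtain m where "UNIV - {k,l} = {m}" by (rule card_1_singletonE)
  then show ?thesis by blast
qed

section \<open>Generic maps and the local form of their double pairs\<close>

locale generic_map =
  fixes F :: "'b::euclidean_space set" and M :: "'a::euclidean_space set" and i :: "'b \<Rightarrow> 'a"
  assumes generic: "generic_surface F M i"
begin

lemma generic_props: "compact F" "pl_surface F" "pl_3manifold M" "proper_pl_map (2::2) F (3::3) M i"
  using generic unfolding generic_surface_def by blast+

lemma pl_i: "pl_on i F" and i_into: "i ` F \<subseteq> M"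
  using generic_props(4) unfolding proper_pl_map_def by blast+

lemma cont_i: "continuous_on F i" using pl_i pl_on_continuous by blast

lemma nonbranch_sheets:
  assumes "p \<in> i ` F" "\<not> branch_value F M i p"
  obtains B K where "sheet_model B K" "sheets_at F M i B K p"
proof -
  have "regular_value F M i p \<or> double_value F M i p \<or> triple_value F M i p \<or> RB_value F M i p \<or> DB_value F M i p"
    using generic assms unfolding generic_surface_def by blast
  then have "\<exists>B K. sheets_at F M i B K p \<and> K \<noteq> {} \<and> (B = cube \<or> B = half_cube \<and> K \<subseteq> {1, 2})"
    unfolding regular_value_def double_value_def triple_value_def RB_value_def DB_value_def
    by - (elim disjE exE conjE; intro exI; (rule conjI, assumption); force)
  then show thesis using that unfolding sheet_model_def by auto
qed

text \<open>The off-diagonal part of the fibre product of \<open>F\<close> with itself over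
  \<open>i\<close>. Double curves that cross at a triple value are separated here, since the six
  ordered pairs over this value are different points.\<close>

definition pairs :: "('b \<times> 'b) set" where
  "pairs = {w. fst w \<in> F \<and> snd w \<in> F \<and> fst w \<noteq> snd w \<and> i (fst w) = i (snd w)}"

lemma branch_fibre: "branch_value F M i (i x) \<Longrightarrow> x \<in> F \<Longrightarrow> y \<in> F \<Longrightarrow> i x = i y \<Longrightarrow> x = y"
proof -
  assume a: "branch_value F M i (i x)" "x \<in> F" "y \<in> F" "i x = i y"
  then obtain z where "{x' \<in> F. i x' = i x} = {z}" unfolding branch_value_def by auto
  then show "x = y" using a by (metis (mono_tags, lifting) mem_Collect_eq singletonD)
qed

text \<open>There is one preimage for each sheet, and a single one at a branch value. This will
  exclude that \<open>i\<close> collapses a segment.\<close>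

lemma finite_fibre: "finite {x \<in> F. i x = p}"
proof (cases "p \<in> i ` F")
  case False then have "{x \<in> F. i x = p} = {}" by blast
  then show ?thesis by (simp only: finite.emptyI)
next
  case True
  show ?thesis
  proof (cases "branch_value F M i p")
    case True then show ?thesis unfolding branch_value_def by force
  next
    case False
    then obtain B K where "sheet_model B K" "sheets_at F M i B K p" using nonbranch_sheets True by metis
    then obtain N f g \<sigma> where "sheet_chart F M i p B K N f g \<sigma>" using sheets_at_imp_chart by metis
    then show ?thesis using sheet_chart_fibre by fastforce
  qed
qed

text \<open>The sheets over the coordinate planes \<open>k\<close> and \<open>l\<close> meet along
  the axis of the remaining coordinate \<open>m\<close>, and \<open>lam\<close> reads off this
  coordinate. The axis is a full interval in the cube and a half interval in the half cube; this
  tells inner points of the 1-manifold of pairs from its ends at DB values.\<close>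

lemma pair_chart:
  assumes w: "w \<in> pairs"
  obtains W T \<tau> lam where "open W" "w \<in> W" "0 \<in> T" "\<tau> 0 = w" "\<tau> ` T \<subseteq> pairs" "pairs \<inter> W \<subseteq> \<tau> ` T"
    "homeomorphism T (\<tau> ` T) \<tau> lam"
    "T = {-1..1::real} \<and> (double_value F M i (i (fst w)) \<or> triple_value F M i (i (fst w))) \<or>
     T = {0..1} \<and> DB_value F M i (i (fst w))"
proof -
  define x y p where "x = fst w" "y = snd w" "p = i x"
  have xy: "x \<in> F" "y \<in> F" "x \<noteq> y" "i y = p" "i x = p" using w unfolding pairs_def x_y_p_def by auto
  have "\<not> branch_value F M i p" using branch_fibre[of x y] xy by auto
  then obtain B K where BK: "sheet_model B K" "sheets_at F M i B K p" using nonbranch_sheets xy by blast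
  then obtain N f g \<sigma> where ch: "sheet_chart F M i p B K N f g \<sigma>" using sheets_at_imp_chart by metis
  note fib = sheet_chart_fibre[OF ch]
  obtain k l where kl: "k \<in> K" "l \<in> K" "x = \<sigma> k 0" "y = \<sigma> l 0"
    using fib xy by (metis (mono_tags, lifting) imageE mem_Collect_eq)
  have "k \<noteq> l" using kl xy by blast
  then obtain m where m: "m \<noteq> k" "m \<noteq> l" "\<And>j. j = k \<or> j = l \<or> j = m" using three_other by metis
  note mod = sheet_chart_model[OF ch]
  define T where "T = {t. t *\<^sub>R axis m 1 \<in> B}"
  have T: "T = {-1..1::real} \<and> (double_value F M i p \<or> triple_value F M i p) \<or> T = {0..1} \<and> DB_value F M i p"
  proof (cases "B = cube")
    case True
    have "T = {-1..1}" unfolding T_def True cube_def by (auto simp: mem_box_cart axis_def)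
    moreover have "card K = 2 \<or> card K = 3"
    proof -
      have "card {k,l} \<le> card K" "card K \<le> card (UNIV::3 set)" using kl by (intro card_mono; simp)+
      then show ?thesis using \<open>k \<noteq> l\<close> by auto
    qed
    then have "double_value F M i p \<or> triple_value F M i p"
      using BK(2) True unfolding double_value_def triple_value_def by blast
    ultimately show ?thesis by blast
  next
    case False
    then have h: "B = half_cube" "K \<subseteq> {1,2}" using BK(1) unfolding sheet_model_def by auto
    \<comment> \<open>In the half cube, the remaining axis is the inward normal of the boundary
      face.\<close>
    then have K: "K = {1,2}" using kl(1,2) \<open>k \<noteq> l\<close> by auto
    then have "m = 3" using m(1,2) exhaust_3[of m] kl(1,2) \<open>k \<noteq> l\<close> by auto
    then have "T = {0..1}" unfolding T_def h half_cube_def cube_def half_space_def by (auto simp: mem_box_cart axis_def)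
    moreover have "DB_value F M i p" unfolding DB_value_def using BK(2) h K by (intro exI[of _ K]) auto
    ultimately show ?thesis by blast
  qed
  have T0: "0 \<in> T" unfolding T_def using mod by simp
  have Tpl: "t *\<^sub>R axis m 1 \<in> coord_plane k" "t *\<^sub>R axis m 1 \<in> coord_plane l" for t
    using m by (auto simp: coord_plane_def axis_def)
  define \<tau> where "\<tau> = (\<lambda>t. (\<sigma> k (t *\<^sub>R axis m 1), \<sigma> l (t *\<^sub>R axis m 1)))"
  define lam where "lam = (\<lambda>z :: 'b \<times> 'b. f (i (fst z)) $ m)"
  have \<tau>0: "\<tau> 0 = w" using kl x_y_p_def by (simp add: \<tau>_def prod_eq_iff)
  have \<tau>P: "\<tau> t \<in> pairs" if t: "t \<in> T" for t
  proof -
    let ?v = "t *\<^sub>R axis m 1"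
    have v: "?v \<in> B" using t by (simp add: T_def)
    have "\<sigma> k ?v \<noteq> \<sigma> l ?v"
      using sheet_chart_disjoint[OF ch kl(1,2) \<open>k \<noteq> l\<close>] v Tpl by blast
    then show ?thesis
      using sheet_chart_mem[OF ch kl(1) v Tpl(1)] sheet_chart_mem[OF ch kl(2) v Tpl(2)]
      by (simp add: pairs_def \<tau>_def)
  qed
  have lam\<tau>: "lam (\<tau> t) = t" if "t \<in> T" for t
    using sheet_chart_inv[OF ch kl(1) _ Tpl(1)] that by (simp add: lam_def \<tau>_def T_def axis_def)
  have contT: "continuous_on T \<tau>"
  proof -
    have "continuous_on T (\<lambda>t. \<sigma> j (t *\<^sub>R axis m 1))" if "j \<in> {k,l}" for j
    proof -
      have "continuous_on (B \<inter> coord_plane j) (\<sigma> j)"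
        using sheet_chart_hom[OF ch, of j] that kl unfolding homeomorphism_def by blast
      then show ?thesis
        by (rule continuous_on_compose2) (use Tpl that in \<open>auto intro!: continuous_intros simp: T_def\<close>)
    qed
    then show ?thesis unfolding \<tau>_def by (intro continuous_on_Pair) auto
  qed
  have "compact T" using T by auto
  have hom: "homeomorphism T (\<tau> ` T) \<tau> lam"
    unfolding homeomorphism_def
  proof (intro conjI ballI contT)
    show "continuous_on (\<tau> ` T) lam"
      using continuous_on_inv[OF contT \<open>compact T\<close>] lam\<tau> by blast
    show "lam ` \<tau> ` T = T" using lam\<tau> by (auto simp: image_iff)
  qed (use lam\<tau> in auto)
  obtain U where U: "openin (top_of_set M) U" "p \<in> U" "U \<subseteq> N"
    using sheet_chart_base(1)[OF ch] unfolding nbhd_in_def by blast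
  have g0: "g 0 = p" using sheet_chart_fgI(1)[OF ch sheet_chart_base(4)[OF ch]] sheet_chart_base(3)[OF ch] by simp
  obtain W1 where W1: "open W1" "x \<in> W1" "F \<inter> W1 \<subseteq> \<sigma> k ` (B \<inter> coord_plane k)"
    using sheet_chart_open[OF ch cont_i kl(1) U(1,3) i_into mod(4) coord_plane_props(3)] g0 U(2) kl(3) by metis
  obtain W2 where W2: "open W2" "y \<in> W2" "F \<inter> W2 \<subseteq> \<sigma> l ` (B \<inter> coord_plane l)"
    using sheet_chart_open[OF ch cont_i kl(2) U(1,3) i_into mod(4) coord_plane_props(3)] g0 U(2) kl(4) by metis
  \<comment> \<open>\<open>W1\<close> and \<open>W2\<close> confine the two points to the sheets
    \<open>k\<close> and \<open>l\<close>, so their common value has to lie on the axis.\<close>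
  have sub: "pairs \<inter> (W1 \<times> W2) \<subseteq> \<tau> ` T"
  proof
    fix z assume z: "z \<in> pairs \<inter> (W1 \<times> W2)"
    then have "fst z \<in> \<sigma> k ` (B \<inter> coord_plane k)" "snd z \<in> \<sigma> l ` (B \<inter> coord_plane l)"
      using W1(3) W2(3) unfolding pairs_def by (auto simp: mem_Times_iff)
    then obtain u v where uv: "fst z = \<sigma> k u" "u \<in> B" "u \<in> coord_plane k" "snd z = \<sigma> l v" "v \<in> B" "v \<in> coord_plane l"
      by (elim imageE) auto
    have "f (i (fst z)) = u" "f (i (snd z)) = v" using uv sheet_chart_inv[OF ch] kl by auto
    then have "u = v" using z by (auto simp: pairs_def)
    have "u = (u $ m) *\<^sub>R axis m 1"
      unfolding vec_eq_iff
    proof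
      fix j show "u $ j = ((u $ m) *\<^sub>R axis m 1) $ j"
        using m(3)[of j] m(1,2) uv(3,6) \<open>u = v\<close> by (auto simp: coord_plane_def axis_def)
    qed
    then have "z = \<tau> (u $ m)" "u $ m \<in> T" using uv \<open>u = v\<close> by (auto simp: \<tau>_def prod_eq_iff T_def)
    then show "z \<in> \<tau> ` T" by blast
  qed
  show thesis
    by (rule that[of "W1 \<times> W2" T \<tau> lam])
       (use W1 W2 T0 \<tau>0 \<tau>P sub hom T x_y_p_def in \<open>auto simp: open_Times mem_Times_iff\<close>)
qed

end

section \<open>The space of double pairs\<close>

lemma collinear_if_triples:
  assumes "w \<in> S" "\<And>a b. a \<in> S \<Longrightarrow> b \<in> S \<Longrightarrow> collinear {w, a, b}"
  shows "collinear S"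
proof (cases "S = {w}")
  case True then show ?thesis by simp
next
  case False
  then obtain a where a: "a \<in> S" "a \<noteq> w" using assms(1) by blast
  have "collinear (insert w (insert a S))"
    using a assms(2) by (subst collinear_triples) auto
  moreover have "insert w (insert a S) = S" using a assms(1) by blast
  ultimately show ?thesis by simp
qed

text \<open>Of three points, the one with the middle value lies between the other two: by the
  intermediate value theorem the segment joining these contains a point with the same value, and
  \<open>h\<close> is injective.\<close>

lemma inj_real_convex_collinear:
  fixes h :: "'a::euclidean_space \<Rightarrow> real"
  assumes C: "convex C" and h: "continuous_on C h" "inj_on h C"
  shows "collinear C"
proof -
  have mid: "collinear {u, v, s}" if "u \<in> C" "v \<in> C" "s \<in> C" "h u \<le> h v" "h v \<le> h s" for u v s
  proof -
    have sub: "closed_segment u s \<subseteq> C" using that C closed_segment_subset by blast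
    have "h ` closed_segment u s \<subseteq> UNIV \<and> connected (h ` closed_segment u s)"
      using sub h(1) continuous_on_subset by (blast intro: connected_continuous_image connected_segment)
    then have "h v \<in> h ` closed_segment u s"
      using that(4,5) unfolding connected_iff_interval by (meson ends_in_segment image_eqI)
    then obtain z where z: "z \<in> closed_segment u s" "h z = h v" by auto
    then have "z = v" using h(2) sub that(2) by (meson inj_onD subsetD)
    then show ?thesis using z(1) collinear_between_cases[of u v s] between_mem_segment[of s u v]
      by (simp add: closed_segment_commute)
  qed
  show ?thesis
  proof (cases "C = {}")
    case False
    then obtain w where w: "w \<in> C" by blast
    show ?thesis
    proof (rule collinear_if_triples[OF w])
      fix a b assume ab: "a \<in> C" "b \<in> C"
      have p: "{w,a,b} = {w,b,a}" "{w,a,b} = {a,w,b}" "{w,a,b} = {a,b,w}" "{w,a,b} = {b,a,w}" "{w,a,b} = {b,w,a}"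
        by auto
      consider "h w \<le> h a" "h a \<le> h b" | "h w \<le> h b" "h b \<le> h a" | "h a \<le> h w" "h w \<le> h b"
        | "h a \<le> h b" "h b \<le> h w" | "h b \<le> h w" "h w \<le> h a" | "h b \<le> h a" "h a \<le> h w" by linarith
      then show "collinear {w,a,b}"
      proof cases
        case 1 then show ?thesis using mid[OF w ab] by simp
      next
        case 2 then show ?thesis using mid[OF w ab(2,1)] unfolding p(1) by simp
      next
        case 3 then show ?thesis using mid[OF ab(1) w ab(2)] unfolding p(2) by simp
      next
        case 4 then show ?thesis using mid[OF ab w] unfolding p(3) by simp
      next
        case 5 then show ?thesis using mid[OF ab(2) w ab(1)] unfolding p(5) by simp
      next
        case 6 then show ?thesis using mid[OF ab(2,1) w] unfolding p(4) by simp
      qed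
    qed
  qed auto
qed

definition diag :: "('b \<times> 'b) set" where "diag = {w. fst w = snd w}"

lemma closed_diag: "closed (diag :: ('b::t2_space \<times> 'b) set)"
  unfolding diag_def by (intro closed_Collect_eq continuous_intros)

text \<open>The diagonal is a linear subspace, and a line that meets it twice lies in it.\<close>

lemma collinear_diag:
  assumes "collinear S" "u \<in> S" "v \<in> S" "u \<noteq> v" "u \<in> diag" "v \<in> diag"
  shows "S \<subseteq> (diag :: ('b::euclidean_space \<times> 'b) set)"
proof
  fix x assume "x \<in> S"
  then have "collinear {u,x,v}" using assms(1-3) collinear_subset[of S "{u,x,v}"] by auto
  then obtain c where "x = c *\<^sub>R u + (1 - c) *\<^sub>R v" using assms(4) unfolding collinear_3_expand by blast
  then show "x \<in> diag" using assms(5,6) unfolding diag_def by simp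
qed

context generic_map
begin

definition pair_chart_at ::
  "'b \<times> 'b \<Rightarrow> ('b \<times> 'b) set \<Rightarrow> real set \<Rightarrow> (real \<Rightarrow> 'b \<times> 'b) \<Rightarrow> ('b \<times> 'b \<Rightarrow> real) \<Rightarrow> bool" where
  "pair_chart_at w W T \<tau> lam \<longleftrightarrow>
     open W \<and> w \<in> W \<and> 0 \<in> T \<and> \<tau> 0 = w \<and> \<tau> ` T \<subseteq> pairs \<and> pairs \<inter> W \<subseteq> \<tau> ` T \<and>
     homeomorphism T (\<tau> ` T) \<tau> lam \<and>
     (T = {-1..1} \<and> (double_value F M i (i (fst w)) \<or> triple_value F M i (i (fst w))) \<or>
      T = {0..1} \<and> DB_value F M i (i (fst w)))"

lemma pair_chart_atD:
  assumes "pair_chart_at w W T \<tau> lam"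
  shows "open W" "w \<in> W" "0 \<in> T" "\<tau> 0 = w" "\<tau> ` T \<subseteq> pairs" "pairs \<inter> W \<subseteq> \<tau> ` T"
    "homeomorphism T (\<tau> ` T) \<tau> lam"
    "T = {-1..1} \<and> (double_value F M i (i (fst w)) \<or> triple_value F M i (i (fst w))) \<or>
     T = {0..1} \<and> DB_value F M i (i (fst w))"
  using assms unfolding pair_chart_at_def by auto

lemma ex_pair_chart_at:
  assumes "w \<in> pairs"
  shows "\<exists>W T \<tau> lam. pair_chart_at w W T \<tau> lam"
  by (rule pair_chart[OF assms], intro exI, unfold pair_chart_at_def, intro conjI, assumption+)

lemma pairs_diag: "pairs \<inter> diag = {}"
  unfolding pairs_def diag_def by auto

lemma pairs_swap: "w \<in> pairs \<Longrightarrow> prod.swap w \<in> pairs"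
  unfolding pairs_def by auto

lemma pairs_fst_snd: "w \<in> pairs \<Longrightarrow> i (snd w) = i (fst w)"
  unfolding pairs_def by auto

text \<open>Near \<open>w\<close> the pairs have an injective real coordinate, so the convex set is
  collinear there. A contraction towards \<open>w\<close> carries this over to arbitrary points of
  \<open>S\<close>.\<close>

lemma convex_pairs_collinear:
  assumes "convex S" "S \<subseteq> pairs \<union> diag" "w \<in> S" "w \<in> pairs"
  shows "collinear S"
proof -
  obtain W T \<tau> lam where "pair_chart_at w W T \<tau> lam"
    using ex_pair_chart_at[OF assms(4)] by (elim exE)
  note ch = pair_chart_atD(1,2,6,7)[OF this]
  have "open (W - diag)" by (rule open_Diff[OF ch(1) closed_diag])
  moreover have "w \<in> W - diag" using ch(2) assms(4) pairs_diag by auto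
  ultimately obtain r where r: "r > 0" "ball w r \<subseteq> W - diag" using open_contains_ball by metis
  define C where "C = S \<inter> ball w r"
  have C: "C \<subseteq> \<tau> ` T" using r(2) assms(2) ch(3) unfolding C_def by blast
  have "continuous_on C lam" using continuous_on_subset[OF homeomorphism_cont2[OF ch(4)] C] .
  moreover have "inj_on lam C"
    by (rule inj_on_inverseI[of _ \<tau>]) (use C homeomorphism_apply2[OF ch(4)] in auto)
  moreover have "convex C" unfolding C_def using assms(1) by (simp add: convex_Int)
  ultimately have col: "collinear C" by (intro inj_real_convex_collinear)
  show ?thesis
  proof (rule collinear_if_triples[OF assms(3)])
    fix a b assume ab: "a \<in> S" "b \<in> S"
    \<comment> \<open>\<open>d\<close> dominates the distances of \<open>a\<close> and
      \<open>b\<close> from \<open>w\<close>, so contraction by the factor \<open>e\<close> brings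
      both into the ball of radius \<open>r\<close>.\<close>
    define d where "d = 1 + norm (a - w) + norm (b - w)"
    define e where "e = min 1 (r / (2 * d))"
    have den: "d > 0" by (simp add: d_def add_pos_nonneg)
    have e: "e > 0" "e \<le> 1" using r(1) den by (auto simp: e_def)
    have "e \<le> r / (2 * d)" by (simp add: e_def)
    then have ed: "e * d \<le> r / 2" using den by (simp add: field_simps)
    have in_C: "w + e *\<^sub>R (c - w) \<in> C" if "c = a \<or> c = b" for c
    proof -
      have "e * norm (c - w) \<le> e * d"
        using that e(1) by (intro mult_left_mono) (auto simp: d_def)
      moreover have "norm (e *\<^sub>R (c - w)) = e * norm (c - w)" using e(1) by simp
      ultimately have "norm (e *\<^sub>R (c - w)) < r" using ed r(1) by linarith
      then have "w + e *\<^sub>R (c - w) \<in> ball w r" by (simp add: dist_norm)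
      moreover have "w + e *\<^sub>R (c - w) = (1 - e) *\<^sub>R w + e *\<^sub>R c" by (simp add: algebra_simps)
      then have "w + e *\<^sub>R (c - w) \<in> S"
        using convexD_alt[OF assms(1,3), of c e] that ab e by auto
      ultimately show ?thesis unfolding C_def by blast
    qed
    have "w \<in> C" using assms(3) r(1) by (simp add: C_def)
    then have "collinear {w + e *\<^sub>R (a - w), w, w + e *\<^sub>R (b - w)}"
      using in_C collinear_subset[OF col] by auto
    then have "collinear {0, e *\<^sub>R (a - w), e *\<^sub>R (b - w)}"
      unfolding collinear_def by (auto simp: algebra_simps)
    then consider "a = w" | "b = w" | c where "e *\<^sub>R (b - w) = c *\<^sub>R (e *\<^sub>R (a - w))"
      unfolding collinear_lemma using e(1) by auto
    then have "collinear {0, a - w, b - w}"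
    proof cases
      case (3 c)
      then have "e *\<^sub>R (b - w) = e *\<^sub>R (c *\<^sub>R (a - w))" by (simp add: mult.commute)
      then have "b - w = c *\<^sub>R (a - w)" using e(1) by (simp only: scaleR_cancel_left) simp
      then show ?thesis unfolding collinear_lemma by (intro disjI2 exI)
    qed (simp_all add: collinear_lemma)
    then have "collinear {a, w, b}" unfolding collinear_def by (auto simp: algebra_simps)
    then show "collinear {w, a, b}" by (simp add: insert_commute)
  qed
qed

text \<open>An affine map that identifies two points of a polytope is constant on the segment
  between them, contrary to the finiteness of fibres.\<close>

lemma cells:
  obtains \<Q> where "finite \<Q>" "F = \<Union>\<Q>" "\<And>Q. Q \<in> \<Q> \<Longrightarrow> polytope Q \<and> affine_on i Q \<and> inj_on i Q"
proof -
  obtain \<Q> where Q: "finite \<Q>" "F = \<Union>\<Q>" "\<And>Q. Q \<in> \<Q> \<Longrightarrow> polytope Q \<and> affine_on i Q"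
    by (rule pl_on_compact[OF pl_i generic_props(1)]) (rule that)
  have "inj_on i Q" if "Q \<in> \<Q>" for Q
  proof (rule inj_onI, rule ccontr)
    fix x y assume xy: "x \<in> Q" "y \<in> Q" "i x = i y" "x \<noteq> y"
    have "closed_segment x y \<subseteq> {z \<in> F. i z = i x}"
    proof
      fix z assume "z \<in> closed_segment x y"
      then obtain u where u: "0 \<le> u" "u \<le> 1" "z = (1 - u) *\<^sub>R x + u *\<^sub>R y" unfolding in_segment by blast
      have z: "z \<in> Q" using convexD_alt[of Q x y u] Q(3)[OF that] xy u polytope_imp_convex by blast
      then have "i z = (1 - u) *\<^sub>R i x + u *\<^sub>R i y"
        using affine_on_convex_comb[of i Q x y u] Q(3)[OF that] xy u by blast
      then have "i z = i x" using xy(3) by (simp add: algebra_simps)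
      then show "z \<in> {z \<in> F. i z = i x}" using z that Q(2) by auto
    qed
    then have "finite (closed_segment x y)" using finite_fibre finite_subset by blast
    then show False using xy(4) by simp
  qed
  then show thesis using that Q by auto
qed

text \<open>The last condition discards those cells of the fibre product that lie in the diagonal,
  such as the one obtained from a cell of \<open>F\<close> and itself. The remaining ones can only
  touch the diagonal.\<close>

definition is_segs :: "('b \<times> 'b) set set \<Rightarrow> bool" where
  "is_segs \<S> \<longleftrightarrow> finite \<S> \<and> pairs \<subseteq> \<Union>\<S> \<and> \<Union>\<S> \<subseteq> pairs \<union> diag \<and>
     (\<forall>S\<in>\<S>. (\<exists>c d. S = closed_segment c d) \<and> finite (S \<inter> diag) \<and> S \<inter> pairs \<noteq> {})"

text \<open>For two cells, the points of their product with equal values form a compact convex set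
  inside \<open>pairs \<union> diag\<close>. If it contains a pair it is collinear, hence a segment,
  and it meets the diagonal at most once.\<close>

lemma ex_segs: "\<exists>\<S>. is_segs \<S>"
proof -
  obtain \<Q> where Q: "finite \<Q>" "F = \<Union>\<Q>" "\<And>Q. Q \<in> \<Q> \<Longrightarrow> polytope Q \<and> affine_on i Q \<and> inj_on i Q"
    using cells by metis
  define R where "R = (\<lambda>(Q, Q'). {w. fst w \<in> Q \<and> snd w \<in> Q' \<and> i (fst w) = i (snd w)})"
  define \<S> where "\<S> = {S \<in> R ` (\<Q> \<times> \<Q>). S \<inter> pairs \<noteq> {}}"
  have sub: "R z \<subseteq> pairs \<union> diag" if "z \<in> \<Q> \<times> \<Q>" for z
    using that Q(2) unfolding R_def pairs_def diag_def by auto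
  have conv: "convex (R z)" if z: "z \<in> \<Q> \<times> \<Q>" for z
    unfolding convex_alt
  proof (intro ballI allI impI)
    obtain P P' where P: "z = (P, P')" "P \<in> \<Q>" "P' \<in> \<Q>" using z by auto
    note pp = Q(3)[OF P(2)] Q(3)[OF P(3)]
    fix v w u assume vw: "v \<in> R z" "w \<in> R z" and u: "0 \<le> u \<and> u \<le> (1::real)"
    have a: "(1 - u) *\<^sub>R fst v + u *\<^sub>R fst w \<in> P" "(1 - u) *\<^sub>R snd v + u *\<^sub>R snd w \<in> P'"
      using convexD_alt[of P "fst v" "fst w" u] convexD_alt[of P' "snd v" "snd w" u] u vw pp polytope_imp_convex
      unfolding R_def P(1) by auto
    have "i ((1 - u) *\<^sub>R fst v + u *\<^sub>R fst w) = (1 - u) *\<^sub>R i (fst v) + u *\<^sub>R i (fst w)"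
      using affine_on_convex_comb[of i P "fst v" "fst w" u] a vw pp unfolding R_def P(1) by auto
    moreover have "i ((1 - u) *\<^sub>R snd v + u *\<^sub>R snd w) = (1 - u) *\<^sub>R i (snd v) + u *\<^sub>R i (snd w)"
      using affine_on_convex_comb[of i P' "snd v" "snd w" u] a vw pp unfolding R_def P(1) by auto
    ultimately show "(1 - u) *\<^sub>R v + u *\<^sub>R w \<in> R z" using a vw unfolding R_def P(1) by simp
  qed
  have comp: "compact (R z)" if z: "z \<in> \<Q> \<times> \<Q>" for z
  proof -
    obtain P P' where P: "z = (P, P')" "P \<in> \<Q>" "P' \<in> \<Q>" using z by auto
    note pp = Q(3)[OF P(2)] Q(3)[OF P(3)]
    have "compact (P \<times> P')" using pp polytope_imp_compact compact_Times by blast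
    moreover have "continuous_on (P \<times> P') (\<lambda>w. i (fst w) - i (snd w))"
    proof (intro continuous_on_diff)
      show "continuous_on (P \<times> P') (\<lambda>w. i (fst w))"
        by (rule continuous_on_compose2[of P i]) (use pp affine_on_continuous in \<open>auto intro: continuous_on_fst continuous_on_id\<close>)
      show "continuous_on (P \<times> P') (\<lambda>w. i (snd w))"
        by (rule continuous_on_compose2[of P' i]) (use pp affine_on_continuous in \<open>auto intro: continuous_on_snd continuous_on_id\<close>)
    qed
    moreover have "R z = {w \<in> P \<times> P'. i (fst w) - i (snd w) = 0}"
      unfolding R_def P(1) by (auto simp: mem_Times_iff)
    ultimately show ?thesis
      using continuous_closedin_preimage_constant[of "P \<times> P'" "\<lambda>w. i (fst w) - i (snd w)" 0]
        closedin_compact[of "P \<times> P'" "R z"] by simp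
  qed
  have "is_segs \<S>"
    unfolding is_segs_def
  proof (intro conjI ballI)
    show "finite \<S>" unfolding \<S>_def using Q(1) by simp
    show "pairs \<subseteq> \<Union>\<S>"
    proof
      fix w assume w: "w \<in> pairs"
      then obtain P P' where "P \<in> \<Q>" "P' \<in> \<Q>" "fst w \<in> P" "snd w \<in> P'"
        using Q(2) unfolding pairs_def by auto
      then have "w \<in> R (P, P')" "(P, P') \<in> \<Q> \<times> \<Q>" using w unfolding R_def pairs_def by auto
      then have "R (P, P') \<in> \<S>" using w unfolding \<S>_def by blast
      then show "w \<in> \<Union>\<S>" using \<open>w \<in> R (P, P')\<close> by (rule UnionI)
    qed
    show "\<Union>\<S> \<subseteq> pairs \<union> diag" using sub unfolding \<S>_def by (intro Union_least) auto
    fix S assume "S \<in> \<S>"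
    then obtain z where z: "z \<in> \<Q> \<times> \<Q>" "S = R z" "S \<inter> pairs \<noteq> {}" unfolding \<S>_def by auto
    then obtain w where w: "w \<in> S" "w \<in> pairs" by blast
    have col: "collinear S"
      using convex_pairs_collinear[OF _ _ w] conv[OF z(1)] sub[OF z(1)] z(2) by simp
    show "S \<inter> pairs \<noteq> {}" by fact
    have "S \<noteq> {}" "compact S" "convex S" using w conv comp z by auto
    then show "\<exists>c d. S = closed_segment c d" using compact_convex_collinear_segment col by metis
    have "u = v" if "u \<in> S \<inter> diag" "v \<in> S \<inter> diag" for u v
      using collinear_diag[OF col, of u v] w that pairs_diag by blast
    then show "finite (S \<inter> diag)" by (metis finite.simps finite_subset singletonI subsetI insertI1)
  qed
  then show ?thesis by blast
qed

definition segs :: "('b \<times> 'b) set set" where "segs = (SOME \<S>. is_segs \<S>)"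

lemma segs: "is_segs segs"
  unfolding segs_def using ex_segs by (rule someI_ex)

lemma segs_props:
  "finite segs" "pairs \<subseteq> \<Union>segs" "\<Union>segs \<subseteq> pairs \<union> diag"
  "S \<in> segs \<Longrightarrow> \<exists>c d. S = closed_segment c d" "S \<in> segs \<Longrightarrow> finite (S \<inter> diag)" "S \<in> segs \<Longrightarrow> S \<inter> pairs \<noteq> {}"
  using segs unfolding is_segs_def by auto

lemma closed_segs: "S \<in> segs \<Longrightarrow> closed S"
  using segs_props(4) by force

lemma closure_pairs: "closure pairs \<subseteq> \<Union>segs"
  using segs_props(1,2) closed_segs by (intro closure_minimal closed_Union) auto

lemma finite_diag_segs: "finite (\<Union>segs \<inter> diag)"
proof -
  have "\<Union>segs \<inter> diag = (\<Union>S\<in>segs. S \<inter> diag)" by blast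
  moreover have "finite (\<Union>S\<in>segs. S \<inter> diag)" by (intro finite_UN_I segs_props(1,5))
  ultimately show ?thesis by (simp only:)
qed

text \<open>At any other value, a neighbourhood of \<open>x\<close> lies in a single sheet, where
  \<open>i\<close> is injective.\<close>

lemma diag_closure_branch:
  assumes "x \<in> F" "(x, x) \<in> closure pairs"
  shows "branch_value F M i (i x)"
proof (rule ccontr)
  assume "\<not> ?thesis"
  then obtain B K where BK: "sheet_model B K" "sheets_at F M i B K (i x)" using nonbranch_sheets assms(1) by blast
  then obtain N f g \<sigma> where ch: "sheet_chart F M i (i x) B K N f g \<sigma>" using sheets_at_imp_chart by metis
  have "x \<in> {y \<in> F. i y = i x}" using assms(1) by simp
  then obtain k where k: "k \<in> K" "x = \<sigma> k 0" unfolding sheet_chart_fibre[OF ch] by blast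
  obtain U where U: "openin (top_of_set M) U" "i x \<in> U" "U \<subseteq> N"
    using sheet_chart_base(1)[OF ch] unfolding nbhd_in_def by blast
  have g0: "g 0 = i x" using sheet_chart_fgI(1)[OF ch sheet_chart_base(4)[OF ch]] sheet_chart_base(3)[OF ch] by simp
  obtain W where W: "open W" "x \<in> W" "F \<inter> W \<subseteq> \<sigma> k ` (B \<inter> coord_plane k)"
    using sheet_chart_open[OF ch cont_i k(1) U(1,3) i_into sheet_chart_model(4)[OF ch] coord_plane_props(3)]
      g0 U(2) k(2) by metis
  have "(x, x) \<in> W \<times> W" "open (W \<times> W)" using W by (auto simp: open_Times)
  then obtain w where w: "w \<in> pairs" "w \<in> W \<times> W" using assms(2) closure_iff_nhds_not_empty by blast
  then have "fst w \<in> \<sigma> k ` (B \<inter> coord_plane k)" "snd w \<in> \<sigma> k ` (B \<inter> coord_plane k)"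
    using W(3) unfolding pairs_def by (auto simp: mem_Times_iff)
  then obtain u v where "fst w = \<sigma> k u" "snd w = \<sigma> k v" "u \<in> B" "u \<in> coord_plane k" "v \<in> B" "v \<in> coord_plane k"
    by (elim imageE) auto
  then have "fst w = snd w"
    using sheet_chart_inv[OF ch k(1)] pairs_fst_snd[OF w(1)] by metis
  then show False using w(1) unfolding pairs_def by simp
qed

end

section \<open>Branch points\<close>

definition pt :: "real \<Rightarrow> real \<Rightarrow> real \<Rightarrow> real^3" where
  "pt x y z = x *\<^sub>R axis 1 1 + y *\<^sub>R axis 2 1 + z *\<^sub>R axis 3 1"

lemma pt_nth [simp]: "pt x y z $ 1 = x" "pt x y z $ 2 = y" "pt x y z $ 3 = z"
  by (simp_all add: pt_def axis_def)

lemma vec3_eq_iff: "v = w \<longleftrightarrow> v $ 1 = w $ 1 \<and> v $ 2 = w $ 2 \<and> v $ 3 = w $ 3" for v w :: "real^3"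
  by (simp add: vec_eq_iff forall_3)

lemma pt_collapse [simp]: "pt (v $ 1) (v $ 2) (v $ 3) = v"
  by (simp add: vec3_eq_iff)

lemma continuous_on_pt [continuous_intros]:
  "continuous_on S a \<Longrightarrow> continuous_on S b \<Longrightarrow> continuous_on S c \<Longrightarrow> continuous_on S (\<lambda>x. pt (a x) (b x) (c x))"
  unfolding pt_def by (intro continuous_intros)

lemma mem_cube: "v \<in> cube \<longleftrightarrow> (\<forall>k. \<bar>v $ k\<bar> \<le> 1)"
  unfolding cube_def by (auto simp: mem_box_cart abs_le_iff)

definition ocube :: "real \<Rightarrow> (real^3) set" where
  "ocube r = {v. \<forall>k. \<bar>v $ k\<bar> < r}"

lemma open_ocube: "open (ocube r)"
proof -
  have "ocube r = (\<Inter>k\<in>UNIV. {v. \<bar>v $ k\<bar> < r})" by (auto simp: ocube_def)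
  moreover have "open {v :: real^3. \<bar>v $ k\<bar> < r}" for k by (intro open_Collect_less continuous_intros)
  ultimately show ?thesis by auto
qed

lemma mem_ocube_3: "v \<in> ocube r \<longleftrightarrow> \<bar>v $ 1\<bar> < r \<and> \<bar>v $ 2\<bar> < r \<and> \<bar>v $ 3\<bar> < r"
  by (simp add: ocube_def forall_3)

lemma ocube_small:
  assumes "open V" "0 \<in> V"
  obtains r where "0 < r" "r < 1" "ocube r \<subseteq> V"
proof -
  obtain e where e: "e > 0" "ball 0 e \<subseteq> V" using assms open_contains_ball by blast
  define r where "r = min (1/2) (e / 4)"
  have "ocube r \<subseteq> ball 0 e"
  proof
    fix v assume v: "v \<in> ocube r"
    have "norm v \<le> (\<Sum>k\<in>UNIV. \<bar>v $ k\<bar>)" by (rule norm_le_l1_cart)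
    also have "\<dots> = \<bar>v $ 1\<bar> + \<bar>v $ 2\<bar> + \<bar>v $ 3\<bar>" by (simp add: sum_3)
    also have "\<dots> < e" using v e(1) unfolding mem_ocube_3 r_def by linarith
    finally show "v \<in> ball 0 e" by simp
  qed
  then show thesis using that[of r] e by (auto simp: r_def)
qed

text \<open>\<open>N\<close> need not be open in \<open>M\<close>. Inside a sufficiently small cube,
  openness in the coordinates does give openness in \<open>M\<close>.\<close>

lemma chart_core:
  assumes N: "nbhd_in M p N" and fg: "homeomorphism N B f g" and p: "f p = 0"
  obtains r where "0 < r" "r < 1" "\<And>V. open V \<Longrightarrow> V \<subseteq> ocube r \<Longrightarrow> openin (top_of_set M) {q \<in> N. f q \<in> V}"
proof -
  obtain U where U: "openin (top_of_set M) U" "p \<in> U" "U \<subseteq> N" "N \<subseteq> M"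
    using N unfolding nbhd_in_def by blast
  have "openin (top_of_set N) U" using U openin_subset_trans by blast
  then have "openin (top_of_set B) (f ` U)"
    using homeomorphism_imp_open_map[OF fg] by blast
  then obtain V where V: "open V" "f ` U = B \<inter> V" unfolding openin_open by blast
  have "f p \<in> f ` U" using U(2) by blast
  then have "0 \<in> V" using V(2) p by auto
  then obtain r where r: "0 < r" "r < 1" "ocube r \<subseteq> V" using ocube_small[OF V(1)] by metis
  show thesis
  proof (rule that[OF r(1,2)])
    fix V' assume V': "open V'" "V' \<subseteq> ocube r"
    have "{q \<in> N. f q \<in> V'} = U \<inter> f -` V'"
    proof
      show "{q \<in> N. f q \<in> V'} \<subseteq> U \<inter> f -` V'"
      proof
        fix q assume q: "q \<in> {q \<in> N. f q \<in> V'}"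
        then have "f q \<in> B" using homeomorphism_image1[OF fg] by auto
        then have "f q \<in> f ` U" using V(2) V'(2) r(3) q by auto
        then obtain q' where "q' \<in> U" "f q = f q'" by auto
        then have "q = q'" using q U(3) homeomorphism_apply1[OF fg] by (metis mem_Collect_eq subsetD)
        then show "q \<in> U \<inter> f -` V'" using q \<open>q' \<in> U\<close> by simp
      qed
    qed (use U(3) in auto)
    moreover have "openin (top_of_set U) (U \<inter> f -` V')"
      using continuous_on_subset[OF homeomorphism_cont1[OF fg] U(3)] V'(1) continuous_openin_preimage_gen by blast
    ultimately show "openin (top_of_set M) {q \<in> N. f q \<in> V'}" using U(1) openin_trans by metis
  qed
qed

text \<open>If \<open>e\<close> embeds both patches in a plane, then invariance of domain makes the
  image of the second one open, so the first patch lies in the second near their common point. But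
  they meet only along the line \<open>fst s = c\<close>.\<close>

lemma no_planar_cross:
  fixes \<alpha>1 \<alpha>2 :: "real \<times> real \<Rightarrow> 'c::topological_space" and e :: "'c \<Rightarrow> 'd::euclidean_space"
  assumes S: "open S1" "open S2" and a1: "continuous_on S1 \<alpha>1" "inj_on \<alpha>1 S1"
    and a2: "continuous_on S2 \<alpha>2" "inj_on \<alpha>2 S2"
    and e: "continuous_on (\<alpha>1 ` S1 \<union> \<alpha>2 ` S2) e" "inj_on e (\<alpha>1 ` S1 \<union> \<alpha>2 ` S2)" "DIM('d) \<le> 2"
    and st: "s \<in> S1" "t \<in> S2" "\<alpha>1 s = \<alpha>2 t"
    and cross: "\<And>s t. s \<in> S1 \<Longrightarrow> t \<in> S2 \<Longrightarrow> \<alpha>1 s = \<alpha>2 t \<Longrightarrow> fst s = c"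
  shows False
proof -
  have c1: "continuous_on S1 (e \<circ> \<alpha>1)" "inj_on (e \<circ> \<alpha>1) S1"
    by (rule continuous_on_compose[OF a1(1)], rule continuous_on_subset[OF e(1)], simp)
       (rule comp_inj_on[OF a1(2)], rule inj_on_subset[OF e(2)], simp)
  have c2: "continuous_on S2 (e \<circ> \<alpha>2)" "inj_on (e \<circ> \<alpha>2) S2"
    by (rule continuous_on_compose[OF a2(1)], rule continuous_on_subset[OF e(1)], simp)
       (rule comp_inj_on[OF a2(2)], rule inj_on_subset[OF e(2)], simp)
  have "open ((e \<circ> \<alpha>2) ` S2)" using invariance_of_domain_gen[OF S(2) c2] e(3) by simp
  then have "open (S1 \<inter> (e \<circ> \<alpha>1) -` ((e \<circ> \<alpha>2) ` S2))"
    using continuous_open_preimage[OF c1(1) S(1)] by blast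
  moreover have "s \<in> S1 \<inter> (e \<circ> \<alpha>1) -` ((e \<circ> \<alpha>2) ` S2)"
  proof -
    have "(e \<circ> \<alpha>1) s = (e \<circ> \<alpha>2) t" using st by simp
    then show ?thesis using st by auto
  qed
  ultimately obtain d where d: "d > 0" "ball s d \<subseteq> S1 \<inter> (e \<circ> \<alpha>1) -` ((e \<circ> \<alpha>2) ` S2)"
    using open_contains_ball by blast
  have on_c: "fst s' = c" if s': "s' \<in> ball s d" for s'
  proof -
    have "s' \<in> S1" "e (\<alpha>1 s') \<in> (e \<circ> \<alpha>2) ` S2" using d(2) s' by auto
    then obtain t' where t': "t' \<in> S2" "e (\<alpha>1 s') = e (\<alpha>2 t')" by auto
    then have "\<alpha>1 s' = \<alpha>2 t'" using inj_onD[OF e(2), of "\<alpha>1 s'" "\<alpha>2 t'"] \<open>s' \<in> S1\<close> by auto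
    then show ?thesis using cross \<open>s' \<in> S1\<close> t'(1) by blast
  qed
  have "s + (d / 2, 0) \<in> ball s d" using d(1) by (simp add: dist_norm norm_Pair)
  then have "fst s + d / 2 = c" using on_c[of "s + (d / 2, 0)"] by simp
  moreover have "fst s = c" using on_c[of s] d(1) by simp
  ultimately show False using d(1) by simp
qed

lemma connected_finite_closed_cover:
  assumes "connected S" "S \<noteq> {}" "finite K" "\<And>k. k \<in> K \<Longrightarrow> closedin (top_of_set S) (C k)"
    "S \<subseteq> (\<Union>k\<in>K. C k)" "\<And>k l. k \<in> K \<Longrightarrow> l \<in> K \<Longrightarrow> k \<noteq> l \<Longrightarrow> C k \<inter> C l = {}"
  obtains k where "k \<in> K" "C k = S"
proof -
  obtain s where s: "s \<in> S" using assms(2) by blast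
  then obtain k where k: "k \<in> K" "s \<in> C k" using assms(5) by blast
  define D where "D = (\<Union>l\<in>K - {k}. C l)"
  have "closedin (top_of_set S) D" unfolding D_def using assms(3,4) by (intro closedin_Union) auto
  moreover have "S \<subseteq> C k \<union> D" using assms(5) unfolding D_def by blast
  moreover have "C k \<inter> D = {}" using assms(6) k(1) unfolding D_def by blast
  ultimately have "D = {}"
    using assms(1) assms(4)[OF k(1)] k(2) closedin_imp_subset unfolding connected_closedin_eq
    by (metis Un_subset_iff empty_iff subset_antisym closedin_subset topspace_euclidean_subtopology)
  then have "S \<subseteq> C k" using \<open>S \<subseteq> C k \<union> D\<close> by blast
  then show thesis using that k(1) assms(4)[OF k(1)] closedin_imp_subset by blast
qed

definition fig_cone :: "(real^3) set" where
  "fig_cone = (\<Union>v\<in>figure_eight. closed_segment 0 v)"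

text \<open>The first alternative describes the parts of the planes \<open>y = x\<close> and
  \<open>y = - x\<close> in the cone, the second the two faces over the outer edges of the
  triangles, where \<open>2 |x| = z\<close>.\<close>

lemma mem_fig_cone:
  "v \<in> fig_cone \<longleftrightarrow> 0 \<le> v $ 3 \<and> v $ 3 \<le> 1 \<and>
     (\<bar>v $ 1\<bar> = \<bar>v $ 2\<bar> \<and> 2 * \<bar>v $ 1\<bar> \<le> v $ 3 \<or> 2 * \<bar>v $ 1\<bar> = v $ 3 \<and> 2 * \<bar>v $ 2\<bar> \<le> v $ 3)"
    (is "?L \<longleftrightarrow> ?R")
proof
  assume ?L
  then obtain w s where w: "w \<in> figure_eight" "0 \<le> s" "s \<le> 1" "v = s *\<^sub>R w"
    unfolding fig_cone_def by (auto simp: in_segment)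
  have w3: "w $ 3 = 1" using w(1) by (simp add: figure_eight_def)
  have a: "\<bar>v $ k\<bar> = s * \<bar>w $ k\<bar>" for k using w by (simp add: abs_mult)
  consider "\<bar>w $ 1\<bar> = \<bar>w $ 2\<bar>" "\<bar>w $ 1\<bar> \<le> 1/2" | "\<bar>w $ 1\<bar> = 1/2" "\<bar>w $ 2\<bar> \<le> 1/2"
    using w(1) by (auto simp: figure_eight_def)
  then show ?R
  proof cases
    case 1
    have "s * \<bar>w $ 1\<bar> \<le> s * (1/2)" using 1 w by (intro mult_left_mono) auto
    then show ?thesis using 1 w w3 a[of 1] a[of 2] by simp
  next
    case 2
    have "s * \<bar>w $ 2\<bar> \<le> s * (1/2)" using 2 w by (intro mult_left_mono) auto
    then show ?thesis using 2 w w3 a[of 1] a[of 2] by simp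
  qed
next
  assume R: ?R
  show ?L
  proof (cases "v $ 3 = 0")
    case True
    then have "v $ 1 = 0" "v $ 2 = 0" using R by auto
    then have v: "v = 0" using True by (simp add: vec3_eq_iff)
    have "pt 0 0 1 \<in> figure_eight" by (simp add: figure_eight_def)
    then show ?thesis unfolding fig_cone_def v by (rule UN_I) simp
  next
    case False
    then have p: "v $ 3 > 0" using R by simp
    define w where "w = (1 / v $ 3) *\<^sub>R v"
    have w: "w $ k = v $ k / v $ 3" for k by (simp add: w_def)
    have "w \<in> figure_eight"
      using R p by (auto simp: figure_eight_def w field_simps abs_divide)
    moreover have "v \<in> closed_segment 0 w"
      unfolding in_segment by (rule exI[of _ "v $ 3"]) (use R p in \<open>simp add: w_def\<close>)
    ultimately show ?thesis unfolding fig_cone_def by (rule UN_I)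
  qed
qed

lemma fig_cone_cube: "fig_cone \<subseteq> cube"
  by (auto simp: mem_fig_cone mem_cube forall_3)

text \<open>The coordinate along the remaining axis \<open>m\<close> is kept non-negative, because
  \<open>m\<close> is 3 in the half cube; along \<open>l\<close> both signs are available. Such
  points show that a sheet has parts on either side of any other sheet.\<close>

lemma model_point:
  assumes "sheet_model B K" "k \<in> K" "l \<in> K" "k \<noteq> l" "m \<noteq> k" "m \<noteq> l" "\<bar>s\<bar> \<le> 1" "0 \<le> t" "t \<le> 1"
  shows "s *\<^sub>R axis l 1 + t *\<^sub>R axis m 1 \<in> B" "s *\<^sub>R axis l 1 + t *\<^sub>R axis m 1 \<in> coord_plane k"
proof -
  let ?w = "s *\<^sub>R axis l 1 + t *\<^sub>R axis m 1 :: real^3"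
  have c: "?w \<in> cube" using assms(6-9) by (auto simp: mem_cube axis_def)
  show "?w \<in> B"
  proof (cases "B = cube")
    case False
    then have h: "B = half_cube" "K \<subseteq> {1,2}" using assms(1) unfolding sheet_model_def by auto
    then have "m = 3" using assms(2-6) exhaust_3[of m] by auto
    then show ?thesis using c h assms(3,8) by (auto simp: half_cube_def half_space_def axis_def)
  qed (use c in simp)
  show "?w \<in> coord_plane k" using assms(4,5) by (simp add: coord_plane_def axis_def)
qed

context generic_map
begin

text \<open>Two sheets through \<open>q\<close> would be crossing patches embedded in a
  plane.\<close>

lemma planar_single:
  fixes e :: "'a \<Rightarrow> 'd::euclidean_space"
  assumes ch: "sheet_chart F M i q B K N f g \<sigma>" and O: "openin (top_of_set M) O'" "q \<in> O'"
    and e: "continuous_on (O' \<inter> i ` F) e" "inj_on e (O' \<inter> i ` F)" "DIM('d) \<le> 2"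
  shows "\<exists>k. K = {k}"
proof (rule ccontr)
  assume no: "\<not> ?thesis"
  note mod = sheet_chart_model[OF ch]
  obtain k where k: "k \<in> K" using mod(6) by blast
  obtain l where l: "l \<in> K" "l \<noteq> k" using no k by blast
  obtain m where m: "m \<noteq> k" "m \<noteq> l" "\<And>j. j = k \<or> j = l \<or> j = m" using three_other[OF l(2)[symmetric]] by metis
  have g0: "g 0 = q" using sheet_chart_fgI(1)[OF ch sheet_chart_base(4)[OF ch]] sheet_chart_base(3)[OF ch] by simp
  obtain P where P: "open P" "O' = M \<inter> P" using O(1) openin_open by metis
  have contg: "continuous_on B g" using homeomorphism_cont2[OF sheet_chart_fg(1)[OF ch]] .
  obtain V where V: "open V" "g -` P \<inter> B = V \<inter> B" using continuous_on_open_invariant[of B g] contg P(1) by metis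
  have "0 \<in> V" using V(2) g0 O(2) P(2) mod(4) by auto
  then obtain r where r: "0 < r" "r < 1" "ocube r \<subseteq> V" using ocube_small[OF V(1)] by metis
  have in_O: "g w \<in> O' \<inter> i ` F" if w: "w \<in> B" "w \<in> ocube r" "w \<in> coord_plane j" "j \<in> K" for w j
  proof -
    have "g w \<in> P" using V(2) r(3) w by auto
    moreover have "g w \<in> M" using sheet_chart_fgI(4)[OF ch w(1)] sheet_chart_base(6)[OF ch] by blast
    moreover have "g w \<in> i ` F" using sheet_chart_mem[OF ch w(4,1,3)] by (metis image_eqI)
    ultimately show ?thesis using P(2) by blast
  qed
  define d where "d = r / 4"
  have d: "0 < d" "4 * d = r" using r by (auto simp: d_def)
  define S where "S = {-d<..<d} \<times> {-d<..<d}"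
  have openS: "open S" unfolding S_def by (intro open_Times) auto
  \<comment> \<open>The patches are centred at \<open>2 * d\<close> on the axis \<open>m\<close> and
    not at the origin, so that they are full squares also when the model is the half cube.\<close>
  define w where "w = (\<lambda>a (z :: real \<times> real). fst z *\<^sub>R axis a 1 + (2 * d + snd z) *\<^sub>R axis m 1 :: real^3)"
  have w_in: "w b z \<in> B" "w b z \<in> coord_plane a" "w b z \<in> ocube r"
    if "z \<in> S" "(a = k \<and> b = l) \<or> (a = l \<and> b = k)" for a b z
  proof -
    have *: "\<bar>fst z\<bar> < d" "0 < 2 * d + snd z" "2 * d + snd z < 3 * d" using that(1) by (auto simp: S_def)
    then have "\<bar>fst z\<bar> \<le> 1" "0 \<le> 2 * d + snd z" "2 * d + snd z \<le> 1" using d r by auto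
    then show "w b z \<in> B" "w b z \<in> coord_plane a"
      using model_point[OF mod(1), of a b m "fst z" "2 * d + snd z"] k l m(1,2) that(2) by (auto simp: w_def)
    show "w b z \<in> ocube r" using * d(2) m(1,2) that(2) unfolding w_def ocube_def by (auto simp: axis_def)
  qed
  have w_B: "w b z \<in> B" if "b = k \<or> b = l" "z \<in> S" for b z
    using w_in(1)[of z k l] w_in(1)[of z l k] that by blast
  have w_b: "w b z $ b = fst z" "w b z $ m = 2 * d + snd z" if "b = k \<or> b = l" for b z
    using that m(1,2) by (auto simp: w_def axis_def)
  define al where "al = (\<lambda>b z. g (w b z))"
  have cont: "continuous_on S (al b)" if "b = k \<or> b = l" for b
    unfolding al_def
    by (rule continuous_on_compose2[OF contg])
       (use w_B[OF that] in \<open>auto simp: w_def intro!: continuous_intros\<close>)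
  have f_al: "f (al b z) = w b z" if "b = k \<or> b = l" "z \<in> S" for b z
    using sheet_chart_fgI(3)[OF ch w_B[OF that]] by (simp add: al_def)
  have inj: "inj_on (al b) S" if b: "b = k \<or> b = l" for b
  proof (rule inj_onI)
    fix y z assume yz: "y \<in> S" "z \<in> S" "al b y = al b z"
    then have "w b y = w b z" using f_al b by metis
    then show "y = z" using w_b[OF b, of y] w_b[OF b, of z] by (simp add: prod_eq_iff)
  qed
  have sub: "al l ` S \<union> al k ` S \<subseteq> O' \<inter> i ` F"
  proof -
    have "al l z \<in> O' \<inter> i ` F \<and> al k z \<in> O' \<inter> i ` F" if z: "z \<in> S" for z
      using in_O[OF w_in(1)[of z k l] w_in(3)[of z k l] w_in(2)[of z k l] k]
        in_O[OF w_in(1)[of z l k] w_in(3)[of z l k] w_in(2)[of z l k] l(1)] z by (simp add: al_def)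
    then show ?thesis by (simp add: image_subset_iff)
  qed
  show False
  proof (rule no_planar_cross[OF openS openS cont inj cont inj])
    show "continuous_on (al l ` S \<union> al k ` S) e" using e(1) sub continuous_on_subset by blast
    show "inj_on e (al l ` S \<union> al k ` S)" using e(2) sub inj_on_subset by blast
    show "(0,0) \<in> S" "(0,0) \<in> S" using d by (auto simp: S_def)
    show "al l (0,0) = al k (0,0)" by (simp add: al_def w_def)
    fix s t assume st: "s \<in> S" "t \<in> S" "al l s = al k t"
    then have "w l s = w k t" using f_al by metis
    then have "fst s = w k t $ l" using w_b by metis
    then show "fst s = 0" using l m by (simp add: w_def axis_def)
  qed (use e(3) in auto)
qed

section \<open>Branch charts and the finiteness of branch values\<close>

definition branch_chart :: "'a \<Rightarrow> 'a set \<Rightarrow> ('a \<Rightarrow> real^3) \<Rightarrow> (real^3 \<Rightarrow> 'a) \<Rightarrow> bool" where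
  "branch_chart p N f g \<longleftrightarrow>
     nbhd_in M p N \<and> pl_homeomorphism N cube f g \<and> f p = 0 \<and> f ` (N \<inter> i ` F) = fig_cone"

lemma ex_branch_chart:
  assumes "branch_value F M i p"
  obtains N f g x where "branch_chart p N f g" "{x' \<in> F. i x' = p} = {x}"
proof -
  have "\<exists>N f g. branch_chart p N f g" "\<exists>x. {x' \<in> F. i x' = p} = {x}"
    using assms unfolding branch_value_def branch_chart_def fig_cone_def by simp_all
  then show thesis using that by blast
qed

context
  fixes p N f g
  assumes bc: "branch_chart p N f g"
begin

lemma bc_props: "nbhd_in M p N" "pl_homeomorphism N cube f g" "f p = 0" "f ` (N \<inter> i ` F) = fig_cone"
  "homeomorphism N cube f g" "p \<in> N" "N \<subseteq> M" "pl_on f N" "pl_on g cube"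
  using bc unfolding branch_chart_def nbhd_in_def pl_homeomorphism_def by blast+

lemma bc_gf: "q \<in> N \<Longrightarrow> g (f q) = q" "q \<in> N \<Longrightarrow> f q \<in> cube"
  using bc_props(5) unfolding homeomorphism_def by auto

lemma bc_fg: "v \<in> cube \<Longrightarrow> f (g v) = v" "v \<in> cube \<Longrightarrow> g v \<in> N"
  using bc_props(5) unfolding homeomorphism_def by auto

lemma bc_image: "v \<in> cube \<Longrightarrow> g v \<in> i ` F \<longleftrightarrow> v \<in> fig_cone"
proof
  assume v: "v \<in> cube"
  show "g v \<in> i ` F \<Longrightarrow> v \<in> fig_cone" using bc_props(4) bc_fg[OF v] by (metis IntI image_eqI)
  assume "v \<in> fig_cone"
  then obtain q where "q \<in> N" "q \<in> i ` F" "v = f q" using bc_props(4) by blast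
  then show "g v \<in> i ` F" using bc_gf by simp
qed

lemma bc_cone: "x \<in> F \<Longrightarrow> i x \<in> N \<Longrightarrow> f (i x) \<in> fig_cone"
  using bc_props(4) by blast

text \<open>At height \<open>z\<close> on the double line, the planes \<open>y = x\<close> and
  \<open>y = - x\<close> provide crossing patches. The bound \<open>4 * d \<le> z\<close> keeps them
  away from the outer faces of the cone.\<close>

lemma branch_cross:
  fixes e :: "'a \<Rightarrow> 'd::euclidean_space"
  assumes z: "0 < d" "4 * d \<le> z" "z + d \<le> 1"
    and Y: "Y = {q \<in> N \<inter> i ` F. \<bar>f q $ 1\<bar> < d \<and> \<bar>f q $ 2\<bar> < d \<and> \<bar>f q $ 3 - z\<bar> < d}"
    and e: "continuous_on Y e" "inj_on e Y" "DIM('d) \<le> 2"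
  shows False
proof -
  define S where "S = {-d<..<d} \<times> {-d<..<d}"
  have openS: "open S" unfolding S_def by (intro open_Times) auto
  define w where "w = (\<lambda>b (y :: real \<times> real). pt (fst y) (b * fst y) (z + snd y))"
  have w_cone: "w b y \<in> fig_cone" if "y \<in> S" "b = 1 \<or> b = -1" for b y
    using that z by (auto simp: mem_fig_cone w_def S_def)
  define al where "al = (\<lambda>b y. g (w b y))"
  have f_al: "f (al b y) = w b y" if "b = 1 \<or> b = -1" "y \<in> S" for b y
    using bc_fg(1) w_cone[OF that(2,1)] fig_cone_cube by (auto simp: al_def)
  have contg: "continuous_on cube g" using homeomorphism_cont2[OF bc_props(5)] .
  have cont: "continuous_on S (al b)" if "b = 1 \<or> b = -1" for b
    unfolding al_def
    by (rule continuous_on_compose2[OF contg])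
       (use w_cone that fig_cone_cube in \<open>auto simp: w_def intro!: continuous_intros\<close>)
  have inj: "inj_on (al b) S" if b: "b = 1 \<or> b = -1" for b
  proof (rule inj_onI)
    fix y y' assume yz: "y \<in> S" "y' \<in> S" "al b y = al b y'"
    then have "w b y = w b y'" using f_al b by metis
    then show "y = y'" unfolding w_def vec3_eq_iff by (simp add: prod_eq_iff)
  qed
  have sub: "al b y \<in> Y" if "b = 1 \<or> b = -1" "y \<in> S" for b y
  proof -
    have c: "w b y \<in> cube" using w_cone[OF that(2,1)] fig_cone_cube by blast
    have "al b y \<in> N" "al b y \<in> i ` F" using bc_fg(2)[OF c] bc_image[OF c] w_cone[OF that(2,1)] by (auto simp: al_def)
    moreover have "\<bar>w b y $ 1\<bar> < d" "\<bar>w b y $ 2\<bar> < d" "\<bar>w b y $ 3 - z\<bar> < d"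
      using that by (auto simp: w_def S_def)
    ultimately show ?thesis using f_al[OF that] by (simp add: Y)
  qed
  then have sub': "al 1 ` S \<union> al (-1) ` S \<subseteq> Y" by blast
  show False
  proof (rule no_planar_cross[OF openS openS cont inj cont inj])
    show "continuous_on (al 1 ` S \<union> al (-1) ` S) e" using e(1) sub' continuous_on_subset by blast
    show "inj_on e (al 1 ` S \<union> al (-1) ` S)" using e(2) sub' inj_on_subset by blast
    show "(0,0) \<in> S" "(0,0) \<in> S" using z by (auto simp: S_def)
    show "al 1 (0,0) = al (-1) (0,0)" by (simp add: al_def w_def)
    fix s t assume st: "s \<in> S" "t \<in> S" "al 1 s = al (-1) t"
    then have "w 1 s = w (-1) t" using f_al by metis
    then show "fst s = 0" unfolding w_def vec3_eq_iff by simp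
  qed (use e(3) in auto)
qed

text \<open>Otherwise \<open>i\<close> is injective near \<open>x\<close>. Then the image near
  \<open>p\<close> can be mapped back to \<open>F\<close> and embedded in a plane by a chart of
  \<open>F\<close>, in contradiction to the crossing along the double line.\<close>

lemma branch_in_closure:
  assumes fib: "{x' \<in> F. i x' = p} = {x}"
  shows "(x, x) \<in> closure pairs"
proof (rule ccontr)
  assume "(x, x) \<notin> closure pairs"
  then have "open (- closure pairs)" "(x, x) \<in> - closure pairs" by auto
  then obtain W1 W2 where W: "open W1" "open W2" "x \<in> W1" "x \<in> W2" "W1 \<times> W2 \<subseteq> - closure pairs"
    by (elim open_prod_elim) auto
  have x: "x \<in> F" "i x = p" using fib by auto
  obtain U fc gc where U: "x \<in> U" "pl_chart (2::2) F U fc gc"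
    using generic_props(2) x(1) unfolding pl_manifold_def by blast
  obtain W3 where W3: "open W3" "U = F \<inter> W3" using U(2) unfolding pl_chart_def openin_open by blast
  have homU: "homeomorphism U (fc ` U) fc gc" using U(2) unfolding pl_chart_def pl_homeomorphism_def by blast
  define W where "W = W1 \<inter> W2 \<inter> W3"
  have Wo: "open W" "x \<in> W" using W W3 U(1) by (auto simp: W_def)
  have inj: "y = y'" if "y \<in> F \<inter> W" "y' \<in> F \<inter> W" "i y = i y'" for y y'
  proof (rule ccontr)
    assume "y \<noteq> y'"
    then have "(y, y') \<in> pairs" using that by (auto simp: pairs_def)
    moreover have "(y, y') \<in> W1 \<times> W2" using that by (auto simp: W_def)
    ultimately show False using W(5) closure_subset by blast
  qed
  have "compact (F - W)" using generic_props(1) Wo(1) by (simp add: compact_diff)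
  then have "compact (i ` (F - W))"
    using compact_continuous_image continuous_on_subset[OF cont_i] by blast
  moreover have "p \<notin> i ` (F - W)" using fib Wo(2) by auto
  ultimately have "open (- (i ` (F - W)))" "p \<in> - (i ` (F - W))"
    by (auto simp: compact_imp_closed open_Compl)
  then obtain \<rho> where \<rho>: "\<rho> > 0" "cball p \<rho> \<subseteq> - (i ` (F - W))"
    using open_contains_cball by blast
  define F2 where "F2 = F \<inter> i -` cball p \<rho>"
  have F2W: "F2 \<subseteq> F \<inter> W" using \<rho>(2) by (auto simp: F2_def)
  have "closedin (top_of_set F) F2" unfolding F2_def
    by (rule continuous_closedin_preimage[OF cont_i]) simp
  then have cF2: "compact F2" using generic_props(1) closedin_compact by blast
  have ci: "continuous_on F2 i" using cont_i F2W continuous_on_subset by blast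
  define j where "j = inv_into F2 i"
  have "inj_on i F2" using inj F2W by (intro inj_onI) blast
  then have ji: "\<And>y. y \<in> F2 \<Longrightarrow> j (i y) = y" by (simp add: j_def)
  then have cj: "continuous_on (i ` F2) j" using continuous_on_inv[OF ci cF2] by blast
  have jW: "j q \<in> U" if "q \<in> i ` F2" for q
    using that ji F2W W3(2) by (auto simp: W_def)
  have ce: "continuous_on (i ` F2) (\<lambda>q. fc (j q))"
    by (rule continuous_on_compose2[OF homeomorphism_cont1[OF homU] cj]) (use jW in auto)
  have ie: "inj_on (\<lambda>q. fc (j q)) (i ` F2)"
  proof (rule inj_onI)
    fix q q' assume q: "q \<in> i ` F2" "q' \<in> i ` F2" "fc (j q) = fc (j q')"
    then have "j q = j q'" using jW homeomorphism_apply1[OF homU] by metis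
    then show "q = q'" using q(1,2) ji by auto
  qed
  have contg: "continuous_on cube g" using homeomorphism_cont2[OF bc_props(5)] .
  obtain V where V: "open V" "g -` ball p \<rho> \<inter> cube = V \<inter> cube"
    using continuous_on_open_invariant[of cube g] contg open_ball by metis
  have "g 0 = p" using bc_gf[OF bc_props(6)] bc_props(3) by simp
  moreover have "(0::real^3) \<in> cube" by (simp add: mem_cube)
  ultimately have "0 \<in> V" using V(2) \<rho>(1) by auto
  then obtain r where r: "0 < r" "r < 1" "ocube r \<subseteq> V" using ocube_small[OF V(1)] by metis
  define Y where "Y = {q \<in> N \<inter> i ` F. \<bar>f q $ 1\<bar> < r/8 \<and> \<bar>f q $ 2\<bar> < r/8 \<and> \<bar>f q $ 3 - r/2\<bar> < r/8}"
  have "Y \<subseteq> i ` F2"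
  proof
    fix q assume q: "q \<in> Y"
    then have "f q \<in> ocube r" unfolding Y_def mem_ocube_3 using r by (auto simp: abs_if split: if_splits)
    then have "f q \<in> V \<inter> cube" using r(3) bc_gf(2) q by (auto simp: Y_def)
    then have "g (f q) \<in> ball p \<rho>" using V(2) by blast
    then have "q \<in> ball p \<rho>" using bc_gf(1) q by (simp add: Y_def)
    then show "q \<in> i ` F2" using q by (auto simp: Y_def F2_def)
  qed
  then have "continuous_on Y (\<lambda>q. fc (j q))" "inj_on (\<lambda>q. fc (j q)) Y"
    using ce ie continuous_on_subset inj_on_subset by blast+
  then show False
    using branch_cross[of "r/8" "r/2" Y "\<lambda>q. fc (j q)"] r Y_def by simp
qed

end

text \<open>Every branch point gives a diagonal point in the closure of the pairs, hence one on the
  finitely many segments, which meet the diagonal in a finite set.\<close>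

lemma finite_branch: "finite {p. branch_value F M i p}"
proof -
  have "{p. branch_value F M i p} \<subseteq> (\<lambda>w. i (fst w)) ` (\<Union>segs \<inter> diag)"
  proof
    fix p assume "p \<in> {p. branch_value F M i p}"
    then obtain N f g x where x: "branch_chart p N f g" "{x' \<in> F. i x' = p} = {x}"
      using ex_branch_chart by blast
    then have "(x, x) \<in> \<Union>segs" using branch_in_closure closure_pairs by blast
    moreover have "i x = p" using x(2) by blast
    ultimately show "p \<in> (\<lambda>w. i (fst w)) ` (\<Union>segs \<inter> diag)"
      by (intro image_eqI[of _ _ "(x, x)"]) (auto simp: diag_def)
  qed
  then show ?thesis using finite_diag_segs finite_surj by blast
qed

end

lemma box_small:
  fixes V :: "(real^3) set"
  assumes "open V" "v0 \<in> V"
  obtains d where "0 < d" "\<And>v. \<bar>v $ 1 - v0 $ 1\<bar> < d \<Longrightarrow> \<bar>v $ 2 - v0 $ 2\<bar> < d \<Longrightarrow> \<bar>v $ 3 - v0 $ 3\<bar> < d \<Longrightarrow> v \<in> V"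
proof -
  have "open ((+) (- v0) ` V)" using assms(1) open_translation by blast
  moreover have "0 \<in> (+) (- v0) ` V" using assms(2) by force
  ultimately obtain d where d: "0 < d" "d < 1" "ocube d \<subseteq> (+) (- v0) ` V" using ocube_small by metis
  have "v \<in> V" if "\<bar>v $ 1 - v0 $ 1\<bar> < d" "\<bar>v $ 2 - v0 $ 2\<bar> < d" "\<bar>v $ 3 - v0 $ 3\<bar> < d" for v
  proof -
    have "v - v0 \<in> ocube d" using that by (simp add: mem_ocube_3)
    then have "v - v0 \<in> (+) (- v0) ` V" using d(3) by blast
    then show ?thesis by auto
  qed
  then show thesis using that d(1) by blast
qed

lemma connected_nonzero_sign:
  fixes h :: "'c::topological_space \<Rightarrow> real"
  assumes "connected S" "continuous_on S h" "\<And>x. x \<in> S \<Longrightarrow> h x \<noteq> 0" "x \<in> S" "y \<in> S" "h x > 0"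
  shows "h y > 0"
proof (rule ccontr)
  assume "\<not> h y > 0"
  then have "h y < 0" using assms(3,5) by (meson linorder_neqE_linordered_idom)
  have "connected (h ` S)" using assms(1,2) connected_continuous_image by blast
  then have "0 \<in> h ` S"
    using assms(4-6) \<open>h y < 0\<close> unfolding connected_iff_interval by (meson image_eqI less_imp_le)
  then show False using assms(3) by auto
qed

section \<open>Sheets along the double line of the umbrella\<close>

context generic_map
begin

text \<open>The radius is so small that the core is open in \<open>M\<close> and contains no branch
  value except the apex. Every other value of \<open>i\<close> in the core thus has a sheet
  chart.\<close>

definition branch_core where
  "branch_core p N f g r \<longleftrightarrow> branch_chart p N f g \<and> 0 < r \<and> r < 1 \<and>
     (\<forall>V. open V \<longrightarrow> V \<subseteq> ocube r \<longrightarrow> openin (top_of_set M) {q \<in> N. f q \<in> V}) \<and>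
     (\<forall>q\<in>N. f q \<in> ocube r \<longrightarrow> q \<noteq> p \<longrightarrow> \<not> branch_value F M i q)"

lemma ex_branch_core:
  assumes "branch_value F M i p"
  obtains N f g r x where "branch_core p N f g r" "{x' \<in> F. i x' = p} = {x}"
proof -
  obtain N f g x where bc: "branch_chart p N f g" and x: "{x' \<in> F. i x' = p} = {x}"
    using ex_branch_chart[OF assms] by blast
  note p = bc_props[OF bc]
  obtain r where r: "0 < r" "r < 1" "\<And>V. open V \<Longrightarrow> V \<subseteq> ocube r \<Longrightarrow> openin (top_of_set M) {q \<in> N. f q \<in> V}"
    using chart_core[OF p(1,5,3)] by metis
  define Z where "Z = f ` ({q. branch_value F M i q} \<inter> N - {p})"
  have "finite Z" unfolding Z_def using finite_branch by simp
  then have "open (- Z)" by (simp add: finite_imp_closed open_Compl)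
  moreover have "0 \<in> - Z"
  proof -
    have "f q \<noteq> 0" if "q \<in> N" "q \<noteq> p" for q
      using that p(3) bc_gf(1)[OF bc that(1)] bc_gf(1)[OF bc p(6)] by metis
    then show ?thesis unfolding Z_def by force
  qed
  ultimately obtain r' where r': "0 < r'" "r' < 1" "ocube r' \<subseteq> - Z" using ocube_small by metis
  have sub: "ocube (min r r') \<subseteq> ocube r" "ocube (min r r') \<subseteq> ocube r'" by (auto simp: ocube_def)
  have "branch_core p N f g (min r r')"
    unfolding branch_core_def
  proof (intro conjI allI impI ballI)
    fix q assume q: "q \<in> N" "f q \<in> ocube (min r r')" "q \<noteq> p"
    then have "f q \<notin> Z" using sub(2) r'(3) by blast
    then show "\<not> branch_value F M i q" using q unfolding Z_def by blast
  qed (use bc r r' sub in auto)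
  then show thesis using that x by blast
qed

context
  fixes p N f g r
  assumes core: "branch_core p N f g r"
begin

lemma core_props: "branch_chart p N f g" "0 < r" "r < 1"
  "open V \<Longrightarrow> V \<subseteq> ocube r \<Longrightarrow> openin (top_of_set M) {q \<in> N. f q \<in> V}"
  "q \<in> N \<Longrightarrow> f q \<in> ocube r \<Longrightarrow> q \<noteq> p \<Longrightarrow> \<not> branch_value F M i q"
  using core unfolding branch_core_def by auto

lemma core_chart:
  assumes "v \<in> fig_cone" "v \<in> ocube r" "v \<noteq> 0"
  obtains B K N' f' g' \<sigma> where "sheet_chart F M i (g v) B K N' f' g' \<sigma>"
proof -
  note bc = core_props(1)
  have v: "v \<in> cube" using assms(1) fig_cone_cube by blast
  have "f (g v) = v" "g v \<in> N" using bc_fg[OF bc v] .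
  moreover have "g v \<noteq> p" using bc_props(3)[OF bc] assms(3) \<open>f (g v) = v\<close> by metis
  ultimately have "\<not> branch_value F M i (g v)" using core_props(5) assms(2) by simp
  moreover have "g v \<in> i ` F" using bc_image[OF bc v] assms(1) by blast
  ultimately obtain B K where "sheet_model B K" "sheets_at F M i B K (g v)" using nonbranch_sheets by blast
  then show thesis using that sheets_at_imp_chart by metis
qed

text \<open>
  Away from the double line, either half of the cone projects injectively to a plane
  along the direction \<open>(\<plusminus>1, 0, 3)\<close>.
\<close>

lemma off_axis_single:
  assumes v: "v \<in> fig_cone" "v \<in> ocube r" "v $ 1 \<noteq> 0"
  shows "\<exists>x. {x' \<in> F. i x' = g v} = {x}"
proof -
  note bc = core_props(1)
  have v0: "v \<noteq> 0" using v(3) by auto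
  obtain B K N' f' g' \<sigma> where ch: "sheet_chart F M i (g v) B K N' f' g' \<sigma>"
    by (rule core_chart[OF v(1,2) v0])
  define s where "s = sgn (v $ 1)"
  have s: "s = 1 \<or> s = -1" using v(3) by (simp add: s_def sgn_if)
  define V where "V = {w \<in> ocube r. s * w $ 1 > 0}"
  have "V = ocube r \<inter> {w. s * w $ 1 > 0}" by (auto simp: V_def)
  moreover have "open {w :: real^3. s * w $ 1 > 0}" by (intro open_Collect_less continuous_intros)
  ultimately have "open V" using open_ocube by auto
  define O' where "O' = {q \<in> N. f q \<in> V}"
  have O: "openin (top_of_set M) O'" unfolding O'_def using core_props(4)[OF \<open>open V\<close>] by (simp add: V_def)
  have cube: "v \<in> cube" using v(1) fig_cone_cube by blast
  have "v \<in> V" using v by (auto simp: V_def s_def sgn_if)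
  then have q: "g v \<in> O'" using bc_fg[OF bc cube] by (simp add: O'_def)
  define e where "e = (\<lambda>q. (f q $ 2, 3 * (s * f q $ 1) - f q $ 3))"
  have cf: "continuous_on N f" using homeomorphism_cont1[OF bc_props(5)[OF bc]] .
  have "continuous_on (O' \<inter> i ` F) e"
    unfolding e_def by (intro continuous_intros continuous_on_subset[OF cf]) (auto simp: O'_def)
  moreover have "inj_on e (O' \<inter> i ` F)"
  proof (rule inj_onI)
    fix q q' assume qq: "q \<in> O' \<inter> i ` F" "q' \<in> O' \<inter> i ` F" "e q = e q'"
    have c: "f q \<in> fig_cone" "f q' \<in> fig_cone" using qq bc_cone[OF bc] by (auto simp: O'_def)
    have h: "s * f q $ 1 > 0" "s * f q' $ 1 > 0" "f q $ 2 = f q' $ 2"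
      "3 * (s * f q $ 1) - f q $ 3 = 3 * (s * f q' $ 1) - f q' $ 3"
      using qq by (auto simp: O'_def V_def e_def)
    have ab: "\<bar>f q $ 1\<bar> = s * f q $ 1" "\<bar>f q' $ 1\<bar> = s * f q' $ 1" using h(1,2) s by auto
    \<comment> \<open>For a fixed second coordinate \<open>y\<close>, let \<open>a\<close> be
      \<open>s\<close> times the first one. The half of the cone has a vertical part
      \<open>a = |y|\<close>, where \<open>3 * a - z\<close> is at most \<open>|y|\<close>, and a
      part \<open>z = 2 * a\<close>, where it equals \<open>a\<close> and is at least
      \<open>|y|\<close>. So \<open>y\<close> and \<open>3 * a - z\<close> determine
      \<open>a\<close>.\<close>
    have "s * f q $ 1 = s * f q' $ 1"
      using c h unfolding mem_fig_cone ab by linarith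
    then have "f q = f q'" using h s unfolding vec3_eq_iff by auto
    then show "q = q'" using qq bc_gf(1)[OF bc] by (metis (no_types, lifting) IntD1 O'_def mem_Collect_eq)
  qed
  ultimately obtain k where "K = {k}" using planar_single[OF ch O q, of e] by auto
  then show ?thesis using sheet_chart_fibre[OF ch] by auto
qed

text \<open>With one sheet only, the two other coordinates of its chart would embed the image in a
  plane near a point where it crosses itself.\<close>

lemma axis_multi:
  assumes z: "0 < z" "z < r"
  shows "\<exists>x y. x \<in> F \<and> y \<in> F \<and> x \<noteq> y \<and> i x = g (pt 0 0 z) \<and> i y = g (pt 0 0 z)"
proof -
  note bc = core_props(1)
  define v where "v = pt 0 0 z"
  have v: "v \<in> fig_cone" "v \<in> ocube r" "v \<noteq> 0"
    using z core_props(3) by (auto simp: v_def mem_fig_cone mem_ocube_3 vec3_eq_iff)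
  obtain B K N' f' g' \<sigma> where ch: "sheet_chart F M i (g v) B K N' f' g' \<sigma>"
    by (rule core_chart[OF v])
  note fib = sheet_chart_fibre[OF ch]
  have "\<not> (\<exists>k. K = {k})"
  proof
    assume "\<exists>k. K = {k}"
    then obtain k where K: "K = {k}" by blast
    obtain l :: 3 where l: "l \<noteq> k" using exhaust_3 by (metis zero_neq_one)
    obtain m where m: "m \<noteq> k" "m \<noteq> l" "\<And>j. j = k \<or> j = l \<or> j = m" using three_other[OF l[symmetric]] by metis
    obtain U where U: "openin (top_of_set M) U" "g v \<in> U" "U \<subseteq> N'"
      using sheet_chart_base(1)[OF ch] unfolding nbhd_in_def by blast
    obtain P where P: "open P" "U = M \<inter> P" using U(1) openin_open by metis
    have contg: "continuous_on cube g" using homeomorphism_cont2[OF bc_props(5)[OF bc]] .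
    obtain V where V: "open V" "g -` P \<inter> cube = V \<inter> cube"
      using continuous_on_open_invariant[of cube g] contg P(1) by metis
    have "v \<in> V" using V(2) U(2) P(2) v(1) fig_cone_cube by blast
    then obtain d0 where d0: "0 < d0"
      "\<And>w. \<bar>w $ 1 - v $ 1\<bar> < d0 \<Longrightarrow> \<bar>w $ 2 - v $ 2\<bar> < d0 \<Longrightarrow> \<bar>w $ 3 - v $ 3\<bar> < d0 \<Longrightarrow> w \<in> V"
      using box_small[OF V(1)] by metis
    define d where "d = min d0 (min (z/4) (r - z))"
    have d: "0 < d" "4 * d \<le> z" "z + d \<le> 1" "d \<le> d0" using d0(1) z core_props(3) by (auto simp: d_def min_def)
    define Y where "Y = {q \<in> N \<inter> i ` F. \<bar>f q $ 1\<bar> < d \<and> \<bar>f q $ 2\<bar> < d \<and> \<bar>f q $ 3 - z\<bar> < d}"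
    have YN: "q \<in> N'" if q: "q \<in> Y" for q
    proof -
      have "f q \<in> V" by (rule d0(2)) (use q d(4) in \<open>auto simp: Y_def v_def\<close>)
      then have "g (f q) \<in> P" using V(2) bc_gf(2)[OF bc] q by (auto simp: Y_def)
      then have "q \<in> P" using bc_gf(1)[OF bc] q by (simp add: Y_def)
      moreover have "q \<in> M" using q bc_props(7)[OF bc] by (auto simp: Y_def)
      ultimately show ?thesis using P(2) U(3) by blast
    qed
    have plane: "f' q $ k = 0" if q: "q \<in> Y" for q
    proof -
      obtain x where x: "x \<in> F" "i x = q" using q by (auto simp: Y_def)
      then obtain k' where "k' \<in> K" "f' (i x) \<in> coord_plane k'"
        using sheet_chart_cases[OF ch x(1)] YN[OF q] by metis
      then show ?thesis using K x by (simp add: coord_plane_def)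
    qed
    define e where "e = (\<lambda>q. (f' q $ l, f' q $ m))"
    have cf: "continuous_on N' f'" using homeomorphism_cont1[OF sheet_chart_fg(1)[OF ch]] .
    have "continuous_on Y e"
      unfolding e_def by (intro continuous_intros continuous_on_subset[OF cf]) (use YN in auto)
    moreover have "inj_on e Y"
    proof (rule inj_onI)
      fix q q' assume qq: "q \<in> Y" "q' \<in> Y" "e q = e q'"
      have "f' q = f' q'" unfolding vec_eq_iff
      proof
        fix j show "f' q $ j = f' q' $ j" using m(3)[of j] plane[OF qq(1)] plane[OF qq(2)] qq(3) by (auto simp: e_def)
      qed
      then show "q = q'" using sheet_chart_fgI(1)[OF ch] YN qq by metis
    qed
    ultimately show False using branch_cross[OF bc d(1-3) Y_def, of e] by simp
  qed
  moreover obtain k where "k \<in> K" using sheet_chart_model(6)[OF ch] by blast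
  ultimately obtain l where l: "k \<in> K" "l \<in> K" "k \<noteq> l" by blast
  then have "\<sigma> k 0 \<noteq> \<sigma> l 0" using inj_onD[OF sheet_chart_inj[OF ch]] by blast
  moreover have "\<sigma> k 0 \<in> {x \<in> F. i x = g v}" "\<sigma> l 0 \<in> {x \<in> F. i x = g v}" unfolding fib using l by blast+
  ultimately show ?thesis unfolding v_def by blast
qed

end

end

context generic_map
begin

context
  fixes p N f g r
  assumes core: "branch_core p N f g r"
begin

text \<open>
  At a point of the double line, each of the four half-planes of the cone lies in one sheet, and each
  sheet contains half-planes on both sides of any other sheet, hence exactly two of them.  Two
  neighbouring half-planes cannot form a sheet: the other two would then bound a wedge, which is
  connected after removal of its edge and so lies on one side of that sheet.
\<close>

lemma two_sheets:
  assumes z: "0 < z" "z < r"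
  obtains x y W1 W2 where "{x' \<in> F. i x' = g (pt 0 0 z)} = {x, y}" "x \<noteq> y"
    "open W1" "x \<in> W1" "\<And>x'. x' \<in> F \<inter> W1 \<Longrightarrow> i x' \<in> N \<and> f (i x') $ 1 = f (i x') $ 2"
    "open W2" "y \<in> W2" "\<And>x'. x' \<in> F \<inter> W2 \<Longrightarrow> i x' \<in> N \<and> f (i x') $ 1 = - f (i x') $ 2"
    "\<And>W. open W \<Longrightarrow> x \<in> W \<Longrightarrow> \<exists>x'\<in>F \<inter> W. i x' \<in> N \<and> f (i x') $ 1 \<noteq> 0"
    "\<And>W. open W \<Longrightarrow> y \<in> W \<Longrightarrow> \<exists>x'\<in>F \<inter> W. i x' \<in> N \<and> f (i x') $ 1 \<noteq> 0"
proof -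
  note bc = core_props(1)[OF core]
  have r1: "r < 1" using core_props(3)[OF core] .
  define v0 where "v0 = pt 0 0 z"
  have v0: "v0 \<in> fig_cone" "v0 \<in> ocube r" "v0 \<noteq> 0" "v0 \<in> cube"
    using z r1 by (auto simp: v0_def mem_fig_cone mem_ocube_3 vec3_eq_iff mem_cube forall_3)
  obtain B K N' f' g' \<sigma> where ch: "sheet_chart F M i (g v0) B K N' f' g' \<sigma>"
    by (rule core_chart[OF core v0(1-3)])
  note mod = sheet_chart_model[OF ch]
  note fib0 = sheet_chart_fibre[OF ch]
  obtain U where U: "openin (top_of_set M) U" "g v0 \<in> U" "U \<subseteq> N'"
    using sheet_chart_base(1)[OF ch] unfolding nbhd_in_def by blast
  obtain P where P: "open P" "U = M \<inter> P" using U(1) openin_open by metis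
  have contg: "continuous_on cube g" using homeomorphism_cont2[OF bc_props(5)[OF bc]] .
  obtain V where V: "open V" "g -` P \<inter> cube = V \<inter> cube"
    using continuous_on_open_invariant[of cube g] contg P(1) by metis
  have "v0 \<in> V" using V(2) U(2) P(2) v0(4) by blast
  then obtain d0 where d0: "0 < d0"
    "\<And>w. \<bar>w $ 1 - v0 $ 1\<bar> < d0 \<Longrightarrow> \<bar>w $ 2 - v0 $ 2\<bar> < d0 \<Longrightarrow> \<bar>w $ 3 - v0 $ 3\<bar> < d0 \<Longrightarrow> w \<in> V"
    using box_small[OF V(1)] by metis
  \<comment> \<open>The three bounds keep the box \<open>Om\<close> inside the sheet chart, away
    from the outer faces of the cone, and inside the core.\<close>
  define d where "d = min d0 (min (z/4) (r - z))"
  have d: "0 < d" "4 * d \<le> z" "z + d \<le> r" "d \<le> d0" using d0(1) z r1 by (auto simp: d_def min_def)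
  define Om where "Om = {v :: real^3. \<bar>v $ 1\<bar> < d \<and> \<bar>v $ 2\<bar> < d \<and> \<bar>v $ 3 - z\<bar> < d}"
  have Om_ocube: "Om \<subseteq> ocube r" using d by (auto simp: Om_def mem_ocube_3)
  have Om_cube: "v \<in> cube" if "v \<in> Om" for v
    using Om_ocube that r1 by (force simp: ocube_def mem_cube intro: less_imp_le less_trans)
  have openOm: "open Om"
    unfolding Om_def by (intro open_Collect_conj open_Collect_less continuous_intros)
  have Om_N': "g v \<in> N'" if v: "v \<in> Om" for v
  proof -
    have "v \<in> V" by (rule d0(2)) (use v d(4) in \<open>auto simp: Om_def v0_def\<close>)
    then have "g v \<in> P" using V(2) Om_cube[OF v] by blast
    moreover have "g v \<in> M" using bc_fg(2)[OF bc Om_cube[OF v]] bc_props(7)[OF bc] by blast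
    ultimately show ?thesis using P(2) U(3) by blast
  qed
  define NO where "NO = {q \<in> N. f q \<in> Om}"
  have openNO: "openin (top_of_set M) NO" unfolding NO_def using core_props(4)[OF core openOm Om_ocube] .
  have NO_N': "NO \<subseteq> N'"
  proof
    fix q assume "q \<in> NO"
    then show "q \<in> N'" using Om_N'[of "f q"] bc_gf(1)[OF bc, of q] by (simp add: NO_def)
  qed
  have v0Om: "v0 \<in> Om" using d(1) by (simp add: Om_def v0_def)
  have g0NO: "g v0 \<in> NO" using v0Om bc_fg[OF bc v0(4)] by (simp add: NO_def)
  \<comment> \<open>The change of coordinates from the umbrella chart to the sheet chart; a point
    lies on sheet \<open>k\<close> when coordinate \<open>k\<close> of \<open>T v\<close>
    vanishes.\<close>
  define T where "T = (\<lambda>v. f' (g v))"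
  have TB: "T v \<in> B" "g' (T v) = g v" if "v \<in> Om" for v
    using sheet_chart_fgI(1,2)[OF ch Om_N'[OF that]] by (auto simp: T_def)
  have contT: "continuous_on Om T"
  proof -
    have "continuous_on N' f'" using homeomorphism_cont1[OF sheet_chart_fg(1)[OF ch]] .
    then show ?thesis unfolding T_def
      by (rule continuous_on_compose2[OF _ continuous_on_subset[OF contg]]) (use Om_cube Om_N' in auto)
  qed
  have contTl: "continuous_on S (\<lambda>v. T v $ l)" if "S \<subseteq> Om" for S l
    using continuous_on_subset[OF contT that] by (intro continuous_intros)
  have fibI: "\<sigma> k (T v) \<in> F" "i (\<sigma> k (T v)) = g v" if "v \<in> Om" "k \<in> K" "T v $ k = 0" for v k
    using sheet_chart_mem[OF ch that(2) TB(1)[OF that(1)]] TB(2)[OF that(1)] that(3) by (auto simp: coord_plane_def)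
  have fibE: "\<exists>k\<in>K. T v $ k = 0 \<and> x = \<sigma> k (T v)" if xF: "x \<in> F" "i x = g v" "v \<in> Om" for x v
  proof -
    have xN: "i x \<in> N'" using xF Om_N' by simp
    obtain k where "k \<in> K" "f' (i x) \<in> coord_plane k" "x = \<sigma> k (f' (i x))"
      using sheet_chart_cases[OF ch xF(1) xN] by metis
    then show ?thesis using xF(2) by (auto simp: T_def coord_plane_def)
  qed
  have inC: "(\<exists>k\<in>K. T v $ k = 0) \<longleftrightarrow> v \<in> fig_cone" if vO: "v \<in> Om" for v
  proof -
    have "(\<exists>k\<in>K. T v $ k = 0) \<longleftrightarrow> g v \<in> i ` F"
    proof
      show "g v \<in> i ` F" if "\<exists>k\<in>K. T v $ k = 0" using fibI[OF vO] that by (metis image_eqI)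
      show "\<exists>k\<in>K. T v $ k = 0" if "g v \<in> i ` F" using fibE[OF _ _ vO] that by (metis imageE)
    qed
    then show ?thesis using bc_image[OF bc Om_cube[OF vO]] by simp
  qed
  have Omcone: "v \<in> fig_cone \<longleftrightarrow> \<bar>v $ 1\<bar> = \<bar>v $ 2\<bar>" if "v \<in> Om" for v
  proof -
    have h: "\<bar>v $ 1\<bar> < d" "\<bar>v $ 2\<bar> < d" "z - d < v $ 3" "v $ 3 < z + d" using that by (auto simp: Om_def)
    have "2 * \<bar>v $ 1\<bar> < v $ 3" "0 \<le> v $ 3" "v $ 3 \<le> 1" using h d r1 by linarith+
    then show ?thesis unfolding mem_fig_cone by linarith
  qed
  have disj: "\<sigma> k (T v) \<noteq> \<sigma> l (T v)" if "v \<in> Om" "k \<in> K" "l \<in> K" "k \<noteq> l" "T v $ k = 0" "T v $ l = 0" for v k l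
    using sheet_chart_disjoint[OF ch that(2-4)] TB(1)[OF that(1)] that(5,6) by (auto simp: coord_plane_def)
  \<comment> \<open>Off the double line the fibre is a single point, while different sheets give
    different points of \<open>F\<close>.\<close>
  have uniq: "k = l" if u: "v \<in> Om" "v $ 1 \<noteq> 0" "k \<in> K" "l \<in> K" "T v $ k = 0" "T v $ l = 0" for v k l
  proof (rule ccontr)
    assume ne: "k \<noteq> l"
    have "v \<in> fig_cone" using inC[OF u(1)] u(3,5) by blast
    then obtain x where x: "{x' \<in> F. i x' = g v} = {x}"
      using off_axis_single[OF core] Om_ocube u(1,2) by blast
    have "\<sigma> k (T v) \<in> {x' \<in> F. i x' = g v}" "\<sigma> l (T v) \<in> {x' \<in> F. i x' = g v}" using fibI u by auto
    then show False using x disj[OF u(1,3,4) ne u(5,6)] by simp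
  qed
  have axis2: "\<exists>k\<in>K. \<exists>l\<in>K. k \<noteq> l \<and> T v $ k = 0 \<and> T v $ l = 0" if v: "v \<in> Om" "v $ 1 = 0" "v $ 2 = 0" for v
  proof -
    have e: "v = pt 0 0 (v $ 3)" using v by (simp add: vec3_eq_iff)
    have "z - d < v $ 3" "v $ 3 < z + d" using v by (auto simp: Om_def)
    then have b: "0 < v $ 3" "v $ 3 < r" using d z by linarith+
    obtain x y where xy: "x \<in> F" "y \<in> F" "x \<noteq> y" "i x = g v" "i y = g v"
      using axis_multi[OF core b] e by auto
    obtain k where k: "k \<in> K" "T v $ k = 0" "x = \<sigma> k (T v)" using fibE[OF xy(1,4) v(1)] by blast
    obtain l where l: "l \<in> K" "T v $ l = 0" "y = \<sigma> l (T v)" using fibE[OF xy(2,5) v(1)] by blast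
    have "k \<noteq> l" using k l xy(3) by blast
    then show ?thesis using k l by blast
  qed
  \<comment> \<open>The four half-planes of the cone: \<open>a\<close> is the sign of the first
    coordinate, \<open>b\<close> the slope of the plane.\<close>
  define H where "H = (\<lambda>a b. {v \<in> Om. a * v $ 1 > 0 \<and> v $ 2 = b * v $ 1})"
  define I where "I = {1, -1 :: real}"
  have HOm: "H a b \<subseteq> Om" for a b by (auto simp: H_def)
  have Hcone: "v \<in> fig_cone" "v $ 1 \<noteq> 0" if "v \<in> H a b" "b \<in> I" for a b v
    using that Omcone[of v] by (auto simp: H_def I_def abs_mult)
  have Hex: "\<exists>a\<in>I. \<exists>b\<in>I. v \<in> H a b" if "v \<in> Om" "v $ 1 \<noteq> 0" "\<bar>v $ 1\<bar> = \<bar>v $ 2\<bar>" for v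
  proof -
    have a: "sgn (v $ 1) \<in> I" "sgn (v $ 1) * v $ 1 > 0" using that(2) by (auto simp: I_def sgn_if)
    have "v $ 2 = v $ 1 \<or> v $ 2 = - v $ 1" using that(3) by linarith
    then have "\<exists>b\<in>I. v $ 2 = b * v $ 1" by (auto simp: I_def)
    then show ?thesis using a that(1) by (auto simp: H_def)
  qed
  have half: "convex {v :: real^3. a * v $ 1 + b * v $ 2 + c * v $ 3 < e}"
    "convex {v :: real^3. a * v $ 1 + b * v $ 2 + c * v $ 3 \<le> e}"
    "convex {v :: real^3. a * v $ 1 + b * v $ 2 + c * v $ 3 = e}" for a b c e
  proof -
    have eq: "a * v $ 1 + b * v $ 2 + c * v $ 3 = pt a b c \<bullet> v" for v by (simp add: inner_vec_def sum_3)
    show "convex {v :: real^3. a * v $ 1 + b * v $ 2 + c * v $ 3 < e}"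
      "convex {v :: real^3. a * v $ 1 + b * v $ 2 + c * v $ 3 \<le> e}"
      "convex {v :: real^3. a * v $ 1 + b * v $ 2 + c * v $ 3 = e}"
      unfolding eq by (rule convex_halfspace_lt convex_halfspace_le convex_hyperplane)+
  qed
  have convOm: "convex Om"
  proof -
    have eq: "Om = {v. 1 * v $ 1 + 0 * v $ 2 + 0 * v $ 3 < d} \<inter> {v. -1 * v $ 1 + 0 * v $ 2 + 0 * v $ 3 < d} \<inter>
      {v. 0 * v $ 1 + 1 * v $ 2 + 0 * v $ 3 < d} \<inter> {v. 0 * v $ 1 + -1 * v $ 2 + 0 * v $ 3 < d} \<inter>
      {v. 0 * v $ 1 + 0 * v $ 2 + 1 * v $ 3 < d + z} \<inter> {v. 0 * v $ 1 + 0 * v $ 2 + -1 * v $ 3 < d - z}"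
      unfolding Om_def by auto
    show ?thesis unfolding eq by (intro convex_Int half)
  qed
  have Hconn: "connected (H a b)" for a b
  proof (rule convex_connected)
    have eq: "H a b = Om \<inter> {v. -a * v $ 1 + 0 * v $ 2 + 0 * v $ 3 < 0} \<inter> {v. - b * v $ 1 + 1 * v $ 2 + 0 * v $ 3 = 0}"
      unfolding H_def by auto
    show "convex (H a b)" unfolding eq by (intro convex_Int half convOm)
  qed
  have convOm1: "convex {v \<in> Om. v $ 1 < 0 \<and> \<bar>v $ 2\<bar> \<le> - v $ 1}"
  proof -
    have eq: "{v \<in> Om. v $ 1 < 0 \<and> \<bar>v $ 2\<bar> \<le> - v $ 1} = Om \<inter> {v. 1 * v $ 1 + 0 * v $ 2 + 0 * v $ 3 < 0} \<inter>
      {v. 1 * v $ 1 + 1 * v $ 2 + 0 * v $ 3 \<le> 0} \<inter> {v. 1 * v $ 1 + -1 * v $ 2 + 0 * v $ 3 \<le> 0}" by auto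
    show ?thesis unfolding eq by (intro convex_Int half convOm)
  qed
  have convOm2: "convex {v \<in> Om. v $ 2 < 0 \<and> \<bar>v $ 1\<bar> \<le> - v $ 2}"
  proof -
    have eq: "{v \<in> Om. v $ 2 < 0 \<and> \<bar>v $ 1\<bar> \<le> - v $ 2} = Om \<inter> {v. 0 * v $ 1 + 1 * v $ 2 + 0 * v $ 3 < 0} \<inter>
      {v. 1 * v $ 1 + 1 * v $ 2 + 0 * v $ 3 \<le> 0} \<inter> {v. -1 * v $ 1 + 1 * v $ 2 + 0 * v $ 3 \<le> 0}" by auto
    show ?thesis unfolding eq by (intro convex_Int half convOm)
  qed
  have Hne: "H a b \<noteq> {}" if "a \<in> I" "b \<in> I" for a b
  proof -
    have "pt (a * (d/2)) (b * (a * (d/2))) z \<in> H a b"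
      using that d(1) by (auto simp: H_def Om_def I_def)
    then show ?thesis by blast
  qed
  have "\<exists>k\<in>K. \<forall>v\<in>H a b. T v $ k = 0" if ab: "a \<in> I" "b \<in> I" for a b
  proof -
    have c1: "closedin (top_of_set (H a b)) {v \<in> H a b. T v $ k = 0}" for k
      by (rule continuous_closedin_preimage_constant[OF contTl[OF HOm]])
    have c2: "H a b \<subseteq> (\<Union>k\<in>K. {v \<in> H a b. T v $ k = 0})"
    proof
      fix v assume v: "v \<in> H a b"
      then have "v \<in> fig_cone" "v \<in> Om" using Hcone(1) ab HOm by blast+
      then obtain k where "k \<in> K" "T v $ k = 0" using inC by blast
      then show "v \<in> (\<Union>k\<in>K. {v \<in> H a b. T v $ k = 0})" using v by auto
    qed
    have c3: "{v \<in> H a b. T v $ k = 0} \<inter> {v \<in> H a b. T v $ l = 0} = {}" if "k \<in> K" "l \<in> K" "k \<noteq> l" for k l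
      using uniq[OF _ _ that(1,2)] that(3) HOm Hcone(2)[OF _ ab(2)] by fastforce
    have "\<exists>k\<in>K. {v \<in> H a b. T v $ k = 0} = H a b"
      by (rule connected_finite_closed_cover[OF Hconn Hne[OF ab] sheet_model_props(6)[OF mod(1)], of "\<lambda>k. {v \<in> H a b. T v $ k = 0}",
          OF c1 c2 c3]) (assumption | rule bexI)+
    then show ?thesis by blast
  qed
  \<comment> \<open>\<open>\<kappa> a b\<close> is the sheet containing the half-plane; it exists
    because the sheets cut a connected half-plane into disjoint closed sets.\<close>
  then obtain \<kappa> where \<kappa>: "\<And>a b. a \<in> I \<Longrightarrow> b \<in> I \<Longrightarrow> \<kappa> a b \<in> K \<and> (\<forall>v\<in>H a b. T v $ \<kappa> a b = 0)" by metis
  have \<kappa>u: "\<kappa> a b = k" if "a \<in> I" "b \<in> I" "v \<in> H a b" "k \<in> K" "T v $ k = 0" for a b v k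
    using uniq[of v "\<kappa> a b" k] \<kappa>[OF that(1,2)] that HOm Hcone(2)[OF that(3,2)] by blast
  \<comment> \<open>On sheet \<open>k\<close>, arbitrarily close to its centre, there are points on
    the prescribed side of \<open>l\<close> that lie on no other sheet. Such a point is off the
    double line, hence in one of the half-planes.\<close>
  have pts: "\<exists>a\<in>I. \<exists>b\<in>I. \<exists>v\<in>H a b. \<kappa> a b = k \<and> T v $ k = 0 \<and> s * T v $ l > 0 \<and> \<sigma> k (T v) \<in> W"
    if kl: "k \<in> K" "l \<in> K" "k \<noteq> l" and s: "s \<in> I" and W: "open W" "\<sigma> k 0 \<in> W" for k l s W
  proof -
    obtain m where m: "m \<noteq> k" "m \<noteq> l" "\<And>j. j = k \<or> j = l \<or> j = m" using three_other[OF kl(3)] by metis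
    obtain PO where PO: "open PO" "NO = M \<inter> PO" using openNO openin_open by metis
    have cg': "continuous_on B g'" using homeomorphism_cont2[OF sheet_chart_fg(1)[OF ch]] .
    obtain V1 where V1: "open V1" "g' -` PO \<inter> B = V1 \<inter> B"
      using continuous_on_open_invariant[of B g'] cg' PO(1) by metis
    have cs: "continuous_on (B \<inter> coord_plane k) (\<sigma> k)" using homeomorphism_cont1[OF sheet_chart_hom[OF ch kl(1)]] .
    obtain V2 where V2: "open V2" "\<sigma> k -` W \<inter> (B \<inter> coord_plane k) = V2 \<inter> (B \<inter> coord_plane k)"
      using continuous_on_open_invariant[of "B \<inter> coord_plane k" "\<sigma> k"] cs W(1) by metis
    have "g' 0 = g v0" using sheet_chart_fgI(1)[OF ch sheet_chart_base(4)[OF ch]] sheet_chart_base(3)[OF ch] by simp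
    then have "0 \<in> V1" using V1(2) PO(2) g0NO mod(4) by auto
    moreover have "0 \<in> V2" using V2(2) W(2) mod(4) coord_plane_props(3)[of k] by blast
    ultimately obtain e where e: "0 < e" "e < 1" "ocube e \<subseteq> V1 \<inter> V2"
      using ocube_small[of "V1 \<inter> V2"] V1(1) V2(1) by auto
    define w :: "real^3" where "w = (s * (e/2)) *\<^sub>R axis l 1 + (e/2) *\<^sub>R axis m 1"
    have s': "s \<noteq> 0" "s * s = 1" "\<bar>s\<bar> = 1" using s by (auto simp: I_def)
    have wB: "w \<in> B" "w \<in> coord_plane k"
      using model_point[OF mod(1) kl m(1,2), of "s * (e/2)" "e/2"] e s' by (auto simp: w_def abs_mult)
    have wl: "w $ l = s * (e/2)" "w $ m = e/2" "w $ k = 0" using m kl(3) by (auto simp: w_def axis_def)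
    have we: "w \<in> ocube e" unfolding ocube_def
    proof (intro CollectI allI)
      fix j show "\<bar>w $ j\<bar> < e" using m(3)[of j] wl e(1) s' by (auto simp: abs_mult)
    qed
    have "g' w \<in> PO" using V1(2) wB(1) we e(3) by blast
    then have "g' w \<in> NO" using PO(2) sheet_chart_fgI(4)[OF ch wB(1)] sheet_chart_base(6)[OF ch] by blast
    define v where "v = f (g' w)"
    have v: "v \<in> Om" "g v = g' w" using \<open>g' w \<in> NO\<close> bc_gf(1)[OF bc] by (auto simp: v_def NO_def)
    have Tv: "T v = w" unfolding T_def v(2) using sheet_chart_fgI(3)[OF ch wB(1)] .
    have only: "j = k" if "T v $ j = 0" for j using m(3)[of j] wl e(1) s' that Tv by auto
    have "v \<in> fig_cone" using inC[OF v(1)] kl(1) wl(3) Tv by metis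
    then have abs: "\<bar>v $ 1\<bar> = \<bar>v $ 2\<bar>" using Omcone[OF v(1)] by simp
    have "v $ 1 \<noteq> 0"
    proof
      assume "v $ 1 = 0"
      then obtain j j' where "j \<noteq> j'" "T v $ j = 0" "T v $ j' = 0" using axis2[OF v(1)] abs by auto
      then show False using only by metis
    qed
    then obtain a b where ab: "a \<in> I" "b \<in> I" "v \<in> H a b" using Hex[OF v(1) _ abs] by blast
    have "T v $ k = 0" using Tv wl by simp
    moreover have "s * T v $ l > 0"
    proof -
      have "s * T v $ l = (s * s) * (e / 2)" unfolding Tv wl(1) by simp
      then show ?thesis using e(1) s'(2) by simp
    qed
    moreover have "\<sigma> k (T v) \<in> W" using Tv V2(2) wB we e(3) by blast
    ultimately show ?thesis using ab \<kappa>u[OF ab kl(1)] by blast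
  qed
  \<comment> \<open>Points on the two sides of \<open>l\<close> lie in different half-planes, since
    a half-plane belonging to \<open>k\<close> is connected and avoids \<open>l\<close>.\<close>
  have two: "\<exists>a\<in>I. \<exists>b\<in>I. \<exists>a'\<in>I. \<exists>b'\<in>I. (a, b) \<noteq> (a', b') \<and> \<kappa> a b = k \<and> \<kappa> a' b' = k"
    if k: "k \<in> K" and l: "l \<in> K" "k \<noteq> l" for k l
  proof -
    obtain a b v where ab: "a \<in> I" "b \<in> I" "v \<in> H a b" "\<kappa> a b = k" "1 * T v $ l > 0"
      using pts[OF k l, of 1 UNIV] by (auto simp: I_def)
    obtain a' b' v' where ab': "a' \<in> I" "b' \<in> I" "v' \<in> H a' b'" "\<kappa> a' b' = k" "-1 * T v' $ l > 0"
      using pts[OF k l, of "-1" UNIV] by (auto simp: I_def)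
    have "(a, b) \<noteq> (a', b')"
    proof
      assume eq: "(a, b) = (a', b')"
      have nz: "T w $ l \<noteq> 0" if "w \<in> H a b" for w
        using \<kappa>u[OF ab(1,2) that l(1)] ab(4) l(2) by auto
      have "T v' $ l > 0"
        by (rule connected_nonzero_sign[OF Hconn contTl[OF HOm] nz ab(3)]) (use ab ab' eq in auto)
      then show False using ab'(5) by simp
    qed
    then show ?thesis using ab ab' by blast
  qed
  \<comment> \<open>The signs of the first two coordinates are (+,+), (-,-), (+,-), (-,+). Thus 1
    and 2 are the halves of \<open>y = x\<close>, and 3 and 4 those of
    \<open>y = - x\<close>.\<close>
  define \<kappa>1 \<kappa>2 \<kappa>3 \<kappa>4 where "\<kappa>1 = \<kappa> 1 1" "\<kappa>2 = \<kappa> (-1) 1" "\<kappa>3 = \<kappa> 1 (-1)" "\<kappa>4 = \<kappa> (-1) (-1)"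
  have two': "\<kappa>1 = k \<and> \<kappa>2 = k \<or> \<kappa>1 = k \<and> \<kappa>3 = k \<or> \<kappa>1 = k \<and> \<kappa>4 = k \<or> \<kappa>2 = k \<and> \<kappa>3 = k \<or> \<kappa>2 = k \<and> \<kappa>4 = k \<or>
     \<kappa>3 = k \<and> \<kappa>4 = k" if "k \<in> K" "l \<in> K" "k \<noteq> l" for k l
    using two[OF that] unfolding I_def \<kappa>1_\<kappa>2_\<kappa>3_\<kappa>4_def by auto
  have wedge: False
    if kl: "k \<in> K" "l \<in> K" "k \<noteq> l" and Y: "convex Y" "Y \<subseteq> Om" and a: "a \<in> I" "b \<in> I" "a' \<in> I" "b' \<in> I"
      and HY: "H a b \<union> H a' b' \<subseteq> Y" and YH: "\<And>v. v \<in> Y \<Longrightarrow> \<bar>v $ 1\<bar> = \<bar>v $ 2\<bar> \<Longrightarrow> v \<in> H a b \<union> H a' b'"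
      and l: "\<kappa> a b = l" "\<kappa> a' b' = l"
      and only: "\<And>c c'. c \<in> I \<Longrightarrow> c' \<in> I \<Longrightarrow> \<kappa> c c' = l \<Longrightarrow> (c, c') = (a, b) \<or> (c, c') = (a', b')"
    for k l Y a b a' b'
  proof -
    have nz: "T w $ k \<noteq> 0" if w: "w \<in> Y" for w
    proof
      assume 0: "T w $ k = 0"
      have "w \<in> Om" using w Y(2) by blast
      then have "w \<in> fig_cone" using inC 0 kl(1) by blast
      then have "w \<in> H a b \<union> H a' b'" using YH[OF w] Omcone[OF \<open>w \<in> Om\<close>] by simp
      then show False using \<kappa>u[OF a(1,2) _ kl(1) 0] \<kappa>u[OF a(3,4) _ kl(1) 0] l kl(3) by auto
    qed
    obtain c c' v where v: "c \<in> I" "c' \<in> I" "v \<in> H c c'" "\<kappa> c c' = l" "1 * T v $ k > 0"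
      using pts[OF kl(2,1) kl(3)[symmetric], of 1 UNIV] by (auto simp: I_def)
    obtain e e' v' where v': "e \<in> I" "e' \<in> I" "v' \<in> H e e'" "\<kappa> e e' = l" "-1 * T v' $ k > 0"
      using pts[OF kl(2,1) kl(3)[symmetric], of "-1" UNIV] by (auto simp: I_def)
    have vY: "v \<in> Y" using only[OF v(1,2,4)] v(3) HY by auto
    have vY': "v' \<in> Y" using only[OF v'(1,2,4)] v'(3) HY by auto
    have "T v' $ k > 0"
      by (rule connected_nonzero_sign[OF convex_connected[OF Y(1)] contTl[OF Y(2)] nz vY vY']) (use v(5) in auto)
    then show False using v'(5) by simp
  qed
  obtain k l where kl: "k \<in> K" "l \<in> K" "k \<noteq> l" "k = \<kappa>1"
  proof -
    obtain j j' where j: "j \<in> K" "j' \<in> K" "j \<noteq> j'" using axis2[OF v0Om] by (auto simp: v0_def)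
    have "\<kappa>1 \<in> K" using \<kappa>[of 1 1] by (simp add: I_def \<kappa>1_\<kappa>2_\<kappa>3_\<kappa>4_def)
    then show thesis using that[of \<kappa>1 j] that[of \<kappa>1 j'] j by metis
  qed
  note tk = two'[OF kl(1-3)]
  note tl = two'[OF kl(2,1) kl(3)[symmetric]]
  \<comment> \<open>Here sheet \<open>k\<close> would consist of the neighbouring half-planes 1 and
    4, and the wedge in question is the one between 2 and 3.\<close>
  have w23: "\<not> (\<kappa>2 = l \<and> \<kappa>3 = l)"
  proof
    assume l: "\<kappa>2 = l \<and> \<kappa>3 = l"
    then have "\<kappa>4 = k" using tk kl(3) by auto
    then show False
      using l kl
      by (intro wedge[OF kl(1-3), of "{v \<in> Om. v $ 2 < 0 \<and> \<bar>v $ 1\<bar> \<le> - v $ 2}" "-1" 1 1 "-1"])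
         (auto simp: H_def I_def \<kappa>1_\<kappa>2_\<kappa>3_\<kappa>4_def convOm2)
  qed
  have w24: "\<not> (\<kappa>2 = l \<and> \<kappa>4 = l)"
  proof
    assume l: "\<kappa>2 = l \<and> \<kappa>4 = l"
    then have "\<kappa>3 = k" using tk kl(3) by auto
    then show False
      using l kl
      by (intro wedge[OF kl(1-3), of "{v \<in> Om. v $ 1 < 0 \<and> \<bar>v $ 2\<bar> \<le> - v $ 1}" "-1" 1 "-1" "-1"])
         (auto simp: H_def I_def \<kappa>1_\<kappa>2_\<kappa>3_\<kappa>4_def convOm1)
  qed
  have \<kappa>s: "\<kappa>2 = k" "\<kappa>3 = l" "\<kappa>4 = l" using tk tl w23 w24 kl(3,4) by auto
  have K: "j = k \<or> j = l" if "j \<in> K" for j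
    using two'[OF that kl(1)] kl(3,4) \<kappa>s by auto
  have \<kappa>k: "b = 1" if "a \<in> I" "b \<in> I" "\<kappa> a b = k" for a b
    using that \<kappa>s kl(3,4) by (auto simp: I_def \<kappa>1_\<kappa>2_\<kappa>3_\<kappa>4_def)
  have \<kappa>l: "b = -1" if "a \<in> I" "b \<in> I" "\<kappa> a b = l" for a b
    using that \<kappa>s kl(3,4) by (auto simp: I_def \<kappa>1_\<kappa>2_\<kappa>3_\<kappa>4_def)
  have g'0: "g' 0 = g v0" using sheet_chart_fgI(1)[OF ch sheet_chart_base(4)[OF ch]] sheet_chart_base(3)[OF ch] by simp
  have on_plane: "i x' \<in> N \<and> f (i x') $ 1 = b * f (i x') $ 2"
    if j: "j \<in> K" and b: "\<And>a c. a \<in> I \<Longrightarrow> c \<in> I \<Longrightarrow> \<kappa> a c = j \<Longrightarrow> c = b" "b \<in> I"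
      and x': "x' \<in> F" "x' \<in> \<sigma> j ` (B \<inter> coord_plane j)" "i x' \<in> NO" for j b x'
  proof -
    define v where "v = f (i x')"
    have v: "v \<in> Om" "g v = i x'" "i x' \<in> N" using x'(3) bc_gf(1)[OF bc] by (auto simp: v_def NO_def)
    obtain w where w: "w \<in> B" "w \<in> coord_plane j" "x' = \<sigma> j w" using x'(2) by blast
    have "T v = w" unfolding T_def v(2) w(3) using sheet_chart_inv[OF ch j w(1,2)] .
    then have 0: "T v $ j = 0" using w(2) by (simp add: coord_plane_def)
    then have "v \<in> fig_cone" using inC[OF v(1)] j by blast
    then have abs: "\<bar>v $ 1\<bar> = \<bar>v $ 2\<bar>" using Omcone[OF v(1)] by simp
    show ?thesis
    proof (cases "v $ 1 = 0")
      case True then show ?thesis using abs v by (simp add: v_def)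
    next
      case False
      then obtain a c where ac: "a \<in> I" "c \<in> I" "v \<in> H a c" using Hex[OF v(1) _ abs] by blast
      then have "c = b" using b(1) \<kappa>u[OF ac j 0] by blast
      then show ?thesis using ac(3) b(2) v(3) by (auto simp: H_def I_def v_def)
    qed
  qed
  obtain W1 where W1: "open W1" "\<sigma> k 0 \<in> W1" "F \<inter> W1 \<subseteq> \<sigma> k ` (B \<inter> coord_plane k)" "i ` (F \<inter> W1) \<subseteq> NO"
    by (rule sheet_chart_open[OF ch cont_i kl(1) openNO NO_N' i_into mod(4) coord_plane_props(3)])
       (use g'0 g0NO in auto)
  obtain W2 where W2: "open W2" "\<sigma> l 0 \<in> W2" "F \<inter> W2 \<subseteq> \<sigma> l ` (B \<inter> coord_plane l)" "i ` (F \<inter> W2) \<subseteq> NO"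
    by (rule sheet_chart_open[OF ch cont_i kl(2) openNO NO_N' i_into mod(4) coord_plane_props(3)])
       (use g'0 g0NO in auto)
  have acc: "\<exists>x'\<in>F \<inter> W. i x' \<in> N \<and> f (i x') $ 1 \<noteq> 0"
    if j: "j \<in> K" "j' \<in> K" "j \<noteq> j'" and W: "open W" "\<sigma> j 0 \<in> W" for j j' W
  proof -
    obtain a b v where v: "b \<in> I" "v \<in> H a b" "T v $ j = 0" "\<sigma> j (T v) \<in> W"
      using pts[OF j _ W, of 1] by (auto simp: I_def)
    have vO: "v \<in> Om" using v(2) HOm by blast
    have "\<sigma> j (T v) \<in> F" "i (\<sigma> j (T v)) = g v" using fibI[OF vO j(1) v(3)] .
    moreover have "g v \<in> N" "f (g v) $ 1 \<noteq> 0" using bc_fg[OF bc Om_cube[OF vO]] Hcone(2)[OF v(2,1)] by auto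
    ultimately show ?thesis using v(4) by (intro bexI[of _ "\<sigma> j (T v)"]) auto
  qed
  show thesis
  proof (rule that[of "\<sigma> k 0" "\<sigma> l 0" W1 W2])
    have "K = {k, l}" using K kl(1,2) by blast
    then show "{x' \<in> F. i x' = g (pt 0 0 z)} = {\<sigma> k 0, \<sigma> l 0}" using fib0 by (simp add: v0_def)
    show "\<sigma> k 0 \<noteq> \<sigma> l 0" using inj_onD[OF sheet_chart_inj[OF ch] _ kl(1,2)] kl(3) by blast
    show "i x' \<in> N \<and> f (i x') $ 1 = f (i x') $ 2" if "x' \<in> F \<inter> W1" for x'
    proof -
      have "x' \<in> F" "x' \<in> \<sigma> k ` (B \<inter> coord_plane k)" "i x' \<in> NO"
        using that subsetD[OF W1(3) that] subsetD[OF W1(4) imageI[OF that]] by simp_all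
      from on_plane[OF kl(1) \<kappa>k _ this] show ?thesis by (simp add: I_def)
    qed
    show "i x' \<in> N \<and> f (i x') $ 1 = - f (i x') $ 2" if "x' \<in> F \<inter> W2" for x'
    proof -
      have "x' \<in> F" "x' \<in> \<sigma> l ` (B \<inter> coord_plane l)" "i x' \<in> NO"
        using that subsetD[OF W2(3) that] subsetD[OF W2(4) imageI[OF that]] by simp_all
      from on_plane[OF kl(2) \<kappa>l _ this] show ?thesis by (simp add: I_def)
    qed
    show "\<exists>x'\<in>F \<inter> W. i x' \<in> N \<and> f (i x') $ 1 \<noteq> 0" if "open W" "\<sigma> k 0 \<in> W" for W
      using acc[OF kl(1-3) that] .
    show "\<exists>x'\<in>F \<inter> W. i x' \<in> N \<and> f (i x') $ 1 \<noteq> 0" if "open W" "\<sigma> l 0 \<in> W" for W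
      using acc[OF kl(2,1) kl(3)[symmetric] that] .
  qed (use W1 W2 in auto)
qed

end

end

section \<open>A second parameter for the umbrella\<close>

context generic_map
begin

context
  fixes p N f g r
  assumes core: "branch_core p N f g r"
begin

text \<open>
  Near a branch point, the surface is the image of \<open>(x, t) \<mapsto> (x, umb_y x t, umb_z x t)\<close>, with \<open>umb_y\<close> and
  \<open>umb_z\<close> as below.  The coordinate \<open>t\<close> is recovered from the point of the cone, except on the double line,
  where its sign depends on the sheet.
\<close>

definition first_sheet :: "'b \<Rightarrow> bool" where
  "first_sheet x \<longleftrightarrow> (\<exists>W. open W \<and> x \<in> W \<and> (\<forall>x'\<in>F \<inter> W. i x' \<in> N \<and> f (i x') $ 1 = f (i x') $ 2))"

definition second_sheet :: "'b \<Rightarrow> bool" where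
  "second_sheet x \<longleftrightarrow> (\<exists>W. open W \<and> x \<in> W \<and> (\<forall>x'\<in>F \<inter> W. i x' \<in> N \<and> f (i x') $ 1 = - f (i x') $ 2))"

text \<open>Makes the two sheets over a point of the double line distinguishable: a neighbourhood
  contained in both planes could not leave the double line.\<close>

definition crosses_axis :: "'b \<Rightarrow> bool" where
  "crosses_axis x \<longleftrightarrow> (\<forall>W. open W \<longrightarrow> x \<in> W \<longrightarrow> (\<exists>x'\<in>F \<inter> W. f (i x') $ 1 \<noteq> 0))"

lemma axis_fibre_aux:
  assumes "0 < z" "z < r"
  shows "\<exists>x y. {x' \<in> F. i x' = g (pt 0 0 z)} = {x, y} \<and> x \<noteq> y \<and> first_sheet x \<and> second_sheet y \<and>
    crosses_axis x \<and> crosses_axis y"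
proof (rule two_sheets[OF core assms])
  fix x y W1 W2
  assume h: "{x' \<in> F. i x' = g (pt 0 0 z)} = {x, y}" "x \<noteq> y"
    "open W1" "x \<in> W1" "\<And>x'. x' \<in> F \<inter> W1 \<Longrightarrow> i x' \<in> N \<and> f (i x') $ 1 = f (i x') $ 2"
    "open W2" "y \<in> W2" "\<And>x'. x' \<in> F \<inter> W2 \<Longrightarrow> i x' \<in> N \<and> f (i x') $ 1 = - f (i x') $ 2"
    "\<And>W. open W \<Longrightarrow> x \<in> W \<Longrightarrow> \<exists>x'\<in>F \<inter> W. i x' \<in> N \<and> f (i x') $ 1 \<noteq> 0"
    "\<And>W. open W \<Longrightarrow> y \<in> W \<Longrightarrow> \<exists>x'\<in>F \<inter> W. i x' \<in> N \<and> f (i x') $ 1 \<noteq> 0"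
  have "first_sheet x" unfolding first_sheet_def using h(3-5) by (intro exI[of _ W1]) simp
  moreover have "second_sheet y" unfolding second_sheet_def using h(6-8) by (intro exI[of _ W2]) simp
  moreover have "crosses_axis x" unfolding crosses_axis_def
  proof (intro allI impI)
    fix W assume "open W" "x \<in> W"
    from h(9)[OF this] show "\<exists>x'\<in>F \<inter> W. f (i x') $ 1 \<noteq> 0" by blast
  qed
  moreover have "crosses_axis y" unfolding crosses_axis_def
  proof (intro allI impI)
    fix W assume "open W" "y \<in> W"
    from h(10)[OF this] show "\<exists>x'\<in>F \<inter> W. f (i x') $ 1 \<noteq> 0" by blast
  qed
  ultimately show ?thesis using h(1,2) by (intro exI[of _ x] exI[of _ y]) simp
qed

lemma sheets_exclusive:
  assumes "first_sheet x" "second_sheet x" "crosses_axis x"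
  shows False
proof -
  obtain W1 where W1: "open W1" "x \<in> W1" "\<forall>x'\<in>F \<inter> W1. i x' \<in> N \<and> f (i x') $ 1 = f (i x') $ 2"
    using assms(1) unfolding first_sheet_def by auto
  obtain W2 where W2: "open W2" "x \<in> W2" "\<forall>x'\<in>F \<inter> W2. i x' \<in> N \<and> f (i x') $ 1 = - f (i x') $ 2"
    using assms(2) unfolding second_sheet_def by auto
  have "open (W1 \<inter> W2)" "x \<in> W1 \<inter> W2" using W1 W2 by auto
  then obtain x' where x': "x' \<in> F \<inter> (W1 \<inter> W2)" "f (i x') $ 1 \<noteq> 0"
    using assms(3) unfolding crosses_axis_def by blast
  have "f (i x') $ 1 = f (i x') $ 2" "f (i x') $ 1 = - f (i x') $ 2" using bspec[OF W1(3), of x'] bspec[OF W2(3), of x'] x'(1) by simp_all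
  then show False using x'(2) by simp
qed

lemma axis_fibre:
  assumes "0 < z" "z < r"
  obtains x y where "{x' \<in> F. i x' = g (pt 0 0 z)} = {x, y}" "x \<noteq> y" "first_sheet x" "second_sheet y"
    "\<not> first_sheet y" "\<not> second_sheet x"
  using axis_fibre_aux[OF assms] sheets_exclusive by blast

definition nbd :: "'b set" where "nbd = {x \<in> F. i x \<in> N \<and> f (i x) \<in> ocube r}"

text \<open>The parameter \<open>t\<close> of the umbrella. The quotient is \<open>z - |x|\<close>
  on \<open>y = x\<close>, the negative of this on \<open>y = - x\<close>, and \<open>y\<close>
  times the sign of \<open>x\<close> on the outer faces.\<close>

definition ucoord :: "'b \<Rightarrow> real" where
  "ucoord x = (if f (i x) $ 1 = 0 then if first_sheet x then f (i x) $ 3 else - f (i x) $ 3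
     else f (i x) $ 2 * (f (i x) $ 3 - \<bar>f (i x) $ 1\<bar>) / f (i x) $ 1)"

lemma nbd_open: "openin (top_of_set F) nbd"
proof -
  have "openin (top_of_set M) {q \<in> N. f q \<in> ocube r}"
    using core_props(4)[OF core open_ocube] by simp
  then obtain P where P: "open P" "{q \<in> N. f q \<in> ocube r} = M \<inter> P" unfolding openin_open by blast
  have "nbd = F \<inter> i -` P" using P(2) i_into unfolding nbd_def by auto
  then show ?thesis using continuous_openin_preimage_gen[OF cont_i P(1)] by simp
qed

lemma nbd_cone: "x \<in> nbd \<Longrightarrow> f (i x) \<in> fig_cone"
  using bc_cone[OF core_props(1)[OF core]] by (simp add: nbd_def)

lemma nbd_pl: "pl_on (\<lambda>x. f (i x)) nbd"
  by (rule pl_on_compose[OF pl_on_open_subset[OF pl_i nbd_open] bc_props(8)[OF core_props(1)[OF core]]])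
     (auto simp: nbd_def)

lemma nbd_g: "x \<in> nbd \<Longrightarrow> g (f (i x)) = i x"
  using bc_gf[OF core_props(1)[OF core]] by (simp add: nbd_def)

lemma nbd_axis:
  assumes "x \<in> nbd" "f (i x) $ 1 = 0"
  shows "f (i x) = pt 0 0 (f (i x) $ 3)" "0 \<le> f (i x) $ 3" "f (i x) $ 3 < r"
  using nbd_cone[OF assms(1)] assms by (auto simp: mem_fig_cone vec3_eq_iff nbd_def mem_ocube_3)

lemma nbd_axis_sheets:
  assumes "x \<in> nbd" "f (i x) $ 1 = 0" "f (i x) $ 3 \<noteq> 0"
  shows "first_sheet x \<or> second_sheet x" "second_sheet x \<Longrightarrow> \<not> first_sheet x"
proof -
  note ax = nbd_axis[OF assms(1,2)]
  have z: "0 < f (i x) $ 3" using ax(2) assms(3) by simp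
  obtain u v where uv: "{x' \<in> F. i x' = g (pt 0 0 (f (i x) $ 3))} = {u, v}" "u \<noteq> v" "first_sheet u" "second_sheet v"
    "\<not> first_sheet v" "\<not> second_sheet u"
    by (rule axis_fibre[OF z ax(3)])
  have "i x = g (pt 0 0 (f (i x) $ 3))" using nbd_g[OF assms(1)] ax(1) by simp
  then have x: "x = u \<or> x = v" using uv(1) assms(1) by (auto simp: nbd_def)
  then show "first_sheet x \<or> second_sheet x" "second_sheet x \<Longrightarrow> \<not> first_sheet x" using uv by auto
qed

text \<open>Squeezes the parameter at the apex, where no sheet gives a formula for it.\<close>

lemma ucoord_bound: "x \<in> nbd \<Longrightarrow> \<bar>ucoord x\<bar> \<le> f (i x) $ 3"
proof -
  assume x: "x \<in> nbd"
  note c = nbd_cone[OF x, unfolded mem_fig_cone]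
  show ?thesis
  proof (cases "f (i x) $ 1 = 0")
    case True then show ?thesis using c by (simp add: ucoord_def)
  next
    case False
    have "\<bar>ucoord x\<bar> = \<bar>f (i x) $ 2\<bar> * \<bar>f (i x) $ 3 - \<bar>f (i x) $ 1\<bar>\<bar> / \<bar>f (i x) $ 1\<bar>"
      using False by (simp add: ucoord_def abs_mult)
    also have "\<dots> \<le> \<bar>f (i x) $ 1\<bar> * \<bar>f (i x) $ 3 - \<bar>f (i x) $ 1\<bar>\<bar> / \<bar>f (i x) $ 1\<bar>"
      by (intro divide_right_mono mult_right_mono) (use c in linarith)+
    also have "\<dots> = \<bar>f (i x) $ 3 - \<bar>f (i x) $ 1\<bar>\<bar>" using False by simp
    also have "\<dots> \<le> f (i x) $ 3" using c by linarith
    finally show ?thesis .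
  qed
qed

lemma continuous_on_nbd: "continuous_on nbd (\<lambda>x. f (i x) $ k)"
  using pl_on_continuous[OF nbd_pl] by (intro continuous_intros)

text \<open>Off the double line the quotient is continuous. At a point of the line other than the
  apex, the parameter is \<open>z - |x|\<close> or its negative throughout a neighbourhood in
  \<open>F\<close>. At the apex it is bounded by \<open>z\<close>.\<close>

lemma ucoord_continuous: "continuous_on nbd ucoord"
  unfolding continuous_on_eq_continuous_within
proof
  fix x assume x: "x \<in> nbd"
  have loc: "continuous (at x within nbd) ucoord"
    if W: "open W" "x \<in> W" and eq: "\<And>y. y \<in> nbd \<inter> W \<Longrightarrow> ucoord y = h y" and h: "continuous_on (nbd \<inter> W) h" for W h
  proof -
    have "continuous_on (nbd \<inter> W) ucoord" using continuous_on_eq[OF h eq[symmetric]] .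
    then have "continuous (at x within (nbd \<inter> W)) ucoord"
      using W(2) x by (simp add: continuous_on_eq_continuous_within)
    moreover have "at x within (nbd \<inter> W) = at x within nbd"
      by (rule at_within_nhd[OF W(2,1)]) auto
    ultimately show ?thesis by simp
  qed
  have cc: "continuous_on (nbd \<inter> W) (\<lambda>x. f (i x) $ k)" for W k
    using continuous_on_subset[OF continuous_on_nbd] by blast
  show "continuous (at x within nbd) ucoord"
  proof (cases "f (i x) $ 1 = 0")
    case False
    have "openin (top_of_set nbd) (nbd \<inter> (\<lambda>x. f (i x) $ 1) -` (- {0}))"
      by (rule continuous_openin_preimage_gen[OF continuous_on_nbd]) auto
    then obtain W where W: "open W" "nbd \<inter> (\<lambda>x. f (i x) $ 1) -` (- {0}) = nbd \<inter> W" unfolding openin_open by blast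
    then have nz: "f (i y) $ 1 \<noteq> 0" if "y \<in> nbd \<inter> W" for y using that by auto
    show ?thesis
    proof (rule loc[OF W(1)])
      show "x \<in> W" using W(2) x False by blast
      show "ucoord y = f (i y) $ 2 * (f (i y) $ 3 - \<bar>f (i y) $ 1\<bar>) / f (i y) $ 1" if "y \<in> nbd \<inter> W" for y
        using nz[OF that] by (simp add: ucoord_def)
      show "continuous_on (nbd \<inter> W) (\<lambda>y. f (i y) $ 2 * (f (i y) $ 3 - \<bar>f (i y) $ 1\<bar>) / f (i y) $ 1)"
        by (intro continuous_intros cc) (use nz in auto)
    qed
  next
    case ax: True
    show ?thesis
    proof (cases "f (i x) $ 3 = 0")
      case True
      have u0: "ucoord x = 0" using ax True by (simp add: ucoord_def)
      have "((\<lambda>y. f (i y) $ 3) \<longlongrightarrow> 0) (at x within nbd)"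
        using continuous_on_nbd[of 3] x True unfolding continuous_on_def by metis
      moreover have "eventually (\<lambda>y. norm (ucoord y) \<le> f (i y) $ 3) (at x within nbd)"
        unfolding eventually_at_filter using ucoord_bound by (intro always_eventually) auto
      ultimately have "(ucoord \<longlongrightarrow> 0) (at x within nbd)" by (rule Lim_null_comparison[rotated])
      then show ?thesis unfolding continuous_within u0 .
    next
      case False
      consider "first_sheet x" | "second_sheet x" using nbd_axis_sheets(1)[OF x ax False] by blast
      then show ?thesis
      proof cases
        case 1
        then obtain W where W: "open W" "x \<in> W" "\<And>x'. x' \<in> F \<inter> W \<Longrightarrow> i x' \<in> N \<and> f (i x') $ 1 = f (i x') $ 2"
          unfolding first_sheet_def by auto
        show ?thesis
        proof (rule loc[OF W(1,2)])
          fix y assume y: "y \<in> nbd \<inter> W"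
          then have "first_sheet y" "f (i y) $ 1 = f (i y) $ 2"
            using W unfolding first_sheet_def nbd_def by (auto intro!: exI[of _ W])
          then show "ucoord y = f (i y) $ 3 - \<bar>f (i y) $ 1\<bar>" by (simp add: ucoord_def)
        qed (intro continuous_intros cc)
      next
        case 2
        then obtain W where W: "open W" "x \<in> W" "\<And>x'. x' \<in> F \<inter> W \<Longrightarrow> i x' \<in> N \<and> f (i x') $ 1 = - f (i x') $ 2"
          unfolding second_sheet_def by auto
        show ?thesis
        proof (rule loc[OF W(1,2)])
          fix y assume y: "y \<in> nbd \<inter> W"
          then have s: "second_sheet y" "f (i y) $ 2 = - f (i y) $ 1"
            using W unfolding second_sheet_def nbd_def by (auto intro!: exI[of _ W])
          then have "f (i y) $ 1 = 0 \<Longrightarrow> f (i y) $ 3 \<noteq> 0 \<Longrightarrow> \<not> first_sheet y"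
            using nbd_axis_sheets(2)[of y] y by blast
          then show "ucoord y = - (f (i y) $ 3 - \<bar>f (i y) $ 1\<bar>)" using s(2)
            by (auto simp: ucoord_def field_simps)
        qed (intro continuous_intros cc)
      qed
    qed
  qed
qed

text \<open>The quotient is not visibly PL, but the parameter is continuous and agrees everywhere
  with one of six PL functions.\<close>

lemma ucoord_pl: "pl_on ucoord nbd"
proof -
  note c = pl_on_vec_nth[OF nbd_pl]
  define G where "G = {\<lambda>x. f (i x) $ 3 - f (i x) $ 1, \<lambda>x. f (i x) $ 3 + f (i x) $ 1,
     \<lambda>x. - (f (i x) $ 3 - f (i x) $ 1), \<lambda>x. - (f (i x) $ 3 + f (i x) $ 1), \<lambda>x. f (i x) $ 2, \<lambda>x. - f (i x) $ 2}"
  show ?thesis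
  proof (rule pl_on_selection[of G])
    show "pl_on a nbd" if "a \<in> G" for a
      using that unfolding G_def by (auto intro!: pl_on_add pl_on_diff pl_on_minus c)
    fix y assume y: "y \<in> nbd"
    note cone = nbd_cone[OF y, unfolded mem_fig_cone]
    let ?v = "f (i y)"
    have "ucoord y \<in> {?v $ 3 - ?v $ 1, ?v $ 3 + ?v $ 1, - (?v $ 3 - ?v $ 1), - (?v $ 3 + ?v $ 1), ?v $ 2, - ?v $ 2}"
    proof (cases "?v $ 1 = 0")
      case True then show ?thesis by (simp add: ucoord_def)
    next
      case False
      then have u: "ucoord y = ?v $ 2 * (?v $ 3 - \<bar>?v $ 1\<bar>) / ?v $ 1" by (simp add: ucoord_def)
      consider "?v $ 2 = ?v $ 1" | "?v $ 2 = - ?v $ 1" | "?v $ 3 = 2 * \<bar>?v $ 1\<bar>" using cone by linarith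
      then show ?thesis
      proof cases
        case 1 then show ?thesis using u False by (auto simp: abs_if)
      next
        case 2 then show ?thesis using u False by (auto simp: abs_if)
      next
        case 3
        then have "ucoord y = ?v $ 2 * \<bar>?v $ 1\<bar> / ?v $ 1" using u by simp
        then show ?thesis using False by (auto simp: abs_if)
      qed
    qed
    then show "\<exists>a\<in>G. ucoord y = a y" unfolding G_def by auto
  qed (use ucoord_continuous in \<open>auto simp: G_def\<close>)
qed

lemma apex:
  assumes "{x' \<in> F. i x' = p} = {x0}"
  shows "x0 \<in> nbd" "f (i x0) = 0" "ucoord x0 = 0"
proof -
  have "i x0 = p" "x0 \<in> F" using assms by auto
  then show "x0 \<in> nbd" "f (i x0) = 0" "ucoord x0 = 0"
    using bc_props(3,6)[OF core_props(1)[OF core]] core_props(2)[OF core] by (auto simp: nbd_def ocube_def ucoord_def)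
qed

text \<open>Fibres off the double line and over the apex are single points. The opposite values of
  the parameter in a pair are what makes it usable as a height near the branch point.\<close>

lemma nbd_pairs:
  assumes bv: "branch_value F M i p" and asm: "w \<in> pairs" "fst w \<in> nbd"
  shows "f (i (fst w)) $ 1 = 0" "f (i (fst w)) $ 2 = 0" "0 < f (i (fst w)) $ 3" "f (i (fst w)) $ 3 < r"
    "(ucoord (fst w) = f (i (fst w)) $ 3 \<and> ucoord (snd w) = - f (i (fst w)) $ 3) \<or>
     (ucoord (fst w) = - f (i (fst w)) $ 3 \<and> ucoord (snd w) = f (i (fst w)) $ 3)"
proof -
  note bc = core_props(1)[OF core]
  let ?v = "f (i (fst w))"
  have w: "fst w \<in> F" "snd w \<in> F" "fst w \<noteq> snd w" "i (snd w) = i (fst w)"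
    using asm(1) by (auto simp: pairs_def)
  have v: "?v \<in> fig_cone" "?v \<in> ocube r" "g ?v = i (fst w)"
    using nbd_cone[OF asm(2)] nbd_g[OF asm(2)] asm(2) by (auto simp: nbd_def)
  show v1: "?v $ 1 = 0"
  proof (rule ccontr)
    assume "?v $ 1 \<noteq> 0"
    then obtain x where "{x' \<in> F. i x' = g ?v} = {x}" using off_axis_single[OF core v(1,2)] by blast
    moreover have "fst w \<in> {x' \<in> F. i x' = g ?v}" "snd w \<in> {x' \<in> F. i x' = g ?v}" using w v(3) by auto
    ultimately have "fst w = x" "snd w = x" by blast+
    then show False using w(3) by simp
  qed
  note ax = nbd_axis[OF asm(2) v1]
  show "?v $ 2 = 0" using ax(1) by (metis pt_nth(2))
  show "?v $ 3 < r" by (rule ax(3))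
  have "?v $ 3 \<noteq> 0"
  proof
    assume "?v $ 3 = 0"
    then have "?v = 0" using ax(1) by (simp add: vec3_eq_iff)
    then have "i (fst w) = p" using v(3) bc_gf(1)[OF bc bc_props(6)[OF bc]] bc_props(3)[OF bc] by simp
    then show False using branch_fibre[of "fst w" "snd w"] bv w by simp
  qed
  then show v3: "0 < ?v $ 3" using ax(2) by simp
  obtain x y where xy: "{x' \<in> F. i x' = g (pt 0 0 (?v $ 3))} = {x, y}" "x \<noteq> y" "first_sheet x" "second_sheet y"
    "\<not> first_sheet y" "\<not> second_sheet x"
    by (rule axis_fibre[OF v3 ax(3)])
  have "{fst w, snd w} \<subseteq> {x, y}" using xy(1) w v(3) ax(1) by auto
  then have "(fst w = x \<and> snd w = y) \<or> (fst w = y \<and> snd w = x)" using w(3) by auto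
  then show "(ucoord (fst w) = ?v $ 3 \<and> ucoord (snd w) = - ?v $ 3) \<or>
     (ucoord (fst w) = - ?v $ 3 \<and> ucoord (snd w) = ?v $ 3)"
    using xy(3,5) v1 w(4) by (auto simp: ucoord_def)
qed

end

end

text \<open>This is \<open>t\<close> cut off to the interval from \<open>-|x|\<close> to
  \<open>|x|\<close>, times the sign of \<open>x\<close>. In \<open>umb_z\<close>, the two terms
  belong to the outer faces and to the crossing planes.\<close>

definition umb_y :: "real \<Rightarrow> real \<Rightarrow> real" where "umb_y x t = (\<bar>x + t\<bar> - \<bar>x - t\<bar>) / 2"
definition umb_z :: "real \<Rightarrow> real \<Rightarrow> real" where "umb_z x t = max (2 * \<bar>x\<bar>) (\<bar>x\<bar> + \<bar>t\<bar>)"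

section \<open>The umbrella as a graph, and a bump function at a branch point\<close>

context generic_map
begin

context
  fixes p N f g r
  assumes core: "branch_core p N f g r" and bv: "branch_value F M i p"
begin

abbreviation (input) "nb \<equiv> nbd N f r"
abbreviation (input) "uc \<equiv> ucoord N f"

text \<open>The preimage of a compact piece of the double line splits, by the sign of the parameter,
  into two compact sets on which the height \<open>z\<close> is injective; its inverses are
  continuous by compactness.\<close>

lemma axis_param:
  assumes ab: "0 < a" "a \<le> b" "b < r"
  obtains j1 j2 where "continuous_on {a..b} j1" "continuous_on {a..b} j2"
    "\<And>z. z \<in> {a..b} \<Longrightarrow> {x \<in> F. i x = g (pt 0 0 z)} = {j1 z, j2 z} \<and> uc (j1 z) = z \<and> uc (j2 z) = - z"
proof -
  note bc = core_props(1)[OF core]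
  define C where "C = F \<inter> i -` (g ` ((\<lambda>z. pt 0 0 z) ` {a..b}))"
  have S: "pt 0 0 z \<in> cube" "pt 0 0 z \<in> ocube r" if "z \<in> {a..b}" for z
    using that ab core_props(3)[OF core] by (auto simp: mem_cube forall_3 mem_ocube_3)
  have cS: "compact ((\<lambda>z. pt 0 0 z) ` {a..b})"
    by (intro compact_continuous_image continuous_intros) auto
  have "continuous_on ((\<lambda>z. pt 0 0 z) ` {a..b}) g"
    by (rule continuous_on_subset[OF homeomorphism_cont2[OF bc_props(5)[OF bc]]]) (use S in auto)
  then have "compact (g ` ((\<lambda>z. pt 0 0 z) ` {a..b}))" using cS compact_continuous_image by blast
  then have "closedin (top_of_set F) C"
    unfolding C_def by (intro continuous_closedin_preimage cont_i compact_imp_closed)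
  then have cC: "compact C" using generic_props(1) closedin_compact by blast
  have phi: "f (i x) = pt 0 0 z" "x \<in> nb" if "x \<in> F" "i x = g (pt 0 0 z)" "z \<in> {a..b}" for x z
    using that bc_fg[OF bc S(1)[OF that(3)]] S(2)[OF that(3)] by (auto simp: nbd_def[OF core])
  have Cnb: "C \<subseteq> nb" unfolding C_def using phi(2) by auto
  define Z where "Z = (\<lambda>s. {x \<in> C. uc x - s * f (i x) $ 3 = 0})"
  have cZ: "compact (Z s)" for s
  proof -
    have "continuous_on C (\<lambda>x. uc x - s * f (i x) $ 3)"
      by (intro continuous_intros continuous_on_subset[OF ucoord_continuous[OF core] Cnb]
           continuous_on_subset[OF continuous_on_nbd[OF core] Cnb])
    then show ?thesis
      unfolding Z_def by (intro closedin_compact[OF cC] continuous_closedin_preimage_constant)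
  qed
  have fibre: "\<exists>x y. {x' \<in> F. i x' = g (pt 0 0 z)} = {x, y} \<and> x \<in> Z 1 \<and> y \<in> Z (-1) \<and> x \<notin> Z (-1) \<and> y \<notin> Z 1"
    if z: "z \<in> {a..b}" for z
  proof -
    have z': "0 < z" "z < r" using z ab by auto
    obtain x y where xy: "{x' \<in> F. i x' = g (pt 0 0 z)} = {x, y}" "first_sheet N f x" "\<not> first_sheet N f y"
      by (rule axis_fibre[OF core z']) blast
    have F: "x \<in> F" "y \<in> F" "i x = g (pt 0 0 z)" "i y = g (pt 0 0 z)" using xy(1) by auto
    then have "uc x = z" "uc y = - z" "x \<in> C" "y \<in> C"
      using phi(1)[OF _ _ z] xy(2,3) z by (auto simp: ucoord_def[OF core] C_def)
    then show ?thesis using xy(1) F phi(1)[OF _ _ z] z'(1) by (intro exI[of _ x] exI[of _ y]) (simp add: Z_def)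
  qed
  have inv: "\<exists>j. continuous_on {a..b} j \<and> (\<forall>z\<in>{a..b}. j z \<in> Z s \<and> f (i (j z)) $ 3 = z)" if s: "s = 1 \<or> s = -1" for s
  proof -
    define h where "h = (\<lambda>x. f (i x) $ 3)"
    have hZ: "h x \<in> {a..b} \<and> i x = g (pt 0 0 (h x)) \<and> x \<in> F" if "x \<in> Z s" for x
      using that phi(1) by (auto simp: Z_def C_def h_def)
    have "inj_on h (Z s)"
    proof (rule inj_onI)
      fix x y assume xy: "x \<in> Z s" "y \<in> Z s" "h x = h y"
      obtain u v where uv: "{x' \<in> F. i x' = g (pt 0 0 (h x))} = {u, v}" "u \<in> Z 1" "v \<in> Z (-1)" "u \<notin> Z (-1)" "v \<notin> Z 1"
        using fibre hZ[OF xy(1)] by blast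
      have "x \<in> {u, v}" "y \<in> {u, v}" using hZ[OF xy(1)] hZ[OF xy(2)] xy(3) uv(1) by auto
      then show "x = y" using xy(1,2) uv(4,5) s by auto
    qed
    then obtain j where j: "\<And>x. x \<in> Z s \<Longrightarrow> j (h x) = x" by (metis inv_into_f_f)
    have "continuous_on (Z s) h" unfolding h_def
      by (rule continuous_on_subset[OF continuous_on_nbd[OF core]]) (use Cnb in \<open>auto simp: Z_def\<close>)
    then have cj: "continuous_on (h ` Z s) j" by (rule continuous_on_inv[OF _ cZ]) (use j in auto)
    have on: "j z \<in> Z s \<and> h (j z) = z \<and> z \<in> h ` Z s" if z: "z \<in> {a..b}" for z
    proof -
      obtain u v where uv: "{x' \<in> F. i x' = g (pt 0 0 z)} = {u, v}" "u \<in> Z 1" "v \<in> Z (-1)"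
        using fibre z by blast
      then have "\<exists>x\<in>Z s. x \<in> F \<and> i x = g (pt 0 0 z)" using s by auto
      then obtain x where "x \<in> Z s" "h x = z" using phi(1)[OF _ _ z] by (auto simp: h_def)
      then show ?thesis using j by auto
    qed
    then show ?thesis using continuous_on_subset[OF cj] unfolding h_def by (intro exI[of _ j]) blast
  qed
  obtain j1 where j1: "continuous_on {a..b} j1" "\<And>z. z \<in> {a..b} \<Longrightarrow> j1 z \<in> Z 1 \<and> f (i (j1 z)) $ 3 = z"
    using inv[of 1] by blast
  obtain j2 where j2: "continuous_on {a..b} j2" "\<And>z. z \<in> {a..b} \<Longrightarrow> j2 z \<in> Z (-1) \<and> f (i (j2 z)) $ 3 = z"
    using inv[of "-1"] by blast
  show thesis
  proof (rule that[OF j1(1) j2(1)])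
    fix z assume z: "z \<in> {a..b}"
    obtain u v where uv: "{x' \<in> F. i x' = g (pt 0 0 z)} = {u, v}" "u \<in> Z 1" "v \<in> Z (-1)" "u \<notin> Z (-1)" "v \<notin> Z 1"
      using fibre z by blast
    have at: "x \<in> F \<and> i x = g (pt 0 0 z)" if "x \<in> C" "f (i x) $ 3 = z" for x
    proof -
      obtain z' where z': "z' \<in> {a..b}" "x \<in> F" "i x = g (pt 0 0 z')" using \<open>x \<in> C\<close> unfolding C_def by auto
      then show ?thesis using phi(1)[OF z'(2,3,1)] that(2) by simp
    qed
    have "j1 z \<in> {u, v}" "j2 z \<in> {u, v}"
      using at j1(2)[OF z] j2(2)[OF z] uv(1) by (auto simp: Z_def)
    then have "j1 z = u" "j2 z = v" using j1(2)[OF z] j2(2)[OF z] uv by auto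
    then show "{x \<in> F. i x = g (pt 0 0 z)} = {j1 z, j2 z} \<and> uc (j1 z) = z \<and> uc (j2 z) = - z"
      using uv(1) j1(2)[OF z] j2(2)[OF z] by (simp add: Z_def)
  qed
qed

lemma nbd_pairs_eq:
  assumes "w \<in> pairs" "fst w \<in> nb" "w' \<in> pairs" "fst w' \<in> nb" "f (i (fst w)) $ 3 = f (i (fst w')) $ 3"
  shows "w' = w \<or> w' = prod.swap w"
proof -
  note a = nbd_pairs[OF core bv assms(1,2)] nbd_pairs[OF core bv assms(3,4)]
  have "f (i (fst w)) = f (i (fst w'))" using a(1,2,6,7) assms(5) by (simp add: vec3_eq_iff)
  then have e: "i (fst w) = i (fst w')" using nbd_g[OF core assms(2)] nbd_g[OF core assms(4)] by metis
  obtain x y where xy: "{x' \<in> F. i x' = g (pt 0 0 (f (i (fst w)) $ 3))} = {x, y}"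
    by (rule axis_fibre[OF core a(3,4)])
  have "i (fst w) = g (pt 0 0 (f (i (fst w)) $ 3))"
    using nbd_g[OF core assms(2)] nbd_axis(1)[OF core assms(2) a(1)] by simp
  then have "{fst w, snd w, fst w', snd w'} \<subseteq> {x, y}" using xy assms(1,3) e unfolding pairs_def by auto
  moreover have "fst w \<noteq> snd w" "fst w' \<noteq> snd w'" using assms(1,3) by (auto simp: pairs_def)
  ultimately show ?thesis by (auto simp: prod_eq_iff)
qed

text \<open>The pairs whose first point has a positive parameter run along a single curve over the
  double line. Hence a lifting attempt decides once for the whole core which sign is higher.\<close>

lemma nbd_pairs_connected:
  assumes w: "w \<in> pairs" "fst w \<in> nb" "uc (fst w) > 0" and w': "w' \<in> pairs" "fst w' \<in> nb" "uc (fst w') > 0"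
  shows "\<exists>L. connected L \<and> L \<subseteq> pairs \<and> w \<in> L \<and> w' \<in> L"
proof -
  note a = nbd_pairs[OF core bv w(1,2)] and a' = nbd_pairs[OF core bv w'(1,2)]
  define z z' where "z = f (i (fst w)) $ 3" "z' = f (i (fst w')) $ 3"
  have zz: "0 < min z z'" "min z z' \<le> max z z'" "max z z' < r" using a(3,4) a'(3,4) by (auto simp: z_z'_def)
  obtain j1 j2 where j: "continuous_on {min z z'..max z z'} j1" "continuous_on {min z z'..max z z'} j2"
    "\<And>x. x \<in> {min z z'..max z z'} \<Longrightarrow> {y \<in> F. i y = g (pt 0 0 x)} = {j1 x, j2 x} \<and> uc (j1 x) = x \<and> uc (j2 x) = - x"
    using axis_param[OF zz] by blast
  define L where "L = (\<lambda>x. (j1 x, j2 x)) ` {min z z'..max z z'}"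
  have "connected L" unfolding L_def using j(1,2)
    by (intro connected_continuous_image continuous_on_Pair) auto
  moreover have "L \<subseteq> pairs"
  proof
    fix y assume "y \<in> L"
    then obtain x where x: "x \<in> {min z z'..max z z'}" "y = (j1 x, j2 x)" unfolding L_def by blast
    have "j1 x \<in> {y \<in> F. i y = g (pt 0 0 x)}" "j2 x \<in> {y \<in> F. i y = g (pt 0 0 x)}" using j(3)[OF x(1)] by blast+
    moreover have "j1 x \<noteq> j2 x" using j(3)[OF x(1)] zz(1) x(1) by auto
    ultimately show "y \<in> pairs" unfolding pairs_def x(2) by simp
  qed
  moreover have mem: "v \<in> L" if v: "v \<in> pairs" "fst v \<in> nb" "uc (fst v) > 0" "f (i (fst v)) $ 3 \<in> {min z z'..max z z'}" for v
  proof -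
    let ?x = "f (i (fst v)) $ 3"
    note b = nbd_pairs[OF core bv v(1,2)]
    have "i (fst v) = g (pt 0 0 ?x)"
      using nbd_g[OF core v(2)] nbd_axis(1)[OF core v(2) b(1)] by simp
    then have "{fst v, snd v} \<subseteq> {j1 ?x, j2 ?x}" using j(3)[OF v(4)] v(1) unfolding pairs_def by auto
    moreover have "uc (fst v) = ?x" "uc (snd v) = - ?x" using b(3,5) v(3) by auto
    ultimately have "v = (j1 ?x, j2 ?x)" using j(3)[OF v(4)] b(3) by (auto simp: prod_eq_iff)
    then show ?thesis unfolding L_def using v(4) by blast
  qed
  ultimately show ?thesis using mem[OF w] mem[OF w'] by (intro exI[of _ L]) (auto simp: z_z'_def)
qed

text \<open>The parameter, cut off to the interval of radius \<open>max 0 (e - z)\<close>. It is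
  unchanged near the apex and vanishes for \<open>z \<ge> e\<close>; since the cut-off is symmetric,
  the two points of a pair stay separated for \<open>z < e\<close>.\<close>

definition bump :: "real \<Rightarrow> 'b \<Rightarrow> real" where
  "bump e x = (if x \<in> nb then max (- max 0 (e - f (i x) $ 3)) (min (uc x) (max 0 (e - f (i x) $ 3))) else 0)"

text \<open>Two open sets suffice: the core, where all ingredients are PL, and the complement of a
  compact set \<open>S\<close> outside which the function vanishes.\<close>

lemma bump_pl:
  assumes e: "0 < e" "e < r"
  shows "pl_on (bump e) F"
proof (rule pl_on_local)
  note bc = core_props(1)[OF core]
  define S where "S = F \<inter> i -` (g ` {v \<in> cube. v $ 3 \<le> e})"
  have "closed {v :: real^3. v $ 3 \<le> e}" by (intro closed_Collect_le continuous_intros)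
  moreover have "compact cube" unfolding cube_def by simp
  ultimately have "compact (cube \<inter> {v. v $ 3 \<le> e})" by blast
  moreover have "cube \<inter> {v. v $ 3 \<le> e} = {v \<in> cube. v $ 3 \<le> e}" by blast
  ultimately have "compact {v \<in> cube. v $ 3 \<le> e}" by simp
  moreover have "continuous_on {v \<in> cube. v $ 3 \<le> e} g"
    by (rule continuous_on_subset[OF homeomorphism_cont2[OF bc_props(5)[OF bc]]]) auto
  ultimately have "compact (g ` {v \<in> cube. v $ 3 \<le> e})" using compact_continuous_image by blast
  then have "closedin (top_of_set F) S"
    unfolding S_def by (intro continuous_closedin_preimage cont_i compact_imp_closed)
  then have opS: "openin (top_of_set F) (F - S)" by (intro openin_diff) auto
  have Siff: "x \<in> S \<longleftrightarrow> i x \<in> N \<and> f (i x) $ 3 \<le> e" if "x \<in> F" for x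
  proof
    show "x \<in> S \<Longrightarrow> i x \<in> N \<and> f (i x) $ 3 \<le> e" using bc_fg[OF bc] by (auto simp: S_def)
    assume "i x \<in> N \<and> f (i x) $ 3 \<le> e"
    then have "i x = g (f (i x))" "f (i x) \<in> {v \<in> cube. v $ 3 \<le> e}" using bc_gf[OF bc] by auto
    then have "i x \<in> g ` {v \<in> cube. v $ 3 \<le> e}" by (rule image_eqI)
    then show "x \<in> S" using that unfolding S_def by simp
  qed
  have Snb: "x \<in> nb" if "x \<in> S" for x
  proof -
    have x: "x \<in> F" "i x \<in> N" "f (i x) $ 3 \<le> e" using that Siff[of x] by (auto simp: S_def)
    have "f (i x) \<in> ocube r" using bc_cone[OF bc x(1,2)] x(3) e unfolding mem_fig_cone mem_ocube_3 by linarith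
    then show ?thesis using x by (simp add: nbd_def[OF core])
  qed
  have pl_nb: "pl_on (bump e) nb"
  proof -
    note c = pl_on_vec_nth[OF nbd_pl[OF core], of 3]
    have "pl_on (\<lambda>x. max (- max 0 (e - f (i x) $ 3)) (min (uc x) (max 0 (e - f (i x) $ 3)))) nb"
      by (intro pl_on_max pl_on_min pl_on_minus pl_on_diff ucoord_pl[OF core] c pl_on_const[OF c])
    then show ?thesis by (rule pl_on_cong) (simp add: bump_def)
  qed
  have pl_S: "pl_on (bump e) (F - S)"
  proof (rule pl_on_cong[OF pl_on_const[OF pl_on_open_subset[OF pl_i opS], of 0]])
    fix x assume x: "x \<in> F - S"
    show "0 = bump e x"
    proof (cases "x \<in> nb")
      case True
      then have "f (i x) $ 3 > e" using x Siff[of x] by (auto simp: nbd_def[OF core])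
      then show ?thesis by (simp add: bump_def)
    qed (simp add: bump_def)
  qed
  fix x assume x: "x \<in> F"
  show "\<exists>W. openin (top_of_set F) W \<and> x \<in> W \<and> pl_on (bump e) W"
  proof (cases "x \<in> S")
    case True then show ?thesis using nbd_open[OF core] Snb pl_nb by (intro exI[of _ nb]) auto
  next
    case False then show ?thesis using x opS pl_S by (intro exI[of _ "F - S"]) auto
  qed
qed

lemma bump_pair:
  assumes e: "0 < e" and w: "w \<in> pairs"
  shows "(fst w \<in> nb \<longrightarrow> uc (fst w) > 0) \<Longrightarrow> bump e (snd w) \<le> bump e (fst w)"
    "(fst w \<in> nb \<longrightarrow> uc (fst w) < 0) \<Longrightarrow> bump e (fst w) \<le> bump e (snd w)"
    "fst w \<in> nb \<Longrightarrow> f (i (fst w)) $ 3 < e \<Longrightarrow> bump e (fst w) \<noteq> bump e (snd w)"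
proof -
  have s: "snd w \<in> nb \<longleftrightarrow> fst w \<in> nb" "f (i (snd w)) = f (i (fst w))" using w by (auto simp: pairs_def nbd_def[OF core])
  show "(fst w \<in> nb \<longrightarrow> uc (fst w) > 0) \<Longrightarrow> bump e (snd w) \<le> bump e (fst w)"
    "(fst w \<in> nb \<longrightarrow> uc (fst w) < 0) \<Longrightarrow> bump e (fst w) \<le> bump e (snd w)"
    "fst w \<in> nb \<Longrightarrow> f (i (fst w)) $ 3 < e \<Longrightarrow> bump e (fst w) \<noteq> bump e (snd w)"
    using nbd_pairs(3,5)[OF core bv w] s e by (auto simp: bump_def)
qed

lemma bump_near_apex: "x \<in> nb \<Longrightarrow> f (i x) $ 3 < e / 2 \<Longrightarrow> bump e x = uc x"
  using ucoord_bound[OF core, of x] by (auto simp: bump_def)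

text \<open>With the parameter as a fourth coordinate, the surface becomes a graph over the plane of
  \<open>x\<close> and \<open>t\<close>, and a graph can be straightened by a shear. The local
  flatness at branch points comes from here.\<close>

lemma umbrella_graph:
  assumes x: "x \<in> nb"
  shows "f (i x) $ 2 = umb_y (f (i x) $ 1) (uc x)" "f (i x) $ 3 = umb_z (f (i x) $ 1) (uc x)"
proof -
  let ?v = "f (i x)"
  note c = nbd_cone[OF core x, unfolded mem_fig_cone]
  have "?v $ 2 = umb_y (?v $ 1) (uc x) \<and> ?v $ 3 = umb_z (?v $ 1) (uc x)"
  proof (cases "?v $ 1 = 0")
    case True
    then show ?thesis using c by (auto simp: ucoord_def[OF core] umb_y_def umb_z_def)
  next
    case False
    then have u: "uc x = ?v $ 2 * (?v $ 3 - \<bar>?v $ 1\<bar>) / ?v $ 1" by (simp add: ucoord_def[OF core])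
    consider "?v $ 2 = ?v $ 1" | "?v $ 2 = - ?v $ 1" | "?v $ 3 = 2 * \<bar>?v $ 1\<bar>" using c by linarith
    then show ?thesis
    proof cases
      case 1
      then have "uc x = ?v $ 3 - \<bar>?v $ 1\<bar>" using u False by simp
      then show ?thesis using 1 c by (auto simp: umb_y_def umb_z_def abs_if)
    next
      case 2
      then have "uc x = - (?v $ 3 - \<bar>?v $ 1\<bar>)" using u False by simp
      then show ?thesis using 2 c by (auto simp: umb_y_def umb_z_def abs_if)
    next
      case 3
      then have "uc x = ?v $ 2 * \<bar>?v $ 1\<bar> / ?v $ 1" using u by simp
      then have "uc x = (if ?v $ 1 > 0 then ?v $ 2 else - ?v $ 2)" using False by (auto simp: abs_if)
      moreover have "\<bar>?v $ 2\<bar> \<le> \<bar>?v $ 1\<bar>" using c by linarith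
      ultimately show ?thesis using 3 False by (auto simp: umb_y_def umb_z_def abs_if split: if_splits)
    qed
  qed
  then show "f (i x) $ 2 = umb_y (f (i x) $ 1) (uc x)" "f (i x) $ 3 = umb_z (f (i x) $ 1) (uc x)" by blast+
qed

text \<open>The parameter can be solved for in each of its ranges. Over the double line both signs
  have to be attained, which holds because the fibre has a point on each sheet.\<close>

lemma umbrella_graph_onto:
  assumes v: "v \<in> ocube r" "v $ 2 = umb_y (v $ 1) t" "v $ 3 = umb_z (v $ 1) t"
  obtains x where "x \<in> nb" "f (i x) = v" "uc x = t"
proof -
  note bc = core_props(1)[OF core]
  have b: "v $ 3 < r" "r < 1" using v(1) core_props(3)[OF core] by (auto simp: mem_ocube_3)
  have cone: "v \<in> fig_cone"
    unfolding mem_fig_cone using v(2,3) b unfolding umb_y_def umb_z_def by (auto simp: abs_if max_def split: if_splits)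
  have cube: "v \<in> cube" using cone fig_cone_cube by blast
  have mem: "x \<in> nb" "f (i x) = v" if "x \<in> F" "i x = g v" for x
    using that bc_fg[OF bc cube] v(1) by (auto simp: nbd_def[OF core])
  obtain x where x: "x \<in> F" "i x = g v" using bc_image[OF bc cube] cone by (metis imageE)
  show thesis
  proof (cases "v $ 1 = 0")
    case False
    have u: "uc x = v $ 2 * (v $ 3 - \<bar>v $ 1\<bar>) / v $ 1" using mem[OF x] False by (simp add: ucoord_def[OF core])
    consider "t \<ge> \<bar>v $ 1\<bar>" | "t \<le> - \<bar>v $ 1\<bar>" | "\<bar>t\<bar> \<le> \<bar>v $ 1\<bar>" by linarith
    then have "uc x = t"
    proof cases
      case 1
      then have "v $ 2 = v $ 1" "v $ 3 - \<bar>v $ 1\<bar> = t" using v(2,3) by (auto simp: umb_y_def umb_z_def)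
      then show ?thesis using u False by simp
    next
      case 2
      then have "v $ 2 = - v $ 1" "v $ 3 - \<bar>v $ 1\<bar> = - t" using v(2,3) by (auto simp: umb_y_def umb_z_def)
      then show ?thesis using u False by simp
    next
      case 3
      then have "v $ 3 - \<bar>v $ 1\<bar> = \<bar>v $ 1\<bar>" "v $ 2 = (if v $ 1 > 0 then t else - t)"
        using v(2,3) by (auto simp: umb_y_def umb_z_def abs_if split: if_splits)
      then show ?thesis using u False by (auto simp: abs_if)
    qed
    then show thesis using that mem[OF x] by blast
  next
    case True
    then have v3: "v $ 3 = \<bar>t\<bar>" "v $ 2 = 0" using v(2,3) by (auto simp: umb_y_def umb_z_def)
    then have vp: "v = pt 0 0 \<bar>t\<bar>" using True by (simp add: vec3_eq_iff)
    show thesis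
    proof (cases "t = 0")
      case 0: True
      then have "uc x = t" using mem[OF x] v3 True by (simp add: ucoord_def[OF core])
      then show thesis using that mem[OF x] by blast
    next
      case False
      have tr: "0 < \<bar>t\<bar>" "\<bar>t\<bar> < r" using False b v3 by auto
      obtain a c where ac: "{x' \<in> F. i x' = g (pt 0 0 \<bar>t\<bar>)} = {a, c}" "first_sheet N f a" "\<not> first_sheet N f c"
        by (rule axis_fibre[OF core tr]) blast
      have F: "a \<in> F" "c \<in> F" "i a = g v" "i c = g v" using ac(1) vp by auto
      have "uc a = \<bar>t\<bar>" "uc c = - \<bar>t\<bar>"
        using mem(2)[OF F(1,3)] mem(2)[OF F(2,4)] ac(2,3) True v3 by (auto simp: ucoord_def[OF core])
      then show thesis using that[of a] that[of c] mem F by (cases "t > 0") auto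
    qed
  qed
qed

end

end

section \<open>Double arcs\<close>

lemma linear_swap: "linear (prod.swap :: 'b::real_vector \<times> 'b \<Rightarrow> 'b \<times> 'b)"
  by (simp add: linear_iff prod_eq_iff)

lemma midpoint_in_open_segment_of_closed:
  fixes a b :: "'a::euclidean_space"
  assumes "x \<in> closed_segment a b" "y \<in> closed_segment a b" "x \<noteq> y"
  shows "midpoint x y \<in> open_segment a b"
proof -
  obtain s where s: "0 \<le> s" "s \<le> 1" "x = (1 - s) *\<^sub>R a + s *\<^sub>R b" using assms(1) unfolding in_segment by blast
  obtain t where t: "0 \<le> t" "t \<le> 1" "y = (1 - t) *\<^sub>R a + t *\<^sub>R b" using assms(2) unfolding in_segment by blast
  have "a \<noteq> b" using assms by auto
  moreover have "s \<noteq> t" using s t assms(3) by auto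
  then have "0 < (s + t) / 2" "(s + t) / 2 < 1" using s t by auto
  moreover have "midpoint x y = (1 - (s + t) / 2) *\<^sub>R a + ((s + t) / 2) *\<^sub>R b"
  proof -
    have "x + y = (2 - (s + t)) *\<^sub>R a + (s + t) *\<^sub>R b"
      unfolding s(3) t(3) by (simp add: algebra_simps scaleR_2)
    then have "midpoint x y = (inverse 2 * (2 - (s + t))) *\<^sub>R a + (inverse 2 * (s + t)) *\<^sub>R b"
      by (simp only: midpoint_def scaleR_add_right scaleR_scaleR)
    also have "inverse 2 * (2 - (s + t)) = 1 - (s + t) / 2" by (simp add: field_simps)
    also have "inverse 2 * (s + t) = (s + t) / 2" by simp
    finally show ?thesis .
  qed
  ultimately show ?thesis unfolding in_segment by blast
qed

lemma open_segment_directions: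
  fixes v w :: "'a::real_normed_vector"
  assumes "r \<in> open_segment v w"
  obtains u a b where "norm u = 1" "0 < a" "0 < b" "v = r - a *\<^sub>R u" "w = r + b *\<^sub>R u"
proof -
  obtain t where t: "v \<noteq> w" "0 < t" "t < 1" "r = (1 - t) *\<^sub>R v + t *\<^sub>R w" using assms unfolding in_segment by blast
  define n where "n = norm (w - v)"
  define u where "u = (1 / n) *\<^sub>R (w - v)"
  have n: "n > 0" using t(1) by (simp add: n_def)
  have nu: "n *\<^sub>R u = w - v" using n by (simp add: u_def)
  have "r = v + t *\<^sub>R (w - v)" using t(4) by (simp add: algebra_simps)
  then have "v = r - t *\<^sub>R (w - v)" "w = r + (1 - t) *\<^sub>R (w - v)"
    by (simp_all add: algebra_simps)
  then have "v = r - (t * n) *\<^sub>R u" "w = r + ((1 - t) * n) *\<^sub>R u"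
    by (simp_all only: scaleR_scaleR[symmetric] nu)
  moreover have "norm u = 1" using n by (simp add: u_def n_def)
  moreover have "0 < t * n" "0 < (1 - t) * n" using t(2,3) n by simp_all
  ultimately show thesis using that by metis
qed

lemma open_segment_param:
  fixes u :: "'a::real_normed_vector"
  assumes u: "norm u = 1" and ab: "a < b"
  shows "x \<in> open_segment (r + a *\<^sub>R u) (r + b *\<^sub>R u) \<longleftrightarrow> (\<exists>t. a < t \<and> t < b \<and> x = r + t *\<^sub>R u)"
proof
  assume "x \<in> open_segment (r + a *\<^sub>R u) (r + b *\<^sub>R u)"
  then obtain s where s: "0 < s" "s < 1" "x = (1 - s) *\<^sub>R (r + a *\<^sub>R u) + s *\<^sub>R (r + b *\<^sub>R u)"
    unfolding in_segment by blast
  have "x = r + (a + s * (b - a)) *\<^sub>R u" unfolding s(3) by (simp add: algebra_simps)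
  moreover have "a < a + s * (b - a)" using s ab by simp
  moreover have "s * (b - a) < 1 * (b - a)" using s ab by (intro mult_strict_right_mono) auto
  ultimately show "\<exists>t. a < t \<and> t < b \<and> x = r + t *\<^sub>R u" by (intro exI[of _ "a + s * (b - a)"]) auto
next
  assume "\<exists>t. a < t \<and> t < b \<and> x = r + t *\<^sub>R u"
  then obtain t where t: "a < t" "t < b" "x = r + t *\<^sub>R u" by blast
  define s where "s = (t - a) / (b - a)"
  have s: "0 < s" "s < 1" "s * (b - a) = t - a" using t ab by (auto simp: s_def)
  have "x = r + (a + s * (b - a)) *\<^sub>R u" using s(3) t(3) by simp
  also have "\<dots> = (1 - s) *\<^sub>R (r + a *\<^sub>R u) + s *\<^sub>R (r + b *\<^sub>R u)" by (simp add: algebra_simps)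
  finally have "x = (1 - s) *\<^sub>R (r + a *\<^sub>R u) + s *\<^sub>R (r + b *\<^sub>R u)" .
  moreover have "r + a *\<^sub>R u \<noteq> r + b *\<^sub>R u" using u ab by auto
  ultimately show "x \<in> open_segment (r + a *\<^sub>R u) (r + b *\<^sub>R u)" using s unfolding in_segment by blast
qed

section \<open>Rays of double pairs\<close>

context generic_map
begin

definition is_ray :: "'b \<times> 'b \<Rightarrow> 'b \<times> 'b \<Rightarrow> bool" where
  "is_ray z u \<longleftrightarrow> norm u = 1 \<and> (\<exists>e>0. \<forall>t. 0 < t \<and> t \<le> e \<longrightarrow> z + t *\<^sub>R u \<in> pairs)"

definition crossing :: "'b \<times> 'b \<Rightarrow> bool" where
  "crossing z \<longleftrightarrow> double_value F M i (i (fst z)) \<or> triple_value F M i (i (fst z))"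

context
  fixes z W T \<tau> lam
  assumes pc: "pair_chart_at z W T \<tau> lam"
begin

text \<open>\<open>s\<close> records on which side of 0 the ray leaves in the chart coordinate; this
  is how the rays at a pair are counted.\<close>

definition signed_ray :: "real \<Rightarrow> 'b \<times> 'b \<Rightarrow> bool" where
  "signed_ray s u \<longleftrightarrow> norm u = 1 \<and> (\<exists>e>0. (\<forall>t\<in>{0..e}. z + t *\<^sub>R u \<in> pairs \<inter> W) \<and> s * lam (z + e *\<^sub>R u) > 0)"

lemma lam_inverse: "y \<in> pairs \<inter> W \<Longrightarrow> \<tau> (lam y) = y" "y \<in> pairs \<inter> W \<Longrightarrow> lam y \<in> T"
proof -
  assume "y \<in> pairs \<inter> W"
  then have y: "y \<in> \<tau> ` T" using pair_chart_atD(6)[OF pc] by blast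
  show "\<tau> (lam y) = y" using homeomorphism_apply2[OF pair_chart_atD(7)[OF pc] y] .
  show "lam y \<in> T" using y homeomorphism_image2[OF pair_chart_atD(7)[OF pc]] by blast
qed

lemma lam_continuous: "continuous_on (pairs \<inter> W) lam"
  by (rule continuous_on_subset[OF homeomorphism_cont2[OF pair_chart_atD(7)[OF pc]] pair_chart_atD(6)[OF pc]])

lemma lam_zero: "lam z = 0"
  using homeomorphism_apply1[OF pair_chart_atD(7)[OF pc] pair_chart_atD(3)[OF pc]] pair_chart_atD(4)[OF pc] by simp

lemma z_pairs: "z \<in> pairs"
  using pair_chart_atD(3-5)[OF pc] by auto

lemma signed_ray_reaches:
  assumes e: "\<forall>t\<in>{0..e}. z + t *\<^sub>R u \<in> pairs \<inter> W" "e > 0" and c: "0 < c" "c \<le> s * lam (z + e *\<^sub>R u)"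
  obtains t where "0 < t" "t \<le> e" "s * lam (z + t *\<^sub>R u) = c"
proof -
  have cont: "continuous_on {0..e} (\<lambda>t. s * lam (z + t *\<^sub>R u))"
    by (intro continuous_intros continuous_on_compose2[OF lam_continuous, of _ "\<lambda>t. z + t *\<^sub>R u"]) (use e in auto)
  have "s * lam (z + 0 *\<^sub>R u) \<le> c" using lam_zero c by simp
  then obtain t where t: "0 \<le> t" "t \<le> e" "s * lam (z + t *\<^sub>R u) = c"
    using IVT'[of "\<lambda>t. s * lam (z + t *\<^sub>R u)" 0 c e] cont c(2) e(2) by auto
  have "t \<noteq> 0" using t(3) lam_zero c(1) by auto
  then show thesis using that[of t] t by simp
qed

text \<open>By the intermediate value theorem both rays attain a common value of the chart
  coordinate, hence pass through the same pair; a unit direction towards it is unique.\<close>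

lemma signed_ray_unique:
  assumes "signed_ray s u" "signed_ray s u'" "s \<noteq> 0"
  shows "u = u'"
proof -
  obtain e where e: "e > 0" "\<forall>t\<in>{0..e}. z + t *\<^sub>R u \<in> pairs \<inter> W" "s * lam (z + e *\<^sub>R u) > 0"
    using assms(1) unfolding signed_ray_def by blast
  obtain e' where e': "e' > 0" "\<forall>t\<in>{0..e'}. z + t *\<^sub>R u' \<in> pairs \<inter> W" "s * lam (z + e' *\<^sub>R u') > 0"
    using assms(2) unfolding signed_ray_def by blast
  have n: "norm u = 1" "norm u' = 1" using assms unfolding signed_ray_def by auto
  define c where "c = min (s * lam (z + e *\<^sub>R u)) (s * lam (z + e' *\<^sub>R u'))"
  have c: "0 < c" "c \<le> s * lam (z + e *\<^sub>R u)" "c \<le> s * lam (z + e' *\<^sub>R u')" using e e' by (auto simp: c_def)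
  obtain t where t: "0 < t" "t \<le> e" "s * lam (z + t *\<^sub>R u) = c"
    by (rule signed_ray_reaches[OF e(2,1) c(1,2)])
  obtain t' where t': "0 < t'" "t' \<le> e'" "s * lam (z + t' *\<^sub>R u') = c"
    by (rule signed_ray_reaches[OF e'(2,1) c(1,3)])
  have "lam (z + t *\<^sub>R u) = lam (z + t' *\<^sub>R u')" using t(3) t'(3) assms(3) by (metis mult_left_cancel)
  moreover have "z + t *\<^sub>R u \<in> pairs \<inter> W" "z + t' *\<^sub>R u' \<in> pairs \<inter> W" using t t' e e' by auto
  ultimately have eq: "t *\<^sub>R u = t' *\<^sub>R u'" using lam_inverse(1) by (metis add_left_cancel)
  then have "t = t'" using n t(1) t'(1) by (metis abs_of_pos mult.right_neutral norm_scaleR)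
  then show ?thesis using eq t(1) by simp
qed

lemma ray_iff_signed: "is_ray z u \<longleftrightarrow> signed_ray 1 u \<or> signed_ray (-1) u"
proof
  assume "is_ray z u"
  then obtain e where e: "norm u = 1" "e > 0" "\<And>t. 0 < t \<Longrightarrow> t \<le> e \<Longrightarrow> z + t *\<^sub>R u \<in> pairs" unfolding is_ray_def by blast
  obtain r where r: "r > 0" "ball z r \<subseteq> W" using pair_chart_atD(1,2)[OF pc] open_contains_ball by blast
  define d where "d = min e (r / 2)"
  have d: "d > 0" "d \<le> e" "d < r" using e r by (auto simp: d_def)
  have in_W: "\<forall>t\<in>{0..d}. z + t *\<^sub>R u \<in> pairs \<inter> W"
  proof
    fix t assume t: "t \<in> {0..d}"
    have "z + t *\<^sub>R u \<in> ball z r" using t d e(1) by (simp add: dist_norm)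
    then have "z + t *\<^sub>R u \<in> W" using r(2) by blast
    moreover have "z + t *\<^sub>R u \<in> pairs" using e(3)[of t] t d z_pairs by (cases "t = 0") auto
    ultimately show "z + t *\<^sub>R u \<in> pairs \<inter> W" by blast
  qed
  have "lam (z + d *\<^sub>R u) \<noteq> 0"
  proof
    assume "lam (z + d *\<^sub>R u) = 0"
    moreover have "z + d *\<^sub>R u \<in> pairs \<inter> W" using in_W d by auto
    ultimately have "z + d *\<^sub>R u = z" using lam_inverse(1) pair_chart_atD(4)[OF pc] by metis
    then show False using d e(1) by auto
  qed
  then have "1 * lam (z + d *\<^sub>R u) > 0 \<or> -1 * lam (z + d *\<^sub>R u) > 0" by auto
  then show "signed_ray 1 u \<or> signed_ray (-1) u" unfolding signed_ray_def using e(1) d(1) in_W by blast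
next
  assume "signed_ray 1 u \<or> signed_ray (-1) u"
  then show "is_ray z u" unfolding signed_ray_def is_ray_def by fastforce
qed

text \<open>A nearby pair with coordinate of the right sign lies on a segment that also contains
  \<open>z\<close>, and the part of this segment between the two starts a ray.\<close>

lemma ex_signed_ray:
  assumes s: "s = 1 \<or> s = -1" and T: "\<And>t. t \<in> {0..1} \<Longrightarrow> s * t \<in> T"
  shows "\<exists>u. signed_ray s u"
proof -
  \<comment> \<open>Removing the finitely many segments that miss \<open>z\<close> forces all nearby
    pairs onto segments through \<open>z\<close>.\<close>
  define W' where "W' = W - diag - \<Union>{S \<in> segs. z \<notin> S}"
  have "closed (\<Union>{S \<in> segs. z \<notin> S})" using segs_props(1) closed_segs by (intro closed_Union) auto
  then have "open W'" unfolding W'_def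
    by (intro open_Diff pair_chart_atD(1)[OF pc] closed_diag)
  moreover have "z \<in> W'" using pair_chart_atD(2)[OF pc] z_pairs pairs_diag by (auto simp: W'_def)
  ultimately obtain r where r: "r > 0" "ball z r \<subseteq> W'" using open_contains_ball by blast
  have contT: "continuous_on T \<tau>" using homeomorphism_cont1[OF pair_chart_atD(7)[OF pc]] .
  have "continuous_on {0..1} (\<lambda>t. \<tau> (s * t))"
    by (rule continuous_on_compose2[OF contT]) (use T in \<open>auto intro!: continuous_intros\<close>)
  then have "\<exists>d>0. \<forall>t\<in>{0..1}. dist t 0 < d \<longrightarrow> dist (\<tau> (s * t)) (\<tau> (s * 0)) < r"
    using r(1) unfolding continuous_on_iff by (meson atLeastAtMost_iff order_refl zero_le_one)
  then obtain d where d: "d > 0" "\<And>t. t \<in> {0..1} \<Longrightarrow> dist t 0 < d \<Longrightarrow> dist (\<tau> (s * t)) (\<tau> (s * 0)) < r" by blast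
  define t where "t = min 1 (d / 2)"
  have t: "0 < t" "t \<in> {0..1}" "dist t 0 < d" using d(1) by (auto simp: t_def)
  define y where "y = \<tau> (s * t)"
  have st: "s * t \<in> T" using T t by blast
  have y: "y \<in> pairs" "lam y = s * t"
    using pair_chart_atD(5)[OF pc] homeomorphism_apply1[OF pair_chart_atD(7)[OF pc] st] st by (auto simp: y_def)
  have yball: "y \<in> ball z r" using d(2)[OF t(2,3)] pair_chart_atD(4)[OF pc] by (simp add: y_def dist_commute)
  have "y \<noteq> z" using y(2) lam_zero t(1) s by auto
  obtain S where S: "S \<in> segs" "y \<in> S" using segs_props(2) y(1) by blast
  have zS: "z \<in> S" using S yball r(2) unfolding W'_def by blast
  have "convex S" using segs_props(4)[OF S(1)] by auto
  then have seg: "closed_segment z y \<subseteq> S \<inter> ball z r"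
    using S(2) zS yball r(1) closed_segment_subset[of z "S \<inter> ball z r" y] by (simp add: convex_Int)
  have segP: "closed_segment z y \<subseteq> pairs \<inter> W"
    using seg segs_props(3) S(1) r(2) unfolding W'_def by blast
  define n where "n = norm (y - z)"
  have n: "n > 0" using \<open>y \<noteq> z\<close> by (simp add: n_def)
  define u where "u = (1 / n) *\<^sub>R (y - z)"
  have u: "norm u = 1" "z + n *\<^sub>R u = y" using n by (auto simp: u_def n_def)
  have "\<forall>t\<in>{0..n}. z + t *\<^sub>R u \<in> pairs \<inter> W"
  proof
    fix t assume t: "t \<in> {0..n}"
    have "z + t *\<^sub>R u = (1 - t / n) *\<^sub>R z + (t / n) *\<^sub>R y"
      by (simp add: u_def algebra_simps)
    then have "z + t *\<^sub>R u \<in> closed_segment z y"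
      unfolding in_segment using t n by (intro exI[of _ "t / n"]) auto
    then show "z + t *\<^sub>R u \<in> pairs \<inter> W" using segP by blast
  qed
  moreover have "s * lam (z + n *\<^sub>R u) > 0" using u(2) y(2) s t(1) by auto
  ultimately show ?thesis unfolding signed_ray_def using u(1) n by blast
qed

lemma signed_ray_distinct: "signed_ray 1 u \<Longrightarrow> \<not> signed_ray (-1) u"
proof
  assume a: "signed_ray 1 u" "signed_ray (-1) u"
  obtain e where e: "e > 0" "\<forall>t\<in>{0..e}. z + t *\<^sub>R u \<in> pairs \<inter> W" "1 * lam (z + e *\<^sub>R u) > 0"
    using a(1) unfolding signed_ray_def by blast
  obtain e' where e': "e' > 0" "\<forall>t\<in>{0..e'}. z + t *\<^sub>R u \<in> pairs \<inter> W" "-1 * lam (z + e' *\<^sub>R u) > 0"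
    using a(2) unfolding signed_ray_def by blast
  have u: "norm u = 1" using a unfolding signed_ray_def by blast
  have "\<exists>t. 0 < t \<and> z + t *\<^sub>R u \<in> pairs \<inter> W \<and> lam (z + t *\<^sub>R u) = 0"
  proof (rule ccontr)
    assume no: "\<not> ?thesis"
    define m where "m = max e e'"
    have mem: "z + t *\<^sub>R u \<in> pairs \<inter> W" if "t \<in> {0<..m}" for t
      using that e(2) e'(2) by (auto simp: m_def max_def split: if_splits)
    have "continuous_on {0<..m} (\<lambda>t. lam (z + t *\<^sub>R u))"
      by (rule continuous_on_compose2[OF lam_continuous]) (use mem in \<open>auto intro!: continuous_intros\<close>)
    moreover have "e \<in> {0<..m}" "e' \<in> {0<..m}" using e e' by (auto simp: m_def)
    moreover have "lam (z + t *\<^sub>R u) \<noteq> 0" if "t \<in> {0<..m}" for t using no mem that by auto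
    ultimately have "lam (z + e' *\<^sub>R u) > 0"
      using connected_nonzero_sign[of "{0<..m}" "\<lambda>t. lam (z + t *\<^sub>R u)" e e'] e(3) by simp
    then show False using e'(3) by simp
  qed
  then obtain t where t: "0 < t" "z + t *\<^sub>R u \<in> pairs \<inter> W" "lam (z + t *\<^sub>R u) = 0" by blast
  then have "z + t *\<^sub>R u = z" using lam_inverse(1) pair_chart_atD(4)[OF pc] by metis
  then show False using t(1) u by auto
qed

text \<open>A full interval has a ray for each sign, a half interval only the positive one.\<close>

lemma rays_chart:
  "(\<exists>u v. u \<noteq> v \<and> {u. is_ray z u} = {u, v} \<and> crossing z) \<or>
   (\<exists>u. {u. is_ray z u} = {u} \<and> DB_value F M i (i (fst z)))"
  using pair_chart_atD(8)[OF pc]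
proof
  assume T: "T = {-1..1} \<and> (double_value F M i (i (fst z)) \<or> triple_value F M i (i (fst z)))"
  obtain u where u: "signed_ray 1 u" using ex_signed_ray[of 1] T by auto
  obtain v where v: "signed_ray (-1) v" using ex_signed_ray[of "-1"] T by auto
  have iff: "signed_ray 1 x \<longleftrightarrow> x = u" "signed_ray (-1) x \<longleftrightarrow> x = v" for x
    using u v signed_ray_unique[OF u, of x] signed_ray_unique[OF v, of x] by auto
  have "{u. is_ray z u} = {u, v}"
    unfolding ray_iff_signed iff by blast
  moreover have "u \<noteq> v" using signed_ray_distinct[OF u] v by blast
  ultimately show ?thesis using T unfolding crossing_def by blast
next
  assume T: "T = {0..1} \<and> DB_value F M i (i (fst z))"
  obtain u where u: "signed_ray 1 u" using ex_signed_ray[of 1] T by auto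
  have "\<not> signed_ray (-1) v" for v
  proof
    assume "signed_ray (-1) v"
    then obtain e where "e > 0" "z + e *\<^sub>R v \<in> pairs \<inter> W" "lam (z + e *\<^sub>R v) < 0"
      unfolding signed_ray_def by fastforce
    then show False using lam_inverse(2) T by fastforce
  qed
  moreover have "signed_ray 1 x \<longleftrightarrow> x = u" for x
    using u signed_ray_unique[OF u, of x] by auto
  ultimately have "{u. is_ray z u} = {u}"
    unfolding ray_iff_signed by blast
  then show ?thesis using T by blast
qed

end

lemma rays:
  assumes "z \<in> pairs"
  shows "(\<exists>u v. u \<noteq> v \<and> {u. is_ray z u} = {u, v} \<and> crossing z) \<or>
   (\<exists>u. {u. is_ray z u} = {u} \<and> DB_value F M i (i (fst z)))"
  using ex_pair_chart_at[OF assms] rays_chart by blast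

end

section \<open>The finite graph of double pairs\<close>

context generic_map
begin

definition vts0 :: "('b \<times> 'b) set" where
  "vts0 = {c. \<exists>d. closed_segment c d \<in> segs} \<union> (\<Union>segs \<inter> diag)"

text \<open>Made closed under the exchange of the two points, so that this exchange is a symmetry of
  the graph.\<close>

definition vts :: "('b \<times> 'b) set" where "vts = vts0 \<union> prod.swap ` vts0"

text \<open>The segments of \<open>segs\<close> may overlap. An edge is therefore not taken from one
  of them, but characterized by its interior.\<close>

definition adj :: "'b \<times> 'b \<Rightarrow> 'b \<times> 'b \<Rightarrow> bool" where
  "adj v w \<longleftrightarrow> v \<in> vts \<and> w \<in> vts \<and> v \<noteq> w \<and> open_segment v w \<subseteq> pairs - vts"

lemma finite_vts: "finite vts"
proof -
  obtain c d where cd: "\<And>S. S \<in> segs \<Longrightarrow> S = closed_segment (c S) (d S)" using segs_props(4) by metis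
  have "{x. \<exists>y. closed_segment x y \<in> segs} \<subseteq> (\<Union>S\<in>segs. {c S, d S})"
  proof
    fix x assume "x \<in> {x. \<exists>y. closed_segment x y \<in> segs}"
    then obtain y where y: "closed_segment x y \<in> segs" by blast
    then have "closed_segment x y = closed_segment (c (closed_segment x y)) (d (closed_segment x y))" by (rule cd)
    then have "{x, y} = {c (closed_segment x y), d (closed_segment x y)}" by (subst (asm) closed_segment_eq)
    then have "x \<in> {c (closed_segment x y), d (closed_segment x y)}" by blast
    then show "x \<in> (\<Union>S\<in>segs. {c S, d S})" using y by (rule UN_I[rotated])
  qed
  moreover have "finite (\<Union>S\<in>segs. {c S, d S})" using segs_props(1) by (intro finite_UN_I) auto
  ultimately have "finite vts0" unfolding vts0_def using finite_diag_segs finite_subset by blast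
  then show ?thesis unfolding vts_def by simp
qed

lemma vts_swap: "v \<in> vts \<Longrightarrow> prod.swap v \<in> vts"
  unfolding vts_def by auto

lemma vts0_segs: "vts0 \<subseteq> \<Union>segs"
  unfolding vts0_def by (auto intro: ends_in_segment)

lemma vts_sub: "vts \<subseteq> pairs \<union> diag"
proof -
  have "vts0 \<subseteq> pairs \<union> diag" using vts0_segs segs_props(3) by blast
  moreover have "prod.swap v \<in> pairs \<union> diag" if "v \<in> pairs \<union> diag" for v
    using that pairs_swap[of v] unfolding diag_def by auto
  ultimately show ?thesis unfolding vts_def by blast
qed

lemma seg_pairs: "S \<in> segs \<Longrightarrow> x \<in> S \<Longrightarrow> x \<notin> vts \<Longrightarrow> x \<in> pairs"
  using segs_props(3) unfolding vts_def vts0_def by blast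

lemma seg_ends: "closed_segment c d \<in> segs \<Longrightarrow> c \<in> vts \<and> d \<in> vts"
proof -
  assume a: "closed_segment c d \<in> segs"
  then have "closed_segment d c \<in> segs" by (metis closed_segment_commute)
  then show ?thesis unfolding vts_def vts0_def using a by (intro conjI UnI1 CollectI exI)
qed

lemma diag_in_closure:
  assumes "z \<in> \<Union>segs" "z \<in> diag"
  shows "z \<in> closure pairs"
proof -
  obtain S where S: "S \<in> segs" "z \<in> S" using assms(1) by blast
  obtain w where w: "w \<in> S" "w \<in> pairs" using segs_props(6)[OF S(1)] by blast
  have conv: "convex S" using segs_props(4)[OF S(1)] by auto
  have ne: "z \<noteq> w" using assms(2) w pairs_diag by blast
  have "open_segment z w \<subseteq> pairs"
  proof
    fix x assume x: "x \<in> open_segment z w"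
    have "x \<in> S" using x conv S(2) w(1) closed_segment_subset open_closed_segment by blast
    moreover have "x \<notin> diag"
    proof
      assume "x \<in> diag"
      obtain t where t: "0 < t" "x = (1 - t) *\<^sub>R z + t *\<^sub>R w" using x unfolding in_segment by blast
      have "fst x = snd x" "fst z = snd z" using \<open>x \<in> diag\<close> assms(2) by (auto simp: diag_def)
      then have "t *\<^sub>R fst w = t *\<^sub>R snd w" using t(2) by simp
      then show False using t(1) w(2) by (simp add: pairs_def)
    qed
    ultimately show "x \<in> pairs" using S(1) segs_props(3) by blast
  qed
  then have "closure (open_segment z w) \<subseteq> closure pairs" by (rule closure_mono)
  then show ?thesis using ne by auto
qed

lemma vts_diag_branch:
  assumes "v \<in> vts" "v \<in> diag"
  shows "branch_value F M i (i (fst v))" "fst v \<in> F" "snd v = fst v"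
proof -
  show s: "snd v = fst v" using assms(2) by (simp add: diag_def)
  have "v \<in> vts0"
  proof (cases "v \<in> vts0")
    case False
    then obtain v' where "v' \<in> vts0" "v = prod.swap v'" using assms(1) unfolding vts_def by blast
    moreover have "prod.swap v' = v'" using calculation(2) s by (cases v') auto
    ultimately show ?thesis by simp
  qed
  then have c: "v \<in> closure pairs" using diag_in_closure vts0_segs assms(2) by blast
  have "closed (F \<times> F)" using generic_props(1) by (intro compact_imp_closed compact_Times)
  moreover have "pairs \<subseteq> F \<times> F" by (auto simp: pairs_def)
  ultimately have "v \<in> F \<times> F" using c closure_minimal by blast
  then show F: "fst v \<in> F" by (simp add: mem_Times_iff)
  have "v = (fst v, fst v)" using s by (metis prod.collapse)
  then show "branch_value F M i (i (fst v))" using diag_closure_branch F c by metis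
qed

text \<open>The ray starts along a segment through \<open>z\<close>, and in its direction this
  segment ends in a vertex. As there are finitely many vertices, there is a first one.\<close>

lemma ray_end:
  assumes z: "z \<in> pairs" and u: "is_ray z u"
  obtains t where "t > 0" "z + t *\<^sub>R u \<in> vts" "\<And>s. 0 < s \<Longrightarrow> s < t \<Longrightarrow> z + s *\<^sub>R u \<in> pairs - vts"
proof -
  obtain e where e: "norm u = 1" "e > 0" "\<And>t. 0 < t \<Longrightarrow> t \<le> e \<Longrightarrow> z + t *\<^sub>R u \<in> pairs"
    using u unfolding is_ray_def by blast
  have u0: "u \<noteq> 0" using e(1) by auto
  have "closed (\<Union>{S \<in> segs. z \<notin> S})" using segs_props(1) closed_segs by (intro closed_Union) auto
  then have "open (- \<Union>{S \<in> segs. z \<notin> S})" "z \<in> - \<Union>{S \<in> segs. z \<notin> S}" by (auto simp: open_Compl)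
  then obtain r where r: "r > 0" "ball z r \<subseteq> - \<Union>{S \<in> segs. z \<notin> S}" using open_contains_ball by blast
  define d where "d = min e (r / 2)"
  have d: "0 < d" "d \<le> e" "d < r" using e r by (auto simp: d_def)
  have "z + d *\<^sub>R u \<in> pairs" using e(3) d by blast
  then obtain S where S: "S \<in> segs" "z + d *\<^sub>R u \<in> S" using segs_props(2) by blast
  have "z + d *\<^sub>R u \<in> ball z r" using d e(1) by (simp add: dist_norm)
  then have zS: "z \<in> S" using S r(2) by blast
  obtain a b where ab: "S = closed_segment a b" using segs_props(4)[OF S(1)] by blast
  have "\<exists>y te. y \<in> S \<and> y \<in> vts \<and> 0 < te \<and> y = z + te *\<^sub>R u"
  proof -
    \<comment> \<open>\<open>\<alpha>\<close> and \<open>\<beta>\<close> are the positions of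
      \<open>z\<close> and of a point of the ray on the segment; their order tells which end lies
      ahead.\<close>
    obtain \<alpha> where \<alpha>: "0 \<le> \<alpha>" "\<alpha> \<le> 1" "z = (1 - \<alpha>) *\<^sub>R a + \<alpha> *\<^sub>R b" using zS unfolding ab in_segment by blast
    obtain \<beta> where \<beta>: "0 \<le> \<beta>" "\<beta> \<le> 1" "z + d *\<^sub>R u = (1 - \<beta>) *\<^sub>R a + \<beta> *\<^sub>R b"
      using S(2) unfolding ab in_segment by blast
    have du: "d *\<^sub>R u = (\<beta> - \<alpha>) *\<^sub>R (b - a)"
    proof -
      have "d *\<^sub>R u = ((1 - \<beta>) *\<^sub>R a + \<beta> *\<^sub>R b) - z" using \<beta>(3) by (metis add_diff_cancel_left')
      then show ?thesis unfolding \<alpha>(3) by (simp add: algebra_simps)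
    qed
    have ne: "\<alpha> \<noteq> \<beta>" using du u0 d(1) by auto
    have ba: "b - a = (d / (\<beta> - \<alpha>)) *\<^sub>R u"
    proof -
      have "(1 / (\<beta> - \<alpha>)) *\<^sub>R (d *\<^sub>R u) = b - a" unfolding du using ne by simp
      then show ?thesis by simp
    qed
    have zb: "b = z + (1 - \<alpha>) *\<^sub>R (b - a)" "a = z + (- \<alpha>) *\<^sub>R (b - a)"
      unfolding \<alpha>(3) by (simp_all add: algebra_simps)
    have ends: "a \<in> vts" "b \<in> vts" "a \<in> S" "b \<in> S" using seg_ends S(1) ab by auto
    show ?thesis
    proof (cases "\<beta> > \<alpha>")
      case True
      then have "0 < (1 - \<alpha>) * (d / (\<beta> - \<alpha>))" using d(1) \<beta>(2) by simp
      moreover have "b = z + ((1 - \<alpha>) * (d / (\<beta> - \<alpha>))) *\<^sub>R u" using zb(1) ba by (metis scaleR_scaleR)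
      ultimately show ?thesis using ends by blast
    next
      case False
      then have lt: "\<beta> < \<alpha>" using ne by simp
      have "0 < (- \<alpha>) * (d / (\<beta> - \<alpha>))"
        using lt d(1) \<beta>(1) by (intro mult_neg_neg divide_pos_neg) auto
      moreover have "a = z + ((- \<alpha>) * (d / (\<beta> - \<alpha>))) *\<^sub>R u" using zb(2) ba by (metis scaleR_scaleR)
      ultimately show ?thesis using ends by blast
    qed
  qed
  then obtain y te where y: "y \<in> S" "y \<in> vts" "0 < te" "y = z + te *\<^sub>R u" by blast
  define X where "X = {t. 0 < t \<and> z + t *\<^sub>R u \<in> vts}"
  have "inj_on (\<lambda>t. z + t *\<^sub>R u) X" using u0 by (intro inj_onI) simp
  moreover have "(\<lambda>t. z + t *\<^sub>R u) ` X \<subseteq> vts" by (auto simp: X_def)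
  ultimately have fX: "finite X" using finite_vts inj_on_finite by blast
  have teX: "te \<in> X" using y by (simp add: X_def)
  define t where "t = Min X"
  have t: "t \<in> X" "t \<le> te" "\<And>s. s \<in> X \<Longrightarrow> t \<le> s"
    using Min_in[OF fX] Min_le[OF fX] teX by (auto simp: t_def)
  show thesis
  proof (rule that[of t])
    show "t > 0" "z + t *\<^sub>R u \<in> vts" using t(1) by (auto simp: X_def)
    fix s assume s: "0 < s" "s < t"
    then have nv: "z + s *\<^sub>R u \<notin> vts" using t(3)[of s] by (auto simp: X_def)
    have "z + s *\<^sub>R u = (1 - s / te) *\<^sub>R z + (s / te) *\<^sub>R y"
      unfolding y(4) using y(3) by (simp add: algebra_simps)
    then have "z + s *\<^sub>R u \<in> closed_segment z y"
      unfolding in_segment using s t(2) y(3) by (intro exI[of _ "s / te"]) auto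
    then have "z + s *\<^sub>R u \<in> S" using closed_segment_subset[of z S y] zS y(1) ab by auto
    then show "z + s *\<^sub>R u \<in> pairs - vts" using seg_pairs[OF S(1)] nv by blast
  qed
qed

lemma adj_sym: "adj v w \<Longrightarrow> adj w v"
  unfolding adj_def by (auto simp: open_segment_commute)

lemma adj_swap: "adj v w \<Longrightarrow> adj (prod.swap v) (prod.swap w)"
proof -
  assume a: "adj v w"
  have inj: "inj (prod.swap :: 'b \<times> 'b \<Rightarrow> _)" by (rule inj_swap)
  have "prod.swap ` open_segment v w \<subseteq> pairs - vts"
  proof
    fix x assume "x \<in> prod.swap ` open_segment v w"
    then obtain y where y: "y \<in> pairs - vts" "x = prod.swap y" using a unfolding adj_def by blast
    then have "x \<in> pairs" using pairs_swap by blast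
    moreover have "x \<notin> vts" using y vts_swap[of x] by auto
    ultimately show "x \<in> pairs - vts" by blast
  qed
  then show ?thesis
    using a vts_swap unfolding adj_def open_segment_linear_image[OF linear_swap inj] by (auto simp: prod_eq_iff)
qed

lemma adj_directions:
  assumes "adj v w" "r \<in> open_segment v w"
  obtains u a b where "norm u = 1" "0 < a" "0 < b" "v = r - a *\<^sub>R u" "w = r + b *\<^sub>R u" "is_ray r u" "is_ray r (- u)"
    "\<And>t. - a < t \<Longrightarrow> t < b \<Longrightarrow> r + t *\<^sub>R u \<in> pairs - vts"
proof -
  obtain u a b where u: "norm u = 1" "0 < a" "0 < b" "v = r - a *\<^sub>R u" "w = r + b *\<^sub>R u"
    by (rule open_segment_directions[OF assms(2)])
  have on: "r + t *\<^sub>R u \<in> pairs - vts" if "- a < t" "t < b" for t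
  proof -
    have "r + t *\<^sub>R u \<in> open_segment (r + (- a) *\<^sub>R u) (r + b *\<^sub>R u)"
      using that u by (subst open_segment_param) auto
    moreover have "open_segment (r + (- a) *\<^sub>R u) (r + b *\<^sub>R u) \<subseteq> pairs - vts"
      using assms(1) u(4,5) unfolding adj_def by simp
    ultimately show ?thesis by blast
  qed
  have "is_ray r u" unfolding is_ray_def
  proof (intro conjI exI[of _ "b/2"] allI impI u(1))
    fix t assume "0 < t \<and> t \<le> b / 2"
    then have "r + t *\<^sub>R u \<in> pairs - vts" using u(2,3) by (intro on) auto
    then show "r + t *\<^sub>R u \<in> pairs" by blast
  qed (use u in simp)
  moreover have "is_ray r (- u)" unfolding is_ray_def
  proof (intro conjI exI[of _ "a/2"] allI impI)
    fix t assume "0 < t \<and> t \<le> a / 2"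
    then have "r + (- t) *\<^sub>R u \<in> pairs - vts" using u(2,3) by (intro on) auto
    then show "r + t *\<^sub>R (- u) \<in> pairs" by simp
  qed (use u in simp_all)
  ultimately show thesis using that u on by blast
qed

text \<open>Going both ways along the segment to the first vertex gives the edge. The two opposite
  rays at \<open>r\<close> exclude a DB value, which has only one.\<close>

lemma edge_through:
  assumes r: "r \<in> pairs" "r \<notin> vts"
  shows "\<exists>v w. adj v w \<and> r \<in> open_segment v w" "crossing r"
proof -
  obtain S where S: "S \<in> segs" "r \<in> S" using r(1) segs_props(2) by blast
  obtain c d where cd: "S = closed_segment c d" using segs_props(4)[OF S(1)] by blast
  have ends: "c \<in> vts" "d \<in> vts" using seg_ends S(1) cd by auto
  then have "r \<in> open_segment c d" using S(2) cd r(2) unfolding open_segment_def by blast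
  then obtain u a b where u: "norm u = 1" "0 < a" "0 < b" "c = r - a *\<^sub>R u" "d = r + b *\<^sub>R u"
    by (rule open_segment_directions)
  have onS: "r + t *\<^sub>R u \<in> S" if "- a < t" "t < b" for t
  proof -
    have "r + t *\<^sub>R u \<in> open_segment (r + (- a) *\<^sub>R u) (r + b *\<^sub>R u)"
      using that u by (subst open_segment_param) auto
    then show ?thesis using cd u open_closed_segment by simp
  qed
  obtain e where e: "0 < e" "ball r e \<subseteq> - vts"
  proof -
    have "open (- vts)" using finite_vts by (simp add: finite_imp_closed open_Compl)
    then show thesis using r(2) that open_contains_ball by blast
  qed
  have near: "r + t *\<^sub>R u \<in> pairs" if "\<bar>t\<bar> < min e (min a b)" for t
  proof (rule seg_pairs[OF S(1) onS])
    have "r + t *\<^sub>R u \<in> ball r e" using that u(1) by (simp add: dist_norm)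
    then show "r + t *\<^sub>R u \<notin> vts" using e(2) by blast
  qed (use that in auto)
  define m where "m = min e (min a b) / 2"
  have m: "0 < m" "m < min e (min a b)" using e u by (auto simp: m_def)
  have ru: "is_ray r u" unfolding is_ray_def
    by (intro conjI exI[of _ m] allI impI u(1) m(1) near) (use m in auto)
  have ru': "is_ray r (- u)" unfolding is_ray_def
  proof (intro conjI exI[of _ m] allI impI m(1))
    fix t assume "0 < t \<and> t \<le> m"
    then have "r + (- t) *\<^sub>R u \<in> pairs" using m by (intro near) auto
    then show "r + t *\<^sub>R (- u) \<in> pairs" by simp
  qed (use u in simp)
  have "u \<noteq> - u" using u(1) by (metis norm_zero equation_minus_iff eq_neg_iff_add_eq_0 scaleR_2 scaleR_eq_0_iff zero_neq_numeral zero_neq_one)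
  then show "crossing r" using rays[OF r(1)] ru ru' by (metis (mono_tags, lifting) mem_Collect_eq singletonD)
  obtain t1 where t1: "t1 > 0" "r + t1 *\<^sub>R u \<in> vts" "\<And>s. 0 < s \<Longrightarrow> s < t1 \<Longrightarrow> r + s *\<^sub>R u \<in> pairs - vts"
    using ray_end[OF r(1) ru] by metis
  obtain t2 where t2: "t2 > 0" "r + t2 *\<^sub>R (- u) \<in> vts" "\<And>s. 0 < s \<Longrightarrow> s < t2 \<Longrightarrow> r + s *\<^sub>R (- u) \<in> pairs - vts"
    using ray_end[OF r(1) ru'] by metis
  have "adj (r + (- t2) *\<^sub>R u) (r + t1 *\<^sub>R u)"
    unfolding adj_def
  proof (intro conjI subsetI)
    show "r + (- t2) *\<^sub>R u \<in> vts" "r + t1 *\<^sub>R u \<in> vts" using t1 t2 by auto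
    have "u \<noteq> 0" using u(1) by auto
    then show "r + (- t2) *\<^sub>R u \<noteq> r + t1 *\<^sub>R u"
      using t1(1) t2(1) scaleR_cancel_right[of "- t2" u t1] by simp
    fix x assume "x \<in> open_segment (r + (- t2) *\<^sub>R u) (r + t1 *\<^sub>R u)"
    then obtain t where t: "- t2 < t" "t < t1" "x = r + t *\<^sub>R u"
      using open_segment_param[OF u(1), of "- t2" t1 x r] t1(1) t2(1) by auto
    consider "t > 0" | "t = 0" | "t < 0" by linarith
    then show "x \<in> pairs - vts"
    proof cases
      case 1 then show ?thesis using t1(3) t by simp
    next
      case 2 then show ?thesis using t r by simp
    next
      case 3 then show ?thesis using t2(3)[of "- t"] t by simp
    qed
  qed
  moreover have "r \<in> open_segment (r + (- t2) *\<^sub>R u) (r + t1 *\<^sub>R u)"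
    using open_segment_param[OF u(1), of "- t2" t1 r r] t1(1) t2(1) by (auto intro: exI[of _ 0])
  ultimately show "\<exists>v w. adj v w \<and> r \<in> open_segment v w" by blast
qed

text \<open>A pair has at most two rays, so two edges through it lie on one line; and neither can
  end inside the other.\<close>

lemma edges_disjoint:
  assumes "adj v w" "adj v' w'" "r \<in> open_segment v w" "r \<in> open_segment v' w'"
  shows "(v = v' \<and> w = w') \<or> (v = w' \<and> w = v')"
proof -
  have rp: "r \<in> pairs" using assms(1,3) unfolding adj_def by blast
  have same: "v = v' \<and> w = w'" if "adj v w" "adj v' w'" "v = r - a *\<^sub>R u" "w = r + b *\<^sub>R u" "v' = r - a' *\<^sub>R u"
    "w' = r + b' *\<^sub>R u" "0 < a" "0 < b" "0 < a'" "0 < b'"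
    "\<And>t. - a < t \<Longrightarrow> t < b \<Longrightarrow> r + t *\<^sub>R u \<in> pairs - vts" "\<And>t. - a' < t \<Longrightarrow> t < b' \<Longrightarrow> r + t *\<^sub>R u \<in> pairs - vts"
    for v w v' w' u a b a' b'
  proof -
    have "\<not> a' < a" using that(11)[of "- a'"] that(2,5,7,8,9) unfolding adj_def by auto
    moreover have "\<not> a < a'" using that(12)[of "- a"] that(1,3,7,9,10) unfolding adj_def by auto
    moreover have "\<not> b' < b" using that(11)[of b'] that(2,6,7,10) unfolding adj_def by auto
    moreover have "\<not> b < b'" using that(12)[of b] that(1,4,8,9) unfolding adj_def by auto
    ultimately show ?thesis using that by auto
  qed
  obtain u a b where u: "norm u = 1" "0 < a" "0 < b" "v = r - a *\<^sub>R u" "w = r + b *\<^sub>R u" "is_ray r u" "is_ray r (- u)"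
    "\<And>t. - a < t \<Longrightarrow> t < b \<Longrightarrow> r + t *\<^sub>R u \<in> pairs - vts"
    using adj_directions[OF assms(1,3)] by metis
  obtain u' a' b' where u': "norm u' = 1" "0 < a'" "0 < b'" "v' = r - a' *\<^sub>R u'" "w' = r + b' *\<^sub>R u'" "is_ray r u'" "is_ray r (- u')"
    "\<And>t. - a' < t \<Longrightarrow> t < b' \<Longrightarrow> r + t *\<^sub>R u' \<in> pairs - vts"
    using adj_directions[OF assms(2,4)] by metis
  have ne: "u \<noteq> - u" using u(1) by (metis norm_zero equation_minus_iff eq_neg_iff_add_eq_0 scaleR_2 scaleR_eq_0_iff zero_neq_numeral zero_neq_one)
  have "u' = u \<or> u' = - u"
  proof -
    obtain x y where xy: "{u. is_ray r u} \<subseteq> {x, y}" using rays[OF rp] by blast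
    then have "u \<in> {x, y}" "- u \<in> {x, y}" "u' \<in> {x, y}" using u(6,7) u'(6) by blast+
    then show ?thesis using ne by auto
  qed
  then show ?thesis
  proof
    assume "u' = u"
    then show ?thesis using same[OF assms(1,2) u(4,5) _ _ u(2,3) u'(2,3) u(8)] u'(4,5,8) by auto
  next
    assume e: "u' = - u"
    have "r + t *\<^sub>R u \<in> pairs - vts" if "- b' < t" "t < a'" for t
      using u'(8)[of "- t"] that e by auto
    then show ?thesis
      using same[OF assms(1) adj_sym[OF assms(2)] u(4,5) _ _ u(2,3) u'(3,2) u(8)] u'(4,5) e by auto
  qed
qed

lemma adj_ray:
  assumes "adj v w"
  obtains n u where "norm u = 1" "n > 0" "w = v + n *\<^sub>R u" "is_ray v u" "\<And>t. 0 < t \<Longrightarrow> t < n \<Longrightarrow> v + t *\<^sub>R u \<in> pairs - vts"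
proof -
  define n where "n = norm (w - v)"
  have n: "n > 0" using assms unfolding adj_def n_def by auto
  define u where "u = (1 / n) *\<^sub>R (w - v)"
  have u: "norm u = 1" "w = v + n *\<^sub>R u" using n by (auto simp: u_def n_def)
  have on: "v + t *\<^sub>R u \<in> pairs - vts" if "0 < t" "t < n" for t
  proof -
    have "v + t *\<^sub>R u \<in> open_segment (v + 0 *\<^sub>R u) (v + n *\<^sub>R u)"
      using that u n by (subst open_segment_param) auto
    then show ?thesis using assms u(2) unfolding adj_def by auto
  qed
  have "is_ray v u" unfolding is_ray_def
  proof (intro conjI exI[of _ "n/2"] allI impI u(1))
    fix t assume "0 < t \<and> t \<le> n / 2"
    then have "v + t *\<^sub>R u \<in> pairs - vts" using n by (intro on) auto
    then show "v + t *\<^sub>R u \<in> pairs" by blast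
  qed (use n in simp)
  then show thesis using that u n on by blast
qed

lemma adj_dir_inj:
  assumes "adj v w" "adj v w'" "w = v + n *\<^sub>R u" "w' = v + n' *\<^sub>R u" "n > 0" "n' > 0"
    "\<And>t. 0 < t \<Longrightarrow> t < n \<Longrightarrow> v + t *\<^sub>R u \<in> pairs - vts" "\<And>t. 0 < t \<Longrightarrow> t < n' \<Longrightarrow> v + t *\<^sub>R u \<in> pairs - vts"
  shows "w = w'"
proof -
  have "\<not> n < n'" using assms(1,3,5) assms(8)[of n] unfolding adj_def by auto
  moreover have "\<not> n' < n" using assms(2,4,6) assms(7)[of n'] unfolding adj_def by auto
  ultimately show ?thesis using assms(3,4) by simp
qed

lemma ray_adj:
  assumes "v \<in> vts" "v \<in> pairs" "is_ray v u"
  obtains n where "n > 0" "adj v (v + n *\<^sub>R u)"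
proof -
  obtain t where t: "t > 0" "v + t *\<^sub>R u \<in> vts" "\<And>s. 0 < s \<Longrightarrow> s < t \<Longrightarrow> v + s *\<^sub>R u \<in> pairs - vts"
    using ray_end[OF assms(2,3)] by metis
  have u: "norm u = 1" using assms(3) unfolding is_ray_def by blast
  have "adj v (v + t *\<^sub>R u)" unfolding adj_def
  proof (intro conjI subsetI assms(1) t(2))
    show "v \<noteq> v + t *\<^sub>R u" using t(1) u by auto
    fix x assume "x \<in> open_segment v (v + t *\<^sub>R u)"
    then show "x \<in> pairs - vts" using open_segment_param[OF u t(1), of x v] t(3) by auto
  qed
  then show thesis using that t(1) by blast
qed

text \<open>The edges at such a vertex correspond to its rays, each followed to the first
  vertex.\<close>

lemma adj_degree:
  assumes v: "v \<in> vts" "v \<in> pairs"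
  shows "(\<exists>w w'. w \<noteq> w' \<and> {x. adj v x} = {w, w'} \<and> crossing v) \<or> (\<exists>w. {x. adj v x} = {w} \<and> DB_value F M i (i (fst v)))"
proof -
  have "\<exists>w. adj v w \<and> (\<exists>n>0. w = v + n *\<^sub>R u) \<and> (\<forall>x. adj v x \<and> (\<exists>n>0. x = v + n *\<^sub>R u) \<longrightarrow> x = w)" if u: "is_ray v u" for u
  proof -
    obtain n where n: "n > 0" "adj v (v + n *\<^sub>R u)" by (rule ray_adj[OF v u])
    have dirs: "\<And>t. 0 < t \<Longrightarrow> t < m \<Longrightarrow> v + t *\<^sub>R u \<in> pairs - vts" if m: "adj v (v + m *\<^sub>R u)" "m > 0" for m
    proof -
      fix t assume t: "0 < t" "t < m"
      have "norm u = 1" using u unfolding is_ray_def by blast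
      then have "v + t *\<^sub>R u \<in> open_segment (v + 0 *\<^sub>R u) (v + m *\<^sub>R u)"
        using t m(2) by (subst open_segment_param) auto
      then show "v + t *\<^sub>R u \<in> pairs - vts" using m(1) unfolding adj_def by auto
    qed
    have "x = v + n *\<^sub>R u" if x: "adj v x" "m > 0" "x = v + m *\<^sub>R u" for x m
      using adj_dir_inj[OF x(1) n(2) x(3) refl x(2) n(1)] dirs x n by blast
    then show ?thesis using n by blast
  qed
  then obtain nb where nb: "\<And>u. is_ray v u \<Longrightarrow> adj v (nb u) \<and> (\<exists>n>0. nb u = v + n *\<^sub>R u) \<and>
     (\<forall>x. adj v x \<and> (\<exists>n>0. x = v + n *\<^sub>R u) \<longrightarrow> x = nb u)" by metis
  have eq: "{x. adj v x} = nb ` {u. is_ray v u}"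
  proof
    show "{x. adj v x} \<subseteq> nb ` {u. is_ray v u}"
    proof
      fix x assume "x \<in> {x. adj v x}"
      then have x: "adj v x" by simp
      obtain n u where "n > 0" "x = v + n *\<^sub>R u" "is_ray v u" using adj_ray[OF x] by metis
      then have "x = nb u" using nb x by blast
      then show "x \<in> nb ` {u. is_ray v u}" using \<open>is_ray v u\<close> by blast
    qed
  qed (use nb in blast)
  have inj: "u = u'" if iu: "is_ray v u" "is_ray v u'" "nb u = nb u'" for u u'
  proof -
    obtain n where n: "n > 0" "nb u = v + n *\<^sub>R u" using nb[OF iu(1)] by blast
    obtain n' where n': "n' > 0" "nb u' = v + n' *\<^sub>R u'" using nb[OF iu(2)] by blast
    have e: "n *\<^sub>R u = n' *\<^sub>R u'" using n n' iu(3) by simp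
    have "norm u = 1" "norm u' = 1" using iu(1,2) unfolding is_ray_def by auto
    then have "n = n'" using e n(1) n'(1) by (metis abs_of_pos mult.right_neutral norm_scaleR)
    then show ?thesis using e n(1) by simp
  qed
  show ?thesis
    using rays[OF v(2)]
  proof
    assume "\<exists>u u'. u \<noteq> u' \<and> {u. is_ray v u} = {u, u'} \<and> crossing v"
    then obtain u u' where u: "u \<noteq> u'" "{u. is_ray v u} = {u, u'}" "crossing v" by blast
    then have "is_ray v u" "is_ray v u'" by blast+
    then have "nb u \<noteq> nb u'" using inj u(1) by blast
    moreover have "{x. adj v x} = {nb u, nb u'}" unfolding eq u(2) by simp
    ultimately show ?thesis using u(3) by blast
  next
    assume "\<exists>u. {u. is_ray v u} = {u} \<and> DB_value F M i (i (fst v))"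
    then obtain u where u: "{u. is_ray v u} = {u}" "DB_value F M i (i (fst v))" by blast
    have "{x. adj v x} = {nb u}" unfolding eq u(1) by simp
    then show ?thesis using u(2) by blast
  qed
qed

text \<open>The midpoint of a pair and its exchange is diagonal, whereas the interior of an edge
  avoids the diagonal.\<close>

lemma edge_swap_free:
  assumes "adj a b" "x \<in> closed_segment a b" "prod.swap x \<in> closed_segment a b"
  shows "prod.swap x = x"
proof (rule ccontr)
  assume "prod.swap x \<noteq> x"
  then have "midpoint (prod.swap x) x \<in> open_segment a b"
    using midpoint_in_open_segment_of_closed[OF assms(3,2)] by blast
  then have "midpoint (prod.swap x) x \<in> pairs" using assms(1) unfolding adj_def by blast
  moreover have "midpoint (prod.swap x) x \<in> diag" by (simp add: diag_def midpoint_def add.commute)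
  ultimately show False using pairs_diag by blast
qed

text \<open>Along each edge from a branch point, the height \<open>z\<close> in the umbrella takes
  all small positive values, and a pair of given height is unique up to exchange. So only one double
  curve ends there.\<close>

lemma adj_branch:
  assumes "v \<in> diag" "adj v w" "adj v w'"
  shows "w' = w \<or> w' = prod.swap w"
proof -
  have vV: "v \<in> vts" using assms(2) unfolding adj_def by blast
  note b = vts_diag_branch[OF vV assms(1)]
  obtain N f g r x0 where core: "branch_core (i (fst v)) N f g r" and x0: "{x' \<in> F. i x' = i (fst v)} = {x0}"
    by (rule ex_branch_core[OF b(1)])
  have x0v: "x0 = fst v" using x0 b(2) by auto
  note ap = apex[OF core x0]
  obtain P where P: "open P" "nbd N f r = F \<inter> P" using nbd_open[OF core] unfolding openin_open by blast
  have "fst v \<in> P" using P(2) ap(1) x0v by auto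
  then have "open (fst -` P)" "v \<in> fst -` P" using P(1) by (auto intro: open_vimage_fst)
  then obtain \<rho> where \<rho>: "\<rho> > 0" "ball v \<rho> \<subseteq> fst -` P" using open_contains_ball by blast
  have reach: "\<exists>c0>0. \<forall>c. 0 < c \<and> c \<le> c0 \<longrightarrow> (\<exists>z\<in>open_segment v y. z \<in> pairs \<and> fst z \<in> nbd N f r \<and> f (i (fst z)) $ 3 = c)"
    if y: "adj v y" for y
  proof -
    obtain n u where nu: "norm u = 1" "n > 0" "y = v + n *\<^sub>R u"
      "\<And>t. 0 < t \<Longrightarrow> t < n \<Longrightarrow> v + t *\<^sub>R u \<in> pairs - vts" using adj_ray[OF y] by metis
    define e where "e = min (n/2) (\<rho>/2)"
    have e: "0 < e" "e < n" "e < \<rho>" using nu(2) \<rho>(1) by (auto simp: e_def)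
    have in_nb: "fst (v + t *\<^sub>R u) \<in> nbd N f r" if "t \<in> {0..e}" for t
    proof (cases "t = 0")
      case True then show ?thesis using ap(1) x0v by simp
    next
      case False
      have "v + t *\<^sub>R u \<in> ball v \<rho>" using that e nu(1) by (simp add: dist_norm)
      then have "fst (v + t *\<^sub>R u) \<in> P" using \<rho>(2) by blast
      moreover have "v + t *\<^sub>R u \<in> pairs" using nu(4)[of t] that False e by auto
      ultimately show ?thesis using P(2) by (auto simp: pairs_def)
    qed
    have ze: "v + t *\<^sub>R u \<in> pairs" "v + t *\<^sub>R u \<in> open_segment v y" if "0 < t" "t \<le> e" for t
    proof -
      show "v + t *\<^sub>R u \<in> pairs" using nu(4)[of t] that e by auto
      show "v + t *\<^sub>R u \<in> open_segment v y"
        using open_segment_param[OF nu(1,2), of "v + t *\<^sub>R u" v] that e nu(3) by auto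
    qed
    define h where "h = (\<lambda>t. f (i (fst (v + t *\<^sub>R u))) $ 3)"
    have ch: "continuous_on {0..e} h" unfolding h_def
      by (rule continuous_on_compose2[OF continuous_on_nbd[OF core]]) (use in_nb in \<open>auto intro!: continuous_intros\<close>)
    have h0: "h 0 = 0" using ap(2) x0v by (simp add: h_def)
    have he: "h e > 0" unfolding h_def
      by (rule nbd_pairs(3)[OF core b(1) ze(1) in_nb]) (use e in auto)
    have "\<exists>z\<in>open_segment v y. z \<in> pairs \<and> fst z \<in> nbd N f r \<and> f (i (fst z)) $ 3 = c" if c: "0 < c" "c \<le> h e" for c
    proof -
      obtain t where t: "0 \<le> t" "t \<le> e" "h t = c" using IVT'[of h 0 c e] h0 c ch e(1) by auto
      have "t \<noteq> 0" using t(3) h0 c(1) by auto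
      then show ?thesis using ze[of t] in_nb[of t] t by (intro bexI[of _ "v + t *\<^sub>R u"]) (auto simp: h_def)
    qed
    then show ?thesis using he by blast
  qed
  obtain c1 where c1: "c1 > 0" "\<And>c. 0 < c \<Longrightarrow> c \<le> c1 \<Longrightarrow> \<exists>z\<in>open_segment v w. z \<in> pairs \<and> fst z \<in> nbd N f r \<and> f (i (fst z)) $ 3 = c"
    using reach[OF assms(2)] by blast
  obtain c2 where c2: "c2 > 0" "\<And>c. 0 < c \<Longrightarrow> c \<le> c2 \<Longrightarrow> \<exists>z\<in>open_segment v w'. z \<in> pairs \<and> fst z \<in> nbd N f r \<and> f (i (fst z)) $ 3 = c"
    using reach[OF assms(3)] by blast
  define c where "c = min c1 c2"
  have c: "0 < c" "c \<le> c1" "c \<le> c2" using c1 c2 by (auto simp: c_def)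
  obtain z where z: "z \<in> open_segment v w" "z \<in> pairs" "fst z \<in> nbd N f r" "f (i (fst z)) $ 3 = c" using c1(2)[OF c(1,2)] by blast
  obtain z' where z': "z' \<in> open_segment v w'" "z' \<in> pairs" "fst z' \<in> nbd N f r" "f (i (fst z')) $ 3 = c" using c2(2)[OF c(1,3)] by blast
  have vs: "prod.swap v = v" using b(3) by (simp add: prod_eq_iff)
  have "z' = z \<or> z' = prod.swap z" using nbd_pairs_eq[OF core b(1) z(2,3) z'(2,3)] z(4) z'(4) by simp
  then show ?thesis
  proof
    assume "z' = z"
    then show ?thesis using edges_disjoint[OF assms(2,3) z(1)] z'(1) by auto
  next
    assume e: "z' = prod.swap z"
    have "prod.swap z \<in> open_segment v (prod.swap w)"
      using z(1) open_segment_linear_image[OF linear_swap inj_swap, of v w] vs by auto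
    then show ?thesis using edges_disjoint[OF adj_swap[OF assms(2)] assms(3), of z'] z'(1) e vs by auto
  qed
qed

end

section \<open>Concatenation of PL paths, and paths in the graph\<close>

lemma pl_on_Un_closed:
  assumes "pl_on f A" "pl_on f B" "closed A" "closed B"
  shows "pl_on f (A \<union> B)"
  unfolding pl_on_iff
proof
  have loc: "\<exists>\<P> U. finite \<P> \<and> open U \<and> x \<in> U \<and> C \<inter> U \<subseteq> \<Union>\<P> \<and> (\<forall>P\<in>\<P>. polytope P \<and> P \<subseteq> C \<and> affine_on f P)"
    if "pl_on f C" "closed C" for C x
  proof (cases "x \<in> C")
    case True then show ?thesis using that(1) unfolding pl_on_iff by blast
  next
    case False then show ?thesis using that(2) by (intro exI[of _ "{}"] exI[of _ "- C"]) auto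
  qed
  fix x assume "x \<in> A \<union> B"
  obtain \<P> U where U: "finite \<P>" "open U" "x \<in> U" "A \<inter> U \<subseteq> \<Union>\<P>" "\<forall>P\<in>\<P>. polytope P \<and> P \<subseteq> A \<and> affine_on f P"
    using loc[OF assms(1,3), of x] by (elim exE conjE)
  obtain \<Q> V where V: "finite \<Q>" "open V" "x \<in> V" "B \<inter> V \<subseteq> \<Union>\<Q>" "\<forall>P\<in>\<Q>. polytope P \<and> P \<subseteq> B \<and> affine_on f P"
    using loc[OF assms(2,4), of x] by (elim exE conjE)
  show "\<exists>\<P> U. finite \<P> \<and> open U \<and> x \<in> U \<and> (A \<union> B) \<inter> U \<subseteq> \<Union>\<P> \<and> (\<forall>P\<in>\<P>. polytope P \<and> P \<subseteq> A \<union> B \<and> affine_on f P)"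
    by (rule exI[of _ "\<P> \<union> \<Q>"], rule exI[of _ "U \<inter> V"]) (use U V in auto)
qed

lemma pl_on_polytope: "polytope P \<Longrightarrow> affine_on f P \<Longrightarrow> pl_on f P"
  unfolding pl_on_iff by (intro ballI exI[of _ "{P}"] exI[of _ UNIV]) auto

lemma polytope_real_interval: "polytope {a..b::real}"
  using polytope_interval[of a b] by (simp add: cbox_interval)

lemma affine_on_real: "affine_on (\<lambda>t::real. t *\<^sub>R v + c) P"
  unfolding affine_on_def by (intro exI[of _ "\<lambda>t. t *\<^sub>R v"] exI[of _ c]) (auto simp: linear_iff algebra_simps)

lemma pl_on_linepath: "pl_on (linepath a b) {0..1}"
proof (rule pl_on_polytope[OF polytope_real_interval])
  show "affine_on (linepath a b) {0..1}"
    using affine_on_real[of "b - a" a] by (rule affine_on_cong) (simp add: linepath_def algebra_simps)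
qed

lemma pl_on_join:
  fixes g1 g2 :: "real \<Rightarrow> 'a::euclidean_space"
  assumes "pl_on g1 {0..1}" "pl_on g2 {0..1}" "g1 1 = g2 0"
  shows "pl_on (g1 +++ g2) {0..1}"
proof -
  have "pl_on (\<lambda>t::real. 2 * t) {0..1/2}"
    using affine_on_real[of "2::real" 0 "{0..1/2}"] by (intro pl_on_polytope[OF polytope_real_interval]) (simp add: mult.commute)
  moreover have "(\<lambda>t::real. 2 * t) ` {0..1/2} \<subseteq> {0..1}" by auto
  ultimately have "pl_on (\<lambda>t. g1 (2 * t)) {0..1/2}" by (rule pl_on_compose[OF _ assms(1)])
  then have 1: "pl_on (g1 +++ g2) {0..1/2}" by (rule pl_on_cong) (simp add: joinpaths_def)
  have "pl_on (\<lambda>t::real. 2 * t - 1) {1/2..1}"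
    using affine_on_real[of "2::real" "-1" "{1/2..1}"] by (intro pl_on_polytope[OF polytope_real_interval]) (simp add: mult.commute)
  moreover have "(\<lambda>t::real. 2 * t - 1) ` {1/2..1} \<subseteq> {0..1}" by auto
  ultimately have "pl_on (\<lambda>t. g2 (2 * t - 1)) {1/2..1}" by (rule pl_on_compose[OF _ assms(2)])
  then have 2: "pl_on (g1 +++ g2) {1/2..1}"
  proof (rule pl_on_cong)
    fix t :: real assume "t \<in> {1/2..1}"
    show "g2 (2 * t - 1) = (g1 +++ g2) t"
    proof (cases "t = 1/2")
      case True then show ?thesis using assms(3) by (simp only: joinpaths_def) simp
    next
      case False then show ?thesis using \<open>t \<in> {1/2..1}\<close> by (auto simp: joinpaths_def)
    qed
  qed
  have "{0..1::real} = {0..1/2} \<union> {1/2..1}" by auto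
  then show ?thesis using pl_on_Un_closed[OF 1 2] by simp
qed

text \<open>Injectivity is tested after applying \<open>k\<close>, because a double arc has to be
  injective on unordered pairs.\<close>

lemma inj_on_join_open:
  assumes "inj_on (\<lambda>t. k (g1 t)) {0..1}" "inj_on (\<lambda>t. k (g2 t)) {0..1}"
    "\<And>s t. s \<in> {0..1} \<Longrightarrow> t \<in> {0..1} \<Longrightarrow> k (g1 s) = k (g2 t) \<Longrightarrow> s = 1 \<and> t = 0"
  shows "inj_on (\<lambda>t. k ((g1 +++ g2) t)) {0..1::real}"
proof (rule inj_onI)
  have *: "x = y" if "x \<le> y" "x \<in> {0..1}" "y \<in> {0..1}" "k ((g1 +++ g2) x) = k ((g1 +++ g2) y)" for x y
  proof -
    consider "y \<le> 1/2" | "x \<le> 1/2" "y > 1/2" | "x > 1/2" using that by linarith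
    then show ?thesis
    proof cases
      case 1
      then have "k (g1 (2 * x)) = k (g1 (2 * y))" using that by (simp add: joinpaths_def)
      then have "2 * x = 2 * y" using inj_onD[OF assms(1), of "2 * x" "2 * y"] that 1 by simp
      then show ?thesis by simp
    next
      case 2
      then have "k (g1 (2 * x)) = k (g2 (2 * y - 1))" using that by (simp add: joinpaths_def)
      then have "2 * y - 1 = 0" using assms(3)[of "2 * x" "2 * y - 1"] that 2 by simp
      then show ?thesis using 2 by simp
    next
      case 3
      then have "k (g2 (2 * x - 1)) = k (g2 (2 * y - 1))" using that by (simp add: joinpaths_def)
      then have "2 * x - 1 = 2 * y - 1" using inj_onD[OF assms(2), of "2 * x - 1" "2 * y - 1"] that 3 by simp
      then show ?thesis by simp
    qed
  qed
  fix x y :: real assume "x \<in> {0..1}" "y \<in> {0..1}" "k ((g1 +++ g2) x) = k ((g1 +++ g2) y)"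
  then show "x = y" using *[of x y] *[of y x] by (cases "x \<le> y") auto
qed

lemma inj_on_join_closed:
  assumes "inj_on (\<lambda>t. k (g1 t)) {0..1}" "inj_on (\<lambda>t. k (g2 t)) {0..1}"
    "\<And>s t. s \<in> {0..1} \<Longrightarrow> t \<in> {0..1} \<Longrightarrow> k (g1 s) = k (g2 t) \<Longrightarrow> (s = 1 \<and> t = 0) \<or> (s = 0 \<and> t = 1)"
  shows "inj_on (\<lambda>t. k ((g1 +++ g2) t)) {0..<1::real}"
proof (rule inj_onI)
  have *: "x = y" if "x \<le> y" "x \<in> {0..<1}" "y \<in> {0..<1}" "k ((g1 +++ g2) x) = k ((g1 +++ g2) y)" for x y
  proof -
    consider "y \<le> 1/2" | "x \<le> 1/2" "y > 1/2" | "x > 1/2" using that by linarith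
    then show ?thesis
    proof cases
      case 1
      then have "k (g1 (2 * x)) = k (g1 (2 * y))" using that by (simp add: joinpaths_def)
      then have "2 * x = 2 * y" using inj_onD[OF assms(1), of "2 * x" "2 * y"] that 1 by simp
      then show ?thesis by simp
    next
      case 2
      then have "k (g1 (2 * x)) = k (g2 (2 * y - 1))" using that by (simp add: joinpaths_def)
      then have "2 * y - 1 = 0 \<or> 2 * y - 1 = 1" using assms(3)[of "2 * x" "2 * y - 1"] that 2 by auto
      then show ?thesis using 2 that by auto
    next
      case 3
      then have "k (g2 (2 * x - 1)) = k (g2 (2 * y - 1))" using that by (simp add: joinpaths_def)
      then have "2 * x - 1 = 2 * y - 1" using inj_onD[OF assms(2), of "2 * x - 1" "2 * y - 1"] that 3 by simp
      then show ?thesis by simp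
    qed
  qed
  fix x y :: real assume "x \<in> {0..<1}" "y \<in> {0..<1}" "k ((g1 +++ g2) x) = k ((g1 +++ g2) y)"
  then show "x = y" using *[of x y] *[of y x] by (cases "x \<le> y") auto
qed

definition key :: "'b \<times> 'b \<Rightarrow> 'b set" where "key w = {fst w, snd w}"

lemma key_eq_iff: "key v = key w \<longleftrightarrow> w = v \<or> w = prod.swap v"
  unfolding key_def by (auto simp: doubleton_eq_iff prod_eq_iff)

definition polyset :: "'a::real_vector list \<Rightarrow> 'a set" where
  "polyset vs = (\<Union>n\<in>{n. Suc n < length vs}. closed_segment (vs ! n) (vs ! Suc n))"

lemma polyset_two: "polyset [a, b] = closed_segment a b"
proof -
  have "{n. Suc n < length [a, b]} = {0}" by auto
  then show ?thesis unfolding polyset_def by simp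
qed

lemma polyset_Cons: "polyset (a # b # c # r) = closed_segment a b \<union> polyset (b # c # r)"
proof -
  have "{n. Suc n < length (a # b # c # r)} = insert 0 (Suc ` {n. Suc n < length (b # c # r)})"
  proof
    show "{n. Suc n < length (a # b # c # r)} \<subseteq> insert 0 (Suc ` {n. Suc n < length (b # c # r)})"
    proof
      fix n assume "n \<in> {n. Suc n < length (a # b # c # r)}"
      then show "n \<in> insert 0 (Suc ` {n. Suc n < length (b # c # r)})" by (cases n) auto
    qed
  qed auto
  then show ?thesis unfolding polyset_def by simp
qed

context generic_map
begin

lemma pairs_swap_neq: "v \<in> pairs \<Longrightarrow> prod.swap v \<noteq> v"
  by (cases v) (auto simp: pairs_def)

text \<open>Distinctness is required modulo exchange, as for double arcs: a path does not visit both
  a vertex and its exchange.\<close>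

definition gpath :: "('b \<times> 'b) list \<Rightarrow> bool" where
  "gpath vs \<longleftrightarrow> 2 \<le> length vs \<and> (\<forall>n. Suc n < length vs \<longrightarrow> adj (vs ! n) (vs ! Suc n)) \<and> distinct (map key vs)"

lemma gpath_adj: "gpath vs \<Longrightarrow> Suc n < length vs \<Longrightarrow> adj (vs ! n) (vs ! Suc n)"
  unfolding gpath_def by blast

lemma gpath_vts: "gpath vs \<Longrightarrow> n < length vs \<Longrightarrow> vs ! n \<in> vts"
proof -
  assume g: "gpath vs" and n: "n < length vs"
  show ?thesis
  proof (cases n)
    case 0
    then have "adj (vs ! 0) (vs ! Suc 0)" using g unfolding gpath_def by auto
    then show ?thesis using 0 unfolding adj_def by simp
  next
    case (Suc m)
    then have "adj (vs ! m) (vs ! Suc m)" using g n gpath_adj by blast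
    then show ?thesis using Suc unfolding adj_def by simp
  qed
qed

lemma gpath_key: "gpath vs \<Longrightarrow> m < length vs \<Longrightarrow> n < length vs \<Longrightarrow> key (vs ! m) = key (vs ! n) \<Longrightarrow> m = n"
  unfolding gpath_def by (metis distinct_conv_nth length_map nth_map)

lemma gpath_tl: "gpath (a # b # c # r) \<Longrightarrow> gpath (b # c # r)"
  unfolding gpath_def by (auto dest: spec[of _ "Suc _"])

lemma polyset_cases:
  assumes "gpath vs" "x \<in> polyset vs"
  obtains n where "n < length vs" "x = vs ! n" | n where "Suc n < length vs" "x \<in> open_segment (vs ! n) (vs ! Suc n)"
    "x \<in> pairs" "x \<notin> vts"
proof -
  obtain n where n: "Suc n < length vs" "x \<in> closed_segment (vs ! n) (vs ! Suc n)" using assms(2) unfolding polyset_def by blast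
  show thesis
  proof (cases "x = vs ! n \<or> x = vs ! Suc n")
    case True then show thesis using that(1) n(1) Suc_lessD by metis
  next
    case False
    then have "x \<in> open_segment (vs ! n) (vs ! Suc n)" using n(2) unfolding open_segment_def by blast
    moreover have "adj (vs ! n) (vs ! Suc n)" using gpath_adj[OF assms(1) n(1)] .
    ultimately show thesis using that(2)[OF n(1)] unfolding adj_def by blast
  qed
qed

lemma edge_keys_inj:
  assumes "adj a b"
  shows "inj_on (\<lambda>t. key (linepath a b t)) {0..1}"
proof (rule inj_onI)
  fix s t :: real assume st: "s \<in> {0..1}" "t \<in> {0..1}" "key (linepath a b s) = key (linepath a b t)"
  have m: "linepath a b s \<in> closed_segment a b" "linepath a b t \<in> closed_segment a b"
    using st by (auto simp: linepath_in_path)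
  have "linepath a b t = linepath a b s"
    using st(3) edge_swap_free[OF assms m(1)] m(2) unfolding key_eq_iff by auto
  moreover have "a \<noteq> b" using assms unfolding adj_def by blast
  ultimately show "s = t" using inj_on_linepath st(1,2) by (metis inj_onD)
qed

lemma swap_notin_vts: "x \<notin> vts \<Longrightarrow> prod.swap x \<notin> vts"
  using vts_swap[of "prod.swap x"] by auto

lemma edges_disjoint_key:
  assumes "adj v w" "adj v' w'" "r \<in> open_segment v w" "r' \<in> open_segment v' w'" "key r = key r'"
  shows "(key v = key v' \<and> key w = key w') \<or> (key v = key w' \<and> key w = key v')"
proof -
  have "r' = r \<or> r' = prod.swap r" using assms(5) unfolding key_eq_iff .
  then show ?thesis
  proof
    assume "r' = r" then show ?thesis using edges_disjoint[OF assms(1,2,3)] assms(4) by auto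
  next
    assume e: "r' = prod.swap r"
    have "r' \<in> open_segment (prod.swap v) (prod.swap w)"
      using assms(3) e open_segment_linear_image[OF linear_swap inj_swap, of v w] by auto
    then show ?thesis using edges_disjoint[OF adj_swap[OF assms(1)] assms(2) _ assms(4)] unfolding key_eq_iff by auto
  qed
qed

text \<open>Edges are prepended one at a time; modulo exchange, the new edge meets the rest only in
  the common vertex.\<close>

lemma gpath_param:
  assumes "gpath vs"
  shows "\<exists>\<gamma> :: real \<Rightarrow> 'b \<times> 'b. pl_on \<gamma> {0..1} \<and> \<gamma> 0 = hd vs \<and> \<gamma> 1 = last vs \<and> \<gamma> ` {0..1} = polyset vs \<and> inj_on (\<lambda>t. key (\<gamma> t)) {0..1}"
  using assms
proof (induction vs)
  case Nil then show ?case unfolding gpath_def by simp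
next
  case (Cons a vs)
  obtain b r where vs: "vs = b # r" using Cons.prems unfolding gpath_def by (cases vs) auto
  have ab: "adj a b" using gpath_adj[OF Cons.prems, of 0] vs by simp
  show ?case
  proof (cases r)
    case Nil
    have "(linepath a b) ` {0..1} = polyset (a # vs)" using vs Nil polyset_two[of a b] by (simp add: linepath_image_01)
    then show ?thesis
      using pl_on_linepath[of a b] edge_keys_inj[OF ab] vs Nil
      by (intro exI[of _ "linepath a b"]) (simp add: linepath_0' linepath_1')
  next
    case (Cons c r')
    have g: "gpath (b # c # r')" using gpath_tl Cons.prems vs Cons by simp
    then obtain \<gamma> :: "real \<Rightarrow> 'b \<times> 'b" where \<gamma>: "pl_on \<gamma> {0..1}" "\<gamma> 0 = b" "\<gamma> 1 = last vs" "\<gamma> ` {0..1} = polyset vs" "inj_on (\<lambda>t. key (\<gamma> t)) {0..1}"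
      using Cons.IH vs Cons by auto
    have gvs: "gpath vs" using g vs Cons by simp
    have keya: "key a \<noteq> key (vs ! n)" if "n < length vs" for n
      using gpath_key[OF Cons.prems, of 0 "Suc n"] that by auto
    have meet: "s = 1 \<and> t = 0" if s: "s \<in> {0..1}" and t: "t \<in> {0..1}" and k: "key (linepath a b s) = key (\<gamma> t)" for s t
    proof -
      let ?x = "linepath a b s"
      have x: "?x \<in> closed_segment a b" using s by (simp add: linepath_in_path)
      have y: "\<gamma> t \<in> polyset vs" using t \<gamma>(4) by blast
      have yx: "\<gamma> t = ?x \<or> \<gamma> t = prod.swap ?x" using k unfolding key_eq_iff .
      have "?x = b"
      proof (rule ccontr)
        assume "?x \<noteq> b"
        then consider "?x = a" | "?x \<in> open_segment a b" using x unfolding open_segment_def by blast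
        then show False
        proof cases
          case 1
          then have "\<gamma> t \<in> vts" using yx ab vts_swap[of a] unfolding adj_def by auto
          then show False using polyset_cases[OF gvs y] keya k 1 by metis
        next
          case 2
          have "?x \<notin> vts" using 2 ab unfolding adj_def by blast
          then have "\<gamma> t \<notin> vts" using yx swap_notin_vts[of ?x] by metis
          then obtain n where n: "Suc n < length vs" "\<gamma> t \<in> open_segment (vs ! n) (vs ! Suc n)"
            using polyset_cases[OF gvs y] gpath_vts[OF gvs] by metis
          have "key a = key (vs ! n) \<or> key a = key (vs ! Suc n)"
            using edges_disjoint_key[OF ab gpath_adj[OF gvs n(1)] 2 n(2) k] by blast
          then show False using keya[of n] keya[of "Suc n"] n(1) by auto
        qed
      qed
      then have "key (\<gamma> t) = key (\<gamma> 0)" using k \<gamma>(2) by simp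
      then have "t = 0" by (rule inj_onD[OF \<gamma>(5)]) (use t in auto)
      have "linepath a b s = linepath a b 1" using \<open>?x = b\<close> by (simp add: linepath_1')
      moreover have "a \<noteq> b" using ab unfolding adj_def by blast
      ultimately have "s = 1" using inj_on_linepath[of a b] s by (metis inj_onD atLeastAtMost_iff order_refl zero_le_one)
      then show ?thesis using \<open>t = 0\<close> by simp
    qed
    show ?thesis
    proof (intro exI conjI)
      show "pl_on (linepath a b +++ \<gamma>) {0..1}"
        by (rule pl_on_join[OF pl_on_linepath \<gamma>(1)]) (simp add: \<gamma>(2) linepath_1')
      show "(linepath a b +++ \<gamma>) 0 = hd (a # vs)" by (simp add: joinpaths_def linepath_0')
      show "(linepath a b +++ \<gamma>) 1 = last (a # vs)" using \<gamma>(3) vs by (simp add: joinpaths_def)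
      have "path_image (linepath a b +++ \<gamma>) = path_image (linepath a b) \<union> path_image \<gamma>"
        by (rule path_image_join) (simp add: pathfinish_def pathstart_def \<gamma>(2) linepath_1')
      then show "(linepath a b +++ \<gamma>) ` {0..1} = polyset (a # vs)"
        using \<gamma>(4) vs Cons polyset_Cons[of a b c r'] by (simp add: path_image_def linepath_image_01)
      show "inj_on (\<lambda>t. key ((linepath a b +++ \<gamma>) t)) {0..1}"
        by (rule inj_on_join_open[OF edge_keys_inj[OF ab] \<gamma>(5) meet])
    qed
  qed
qed

lemma polyset_sub: "gpath vs \<Longrightarrow> x \<in> polyset vs \<Longrightarrow> fst x \<in> F \<and> snd x \<in> F \<and> i (fst x) = i (snd x)"
proof -
  assume "gpath vs" "x \<in> polyset vs"
  then have "x \<in> vts \<or> x \<in> pairs" using polyset_cases gpath_vts by metis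
  then show ?thesis using vts_sub vts_diag_branch(2,3)[of x] unfolding pairs_def by auto
qed

text \<open>Two neighbours that differ modulo exchange exclude a branch point, whose neighbours are
  exchanges of each other, and a DB value, which has only one.\<close>

lemma interior_vertex:
  assumes g: "gpath vs" and n: "0 < n" "Suc n < length vs"
  shows "vs ! n \<in> pairs" "crossing (vs ! n)" "{x. adj (vs ! n) x} = {vs ! (n - 1), vs ! Suc n}"
proof -
  have a1: "adj (vs ! n) (vs ! (n - 1))" using gpath_adj[OF g, of "n - 1"] n adj_sym by simp
  have a2: "adj (vs ! n) (vs ! Suc n)" using gpath_adj[OF g n(2)] .
  have "n - 1 < length vs" using n by linarith
  then have k: "key (vs ! (n - 1)) \<noteq> key (vs ! Suc n)" using gpath_key[OF g _ n(2), of "n - 1"] n by auto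
  then have ne: "vs ! (n - 1) \<noteq> vs ! Suc n" by auto
  have V: "vs ! n \<in> vts" using gpath_vts[OF g] n by simp
  have "vs ! n \<notin> diag"
    using adj_branch[of "vs ! n" "vs ! (n - 1)" "vs ! Suc n"] a1 a2 k unfolding key_eq_iff by blast
  then show P: "vs ! n \<in> pairs" using V vts_sub by blast
  have "\<not> (\<exists>w. {x. adj (vs ! n) x} = {w})"
  proof
    assume "\<exists>w. {x. adj (vs ! n) x} = {w}"
    then obtain w where "{x. adj (vs ! n) x} = {w}" by blast
    then have "vs ! (n - 1) = w" "vs ! Suc n = w" using a1 a2 by blast+
    then show False using ne by simp
  qed
  then obtain w w' where w: "w \<noteq> w'" "{x. adj (vs ! n) x} = {w, w'}" "crossing (vs ! n)"
    using adj_degree[OF V P] by blast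
  then show "crossing (vs ! n)" by blast
  have "vs ! (n - 1) \<in> {w, w'}" "vs ! Suc n \<in> {w, w'}" using w(2) a1 a2 by blast+
  then have "(vs ! (n - 1) = w \<and> vs ! Suc n = w') \<or> (vs ! (n - 1) = w' \<and> vs ! Suc n = w)" using ne by auto
  then show "{x. adj (vs ! n) x} = {vs ! (n - 1), vs ! Suc n}" unfolding w(2) by auto
qed

text \<open>\<open>w\<close> is the initial vertex or its exchange; the resulting arc is trivial in
  the first case and non-trivial in the second. The inequality for \<open>w\<close> keeps the path
  from closing by running back along its last edge.\<close>

lemma closed_arc:
  assumes g: "gpath vs" and w: "adj (last vs) w" "key w = key (hd vs)" "w \<noteq> vs ! (length vs - 2)"
    and l: "last vs \<in> pairs" "crossing (last vs)"
  shows "\<exists>a b. closed_double_arc F M i a b \<and> polyset vs \<subseteq> strip a b"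
proof -
  have len: "2 \<le> length vs" using g unfolding gpath_def by blast
  define n where "n = length vs - 1"
  have n: "1 \<le> n" "length vs = Suc n" using len by (auto simp: n_def)
  have ne: "vs \<noteq> []" using len by auto
  have last: "last vs = vs ! n" using ne n by (simp add: last_conv_nth)
  have hd: "hd vs = vs ! 0" using ne by (simp add: hd_conv_nth)
  obtain \<gamma> :: "real \<Rightarrow> 'b \<times> 'b" where \<gamma>: "pl_on \<gamma> {0..1}" "\<gamma> 0 = hd vs" "\<gamma> 1 = last vs" "\<gamma> ` {0..1} = polyset vs" "inj_on (\<lambda>t. key (\<gamma> t)) {0..1}"
    using gpath_param[OF g] by blast
  let ?l = "linepath (last vs) w"
  have wV: "w \<in> vts" using w(1) unfolding adj_def by blast
  have meet: "(s = 1 \<and> t = 0) \<or> (s = 0 \<and> t = 1)"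
    if s: "s \<in> {0..1}" and t: "t \<in> {0..1}" and k: "key (\<gamma> s) = key (?l t)" for s t
  proof -
    let ?y = "?l t"
    have y: "?y \<in> closed_segment (last vs) w" using t by (simp add: linepath_in_path)
    have x: "\<gamma> s \<in> polyset vs" using s \<gamma>(4) by blast
    have lw: "last vs \<noteq> w" using w(1) unfolding adj_def by blast
    have injl: "t = t'" if "t' \<in> {0..1}" "?l t = ?l t'" for t'
      using inj_on_linepath[OF lw] t that by (metis inj_onD)
    consider "?y = last vs" | "?y = w" | "?y \<in> open_segment (last vs) w" using y unfolding open_segment_def by blast
    then show ?thesis
    proof cases
      case 1
      then have "key (\<gamma> s) = key (\<gamma> 1)" using k \<gamma>(3) by simp
      then have "s = 1" by (rule inj_onD[OF \<gamma>(5)]) (use s in auto)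
      moreover have "t = 0" using injl[of 0] 1 by (simp add: linepath_0')
      ultimately show ?thesis by simp
    next
      case 2
      then have "key (\<gamma> s) = key (\<gamma> 0)" using k \<gamma>(2) w(2) by simp
      then have "s = 0" by (rule inj_onD[OF \<gamma>(5)]) (use s in auto)
      moreover have "t = 1" using injl[of 1] 2 by (simp add: linepath_1')
      ultimately show ?thesis by simp
    next
      case 3
      have yV: "?y \<notin> vts" using 3 w(1) unfolding adj_def by blast
      have xy: "?y = \<gamma> s \<or> ?y = prod.swap (\<gamma> s)" using k unfolding key_eq_iff .
      then have "\<gamma> s \<notin> vts" using yV vts_swap[of "\<gamma> s"] by auto
      then obtain m where m: "Suc m < length vs" "\<gamma> s \<in> open_segment (vs ! m) (vs ! Suc m)"
        using polyset_cases[OF g x] gpath_vts[OF g] by metis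
      note am = gpath_adj[OF g m(1)]
      have "(key (vs ! m) = key (last vs) \<and> key (vs ! Suc m) = key w) \<or> (key (vs ! m) = key w \<and> key (vs ! Suc m) = key (last vs))"
        using edges_disjoint_key[OF am w(1) m(2) 3 k] .
      \<comment> \<open>The closing edge can coincide modulo exchange with an edge of the path only
        if the path is a single edge; the rest of this case excludes that.\<close>
      then have "m = n \<and> Suc m = 0 \<or> m = 0 \<and> Suc m = n"
        using gpath_key[OF g] m(1) n(2) last hd w(2) by (metis Suc_lessD lessI zero_less_Suc)
      then have m0: "m = 0" "n = 1" by auto
      have wne: "w \<noteq> vs ! 0" using w(3) n(2) m0 by simp
      have wsw: "w = prod.swap (vs ! 0)" using w(2) wne hd unfolding key_eq_iff by auto
      have lV: "last vs = vs ! 1" using last m0 by simp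
      have sl: "prod.swap (last vs) \<noteq> last vs" by (rule pairs_swap_neq[OF l(1)])
      from xy show ?thesis
      proof
        assume "?y = \<gamma> s"
        then have "(vs ! 0 = last vs \<and> vs ! 1 = w) \<or> (vs ! 0 = w \<and> vs ! 1 = last vs)"
          using edges_disjoint[OF am w(1) m(2)] 3 m0(1) by auto
        then show ?thesis using wne lw lV by auto
      next
        assume e: "?y = prod.swap (\<gamma> s)"
        have "?y \<in> open_segment (prod.swap (vs ! 0)) (prod.swap (vs ! 1))"
          using m(2) m0(1) e open_segment_linear_image[OF linear_swap inj_swap, of "vs ! 0" "vs ! 1"] by auto
        moreover have "adj (prod.swap (vs ! 0)) (prod.swap (vs ! 1))" using adj_swap am m0(1) by simp
        ultimately have "(prod.swap (vs ! 0) = last vs \<and> prod.swap (vs ! 1) = w) \<or> (prod.swap (vs ! 0) = w \<and> prod.swap (vs ! 1) = last vs)"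
          using edges_disjoint[OF _ w(1) _ 3] by blast
        then show ?thesis using wsw lw lV sl by auto
      qed
    qed
  qed
  let ?\<delta> = "\<gamma> +++ ?l"
  have pl: "pl_on ?\<delta> {0..1}" by (rule pl_on_join[OF \<gamma>(1) pl_on_linepath]) (simp add: \<gamma>(3) linepath_0')
  have inj: "inj_on (\<lambda>t. key (?\<delta> t)) {0..<1}"
    by (rule inj_on_join_closed[OF \<gamma>(5) edge_keys_inj[OF w(1)] meet])
  have "path_image ?\<delta> = path_image \<gamma> \<union> path_image ?l"
    by (rule path_image_join) (simp add: pathfinish_def pathstart_def \<gamma>(3) linepath_0')
  then have im: "?\<delta> ` {0..1} = polyset vs \<union> closed_segment (last vs) w"
    using \<gamma>(4) by (simp add: path_image_def linepath_image_01)
  \<comment> \<open>The closing edge yields a second edge at the initial vertex, which is therefore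
    neither a branch point nor over a DB value.\<close>
  have h: "hd vs \<in> pairs \<and> crossing (hd vs)"
  proof -
    have a1: "adj (vs ! 0) (vs ! 1)" using gpath_adj[OF g, of 0] n by simp
    obtain x where x: "adj (vs ! 0) x" "x \<noteq> vs ! 1" "key x = key (last vs)" "vs ! 0 \<in> diag \<Longrightarrow> key x \<noteq> key (vs ! 1)"
    proof (cases "w = vs ! 0")
      case True
      then have "n \<noteq> 1" using w(3) n(2) by auto
      then have "key (last vs) \<noteq> key (vs ! 1)" using gpath_key[OF g, of n 1] n last by auto
      moreover have "adj (vs ! 0) (last vs)" using adj_sym[OF w(1)] True by simp
      ultimately show thesis by (intro that[of "last vs"]) auto
    next
      case False
      then have wsw: "w = prod.swap (vs ! 0)" using w(2) hd unfolding key_eq_iff by auto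
      then have "adj (prod.swap (vs ! 0)) (last vs)" using adj_sym[OF w(1)] by simp
      then have "adj (vs ! 0) (prod.swap (last vs))" using adj_swap by fastforce
      moreover have "prod.swap (last vs) \<noteq> vs ! 1"
      proof
        assume e: "prod.swap (last vs) = vs ! 1"
        then have "key (vs ! n) = key (vs ! 1)" using last unfolding key_eq_iff by simp
        then have "n = 1" using gpath_key[OF g, of n 1] n by simp
        then have "prod.swap (last vs) = last vs" using e last by simp
        then show False using pairs_swap_neq[OF l(1)] by blast
      qed
      moreover have "vs ! 0 \<notin> diag" using False wsw by (auto simp: diag_def prod_eq_iff)
      ultimately show thesis using that[of "prod.swap (last vs)"] unfolding key_eq_iff by auto
    qed
    have V: "vs ! 0 \<in> vts" using a1 unfolding adj_def by blast
    have "vs ! 0 \<notin> diag"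
    proof
      assume d: "vs ! 0 \<in> diag"
      have "key x = key (vs ! 1)" using adj_branch[OF d x(1) a1] unfolding key_eq_iff .
      then show False using x(4)[OF d] by simp
    qed
    then have P: "vs ! 0 \<in> pairs" using V vts_sub by blast
    moreover have "crossing (vs ! 0)"
    proof -
      have "\<not> (\<exists>w. {x. adj (vs ! 0) x} = {w})"
      proof
        assume "\<exists>w. {x. adj (vs ! 0) x} = {w}"
        then obtain w where "{x. adj (vs ! 0) x} = {w}" by blast
        then have "x = w" "vs ! 1 = w" using a1 x(1) by blast+
        then show False using x(2) by simp
      qed
      then show ?thesis using adj_degree[OF V P] by blast
    qed
    ultimately show ?thesis using hd by simp
  qed
  have vert: "vs ! m \<in> pairs \<and> crossing (vs ! m)" if m: "m < length vs" for m
  proof -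
    consider "m = 0" | "m = n" | "0 < m" "Suc m < length vs" using m n by linarith
    then show ?thesis using h hd l last interior_vertex[OF g] by cases auto
  qed
  have cross_swap: "crossing (prod.swap v)" if "crossing v" "v \<in> pairs" for v
    using that unfolding crossing_def pairs_def by auto
  have wc: "w \<in> pairs \<and> crossing w"
    using w(2) h cross_swap pairs_swap unfolding key_eq_iff by (metis swap_swap)
  have all: "x \<in> pairs \<and> crossing x" if "x \<in> ?\<delta> ` {0..1}" for x
  proof -
    have "x \<in> polyset vs \<or> x \<in> closed_segment (last vs) w" using that im by blast
    then show ?thesis
    proof
      assume "x \<in> polyset vs"
      then show ?thesis using polyset_cases[OF g] vert edge_through(2) by metis
    next
      assume "x \<in> closed_segment (last vs) w"
      then have "x = last vs \<or> x = w \<or> x \<in> open_segment (last vs) w" unfolding open_segment_def by blast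
      then show ?thesis using l wc w(1) edge_through(2) unfolding adj_def by blast
    qed
  qed
  have onF: "fst (?\<delta> t) \<in> F \<and> snd (?\<delta> t) \<in> F" if "t \<in> {0..1}" for t
    using all[OF imageI[OF that]] by (simp add: pairs_def)
  have "closed_double_arc F M i (fst \<circ> ?\<delta>) (snd \<circ> ?\<delta>)"
    unfolding closed_double_arc_def double_track_def
  proof (intro conjI ballI)
    show "pl_on (fst \<circ> ?\<delta>) {0..1}" "pl_on (snd \<circ> ?\<delta>) {0..1}"
      unfolding o_def by (intro pl_on_linear_compose[OF pl] linear_fst linear_snd)+
    show "(fst \<circ> ?\<delta>) ` {0..1} \<subseteq> F" "(snd \<circ> ?\<delta>) ` {0..1} \<subseteq> F" using onF by auto
    show "inj_on (\<lambda>t. {(fst \<circ> ?\<delta>) t, (snd \<circ> ?\<delta>) t}) {0..<1}" using inj by (simp add: key_def)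
    have "?\<delta> 0 = hd vs" "?\<delta> 1 = w" using \<gamma>(2) by (simp_all add: joinpaths_def linepath_1')
    then show "{(fst \<circ> ?\<delta>) 0, (snd \<circ> ?\<delta>) 0} = {(fst \<circ> ?\<delta>) 1, (snd \<circ> ?\<delta>) 1}" using w(2) by (simp add: key_def)
    fix t :: real assume "t \<in> {0..1}"
    then have "?\<delta> t \<in> pairs \<and> crossing (?\<delta> t)" using all by blast
    then show "i ((fst \<circ> ?\<delta>) t) = i ((snd \<circ> ?\<delta>) t)" "(fst \<circ> ?\<delta>) t \<noteq> (snd \<circ> ?\<delta>) t"
      "double_value F M i (i ((fst \<circ> ?\<delta>) t)) \<or> triple_value F M i (i ((fst \<circ> ?\<delta>) t))"
      by (auto simp: pairs_def crossing_def)
  qed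
  moreover have "strip (fst \<circ> ?\<delta>) (snd \<circ> ?\<delta>) = ?\<delta> ` {0..1}" unfolding strip_def by simp
  ultimately show ?thesis using im by blast
qed

section \<open>Maximal paths and the arc through a pair\<close>

lemma gpath_rev: "gpath vs \<Longrightarrow> gpath (rev vs)"
  unfolding gpath_def
proof (intro conjI allI impI)
  assume g: "2 \<le> length vs \<and> (\<forall>n. Suc n < length vs \<longrightarrow> adj (vs ! n) (vs ! Suc n)) \<and> distinct (map key vs)"
  then show "2 \<le> length (rev vs)" "distinct (map key (rev vs))" by (simp_all add: rev_map[symmetric])
  fix n assume n: "Suc n < length (rev vs)"
  then have "Suc (length vs - Suc (Suc n)) < length vs" by simp
  then have "adj (vs ! (length vs - Suc (Suc n))) (vs ! Suc (length vs - Suc (Suc n)))" using g by blast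
  moreover have "Suc (length vs - Suc (Suc n)) = length vs - Suc n" using n by simp
  ultimately show "adj (rev vs ! n) (rev vs ! Suc n)" using n adj_sym by (simp add: rev_nth)
qed

lemma gpath_snoc:
  assumes "gpath vs" "adj (last vs) w" "key w \<notin> key ` set vs"
  shows "gpath (vs @ [w])"
  unfolding gpath_def
proof (intro conjI allI impI)
  show "2 \<le> length (vs @ [w])" "distinct (map key (vs @ [w]))" using assms unfolding gpath_def by auto
  fix n assume n: "Suc n < length (vs @ [w])"
  show "adj ((vs @ [w]) ! n) ((vs @ [w]) ! Suc n)"
  proof (cases "Suc n < length vs")
    case True then show ?thesis using gpath_adj[OF assms(1) True] by (simp add: nth_append)
  next
    case False
    then have "Suc n = length vs" using n by simp
    then have "vs ! n = last vs" by (metis Suc_not_Zero diff_Suc_1 last_conv_nth list.size(3))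
    then show ?thesis using assms(2) \<open>Suc n = length vs\<close> by (simp add: nth_append)
  qed
qed

lemma polyset_rev: "polyset (rev vs) \<subseteq> polyset vs"
proof
  fix x assume "x \<in> polyset (rev vs)"
  then obtain n where n: "Suc n < length vs" "x \<in> closed_segment (rev vs ! n) (rev vs ! Suc n)" unfolding polyset_def by auto
  define m where "m = length vs - Suc (Suc n)"
  have m: "Suc m < length vs" "rev vs ! n = vs ! Suc m" "rev vs ! Suc n = vs ! m"
    using n(1) by (auto simp: m_def rev_nth intro!: arg_cong[of _ _ "(!) vs"])
  have "x \<in> closed_segment (vs ! m) (vs ! Suc m)" using n(2) m by (simp add: closed_segment_commute)
  then show "x \<in> polyset vs" unfolding polyset_def using m(1) by blast
qed

definition arc_end :: "'b \<times> 'b \<Rightarrow> bool" where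
  "arc_end v \<longleftrightarrow> v \<in> diag \<or> v \<in> pairs \<and> DB_value F M i (i (fst v))"

text \<open>A vertex that is not an arc end has another edge, whose far end is on the path already,
  modulo exchange. It is no interior vertex of the path, since both edges there are used, so the
  path closes up at its start.\<close>

lemma maximal_last:
  assumes g: "gpath vs" and mx: "\<And>w. adj (last vs) w \<Longrightarrow> key w \<in> key ` set vs"
  shows "arc_end (last vs) \<or> (\<exists>a b. closed_double_arc F M i a b \<and> polyset vs \<subseteq> strip a b)"
proof (rule ccontr)
  assume no: "\<not> ?thesis"
  have len: "2 \<le> length vs" using g unfolding gpath_def by blast
  define n where "n = length vs - 1"
  have n: "1 \<le> n" "length vs = Suc n" using len by (auto simp: n_def)
  have ne: "vs \<noteq> []" using len by auto
  have last: "last vs = vs ! n" using ne n by (simp add: last_conv_nth)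
  have V: "last vs \<in> vts" using gpath_vts[OF g, of n] n last by simp
  have "last vs \<notin> diag" using no unfolding arc_end_def by blast
  then have P: "last vs \<in> pairs" using V vts_sub by blast
  then have "\<not> DB_value F M i (i (fst (last vs)))" using no unfolding arc_end_def by blast
  then obtain w1 w2 where w12: "w1 \<noteq> w2" "{x. adj (last vs) x} = {w1, w2}" "crossing (last vs)"
    using adj_degree[OF V P] by blast
  define pr where "pr = vs ! (n - 1)"
  have apr: "adj (last vs) pr" using gpath_adj[OF g, of "n - 1"] n last adj_sym by (simp add: pr_def)
  obtain w where w: "adj (last vs) w" "w \<noteq> pr"
  proof -
    have "adj (last vs) w1" "adj (last vs) w2" using w12(2) by blast+
    then show thesis using that w12(1) by metis
  qed
  obtain j where j: "j < length vs" "key w = key (vs ! j)" using mx[OF w(1)] by (auto simp: in_set_conv_nth)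
  have "j \<noteq> n"
  proof
    assume "j = n"
    then have "w = last vs \<or> w = prod.swap (last vs)" using j(2) last unfolding key_eq_iff by auto
    moreover have "w \<noteq> last vs" using w(1) unfolding adj_def by blast
    moreover have "w \<noteq> prod.swap (last vs)"
      using edge_swap_free[OF w(1), of "last vs"] pairs_swap_neq[OF P] by auto
    ultimately show False by blast
  qed
  moreover have "j = 0"
  proof (rule ccontr)
    assume "j \<noteq> 0"
    then have jj: "0 < j" "Suc j < length vs" using j(1) n \<open>j \<noteq> n\<close> by auto
    note iv = interior_vertex[OF g jj]
    have "w = vs ! j \<or> w = prod.swap (vs ! j)" using j(2) unfolding key_eq_iff by auto
    then obtain l' where l': "adj (vs ! j) l'" "key l' = key (last vs)" "w = vs ! j \<Longrightarrow> l' = last vs" "w \<noteq> vs ! j \<Longrightarrow> l' = prod.swap (last vs)"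
    proof
      assume "w = vs ! j"
      then show thesis using that[of "last vs"] adj_sym[OF w(1)] by simp
    next
      assume e: "w = prod.swap (vs ! j)"
      then have "adj (prod.swap (vs ! j)) (last vs)" using adj_sym[OF w(1)] by simp
      from adj_swap[OF this] have "adj (vs ! j) (prod.swap (last vs))" by simp
      moreover have "w \<noteq> vs ! j" using e pairs_swap_neq[OF iv(1)] by simp
      ultimately show thesis using that[of "prod.swap (last vs)"] unfolding key_eq_iff by auto
    qed
    have "l' \<in> {vs ! (j - 1), vs ! Suc j}" using iv(3) l'(1) by blast
    then have "key (vs ! n) = key (vs ! (j - 1)) \<or> key (vs ! n) = key (vs ! Suc j)" using l'(2) last by auto
    moreover have "n \<noteq> j - 1" using j(1) n jj by linarith
    moreover have "j - 1 < length vs" using jj by linarith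
    ultimately have nj: "n = Suc j" using gpath_key[OF g, of n] jj n(2) by (metis lessI)
    then have "l' = vs ! n \<or> l' = pr'" if "pr' = vs ! (j - 1)" for pr' using \<open>l' \<in> _\<close> that by auto
    then have "l' = last vs"
      using gpath_key[OF g, of n "j - 1"] l'(2) last \<open>n \<noteq> j - 1\<close> \<open>j - 1 < length vs\<close> n(2) by (metis lessI)
    then have "w = vs ! j" using l'(4) pairs_swap_neq[OF P] by metis
    then show False using w(2) nj by (simp add: pr_def)
  qed
  ultimately have "key w = key (hd vs)" "w \<noteq> vs ! (length vs - 2)"
    using j(2) ne n w(2) by (auto simp: hd_conv_nth pr_def)
  then show False using closed_arc[OF g w(1) _ _ P w12(3)] no by blast
qed

lemma open_arc:
  assumes g: "gpath vs" and e: "arc_end (hd vs)" "arc_end (last vs)"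
  shows "\<exists>a b. open_double_arc F M i a b \<and> polyset vs \<subseteq> strip a b"
proof -
  have len: "2 \<le> length vs" using g unfolding gpath_def by blast
  have ne: "vs \<noteq> []" using len by auto
  obtain \<gamma> :: "real \<Rightarrow> 'b \<times> 'b" where \<gamma>: "pl_on \<gamma> {0..1}" "\<gamma> 0 = hd vs" "\<gamma> 1 = last vs" "\<gamma> ` {0..1} = polyset vs" "inj_on (\<lambda>t. key (\<gamma> t)) {0..1}"
    using gpath_param[OF g] by blast
  have sub: "fst (\<gamma> t) \<in> F \<and> snd (\<gamma> t) \<in> F \<and> i (fst (\<gamma> t)) = i (snd (\<gamma> t))" if "t \<in> {0..1}" for t
    using polyset_sub[OF g, of "\<gamma> t"] \<gamma>(4) that by blast
  have int: "\<gamma> t \<in> pairs \<and> crossing (\<gamma> t)" if t: "t \<in> {0<..<1}" for t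
  proof -
    have "\<gamma> t \<in> polyset vs" using t \<gamma>(4) by fastforce
    then consider n where "n < length vs" "\<gamma> t = vs ! n" | "\<gamma> t \<in> pairs" "\<gamma> t \<notin> vts"
      using polyset_cases[OF g] by metis
    then show ?thesis
    proof cases
      case (1 n)
      have "n \<noteq> 0"
      proof
        assume "n = 0"
        then have "key (\<gamma> t) = key (\<gamma> 0)" using 1 \<gamma>(2) ne by (simp add: hd_conv_nth)
        then have "t = 0" by (rule inj_onD[OF \<gamma>(5)]) (use t in auto)
        then show False using t by simp
      qed
      moreover have "n \<noteq> length vs - 1"
      proof
        assume "n = length vs - 1"
        then have "key (\<gamma> t) = key (\<gamma> 1)" using 1 \<gamma>(3) ne by (simp add: last_conv_nth)
        then have "t = 1" by (rule inj_onD[OF \<gamma>(5)]) (use t in auto)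
        then show False using t by simp
      qed
      ultimately have "0 < n" "Suc n < length vs" using 1(1) by auto
      then show ?thesis using interior_vertex[OF g] 1(2) by simp
    next
      case 2 then show ?thesis using edge_through(2) by blast
    qed
  qed
  have ends: "branch_value F M i (i (fst (\<gamma> t))) \<or> fst (\<gamma> t) \<noteq> snd (\<gamma> t) \<and> DB_value F M i (i (fst (\<gamma> t)))"
    if t: "t \<in> {0, 1}" for t
  proof -
    have ae: "arc_end (\<gamma> t)" using t e \<gamma>(2,3) by auto
    have V: "hd vs \<in> vts" "last vs \<in> vts"
      using gpath_vts[OF g, of 0] gpath_vts[OF g, of "length vs - 1"] ne by (simp_all add: hd_conv_nth last_conv_nth)
    then have "\<gamma> t \<in> vts" using t \<gamma>(2,3) by auto
    then show ?thesis using ae vts_diag_branch(1) unfolding arc_end_def pairs_def by blast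
  qed
  have "open_double_arc F M i (fst \<circ> \<gamma>) (snd \<circ> \<gamma>)"
    unfolding open_double_arc_def double_track_def
  proof (intro conjI ballI)
    show "pl_on (fst \<circ> \<gamma>) {0..1}" "pl_on (snd \<circ> \<gamma>) {0..1}"
      unfolding o_def by (intro pl_on_linear_compose[OF \<gamma>(1)] linear_fst linear_snd)+
    show "(fst \<circ> \<gamma>) ` {0..1} \<subseteq> F" "(snd \<circ> \<gamma>) ` {0..1} \<subseteq> F" using sub by auto
    show "inj_on (\<lambda>t. {(fst \<circ> \<gamma>) t, (snd \<circ> \<gamma>) t}) {0..1}" using \<gamma>(5) by (simp add: key_def)
    show "i ((fst \<circ> \<gamma>) t) = i ((snd \<circ> \<gamma>) t)" if "t \<in> {0..1}" for t using sub[OF that] by simp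
    fix t :: real assume "t \<in> {0<..<1}"
    from int[OF this] show "(fst \<circ> \<gamma>) t \<noteq> (snd \<circ> \<gamma>) t"
      "double_value F M i (i ((fst \<circ> \<gamma>) t)) \<or> triple_value F M i (i ((fst \<circ> \<gamma>) t))"
      by (auto simp: pairs_def crossing_def)
  next
    fix t :: real assume "t \<in> {0, 1}"
    from ends[OF this] show "branch_value F M i (i ((fst \<circ> \<gamma>) t)) \<or> (fst \<circ> \<gamma>) t \<noteq> (snd \<circ> \<gamma>) t \<and> DB_value F M i (i ((fst \<circ> \<gamma>) t))"
      by simp
  qed
  moreover have "strip (fst \<circ> \<gamma>) (snd \<circ> \<gamma>) = \<gamma> ` {0..1}" unfolding strip_def by simp
  ultimately show ?thesis using \<gamma>(4) by blast
qed

text \<open>A longest path through the edge exists, as its length is bounded by the number of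
  vertices. Either both its ends are arc ends, or it closes up.\<close>

lemma arc_through_edge:
  assumes e: "adj e1 e2"
  shows "\<exists>a b. double_arc F M i a b \<and> closed_segment e1 e2 \<subseteq> strip a b"
proof -
  define good where "good = (\<lambda>vs. gpath vs \<and> (\<exists>n. Suc n < length vs \<and> {vs ! n, vs ! Suc n} = {e1, e2}))"
  have "key e1 \<noteq> key e2"
  proof
    assume "key e1 = key e2"
    moreover have ne: "e1 \<noteq> e2" using e unfolding adj_def by blast
    ultimately have "prod.swap e1 = e2" unfolding key_eq_iff by auto
    then show False using edge_swap_free[OF e, of e1] ne by simp
  qed
  then have "gpath [e1, e2]" unfolding gpath_def using e by auto
  then have g0: "good [e1, e2]" unfolding good_def by (intro conjI exI[of _ 0]) auto
  have bound: "length vs < Suc (card vts)" if "good vs" for vs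
  proof -
    have g: "gpath vs" using that unfolding good_def by blast
    then have "distinct vs" unfolding gpath_def by (simp add: distinct_map)
    then have "length vs = card (set vs)" by (simp add: distinct_card)
    also have "\<dots> \<le> card vts"
    proof (rule card_mono[OF finite_vts], rule subsetI)
      fix x assume "x \<in> set vs"
      then obtain j where "j < length vs" "vs ! j = x" unfolding in_set_conv_nth by blast
      then show "x \<in> vts" using gpath_vts[OF g, of j] by simp
    qed
    finally show ?thesis by simp
  qed
  obtain vs where vs: "good vs" "\<And>us. good us \<Longrightarrow> length us \<le> length vs"
    using ex_has_greatest_nat[of good "[e1, e2]" length "Suc (card vts)"] g0 bound by blast
  have g: "gpath vs" using vs(1) unfolding good_def by blast
  obtain n where n: "Suc n < length vs" "{vs ! n, vs ! Suc n} = {e1, e2}" using vs(1) unfolding good_def by blast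
  have seg: "closed_segment e1 e2 \<subseteq> polyset vs"
  proof -
    have "closed_segment e1 e2 = closed_segment (vs ! n) (vs ! Suc n)" using n(2) by simp
    moreover have "closed_segment (vs ! n) (vs ! Suc n) \<subseteq> polyset vs"
      unfolding polyset_def using n(1) by (intro UN_upper) simp
    ultimately show ?thesis by (simp only:)
  qed
  have mx: "key w \<in> key ` set us" if us: "good us" "length us = length vs" and w: "adj (last us) w" for us w
  proof (rule ccontr)
    assume "key w \<notin> key ` set us"
    moreover have gu: "gpath us" using us(1) unfolding good_def by blast
    ultimately have "gpath (us @ [w])" using gpath_snoc w by blast
    moreover obtain m where "Suc m < length us" "{us ! m, us ! Suc m} = {e1, e2}" using us(1) unfolding good_def by blast
    then have "Suc m < length (us @ [w]) \<and> {(us @ [w]) ! m, (us @ [w]) ! Suc m} = {e1, e2}" by (simp add: nth_append)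
    ultimately have "good (us @ [w])" unfolding good_def by blast
    then show False using vs(2) us(2) by fastforce
  qed
  \<comment> \<open>The reversed path is longest as well, so the argument for the last vertex also
    applies to the first.\<close>
  have gr: "good (rev vs)" unfolding good_def
  proof (intro conjI exI)
    show "gpath (rev vs)" using gpath_rev[OF g] .
    have "Suc (length vs - Suc (Suc n)) = length vs - Suc n" using n(1) by simp
    then show "Suc (length vs - Suc (Suc n)) < length (rev vs)" using n(1) by simp
    have "rev vs ! (length vs - Suc (Suc n)) = vs ! Suc n" "rev vs ! Suc (length vs - Suc (Suc n)) = vs ! n"
      using n(1) by (simp_all add: rev_nth Suc_diff_Suc)
    then show "{rev vs ! (length vs - Suc (Suc n)), rev vs ! Suc (length vs - Suc (Suc n))} = {e1, e2}"
      using n(2) by (simp add: insert_commute)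
  qed
  have ne: "vs \<noteq> []" using n(1) by auto
  consider "\<exists>a b. closed_double_arc F M i a b \<and> polyset vs \<subseteq> strip a b" | "arc_end (last vs)" "arc_end (hd vs)"
    | "\<exists>a b. closed_double_arc F M i a b \<and> polyset (rev vs) \<subseteq> strip a b"
    using maximal_last[OF g mx[OF vs(1) refl]] maximal_last[OF gpath_rev[OF g] mx[OF gr]] ne by (auto simp: last_rev)
  then show ?thesis
  proof cases
    case 1 then show ?thesis using seg unfolding double_arc_def by blast
  next
    case 2 then show ?thesis using open_arc[OF g] seg unfolding double_arc_def by blast
  next
    case 3
    moreover have "polyset vs \<subseteq> polyset (rev vs)" using polyset_rev[of "rev vs"] by simp
    ultimately show ?thesis using seg unfolding double_arc_def by blast
  qed
qed

lemma arc_through: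
  assumes z: "z \<in> pairs"
  shows "\<exists>a b. double_arc F M i a b \<and> z \<in> strip a b"
proof (cases "z \<in> vts")
  case False
  then obtain v w where "adj v w" "z \<in> open_segment v w" using edge_through(1)[OF z] by blast
  then show ?thesis using arc_through_edge[of v w] open_closed_segment by blast
next
  case True
  then obtain w where "adj z w" using adj_degree[OF True z] by blast
  then show ?thesis using arc_through_edge[of z w] by (meson ends_in_segment(1) subsetD)
qed

end

section \<open>Strips and lifting attempts\<close>

context generic_map
begin

text \<open>By invariance of domain, a small open cube around the value would be mapped onto an open
  neighbourhood of 0 inside the half cube.\<close>

lemma crossing_not_DB:
  assumes "crossing z" "DB_value F M i (i (fst z))"
  shows False
proof -
  let ?p = "i (fst z)"
  obtain K where "sheets_at F M i cube K ?p"
    using assms(1) unfolding crossing_def double_value_def triple_value_def by blast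
  then obtain N f g where N: "nbhd_in M ?p N" "pl_homeomorphism N cube f g" "f ?p = 0"
    unfolding sheets_at_def by auto
  obtain K' where "sheets_at F M i half_cube K' ?p" using assms(2) unfolding DB_value_def by blast
  then obtain N' f' g' where N': "nbhd_in M ?p N'" "pl_homeomorphism N' half_cube f' g'" "f' ?p = 0"
    unfolding sheets_at_def by auto
  have h: "homeomorphism N cube f g" "homeomorphism N' half_cube f' g'"
    using N(2) N'(2) unfolding pl_homeomorphism_def by blast+
  obtain U where U: "openin (top_of_set M) U" "?p \<in> U" "U \<subseteq> N'" using N'(1) unfolding nbhd_in_def by blast
  obtain P where P: "open P" "U = M \<inter> P" using U(1) openin_open by metis
  have pN: "?p \<in> N" "N \<subseteq> M" using N(1) unfolding nbhd_in_def by auto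
  have cg: "continuous_on cube g" using homeomorphism_cont2[OF h(1)] .
  obtain V where V: "open V" "g -` P \<inter> cube = V \<inter> cube"
    using continuous_on_open_invariant[of cube g] cg P(1) by metis
  have g0: "g 0 = ?p" using homeomorphism_apply1[OF h(1) pN(1)] N(3) by simp
  have "(0::real^3) \<in> cube" by (simp add: mem_cube)
  then have "0 \<in> V" using V(2) g0 U(2) P(2) by auto
  then obtain r where r: "0 < r" "r < 1" "ocube r \<subseteq> V" using ocube_small[OF V(1)] by metis
  have rc: "ocube r \<subseteq> cube" using r(2) by (force simp: ocube_def mem_cube intro: less_imp_le less_trans)
  have into: "g v \<in> N'" if "v \<in> ocube r" for v
  proof -
    have "g v \<in> P" using V(2) r(3) rc that by blast
    moreover have "g v \<in> M" using homeomorphism_image2[OF h(1)] rc that pN(2) by blast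
    ultimately show ?thesis using P(2) U(3) by blast
  qed
  have "continuous_on (ocube r) (\<lambda>v. f' (g v))"
    by (rule continuous_on_compose2[OF homeomorphism_cont1[OF h(2)] continuous_on_subset[OF cg rc]]) (use into in auto)
  moreover have "inj_on (\<lambda>v. f' (g v)) (ocube r)"
  proof (rule inj_onI)
    fix v w assume vw: "v \<in> ocube r" "w \<in> ocube r" "f' (g v) = f' (g w)"
    then have "g v = g w" using homeomorphism_apply1[OF h(2)] into by metis
    then show "v = w" using homeomorphism_apply2[OF h(1)] rc vw by (metis subsetD)
  qed
  ultimately have op: "open ((\<lambda>v. f' (g v)) ` ocube r)" using invariance_of_domain open_ocube by blast
  have "0 \<in> (\<lambda>v. f' (g v)) ` ocube r"
    by (rule image_eqI[of _ _ 0]) (use g0 N'(3) r(1) in \<open>auto simp: ocube_def\<close>)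
  then obtain e where e: "e > 0" "ball 0 e \<subseteq> (\<lambda>v. f' (g v)) ` ocube r" using op open_contains_ball by metis
  have "pt 0 0 (- e / 2) \<in> ball 0 e"
  proof -
    have "norm (pt 0 0 (- e / 2)) \<le> (\<Sum>k\<in>UNIV. \<bar>pt 0 0 (- e / 2) $ k\<bar>)" by (rule norm_le_l1_cart)
    also have "\<dots> < e" using e(1) by (simp add: sum_3)
    finally show ?thesis by simp
  qed
  then have "pt 0 0 (- e / 2) \<in> (\<lambda>v. f' (g v)) ` ocube r" using e(2) by blast
  then obtain v where v: "v \<in> ocube r" "pt 0 0 (- e / 2) = f' (g v)" by blast
  then have "pt 0 0 (- e / 2) \<in> half_cube" using homeomorphism_image1[OF h(2)] into by auto
  then show False using e(1) by (simp add: half_cube_def half_space_def)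
qed

context
  fixes z W T \<tau> lam
  assumes pc: "pair_chart_at z W T \<tau> lam"
begin

definition half_arc :: "(real \<Rightarrow> 'b \<times> 'b) \<Rightarrow> real \<Rightarrow> bool" where
  "half_arc \<phi> e \<longleftrightarrow> 0 < e \<and> continuous_on {0..e} \<phi> \<and> \<phi> 0 = z \<and> \<phi> ` {0..e} \<subseteq> pairs \<inter> W \<and> (\<forall>s\<in>{0<..e}. \<phi> s \<noteq> z)"

lemma half_arc_reaches:
  assumes h: "half_arc \<phi> e" and c: "0 < c" "c \<le> s * lam (\<phi> e)"
  obtains t where "0 < t" "t \<le> e" "s * lam (\<phi> t) = c"
proof -
  have e: "0 < e" "continuous_on {0..e} \<phi>" "\<phi> 0 = z" "\<phi> ` {0..e} \<subseteq> pairs \<inter> W" using h unfolding half_arc_def by auto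
  have cont: "continuous_on {0..e} (\<lambda>t. s * lam (\<phi> t))"
    by (intro continuous_intros continuous_on_compose2[OF lam_continuous[OF pc] e(2)]) (use e in auto)
  have "s * lam (\<phi> 0) \<le> c" using lam_zero[OF pc] c e(3) by simp
  then obtain t where t: "0 \<le> t" "t \<le> e" "s * lam (\<phi> t) = c"
    using IVT'[of "\<lambda>t. s * lam (\<phi> t)" 0 c e] cont c(2) e(1) by auto
  have "t \<noteq> 0" using t(3) lam_zero[OF pc] c(1) e(3) by auto
  then show thesis using that[of t] t by simp
qed

lemma half_arc_sign:
  assumes h: "half_arc \<phi> e"
  obtains s where "s = 1 \<or> s = -1" "s * lam (\<phi> e) > 0"
proof -
  have "\<phi> e \<in> pairs \<inter> W" "\<phi> e \<noteq> z" using h unfolding half_arc_def by auto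
  then have "lam (\<phi> e) \<noteq> 0" using lam_inverse(1)[OF pc] pair_chart_atD(4)[OF pc] by metis
  then have "1 * lam (\<phi> e) > 0 \<or> -1 * lam (\<phi> e) > 0" by auto
  then show thesis using that by blast
qed

text \<open>The chart coordinate takes all values between 0 and its final one along the arc, and it
  determines the pair.\<close>

lemma half_arc_cover:
  assumes h: "half_arc \<phi> e" and s: "s = 1 \<or> s = -1" and w: "w \<in> pairs \<inter> W" "0 < s * lam w" "s * lam w \<le> s * lam (\<phi> e)"
  shows "w \<in> \<phi> ` {0<..e}"
proof -
  obtain t where t: "0 < t" "t \<le> e" "s * lam (\<phi> t) = s * lam w" by (rule half_arc_reaches[OF h w(2,3)])
  then have "lam (\<phi> t) = lam w" using s by auto
  moreover have "\<phi> t \<in> pairs \<inter> W" using h t unfolding half_arc_def by auto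
  ultimately have "\<phi> t = w" using lam_inverse(1)[OF pc] w(1) by metis
  then show ?thesis using t by auto
qed

lemma lam_small_nbhd:
  assumes "0 < c"
  obtains W' where "open W'" "z \<in> W'" "\<And>w. w \<in> pairs \<inter> W' \<Longrightarrow> w \<in> W \<and> \<bar>lam w\<bar> < c"
proof -
  have "openin (top_of_set (pairs \<inter> W)) (pairs \<inter> W \<inter> lam -` {-c<..<c})"
    by (rule continuous_openin_preimage_gen[OF lam_continuous[OF pc]]) simp
  then obtain V where V: "open V" "pairs \<inter> W \<inter> lam -` {-c<..<c} = pairs \<inter> W \<inter> V" unfolding openin_open by blast
  have "z \<in> pairs \<inter> W" using z_pairs[OF pc] pair_chart_atD(2)[OF pc] by blast
  then have "z \<in> V" using V(2) lam_zero[OF pc] assms by auto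
  show thesis
  proof (rule that[of "W \<inter> V"])
    show "open (W \<inter> V)" "z \<in> W \<inter> V" using V(1) \<open>z \<in> V\<close> pair_chart_atD(1,2)[OF pc] by auto
    fix w assume w: "w \<in> pairs \<inter> (W \<inter> V)"
    then have "w \<in> pairs \<inter> W \<inter> lam -` {-c<..<c}" using V(2) by blast
    then show "w \<in> W \<and> \<bar>lam w\<bar> < c" by auto
  qed
qed

text \<open>Half arcs that leave on the same side overlap, so disjoint ones leave on opposite sides
  and together fill a neighbourhood.\<close>

lemma two_half_arcs_cover:
  assumes h: "half_arc \<phi> e" "half_arc \<psi> d" and dis: "\<phi> ` {0<..e} \<inter> \<psi> ` {0<..d} = {}"
  shows "\<exists>W'. open W' \<and> z \<in> W' \<and> pairs \<inter> W' \<subseteq> \<phi> ` {0..e} \<union> \<psi> ` {0..d}"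
proof -
  obtain s where s: "s = 1 \<or> s = -1" "s * lam (\<phi> e) > 0" by (rule half_arc_sign[OF h(1)])
  obtain s' where s': "s' = 1 \<or> s' = -1" "s' * lam (\<psi> d) > 0" by (rule half_arc_sign[OF h(2)])
  have in1: "\<phi> e \<in> pairs \<inter> W" "\<phi> e \<in> \<phi> ` {0<..e}" and in2: "\<psi> d \<in> pairs \<inter> W" "\<psi> d \<in> \<psi> ` {0<..d}"
    using h unfolding half_arc_def by auto
  have "s \<noteq> s'"
  proof
    assume e: "s = s'"
    show False
    proof (cases "s * lam (\<phi> e) \<le> s * lam (\<psi> d)")
      case True
      have "\<phi> e \<in> \<psi> ` {0<..d}"
        by (rule half_arc_cover[OF h(2) s'(1) in1(1)]) (use s s' e True in auto)
      then show False using dis in1(2) by blast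
    next
      case False
      have "\<psi> d \<in> \<phi> ` {0<..e}"
        by (rule half_arc_cover[OF h(1) s(1) in2(1)]) (use s s' e False in auto)
      then show False using dis in2(2) by blast
    qed
  qed
  then have ss: "s' = - s" using s(1) s'(1) by auto
  define c where "c = min (s * lam (\<phi> e)) (s' * lam (\<psi> d))"
  have c: "0 < c" using s(2) s'(2) by (simp add: c_def)
  obtain W' where W': "open W'" "z \<in> W'" "\<And>w. w \<in> pairs \<inter> W' \<Longrightarrow> w \<in> W \<and> \<bar>lam w\<bar> < c"
    using lam_small_nbhd[OF c] by metis
  have "pairs \<inter> W' \<subseteq> \<phi> ` {0..e} \<union> \<psi> ` {0..d}"
  proof
    fix w assume w: "w \<in> pairs \<inter> W'"
    have wW: "w \<in> pairs \<inter> W" "\<bar>lam w\<bar> < c" using W'(3)[OF w] w by auto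
    have ls: "s * lam w < c" "s' * lam w < c" using wW(2) s(1) s'(1) by auto
    consider "s * lam w > 0" | "s' * lam w > 0" | "lam w = 0" using s(1) ss by fastforce
    then show "w \<in> \<phi> ` {0..e} \<union> \<psi> ` {0..d}"
    proof cases
      case 1
      have "w \<in> \<phi> ` {0<..e}" by (rule half_arc_cover[OF h(1) s(1) wW(1) 1]) (use ls in \<open>simp add: c_def\<close>)
      then show ?thesis by force
    next
      case 2
      have "w \<in> \<psi> ` {0<..d}" by (rule half_arc_cover[OF h(2) s'(1) wW(1) 2]) (use ls in \<open>simp add: c_def\<close>)
      then show ?thesis by force
    next
      case 3
      then have "w = z" using lam_inverse(1)[OF pc wW(1)] pair_chart_atD(4)[OF pc] by simp
      moreover have "\<phi> 0 = z" "0 < e" using h(1) unfolding half_arc_def by auto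
      ultimately show ?thesis by force
    qed
  qed
  then show ?thesis using W'(1,2) by blast
qed

text \<open>At an end of the 1-manifold there is only one side on which to leave.\<close>

lemma boundary_half_arc_cover:
  assumes h: "half_arc \<phi> e" and T: "T = {0..1}"
  shows "\<exists>W'. open W' \<and> z \<in> W' \<and> pairs \<inter> W' \<subseteq> \<phi> ` {0..e}"
proof -
  have in1: "\<phi> e \<in> pairs \<inter> W" using h unfolding half_arc_def by auto
  obtain s where s: "s = 1 \<or> s = -1" "s * lam (\<phi> e) > 0" by (rule half_arc_sign[OF h])
  have "lam (\<phi> e) \<ge> 0" using lam_inverse(2)[OF pc in1] T by simp
  then have c: "0 < lam (\<phi> e)" using s by auto
  obtain W' where W': "open W'" "z \<in> W'" "\<And>w. w \<in> pairs \<inter> W' \<Longrightarrow> w \<in> W \<and> \<bar>lam w\<bar> < lam (\<phi> e)"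
    using lam_small_nbhd[OF c] by metis
  have "pairs \<inter> W' \<subseteq> \<phi> ` {0..e}"
  proof
    fix w assume w: "w \<in> pairs \<inter> W'"
    have wW: "w \<in> pairs \<inter> W" "\<bar>lam w\<bar> < lam (\<phi> e)" using W'(3)[OF w] w by auto
    have "lam w \<ge> 0" using lam_inverse(2)[OF pc wW(1)] T by simp
    then consider "1 * lam w > 0" | "lam w = 0" by fastforce
    then show "w \<in> \<phi> ` {0..e}"
    proof cases
      case 1
      have "w \<in> \<phi> ` {0<..e}" by (rule half_arc_cover[OF h _ wW(1) 1]) (use wW in auto)
      then show ?thesis by force
    next
      case 2
      then have "w = z" using lam_inverse(1)[OF pc wW(1)] pair_chart_atD(4)[OF pc] by simp
      moreover have "\<phi> 0 = z" "0 < e" using h unfolding half_arc_def by auto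
      ultimately show ?thesis by force
    qed
  qed
  then show ?thesis using W'(1,2) by blast
qed

lemma ex_half_arc:
  assumes c: "continuous_on {0..d} \<phi>" "0 < d" "\<phi> 0 = z" "\<And>s. 0 < s \<Longrightarrow> s \<le> d \<Longrightarrow> \<phi> s \<in> pairs \<and> \<phi> s \<noteq> z"
  obtains e where "e \<le> d" "half_arc \<phi> e"
proof -
  obtain U where U: "open U" "\<phi> -` W \<inter> {0..d} = U \<inter> {0..d}"
    using continuous_on_open_invariant[of "{0..d}" \<phi>] c(1) pair_chart_atD(1)[OF pc] by metis
  have "0 \<in> \<phi> -` W \<inter> {0..d}" using c(2,3) pair_chart_atD(2)[OF pc] by simp
  then have "0 \<in> U" using U(2) by blast
  then obtain \<rho> where \<rho>: "\<rho> > 0" "ball 0 \<rho> \<subseteq> U" using U(1) open_contains_ball by blast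
  define e where "e = min d (\<rho> / 2)"
  have e: "0 < e" "e \<le> d" "e < \<rho>" using c(2) \<rho>(1) by (auto simp: e_def)
  have "\<phi> s \<in> W" if "s \<in> {0..e}" for s
  proof -
    have "s \<in> ball 0 \<rho>" using that e by simp
    then have "s \<in> U \<inter> {0..d}" using \<rho>(2) that e by auto
    then show ?thesis using U(2) by blast
  qed
  moreover have "\<phi> s \<in> pairs" if "s \<in> {0..e}" for s
    using c(3) c(4)[of s] z_pairs[OF pc] that e by (cases "s = 0") auto
  ultimately have "half_arc \<phi> e" unfolding half_arc_def
    using e c(3) c(4) continuous_on_subset[OF c(1)] by auto
  then show thesis using that e(2) by blast
qed

end

section \<open>Strips as components of the set of pairs\<close>

lemma double_arc_track:
  assumes "double_arc F M i a b"
  shows "continuous_on {0..1} (\<lambda>t. (a t, b t))" "\<And>t. t \<in> {0<..<1} \<Longrightarrow> (a t, b t) \<in> pairs"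
proof -
  have tr: "double_track F i a b" using assms unfolding double_arc_def open_double_arc_def closed_double_arc_def by blast
  then show "continuous_on {0..1} (\<lambda>t. (a t, b t))"
    unfolding double_track_def by (intro continuous_on_Pair pl_on_continuous) auto
  fix t :: real assume t: "t \<in> {0<..<1}"
  have "a t \<noteq> b t" using assms t unfolding double_arc_def open_double_arc_def closed_double_arc_def by force
  then show "(a t, b t) \<in> pairs" using tr t unfolding double_track_def pairs_def by force
qed

lemma strip_closed: "double_arc F M i a b \<Longrightarrow> closed (strip a b)"
  unfolding strip_def using double_arc_track(1)[of a b]
  by (intro compact_imp_closed compact_continuous_image) auto

text \<open>Only end points of the parameter interval can fall on the diagonal, and omitting them
  does not disconnect it.\<close>

lemma strip_pairs_connected:
  assumes "double_arc F M i a b"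
  shows "connected (strip a b \<inter> pairs)"
proof -
  define J where "J = {t \<in> {0..1}. (a t, b t) \<in> pairs}"
  have "connected J"
  proof (rule connected_intermediate_closure[of "{0<..<1}"])
    show "{0<..<1} \<subseteq> J" using double_arc_track(2)[OF assms] by (auto simp: J_def)
    show "J \<subseteq> closure {0<..<1}" by (auto simp: J_def)
  qed simp
  then have "connected ((\<lambda>t. (a t, b t)) ` J)"
    by (rule connected_continuous_image[rotated]) (rule continuous_on_subset[OF double_arc_track(1)[OF assms]], auto simp: J_def)
  moreover have "(\<lambda>t. (a t, b t)) ` J = strip a b \<inter> pairs" unfolding J_def strip_def by auto
  ultimately show ?thesis by simp
qed

lemma double_arc_swap:
  assumes "double_arc F M i a b"
  shows "double_arc F M i b a"
proof -
  have tr: "double_track F i a b" using assms unfolding double_arc_def open_double_arc_def closed_double_arc_def by blast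
  then have eq: "i (b t) = i (a t)" if "t \<in> {0..1}" for t using that unfolding double_track_def by simp
  have tr': "double_track F i b a" using tr unfolding double_track_def by simp
  have com: "{b t, a t} = {a t, b t}" for t by blast
  have neq: "b t \<noteq> a t \<longleftrightarrow> a t \<noteq> b t" for t by metis
  show ?thesis
    using assms tr' eq unfolding double_arc_def open_double_arc_def closed_double_arc_def com neq by (simp, elim disjE) simp_all
qed

text \<open>Inside the arc, the two directions of the parameter give disjoint half arcs. At the
  junction of a trivial closed arc they come from the two ends of the parameter interval; for a
  non-trivial arc these ends are different pairs. At a DB end, one half arc fills the half-interval
  chart.\<close>

lemma strip_open:
  assumes arc: "double_arc F M i a b" and nt: "no_nontrivial_closed_double_arcs F M i"
    and z: "z \<in> strip a b" "z \<in> pairs"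
  shows "\<exists>W'. open W' \<and> z \<in> W' \<and> pairs \<inter> W' \<subseteq> strip a b"
proof -
  define \<gamma> where "\<gamma> = (\<lambda>t. (a t, b t))"
  note cont = double_arc_track(1)[OF arc, folded \<gamma>_def]
  have inP: "\<gamma> t \<in> pairs" if "t \<in> {0<..<1}" for t using double_arc_track(2)[OF arc that] by (simp add: \<gamma>_def)
  have st: "strip a b = \<gamma> ` {0..1}" unfolding strip_def \<gamma>_def by simp
  obtain t0 where t0: "t0 \<in> {0..1}" "z = \<gamma> t0" using z(1) st by blast
  obtain W T \<tau> lam where pc: "pair_chart_at z W T \<tau> lam" using ex_pair_chart_at[OF z(2)] by (elim exE)
  have inj: "s = t" if "s \<in> {0..<1}" "t \<in> {0..<1}" "\<gamma> s = \<gamma> t" for s t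
  proof -
    have "inj_on (\<lambda>t. {a t, b t}) {0..<1}"
      using arc unfolding double_arc_def open_double_arc_def closed_double_arc_def by (auto elim: inj_on_subset)
    then show ?thesis by (rule inj_onD) (use that in \<open>auto simp: \<gamma>_def\<close>)
  qed
  have contr: "continuous_on {0..d} (\<lambda>s. \<gamma> (c + s))" "continuous_on {0..d} (\<lambda>s. \<gamma> (c' - s))"
    if "0 \<le> c" "c + d \<le> 1" "c' \<le> 1" "0 \<le> c' - d" for c c' d
    by (rule continuous_on_compose2[OF cont], use that in \<open>auto intro!: continuous_intros\<close>)+
  \<comment> \<open>The arc is followed forwards from \<open>c\<close> and backwards from
    \<open>c'\<close>: both are \<open>t0\<close> inside the arc, and they are 0 and 1 at the
    junction of a closed arc.\<close>
  have two: ?thesis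
    if ends: "0 < d" "0 \<le> c" "c + d < 1" "c' \<le> 1" "0 < c' - d" "c + d < c' - d \<or> c = c'" "\<gamma> c = z" "\<gamma> c' = z"
      and avoid: "\<And>s. 0 < s \<Longrightarrow> s \<le> d \<Longrightarrow> \<gamma> (c + s) \<noteq> z \<and> \<gamma> (c' - s) \<noteq> z" for c c' d
  proof -
    obtain e1 where e1: "e1 \<le> d" "half_arc z W (\<lambda>s. \<gamma> (c + s)) e1"
      by (rule ex_half_arc[OF pc contr(1)[of c d c'] ends(1)]) (use ends avoid inP in auto)
    obtain e2 where e2: "e2 \<le> d" "half_arc z W (\<lambda>s. \<gamma> (c' - s)) e2"
      by (rule ex_half_arc[OF pc contr(2)[of c d c'] ends(1)]) (use ends avoid inP in auto)
    have "(\<lambda>s. \<gamma> (c + s)) ` {0<..e1} \<inter> (\<lambda>s. \<gamma> (c' - s)) ` {0<..e2} = {}"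
    proof (rule ccontr)
      assume "\<not> ?thesis"
      then obtain s s' where s: "0 < s" "s \<le> e1" "0 < s'" "s' \<le> e2" "\<gamma> (c + s) = \<gamma> (c' - s')" by fastforce
      have "c + s = c' - s'" using inj[of "c + s" "c' - s'"] s ends e1(1) e2(1) by auto
      then show False using s ends e1(1) e2(1) by auto
    qed
    from two_half_arcs_cover[OF pc e1(2) e2(2) this]
    obtain W' where W': "open W'" "z \<in> W'" "pairs \<inter> W' \<subseteq> (\<lambda>s. \<gamma> (c + s)) ` {0..e1} \<union> (\<lambda>s. \<gamma> (c' - s)) ` {0..e2}" by blast
    have "(\<lambda>s. \<gamma> (c + s)) ` {0..e1} \<subseteq> strip a b" "(\<lambda>s. \<gamma> (c' - s)) ` {0..e2} \<subseteq> strip a b"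
      unfolding st using ends e1(1) e2(1) by auto
    then have "pairs \<inter> W' \<subseteq> strip a b" using W'(3) by (meson Un_least subset_trans)
    then show ?thesis using W'(1,2) by (intro exI[of _ W']) simp
  qed
  consider "0 < t0" "t0 < 1" | "t0 = 0 \<or> t0 = 1" "open_double_arc F M i a b" | "t0 = 0 \<or> t0 = 1" "closed_double_arc F M i a b"
    using t0(1) arc unfolding double_arc_def by fastforce
  then show ?thesis
  proof cases
    case 1
    define d where "d = min t0 (1 - t0) / 2"
    have d: "0 < d" "t0 + d < 1" "0 < t0 - d" using 1 by (auto simp: d_def min_def field_simps)
    show ?thesis
    proof (rule two[of d t0 t0])
      fix s assume "0 < s" "s \<le> d"
      then show "\<gamma> (t0 + s) \<noteq> z \<and> \<gamma> (t0 - s) \<noteq> z" using inj[of "t0 + s" t0] inj[of "t0 - s" t0] t0(2) d by auto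
    qed (use d 1 t0(2) in auto)
  next
    case 3
    have "{a 0, b 0} = {a 1, b 1}" using 3 unfolding closed_double_arc_def by blast
    then have "(a 1 = a 0 \<and> b 1 = b 0) \<or> (a 1 = b 0 \<and> b 1 = a 0)" by (auto simp: doubleton_eq_iff)
    then have "a 1 = a 0 \<and> b 1 = b 0"
      using nt 3(2) unfolding no_nontrivial_closed_double_arcs_def nontrivial_closed_double_arc_def by auto
    then have g01: "\<gamma> 0 = z" "\<gamma> 1 = z" using 3(1) t0(2) by (auto simp: \<gamma>_def)
    show ?thesis
    proof (rule two[of "1/3" 0 1])
      fix s :: real assume "0 < s" "s \<le> 1/3"
      then show "\<gamma> (0 + s) \<noteq> z \<and> \<gamma> (1 - s) \<noteq> z" using inj[of s 0] inj[of "1 - s" 0] g01 by auto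
    qed (use g01 in auto)
  next
    case 2
    have inj1: "s = t" if "s \<in> {0..1}" "t \<in> {0..1}" "\<gamma> s = \<gamma> t" for s t
    proof -
      have "inj_on (\<lambda>t. {a t, b t}) {0..1}" using 2(2) unfolding open_double_arc_def by blast
      then show ?thesis by (rule inj_onD) (use that in \<open>auto simp: \<gamma>_def\<close>)
    qed
    have "branch_value F M i (i (a t0)) \<or> a t0 \<noteq> b t0 \<and> DB_value F M i (i (a t0))"
      using 2 unfolding open_double_arc_def by blast
    moreover have "\<not> branch_value F M i (i (a t0))"
      using branch_fibre[of "fst z" "snd z"] z(2) t0(2) unfolding pairs_def by (auto simp: \<gamma>_def)
    ultimately have "DB_value F M i (i (fst z))" using t0(2) by (simp add: \<gamma>_def)
    then have T: "T = {0..1}" using pair_chart_atD(8)[OF pc] crossing_not_DB[of z] unfolding crossing_def by blast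
    define \<phi> where "\<phi> = (if t0 = 0 then \<lambda>s. \<gamma> (0 + s) else (\<lambda>s. \<gamma> (1 - s)))"
    have "continuous_on {0..1/2} \<phi>" unfolding \<phi>_def using contr[of 0 "1/2" 1] by auto
    moreover have "\<phi> 0 = z" using 2(1) t0(2) by (auto simp: \<phi>_def)
    moreover have "\<phi> s \<in> pairs \<and> \<phi> s \<noteq> z" if "0 < s" "s \<le> 1/2" for s
      using inP[of s] inP[of "1 - s"] inj1[of s 0] inj1[of "1 - s" 1] that 2(1) t0(2) by (auto simp: \<phi>_def)
    ultimately obtain e where e: "e \<le> 1/2" "half_arc z W \<phi> e"
      using ex_half_arc[OF pc, of "1/2" \<phi>] by auto
    obtain W' where W': "open W'" "z \<in> W'" "pairs \<inter> W' \<subseteq> \<phi> ` {0..e}"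
      using boundary_half_arc_cover[OF pc e(2) T] by blast
    have "\<phi> ` {0..e} \<subseteq> strip a b" unfolding st \<phi>_def using e(1) by auto
    then have "pairs \<inter> W' \<subseteq> strip a b" using W'(3) by (meson subset_trans)
    then show ?thesis using W'(1,2) by (intro exI[of _ W']) simp
  qed
qed

text \<open>A strip is closed, and it is open among the pairs.\<close>

lemma connected_in_strip:
  assumes arc: "double_arc F M i a b" and nt: "no_nontrivial_closed_double_arcs F M i"
    and L: "connected L" "L \<subseteq> pairs" "z \<in> L" "z \<in> strip a b"
  shows "L \<subseteq> strip a b"
proof -
  have "openin (top_of_set L) (L \<inter> strip a b)"
    unfolding openin_subopen[of _ "L \<inter> strip a b"]
  proof
    fix x assume x: "x \<in> L \<inter> strip a b"
    then obtain W' where W': "open W'" "x \<in> W'" "pairs \<inter> W' \<subseteq> strip a b" using strip_open[OF arc nt] L(2) by blast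
    have "openin (top_of_set L) (L \<inter> W')" using W'(1) by (simp add: openin_open_Int)
    moreover have "L \<inter> W' \<subseteq> L \<inter> strip a b" using W'(3) L(2) by blast
    ultimately show "\<exists>T. openin (top_of_set L) T \<and> x \<in> T \<and> T \<subseteq> L \<inter> strip a b" using x W'(2) by blast
  qed
  moreover have "closedin (top_of_set L) (L \<inter> strip a b)"
    using strip_closed[OF arc] by (simp add: closedin_closed_Int)
  ultimately have "L \<inter> strip a b = {} \<or> L \<inter> strip a b = L" using L(1) unfolding connected_clopen by blast
  then show ?thesis using L(3,4) by blast
qed

text \<open>The connected part off the diagonal is contained in the other strip; possible branch
  points at the ends follow by closure.\<close>

lemma strip_subset:
  assumes arc: "double_arc F M i a b" "double_arc F M i a' b'" and nt: "no_nontrivial_closed_double_arcs F M i"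
    and z: "z \<in> pairs" "z \<in> strip a b" "z \<in> strip a' b'"
  shows "strip a b \<subseteq> strip a' b'"
proof -
  have sub: "strip a b \<inter> pairs \<subseteq> strip a' b'"
    using connected_in_strip[OF arc(2) nt strip_pairs_connected[OF arc(1)], of z] z by blast
  have "(\<lambda>t. (a t, b t)) ` closure {0<..<1} \<subseteq> strip a' b'"
  proof (rule image_closure_subset[OF _ strip_closed[OF arc(2)]])
    show "continuous_on (closure {0<..<1}) (\<lambda>t. (a t, b t))" using double_arc_track(1)[OF arc(1)] by simp
    show "(\<lambda>t. (a t, b t)) ` {0<..<1} \<subseteq> strip a' b'"
      using sub double_arc_track(2)[OF arc(1)] unfolding strip_def by force
  qed
  then show ?thesis unfolding strip_def by simp
qed

section \<open>Lifting attempts as orders on fibres\<close>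

context
  fixes \<A>
  assumes nt: "no_nontrivial_closed_double_arcs F M i" and att: "lifting_attempt F M i \<A>"
begin

lemma declared_arc:
  assumes "declared_higher \<A> x y"
  obtains a b where "double_arc F M i a b" "strip a b \<in> \<A>" "(x, y) \<in> strip a b"
  using assms att unfolding declared_higher_def lifting_attempt_def by blast

lemma declared_connected:
  assumes "connected L" "L \<subseteq> pairs" "z \<in> L" "z' \<in> L" "declared_higher \<A> (fst z) (snd z)"
  shows "declared_higher \<A> (fst z') (snd z')"
proof -
  obtain a b where ab: "double_arc F M i a b" "strip a b \<in> \<A>" "(fst z, snd z) \<in> strip a b"
    by (rule declared_arc[OF assms(5)])
  then have "z' \<in> strip a b" using connected_in_strip[OF ab(1) nt assms(1-3)] assms(4) by auto
  then show ?thesis unfolding declared_higher_def using ab(2) by auto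
qed

lemma declared_total:
  assumes "z \<in> pairs"
  shows "declared_higher \<A> (fst z) (snd z) \<or> declared_higher \<A> (snd z) (fst z)"
proof -
  obtain a b where ab: "double_arc F M i a b" "z \<in> strip a b" using arc_through[OF assms] by blast
  have "strip a b \<in> \<A> \<or> strip b a \<in> \<A>" using att ab(1) unfolding lifting_attempt_def by blast
  moreover have "(snd z, fst z) \<in> strip b a" using ab(2) unfolding strip_def by auto
  ultimately show ?thesis unfolding declared_higher_def using ab(2) by auto
qed

text \<open>All arcs through a given pair have the same strip through it. Declarations both ways
  would thus put both strips of one arc into the attempt.\<close>

lemma declared_antisym:
  assumes z: "z \<in> pairs" and d: "declared_higher \<A> (fst z) (snd z)"
  shows "\<not> declared_higher \<A> (snd z) (fst z)"
proof
  assume "declared_higher \<A> (snd z) (fst z)"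
  then obtain a' b' where ab': "double_arc F M i a' b'" "strip a' b' \<in> \<A>" "(snd z, fst z) \<in> strip a' b'"
    by (rule declared_arc)
  obtain a b where ab: "double_arc F M i a b" "strip a b \<in> \<A>" "(fst z, snd z) \<in> strip a b"
    by (rule declared_arc[OF d])
  note arc' = double_arc_swap[OF ab'(1)]
  have zz: "z \<in> strip b' a'"
  proof -
    obtain t where t: "t \<in> {0..1}" "(snd z, fst z) = (a' t, b' t)" using ab'(3) unfolding strip_def by blast
    then have "z = (b' t, a' t)" by (simp add: prod_eq_iff)
    then show ?thesis unfolding strip_def using t(1) by (rule image_eqI)
  qed
  have "strip a b = strip b' a'"
    using strip_subset[OF ab(1) arc' nt z _ zz] strip_subset[OF arc' ab(1) nt z zz] ab(3) by auto
  then show False using ab(2) ab'(1,2) att unfolding lifting_attempt_def by auto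
qed

lemma declared_pair: "declared_higher \<A> x y \<Longrightarrow> x \<noteq> y \<Longrightarrow> (x, y) \<in> pairs"
proof -
  assume d: "declared_higher \<A> x y" and ne: "x \<noteq> y"
  obtain a b where ab: "double_arc F M i a b" "(x, y) \<in> strip a b" by (rule declared_arc[OF d])
  have tr: "double_track F i a b" using ab(1) unfolding double_arc_def open_double_arc_def closed_double_arc_def by blast
  then show ?thesis using ab(2) ne unfolding strip_def double_track_def pairs_def by auto
qed

end

end

section \<open>The height function\<close>

context generic_map
begin

context
  fixes \<A>
  assumes nt: "no_nontrivial_closed_double_arcs F M i" and att: "lifting_attempt F M i \<A>"
    and nocyc: "\<not> (\<exists>p. triple_value F M i p \<and> cyclic_height_relation F M i \<A> p)"
begin

abbreviation (input) "dcl \<equiv> declared_higher \<A>"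

definition vanishes_near :: "('b \<Rightarrow> real) \<Rightarrow> 'a \<Rightarrow> bool" where
  "vanishes_near G b \<longleftrightarrow> (\<exists>V. open V \<and> b \<in> V \<and> (\<forall>x\<in>F. i x \<in> V \<longrightarrow> G x = 0))"

definition bump_at :: "'a \<Rightarrow> ('b \<Rightarrow> real) \<Rightarrow> 'a set \<Rightarrow> bool" where
  "bump_at p G U \<longleftrightarrow> pl_on G F \<and> openin (top_of_set M) U \<and> p \<in> U \<and>
     (\<forall>z\<in>pairs. dcl (fst z) (snd z) \<longrightarrow> G (snd z) \<le> G (fst z) \<and> (i (fst z) \<in> U \<longrightarrow> G (snd z) < G (fst z))) \<and>
     (\<forall>b. branch_value F M i b \<longrightarrow> b \<noteq> p \<longrightarrow> vanishes_near G b)"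

text \<open>
  The sheet \<open>k\<close> gets the height \<open>c k\<close>, the number of sheets below it.
\<close>

lemma sheet_bump:
  assumes p: "p \<in> i ` F" "\<not> branch_value F M i p"
  shows "\<exists>G U. bump_at p G U"
proof -
  obtain B K where BK: "sheet_model B K" "sheets_at F M i B K p" using nonbranch_sheets[OF p] by blast
  obtain N f g \<sigma> where ch: "sheet_chart F M i p B K N f g \<sigma>" using sheets_at_imp_chart[OF BK(2,1)] by metis
  note mod = sheet_chart_model[OF ch] and base = sheet_chart_base[OF ch]
  have fgh: "homeomorphism N B f g" using sheet_chart_fg(1)[OF ch] .
  define sh where "sh = (\<lambda>k. \<sigma> k ` (B \<inter> coord_plane k))"
  obtain r where r: "0 < r" "r < 1" "\<And>V. open V \<Longrightarrow> V \<subseteq> ocube r \<Longrightarrow> openin (top_of_set M) {q \<in> N. f q \<in> V}"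
    using chart_core[OF base(1) fgh base(3)] by metis
  define Z where "Z = f ` ({q. branch_value F M i q} \<inter> N)"
  have "finite Z" unfolding Z_def using finite_branch by simp
  then have "open (- Z)" by (simp add: finite_imp_closed open_Compl)
  moreover have "0 \<in> - Z"
  proof -
    have "q = p" if "q \<in> N" "f q = 0" for q
      using that base(3) sheet_chart_fgI(1)[OF ch that(1)] sheet_chart_fgI(1)[OF ch base(4)] by metis
    then show ?thesis using p(2) unfolding Z_def by force
  qed
  ultimately obtain r' where r': "0 < r'" "r' < 1" "ocube r' \<subseteq> - Z" using ocube_small by metis
  \<comment> \<open>Half of the minimum, so that even the closed cube of radius \<open>e\<close>
    lies where the chart is open and is free of branch values.\<close>
  define e where "e = min r r' / 2"
  have e: "0 < e" "e < r" "e < r'" using r r' by (auto simp: e_def)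
  define mx where "mx = (\<lambda>q. max \<bar>f q $ 1\<bar> (max \<bar>f q $ 2\<bar> \<bar>f q $ 3\<bar>))"
  define \<psi> where "\<psi> = (\<lambda>q. max 0 (e - mx q))"
  define R where "R = (\<lambda>k l. dcl (\<sigma> k 0) (\<sigma> l 0))"
  define c where "c = (\<lambda>k. real (card {l \<in> K. l \<noteq> k \<and> R k l}))"
  have pair0: "(\<sigma> k 0, \<sigma> l 0) \<in> pairs" if "k \<in> K" "l \<in> K" "k \<noteq> l" for k l
  proof -
    have "\<sigma> k 0 \<in> {x \<in> F. i x = p}" "\<sigma> l 0 \<in> {x \<in> F. i x = p}" unfolding sheet_chart_fibre[OF ch] using that by blast+
    moreover have "\<sigma> k 0 \<noteq> \<sigma> l 0" using inj_onD[OF sheet_chart_inj[OF ch] _ that(1,2)] that(3) by blast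
    ultimately show ?thesis by (simp add: pairs_def)
  qed
  have Rtot: "R k l \<or> R l k" "R k l \<Longrightarrow> \<not> R l k" if "k \<in> K" "l \<in> K" "k \<noteq> l" for k l
    using declared_total[OF nt att pair0[OF that]] declared_antisym[OF nt att pair0[OF that]] by (auto simp: R_def)
  \<comment> \<open>A failure of transitivity is a cycle of three different sheets; three sheets
    occur only in the full cube, so the value is triple and the relation there is cyclic.\<close>
  have trans: "R k m" if klm: "k \<in> K" "l \<in> K" "m \<in> K" "k \<noteq> l" "l \<noteq> m" "k \<noteq> m" "R k l" "R l m" for k l m
  proof (rule ccontr)
    assume "\<not> R k m"
    then have mk: "R m k" using Rtot(1)[OF klm(1,3,6)] by blast
    have c3: "card {k, l, m} = 3" using klm(4-6) by auto
    have K3: "K = {k, l, m}"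
    proof -
      have "card {k,l,m} = card (UNIV :: 3 set)" using c3 by simp
      then have "{k, l, m} = UNIV" by (intro card_subset_eq) auto
      then show ?thesis using klm(1-3) by auto
    qed
    have "B = cube"
    proof (rule ccontr)
      assume "B \<noteq> cube"
      then have "K \<subseteq> {1, 2}" using BK(1) unfolding sheet_model_def by blast
      then have "card K \<le> card {1, 2 :: 3}" by (intro card_mono) auto
      also have "\<dots> \<le> 2" by (simp add: card_insert_if)
      finally have "card K \<le> 2" .
      then show False using c3 K3 by simp
    qed
    then have "triple_value F M i p" unfolding triple_value_def using BK(2) K3 c3 by blast
    moreover have "cyclic_height_relation F M i \<A> p"
      unfolding cyclic_height_relation_def
    proof (intro exI conjI)
      show "{x \<in> F. i x = p} = {\<sigma> l 0, \<sigma> k 0, \<sigma> m 0}" unfolding sheet_chart_fibre[OF ch] K3 by auto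
      show "distinct [\<sigma> l 0, \<sigma> k 0, \<sigma> m 0]"
        using klm(1-6) inj_onD[OF sheet_chart_inj[OF ch]] by auto
      show "dcl (\<sigma> k 0) (\<sigma> l 0)" "dcl (\<sigma> m 0) (\<sigma> k 0)" "dcl (\<sigma> l 0) (\<sigma> m 0)" using klm(7,8) mk by (simp_all add: R_def)
    qed
    ultimately show False using nocyc by blast
  qed
  have rank: "c l < c k" if kl: "k \<in> K" "l \<in> K" "k \<noteq> l" "R k l" for k l
  proof -
    have "{j \<in> K. j \<noteq> l \<and> R l j} \<subset> {j \<in> K. j \<noteq> k \<and> R k j}"
    proof
      show "{j \<in> K. j \<noteq> l \<and> R l j} \<subseteq> {j \<in> K. j \<noteq> k \<and> R k j}"
      proof
        fix j assume j: "j \<in> {j \<in> K. j \<noteq> l \<and> R l j}"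
        then have "j \<noteq> k" using Rtot(2)[OF kl(1-3)] kl(4) by auto
        then show "j \<in> {j \<in> K. j \<noteq> k \<and> R k j}" using trans[of k l j] kl j by auto
      qed
      show "{j \<in> K. j \<noteq> l \<and> R l j} \<noteq> {j \<in> K. j \<noteq> k \<and> R k j}" using kl by auto
    qed
    then have "card {j \<in> K. j \<noteq> l \<and> R l j} < card {j \<in> K. j \<noteq> k \<and> R k j}" by (intro psubset_card_mono) auto
    then show ?thesis by (simp add: c_def)
  qed
  define idx where "idx = (\<lambda>x. THE k. k \<in> K \<and> x \<in> sh k)"
  have idx: "idx x = k" if "k \<in> K" "x \<in> sh k" for k x
    unfolding idx_def
  proof (rule the_equality)
    fix l assume "l \<in> K \<and> x \<in> sh l"
    then show "l = k" using sheet_chart_disjoint[OF ch that(1), of l] that(2) unfolding sh_def by blast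
  qed (use that in blast)
  define G where "G = (\<lambda>x. if i x \<in> N then c (idx x) * \<psi> (i x) else 0)"
  define U where "U = {q \<in> N. f q \<in> ocube e}"
  have mx_less: "mx q < a \<longleftrightarrow> f q \<in> ocube a" for q a by (auto simp: mx_def mem_ocube_3)
  have mono: "G (snd z) \<le> G (fst z) \<and> (i (fst z) \<in> U \<longrightarrow> G (snd z) < G (fst z))"
    if z: "z \<in> pairs" "dcl (fst z) (snd z)" for z
  proof (cases "i (fst z) \<in> N")
    case False then show ?thesis using pairs_fst_snd[OF z(1)] by (simp add: G_def U_def)
  next
    case True
    have zF: "fst z \<in> F" "snd z \<in> F" "fst z \<noteq> snd z" "i (snd z) = i (fst z)" using z(1) by (auto simp: pairs_def)
    define v where "v = f (i (fst z))"
    obtain k where k: "k \<in> K" "v \<in> B" "v \<in> coord_plane k" "fst z = \<sigma> k v"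
      using sheet_chart_cases[OF ch zF(1) True] unfolding v_def by metis
    obtain l where l: "l \<in> K" "v \<in> coord_plane l" "snd z = \<sigma> l v"
      using sheet_chart_cases[OF ch zF(2)] True zF(4) unfolding v_def by metis
    have ne: "k \<noteq> l" using k(4) l(3) zF(3) by auto
    \<comment> \<open>The part of the model common to both sheets joins the given pair to the
      corresponding pair over \<open>p\<close> through pairs, so the attempt decides both
      alike.\<close>
    define X where "X = B \<inter> coord_plane k \<inter> coord_plane l"
    define L where "L = (\<lambda>w. (\<sigma> k w, \<sigma> l w)) ` X"
    have "convex X" unfolding X_def using mod(3) coord_plane_props(2) by (intro convex_Int) auto
    moreover have "continuous_on X (\<lambda>w. (\<sigma> k w, \<sigma> l w))"
      by (intro continuous_on_Pair continuous_on_subset[OF homeomorphism_cont1[OF sheet_chart_hom[OF ch k(1)]]]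
          continuous_on_subset[OF homeomorphism_cont1[OF sheet_chart_hom[OF ch l(1)]]]) (auto simp: X_def)
    ultimately have "connected L" unfolding L_def by (intro connected_continuous_image convex_connected)
    moreover have "L \<subseteq> pairs"
    proof
      fix y assume "y \<in> L"
      then obtain w where w: "w \<in> B" "w \<in> coord_plane k" "w \<in> coord_plane l" "y = (\<sigma> k w, \<sigma> l w)" unfolding L_def X_def by blast
      have "\<sigma> k w \<noteq> \<sigma> l w" using sheet_chart_disjoint[OF ch k(1) l(1) ne] w by blast
      then show "y \<in> pairs" using sheet_chart_mem[OF ch k(1) w(1,2)] sheet_chart_mem[OF ch l(1) w(1,3)] w(4) by (simp add: pairs_def)
    qed
    moreover have "z \<in> L" unfolding L_def X_def using k l by (intro image_eqI[of _ _ v]) (auto simp: prod_eq_iff)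
    moreover have "(\<sigma> k 0, \<sigma> l 0) \<in> L" unfolding L_def X_def using mod(4) coord_plane_props(3) by blast
    ultimately have "R k l" using declared_connected[OF nt att, of L z "(\<sigma> k 0, \<sigma> l 0)"] z(2) by (simp add: R_def)
    then have ckl: "c l < c k" using rank[OF k(1) l(1) ne] by blast
    have "idx (fst z) = k" "idx (snd z) = l" using idx[OF k(1)] idx[OF l(1)] k l unfolding sh_def by auto
    then have G: "G (fst z) = c k * \<psi> (i (fst z))" "G (snd z) = c l * \<psi> (i (fst z))" using True zF(4) by (simp_all add: G_def)
    have "\<psi> (i (fst z)) \<ge> 0" by (simp add: \<psi>_def)
    moreover have "\<psi> (i (fst z)) > 0" if "i (fst z) \<in> U" using that mx_less[of "i (fst z)" e] by (simp add: \<psi>_def U_def)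
    ultimately show ?thesis unfolding G using ckl by (auto intro: mult_right_mono mult_strict_right_mono)
  qed
  \<comment> \<open>\<open>G\<close> vanishes outside the compact set \<open>S\<close>, so it stays
    PL where \<open>N\<close> ends.\<close>
  define S where "S = g ` {v \<in> B. \<forall>k. \<bar>v $ k\<bar> \<le> e}"
  have "closed {v :: real^3. \<forall>k. \<bar>v $ k\<bar> \<le> e}" by (intro closed_Collect_all closed_Collect_le continuous_intros)
  then have "compact (B \<inter> {v. \<forall>k. \<bar>v $ k\<bar> \<le> e})" using mod(2) by blast
  moreover have "B \<inter> {v. \<forall>k. \<bar>v $ k\<bar> \<le> e} = {v \<in> B. \<forall>k. \<bar>v $ k\<bar> \<le> e}" by blast
  ultimately have "compact {v \<in> B. \<forall>k. \<bar>v $ k\<bar> \<le> e}" by simp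
  moreover have "continuous_on {v \<in> B. \<forall>k. \<bar>v $ k\<bar> \<le> e} g"
    by (rule continuous_on_subset[OF homeomorphism_cont2[OF fgh]]) auto
  ultimately have cS: "closed S" unfolding S_def by (intro compact_imp_closed compact_continuous_image)
  have Siff: "q \<in> S \<longleftrightarrow> (\<forall>k. \<bar>f q $ k\<bar> \<le> e)" if "q \<in> N" for q
  proof
    show "q \<in> S \<Longrightarrow> \<forall>k. \<bar>f q $ k\<bar> \<le> e" unfolding S_def using sheet_chart_fgI(3)[OF ch] by auto
    assume "\<forall>k. \<bar>f q $ k\<bar> \<le> e"
    then show "q \<in> S" unfolding S_def using sheet_chart_fgI(1,2)[OF ch that] by (intro image_eqI[of _ _ "f q"]) auto
  qed
  have SN: "S \<subseteq> N" unfolding S_def using sheet_chart_fgI(4)[OF ch] by auto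
  have G0: "G x = 0" if "i x \<notin> S" for x
  proof (cases "i x \<in> N")
    case True
    then have "\<not> (\<forall>k. \<bar>f (i x) $ k\<bar> \<le> e)" using that Siff by blast
    then have "mx (i x) > e" unfolding forall_3 mx_def by auto
    then show ?thesis by (simp add: G_def \<psi>_def)
  qed (simp add: G_def)
  have Vn: "open (- S)" using cS by (simp add: open_Compl)
  have opS: "openin (top_of_set F) (F \<inter> i -` (- S))" by (rule continuous_openin_preimage_gen[OF cont_i Vn])
  have pl: "pl_on G F"
  proof (rule pl_on_local)
    fix x assume x: "x \<in> F"
    show "\<exists>W. openin (top_of_set F) W \<and> x \<in> W \<and> pl_on G W"
    proof (cases "i x \<in> S")
      case False
      have "pl_on G (F \<inter> i -` (- S))"
        by (rule pl_on_cong[OF pl_on_const[OF pl_on_open_subset[OF pl_i opS], of 0]]) (simp add: G0)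
      then show ?thesis using opS False x by (intro exI[of _ "F \<inter> i -` (- S)"]) simp
    next
      case True
      then have xN: "i x \<in> N" and xe: "\<forall>k. \<bar>f (i x) $ k\<bar> \<le> e" using SN Siff by blast+
      obtain k where k: "k \<in> K" "f (i x) \<in> B" "f (i x) \<in> coord_plane k" "x = \<sigma> k (f (i x))"
        using sheet_chart_cases[OF ch x xN] by metis
      define Or where "Or = {q \<in> N. f q \<in> ocube r}"
      have Or: "openin (top_of_set M) Or" "Or \<subseteq> N" unfolding Or_def using r(3)[OF open_ocube] by auto
      have "f (i x) \<in> ocube r" unfolding ocube_def using xe e(2) by (auto intro: le_less_trans)
      then have gO: "g (f (i x)) \<in> Or" using xN sheet_chart_fgI(1)[OF ch xN] by (simp add: Or_def)
      obtain W where W: "open W" "\<sigma> k (f (i x)) \<in> W" "F \<inter> W \<subseteq> \<sigma> k ` (B \<inter> coord_plane k)" "i ` (F \<inter> W) \<subseteq> Or"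
        using sheet_chart_open[OF ch cont_i k(1) Or i_into k(2,3) gO] by metis
      have opW: "openin (top_of_set F) (F \<inter> W)" using W(1) by (simp add: openin_open_Int)
      have plf: "pl_on (\<lambda>y. f (i y)) (F \<inter> W)"
        by (rule pl_on_compose[OF pl_on_open_subset[OF pl_i opW] sheet_chart_fg(2)[OF ch]]) (use W(4) Or(2) in blast)
      note cc = pl_on_vec_nth[OF plf]
      have "pl_on (\<lambda>y. c k * max 0 (e - max \<bar>f (i y) $ 1\<bar> (max \<bar>f (i y) $ 2\<bar> \<bar>f (i y) $ 3\<bar>))) (F \<inter> W)"
        by (intro pl_on_cmult pl_on_max pl_on_diff pl_on_abs cc pl_on_const[OF plf])
      then have "pl_on G (F \<inter> W)"
      proof (rule pl_on_cong)
        fix y assume y: "y \<in> F \<inter> W"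
        have "i y \<in> N" using W(4) Or(2) y by blast
        moreover have "idx y = k" using idx[OF k(1)] W(3) y unfolding sh_def by blast
        ultimately show "c k * max 0 (e - max \<bar>f (i y) $ 1\<bar> (max \<bar>f (i y) $ 2\<bar> \<bar>f (i y) $ 3\<bar>)) = G y"
          by (simp add: G_def \<psi>_def mx_def)
      qed
      then show ?thesis using opW x W(2) k(4) by (intro exI[of _ "F \<inter> W"]) simp
    qed
  qed
  have van: "vanishes_near G b" if "branch_value F M i b" for b
  proof -
    have "b \<notin> S"
    proof
      assume bS: "b \<in> S"
      then have bN: "b \<in> N" using SN by blast
      then have "f b \<in> ocube r'" using Siff[OF bN] bS e(3) unfolding ocube_def by (auto intro: le_less_trans)
      moreover have "f b \<in> Z" unfolding Z_def using bN that by blast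
      ultimately show False using r'(3) by blast
    qed
    then show ?thesis unfolding vanishes_near_def using Vn G0 by (intro exI[of _ "- S"]) simp
  qed
  have "openin (top_of_set M) U" unfolding U_def using r(3)[OF open_ocube, of e] e(2) by (force simp: ocube_def intro: less_trans)
  moreover have "p \<in> U" using base(3,4) e(1) by (simp add: U_def ocube_def)
  ultimately have "bump_at p G U" unfolding bump_at_def using pl mono van by simp
  then show ?thesis by blast
qed

text \<open>The cut-off parameter of the umbrella, with the sign that the attempt prescribes along
  the double line.\<close>

lemma branch_bump:
  assumes p: "branch_value F M i p"
  shows "\<exists>G U N f g r e s. bump_at p G U \<and> branch_core p N f g r \<and> 0 < e \<and> (s = 1 \<or> s = -1) \<and>
    (\<forall>x\<in>nbd N f r. f (i x) $ 3 < e \<longrightarrow> G x = s * ucoord N f x)"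
proof -
  obtain N f g r x0 where core: "branch_core p N f g r" and x0: "{x' \<in> F. i x' = p} = {x0}"
    by (rule ex_branch_core[OF p])
  note bc = core_props(1)[OF core] and nd = nbd_def[OF core]
  have r: "0 < r" "r < 1" using core_props(2,3)[OF core] .
  define e where "e = r / 2"
  have e: "0 < e" "e < r" using r by (auto simp: e_def)
  define good where "good = (\<lambda>z. z \<in> pairs \<and> fst z \<in> nbd N f r \<and> ucoord N f (fst z) > 0)"
  \<comment> \<open>One pair with positive parameter decides the sign: such pairs lie in connected
    sets of pairs with each other, so the attempt treats all of them alike.\<close>
  define s where "s = (if \<exists>z. good z \<and> dcl (fst z) (snd z) then 1 else -1 :: real)"
  have nbswap: "snd z \<in> nbd N f r \<longleftrightarrow> fst z \<in> nbd N f r" if "z \<in> pairs" for z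
    using that by (auto simp: pairs_def nd)
  have sign: "ucoord N f (fst z) * s > 0" if z: "z \<in> pairs" "fst z \<in> nbd N f r" "dcl (fst z) (snd z)" for z
  proof -
    note np = nbd_pairs(3,5)[OF core p z(1,2)]
    show ?thesis
    proof (cases "ucoord N f (fst z) > 0")
      case True
      then have "good z" using z by (simp add: good_def)
      then have "\<exists>z. good z \<and> dcl (fst z) (snd z)" using z(3) by blast
      then have "s = 1" unfolding s_def by (simp only: if_True)
      then show ?thesis using True by simp
    next
      case False
      then have neg: "ucoord N f (fst z) < 0" "ucoord N f (snd z) > 0" using np by auto
      have g: "good (prod.swap z)" unfolding good_def using pairs_swap[OF z(1)] nbswap[OF z(1)] z(2) neg(2) by simp
      have "\<not> (\<exists>y. good y \<and> dcl (fst y) (snd y))"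
      proof
        assume "\<exists>y. good y \<and> dcl (fst y) (snd y)"
        then obtain y where y: "good y" "dcl (fst y) (snd y)" by blast
        obtain L where L: "connected L" "L \<subseteq> pairs" "y \<in> L" "prod.swap z \<in> L"
          using nbd_pairs_connected[OF core p, of y "prod.swap z"] y(1) g unfolding good_def by blast
        have "dcl (snd z) (fst z)" using declared_connected[OF nt att L y(2)] by simp
        then show False using declared_antisym[OF nt att z(1,3)] by blast
      qed
      then have "s = -1" unfolding s_def by (simp only: if_False)
      then show ?thesis using neg by simp
    qed
  qed
  have s1: "s = 1 \<or> s = -1" by (simp add: s_def)
  define G where "G = (\<lambda>x. s * bump N f r e x)"
  define U where "U = {q \<in> N. f q \<in> ocube e}"
  have pl: "pl_on G F" unfolding G_def by (intro pl_on_cmult bump_pl[OF core p e])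
  have sub: "ocube e \<subseteq> ocube r" using e(2) by (force simp: ocube_def intro: less_trans)
  have opU: "openin (top_of_set M) U" unfolding U_def using core_props(4)[OF core open_ocube sub] .
  have pU: "p \<in> U" using bc_props(3,6)[OF bc] e(1) by (simp add: U_def ocube_def)
  have mono: "G (snd z) \<le> G (fst z) \<and> (i (fst z) \<in> U \<longrightarrow> G (snd z) < G (fst z))"
    if z: "z \<in> pairs" "dcl (fst z) (snd z)" for z
  proof -
    note bp = bump_pair[OF core p e(1) z(1)]
    have le: "G (snd z) \<le> G (fst z)"
      using bp(1,2) sign[OF z(1) _ z(2)] s1 unfolding G_def by auto
    moreover have "G (snd z) < G (fst z)" if u: "i (fst z) \<in> U"
    proof -
      have "fst z \<in> nbd N f r" using u sub z(1) unfolding nd U_def pairs_def by blast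
      moreover have "f (i (fst z)) $ 3 < e" using u unfolding U_def mem_ocube_3 by auto
      ultimately have "bump N f r e (fst z) \<noteq> bump N f r e (snd z)" using bp(3) by blast
      then show ?thesis using le s1 unfolding G_def by auto
    qed
    ultimately show ?thesis by blast
  qed
  have van: "vanishes_near G b" if b: "branch_value F M i b" "b \<noteq> p" for b
  proof -
    define S where "S = g ` (fig_cone \<inter> {v. v $ 3 \<le> e})"
    have "compact cube" unfolding cube_def by simp
    then have "compact (g ` cube)" using compact_continuous_image homeomorphism_cont2[OF bc_props(5)[OF bc]] by blast
    then have "compact N" using homeomorphism_image2[OF bc_props(5)[OF bc]] by simp
    moreover have "compact (i ` F)" using compact_continuous_image cont_i generic_props(1) by blast
    ultimately have "compact (N \<inter> i ` F)" using compact_imp_closed by blast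
    moreover have "continuous_on (N \<inter> i ` F) f"
      by (rule continuous_on_subset[OF homeomorphism_cont1[OF bc_props(5)[OF bc]]]) blast
    ultimately have "compact fig_cone" using compact_continuous_image bc_props(4)[OF bc] by metis
    moreover have "closed {v :: real^3. v $ 3 \<le> e}" by (intro closed_Collect_le continuous_intros)
    ultimately have "compact (fig_cone \<inter> {v. v $ 3 \<le> e})" by blast
    moreover have "continuous_on (fig_cone \<inter> {v. v $ 3 \<le> e}) g"
      by (rule continuous_on_subset[OF homeomorphism_cont2[OF bc_props(5)[OF bc]]]) (use fig_cone_cube in blast)
    ultimately have "closed S" unfolding S_def by (intro compact_imp_closed compact_continuous_image)
    have "b \<notin> S"
    proof
      assume "b \<in> S"
      then obtain v where v: "v \<in> fig_cone" "v $ 3 \<le> e" "b = g v" unfolding S_def by blast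
      have vc: "v \<in> cube" using v(1) fig_cone_cube by blast
      have "v \<in> ocube r" using v(1,2) e unfolding mem_fig_cone mem_ocube_3 by linarith
      then show False using core_props(5)[OF core, of b] b bc_fg[OF bc vc] v(3) by simp
    qed
    moreover have "G x = 0" if x: "x \<in> F" "i x \<in> - S" for x
    proof (cases "x \<in> nbd N f r")
      case True
      have "f (i x) $ 3 > e"
      proof (rule ccontr)
        assume "\<not> f (i x) $ 3 > e"
        then have "i x \<in> S" unfolding S_def using nbd_cone[OF core True] nbd_g[OF core True]
          by (intro image_eqI[of _ _ "f (i x)"]) auto
        then show False using x(2) by blast
      qed
      then show ?thesis by (simp add: G_def bump_def[OF core p])
    qed (simp add: G_def bump_def[OF core p])
    ultimately show ?thesis unfolding vanishes_near_def using \<open>closed S\<close> by (intro exI[of _ "- S"]) auto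
  qed
  have "bump_at p G U" unfolding bump_at_def using pl opU pU mono van by simp
  \<comment> \<open>For \<open>z < e / 2\<close>, the bound of the parameter by \<open>z\<close>
    makes the cut-off inactive.\<close>
  moreover have "\<forall>x\<in>nbd N f r. f (i x) $ 3 < e / 2 \<longrightarrow> G x = s * ucoord N f x"
    using bump_near_apex[OF core p] by (simp add: G_def)
  ultimately show ?thesis using core e(1) s1
    by (intro exI[of _ G] exI[of _ U] exI[of _ N] exI[of _ f] exI[of _ g] exI[of _ r] exI[of _ "e/2"] exI[of _ s]) simp
qed

lemma ex_height:
  assumes ne: "F \<noteq> {}"
  shows "\<exists>h. pl_on h F \<and> (\<forall>z\<in>pairs. dcl (fst z) (snd z) \<longrightarrow> h (snd z) < h (fst z)) \<and>
    (\<forall>p. branch_value F M i p \<longrightarrow> (\<exists>N f g r e s. branch_core p N f g r \<and> 0 < e \<and> e \<le> r \<and> (s = 1 \<or> s = -1) \<and>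
      (\<forall>x\<in>nbd N f r. f (i x) \<in> ocube e \<longrightarrow> h x = s * ucoord N f x)))"
proof -
  define BB where "BB = (\<lambda>p G N f g r e s. branch_core p N f g r \<and> 0 < (e::real) \<and> (s = 1 \<or> s = -(1::real)) \<and>
    (\<forall>x\<in>nbd N f r. f (i x) $ 3 < e \<longrightarrow> G x = s * ucoord N f x))"
  have "\<exists>G U. bump_at p G U \<and> (branch_value F M i p \<longrightarrow> (\<exists>N f g r e s. BB p G N f g r e s))" if p: "p \<in> i ` F" for p
  proof (cases "branch_value F M i p")
    case True
    obtain G U N f g r e s where "bump_at p G U" "BB p G N f g r e s"
      using branch_bump[OF True] unfolding BB_def by metis
    then show ?thesis by (intro exI[of _ G] exI[of _ U] conjI impI exI[of _ N] exI[of _ f] exI[of _ g] exI[of _ r] exI[of _ e] exI[of _ s])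
  next
    case False
    then show ?thesis using sheet_bump[OF p False] by simp
  qed
  then obtain G U where GU: "\<And>p. p \<in> i ` F \<Longrightarrow> bump_at p (G p) (U p)"
    and GB: "\<And>p. p \<in> i ` F \<Longrightarrow> branch_value F M i p \<Longrightarrow> \<exists>N f g r e s. BB p (G p) N f g r e s"
    by metis
  define BV where "BV = {p. branch_value F M i p}"
  have "p \<in> i ` F" if p: "branch_value F M i p" for p
  proof -
    obtain N f g x where "{x' \<in> F. i x' = p} = {x}" by (rule ex_branch_chart[OF p])
    then have "x \<in> {x' \<in> F. i x' = p}" by (simp only: singletonI)
    then show ?thesis by auto
  qed
  then have BV: "finite BV" "BV \<subseteq> i ` F" using finite_branch by (auto simp: BV_def)
  have "\<exists>O'. open O' \<and> U p = M \<inter> O'" if "p \<in> i ` F" for p using GU[OF that] unfolding bump_at_def openin_open by blast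
  then obtain O' where O': "\<And>p. p \<in> i ` F \<Longrightarrow> open (O' p) \<and> U p = M \<inter> O' p" by metis
  have "compact (i ` F)" using compact_continuous_image cont_i generic_props(1) by blast
  moreover have "i ` F \<subseteq> (\<Union>p\<in>i ` F. O' p)"
  proof
    fix p assume p: "p \<in> i ` F"
    then have "p \<in> O' p" using O'[OF p] GU[OF p] unfolding bump_at_def by blast
    then show "p \<in> (\<Union>p\<in>i ` F. O' p)" using p by (rule UN_I[rotated])
  qed
  ultimately obtain T0 where T0: "T0 \<subseteq> i ` F" "finite T0" "i ` F \<subseteq> (\<Union>p\<in>T0. O' p)"
    using compactE_image[of "i ` F" "i ` F" O'] O' by metis
  \<comment> \<open>All branch values are added to the finite cover, so that each has its own bump,
    the only one not vanishing near it.\<close>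
  define T where "T = T0 \<union> BV"
  have T: "finite T" "T \<noteq> {}" "T \<subseteq> i ` F" using T0 BV ne by (auto simp: T_def)
  define h where "h = (\<lambda>x. \<Sum>p\<in>T. G p x)"
  have bT: "bump_at p (G p) (U p)" if "p \<in> T" for p using GU T(3) that by blast
  have "pl_on h F" unfolding h_def by (rule pl_on_sum[OF T(1,2)]) (use bT in \<open>simp add: bump_at_def\<close>)
  moreover have "h (snd z) < h (fst z)" if z: "z \<in> pairs" "dcl (fst z) (snd z)" for z
    unfolding h_def
  proof (rule sum_strict_mono_ex1[OF T(1)])
    show "\<forall>p\<in>T. G p (snd z) \<le> G p (fst z)" using bT z unfolding bump_at_def by blast
    have zF: "i (fst z) \<in> i ` F" "i (fst z) \<in> M" using z(1) i_into by (auto simp: pairs_def)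
    then obtain p where p: "p \<in> T0" "i (fst z) \<in> O' p" using T0(3) by (meson UN_E subsetD)
    then have "i (fst z) \<in> U p" using O' T0(1) zF(2) by blast
    then have "G p (snd z) < G p (fst z)" using bT[of p] p(1) z unfolding bump_at_def T_def by blast
    then show "\<exists>p\<in>T. G p (snd z) < G p (fst z)" using p(1) by (intro bexI[of _ p]) (simp_all add: T_def)
  qed
  moreover have "\<exists>N f g r e s. branch_core p N f g r \<and> 0 < e \<and> e \<le> r \<and> (s = 1 \<or> s = -1) \<and>
      (\<forall>x\<in>nbd N f r. f (i x) \<in> ocube e \<longrightarrow> h x = s * ucoord N f x)" if p: "branch_value F M i p" for p
  proof -
    have pT: "p \<in> T" using p by (simp add: T_def BV_def)
    obtain N f g r e s where B: "BB p (G p) N f g r e s" using GB[OF _ p] pT T(3) by blast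
    then have core: "branch_core p N f g r" and e: "0 < e" and s: "s = 1 \<or> s = -1"
      and Gs: "\<And>x. x \<in> nbd N f r \<Longrightarrow> f (i x) $ 3 < e \<Longrightarrow> G p x = s * ucoord N f x" by (simp_all add: BB_def)
    note bc = core_props(1)[OF core]
    have "\<exists>V. open V \<and> p \<in> V \<and> (\<forall>x\<in>F. i x \<in> V \<longrightarrow> G q x = 0)" if "q \<in> T - {p}" for q
      using bT[of q] that p unfolding bump_at_def vanishes_near_def by blast
    then obtain V where V: "\<And>q. q \<in> T - {p} \<Longrightarrow> open (V q) \<and> p \<in> V q \<and> (\<forall>x\<in>F. i x \<in> V q \<longrightarrow> G q x = 0)" by metis
    define V' where "V' = (\<Inter>q\<in>T - {p}. V q)"
    have V': "open V'" "p \<in> V'" unfolding V'_def using V T(1) by (auto intro: open_INT)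
    have "openin (top_of_set cube) (cube \<inter> g -` V')"
      by (rule continuous_openin_preimage_gen[OF homeomorphism_cont2[OF bc_props(5)[OF bc]] V'(1)])
    then obtain W where W: "open W" "cube \<inter> g -` V' = cube \<inter> W" unfolding openin_open by blast
    have z: "0 \<in> cube" "g 0 = p" using bc_gf[OF bc, of p] bc_props(3,6)[OF bc] by auto
    then have "0 \<in> W" using W(2) V'(2) by blast
    then obtain r' where r': "0 < r'" "ocube r' \<subseteq> W" using ocube_small[OF W(1)] by metis
    define e' where "e' = min r' (min r e)"
    have e': "0 < e'" "e' \<le> r" "e' \<le> r'" "e' \<le> e" using r' e core_props(2)[OF core] by (auto simp: e'_def)
    have "h x = s * ucoord N f x" if x: "x \<in> nbd N f r" "f (i x) \<in> ocube e'" for x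
    proof -
      have xF: "x \<in> F" and iN: "i x \<in> N" using x(1) nbd_def[OF core] by auto
      have "f (i x) \<in> cube" using homeomorphism_image1[OF bc_props(5)[OF bc]] iN by blast
      moreover have "f (i x) \<in> ocube r'" using x(2) e'(3) unfolding mem_ocube_3 by linarith
      then have "f (i x) \<in> W" using r'(2) by blast
      ultimately have "i x \<in> V'" using W(2) nbd_g[OF core x(1)] by force
      then have "G q x = 0" if "q \<in> T - {p}" for q using V[OF that] xF that unfolding V'_def by blast
      then have "h x = G p x" unfolding h_def using sum.remove[OF T(1) pT, of "\<lambda>q. G q x"] by simp
      moreover have "f (i x) $ 3 < e" using x(2) e'(4) by (auto simp: mem_ocube_3)
      ultimately show ?thesis using Gs[OF x(1)] by simp
    qed
    then show ?thesis using core e' s by (intro exI[of _ N] exI[of _ f] exI[of _ g] exI[of _ r] exI[of _ e'] exI[of _ s]) simp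
  qed
  ultimately show ?thesis by (intro exI[of _ h]) simp
qed

end

end

section \<open>Local flatness\<close>

definition pt4 :: "real \<Rightarrow> real \<Rightarrow> real \<Rightarrow> real \<Rightarrow> real^4" where
  "pt4 a b c d = a *\<^sub>R axis 1 1 + b *\<^sub>R axis 2 1 + c *\<^sub>R axis 3 1 + d *\<^sub>R axis 4 1"

lemma pt4_nth [simp]: "pt4 a b c d $ 1 = a" "pt4 a b c d $ 2 = b" "pt4 a b c d $ 3 = c" "pt4 a b c d $ 4 = d"
  by (simp_all add: pt4_def axis_def)

lemma vec4_eq_iff: "v = w \<longleftrightarrow> v $ 1 = w $ 1 \<and> v $ 2 = w $ 2 \<and> v $ 3 = w $ 3 \<and> v $ 4 = w $ 4" for v w :: "real^4"
  by (simp add: vec_eq_iff forall_4)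

lemma pl_on_pt4:
  assumes "pl_on a X" "pl_on b X" "pl_on c X" "pl_on d X"
  shows "pl_on (\<lambda>x. pt4 (a x) (b x) (c x) (d x)) X"
  unfolding pt4_def
  by (intro pl_on_add pl_on_linear_compose[OF assms(1)] pl_on_linear_compose[OF assms(2)]
    pl_on_linear_compose[OF assms(3)] pl_on_linear_compose[OF assms(4)]) (auto simp: linear_iff algebra_simps)

lemma pl_on_pt:
  assumes "pl_on a X" "pl_on b X" "pl_on c X"
  shows "pl_on (\<lambda>x. pt (a x) (b x) (c x)) X"
  unfolding pt_def
  by (intro pl_on_add pl_on_linear_compose[OF assms(1)] pl_on_linear_compose[OF assms(2)]
    pl_on_linear_compose[OF assms(3)]) (auto simp: linear_iff algebra_simps)

lemma pl_chart_restrict: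
  assumes ch: "pl_chart k M U f g" and U': "openin (top_of_set M) U'" "U' \<subseteq> U"
  shows "pl_chart k M U' f g"
proof -
  have U: "openin (top_of_set M) U" "openin (top_of_set (half_space k)) (f ` U)" "homeomorphism U (f ` U) f g" "pl_on f U" "pl_on g (f ` U)"
    using ch unfolding pl_chart_def pl_homeomorphism_def by auto
  have oU: "openin (top_of_set U) U'" by (rule openin_subset_trans[OF U'(1,2) openin_imp_subset[OF U(1)]])
  have op: "openin (top_of_set (f ` U)) (f ` U')" by (rule homeomorphism_imp_open_map[OF U(3) oU])
  have "homeomorphism U' (f ` U') f g" by (rule homeomorphism_of_subsets[OF U(3) U'(2)]) (use U'(2) in auto)
  then show ?thesis unfolding pl_chart_def pl_homeomorphism_def
    using U'(1) openin_trans[OF op U(2)] pl_on_open_subset[OF U(4) oU] pl_on_open_subset[OF U(5) op] by simp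
qed

text \<open>A PL automorphism \<open>\<Phi>\<close> of the coordinate space may follow any chart of
  \<open>M\<close> times the line, as long as its last component detects the boundary of the model.
  It is applied to the product chart, to the shear along a sheet and to the straightening of the
  umbrella.\<close>

lemma pl_chart_times_line:
  fixes f :: "'a::euclidean_space \<Rightarrow> real^3" and \<Phi> :: "(real^3) \<times> real \<Rightarrow> real^4"
  assumes N: "N \<subseteq> M" "openin (top_of_set M) {q \<in> N. f q \<in> V}"
    and fg: "homeomorphism N B f g" and pf: "pl_on f N"
    and \<Phi>: "pl_on \<Phi> UNIV" "pl_on \<Psi> UNIV" "\<And>z. \<Psi> (\<Phi> z) = z" "\<And>y. \<Phi> (\<Psi> y) = y"
    and W: "open W" "\<And>z. z \<in> W \<Longrightarrow> fst z \<in> V \<and> (fst z \<in> B \<longleftrightarrow> 0 \<le> \<Phi> z $ 4)"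
    and U: "U = {q. fst q \<in> N \<and> (f (fst q), snd q) \<in> W}"
  shows "pl_chart (4::4) (M \<times> UNIV) U (\<lambda>q. \<Phi> (f (fst q), snd q)) (\<lambda>y. (g (fst (\<Psi> y)), snd (\<Psi> y)))"
proof -
  let ?\<theta> = "\<lambda>q. \<Phi> (f (fst q), snd q)" and ?\<eta> = "\<lambda>y. (g (fst (\<Psi> y)), snd (\<Psi> y))"
  define O1 where "O1 = {q \<in> N. f q \<in> V}"
  have cf: "continuous_on N f" and cg: "continuous_on B g" using fg unfolding homeomorphism_def by auto
  have "openin (top_of_set (M \<times> (UNIV :: real set))) (O1 \<times> UNIV)" using N(2) unfolding O1_def by (intro openin_Times) auto
  moreover have "openin (top_of_set (O1 \<times> UNIV)) U"
  proof -
    have "continuous_on (O1 \<times> (UNIV :: real set)) (\<lambda>q. (f (fst q), snd q))"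
      by (intro continuous_intros continuous_on_compose2[OF cf]) (auto simp: O1_def)
    then have "openin (top_of_set (O1 \<times> UNIV)) ((O1 \<times> UNIV) \<inter> (\<lambda>q. (f (fst q), snd q)) -` W)"
      using W(1) continuous_openin_preimage_gen by blast
    moreover have "(O1 \<times> UNIV) \<inter> (\<lambda>q. (f (fst q), snd q)) -` W = U" using W(2) by (force simp: U O1_def)
    ultimately show ?thesis by simp
  qed
  ultimately have oU: "openin (top_of_set (M \<times> UNIV)) U" by (rule openin_trans[rotated])
  have UN: "U \<subseteq> N \<times> UNIV" by (auto simp: U)
  have oUN: "openin (top_of_set (N \<times> UNIV)) U" by (rule openin_subset_trans[OF oU UN]) (use N(1) in auto)
  have inv: "?\<eta> (?\<theta> q) = q" if "q \<in> U" for q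
    using homeomorphism_apply1[OF fg] that by (simp add: U \<Phi>(3) prod_eq_iff)
  have im: "?\<theta> ` U = half_space 4 \<inter> \<Psi> -` W"
  proof
    show "?\<theta> ` U \<subseteq> half_space 4 \<inter> \<Psi> -` W"
    proof
      fix y assume "y \<in> ?\<theta> ` U"
      then obtain q where q: "q \<in> U" "y = ?\<theta> q" by blast
      then have "f (fst q) \<in> B" "(f (fst q), snd q) \<in> W" using homeomorphism_image1[OF fg] by (auto simp: U)
      then show "y \<in> half_space 4 \<inter> \<Psi> -` W" using W(2)[of "(f (fst q), snd q)"] q(2) by (simp add: \<Phi>(3) half_space_def)
    qed
    show "half_space 4 \<inter> \<Psi> -` W \<subseteq> ?\<theta> ` U"
    proof
      fix y assume y: "y \<in> half_space 4 \<inter> \<Psi> -` W"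
      then have "fst (\<Psi> y) \<in> B" using W(2)[of "\<Psi> y"] by (simp add: \<Phi>(4) half_space_def)
      then have *: "g (fst (\<Psi> y)) \<in> N" "f (g (fst (\<Psi> y))) = fst (\<Psi> y)"
        using homeomorphism_image2[OF fg] homeomorphism_apply2[OF fg] by auto
      show "y \<in> ?\<theta> ` U" by (rule image_eqI[of _ _ "?\<eta> y"]) (use y * in \<open>simp_all add: U \<Phi>(4)\<close>)
    qed
  qed
  have "open (\<Psi> -` W)" using W(1) pl_on_continuous[OF \<Phi>(2)] by (simp add: open_vimage continuous_on_eq_continuous_within)
  then have oI: "openin (top_of_set (half_space 4)) (?\<theta> ` U)" unfolding im by (simp add: openin_open_Int)
  have "pl_on (\<lambda>q. (f (fst q), (snd q :: real))) (N \<times> UNIV)"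
    using pl_on_map_prod[OF pf pl_on_linear[of "\<lambda>t::real. t"]] by (simp add: linear_iff)
  then have pl: "pl_on ?\<theta> U" using pl_on_compose_UNIV[OF pl_on_open_subset[OF _ oUN] \<Phi>(1)] by blast
  have "homeomorphism U (?\<theta> ` U) ?\<theta> ?\<eta>"
  proof (rule homeomorphismI)
    show "continuous_on U ?\<theta>" using pl pl_on_continuous by blast
    have "continuous_on (?\<theta> ` U) \<Psi>" using pl_on_continuous[OF \<Phi>(2)] continuous_on_subset by blast
    moreover have "fst (\<Psi> y) \<in> B" if "y \<in> ?\<theta> ` U" for y
      using that homeomorphism_image1[OF fg] by (auto simp: U \<Phi>(3))
    ultimately show "continuous_on (?\<theta> ` U) ?\<eta>"
      by (intro continuous_intros continuous_on_compose2[OF cg]) auto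
  qed (use inv in auto)
  then show ?thesis unfolding pl_chart_def pl_homeomorphism_def using oU oI pl pl_on_inverse by blast
qed

text \<open>Otherwise the transition map would have an open image inside the half-space that
  contains a point of its boundary, against invariance of domain.\<close>

lemma chart_boundary_unique:
  fixes f f' :: "'a::euclidean_space \<Rightarrow> real^'n::finite"
  assumes c: "pl_chart k M U f g" "pl_chart k M U' f' g'" and x: "x \<in> U" "x \<in> U'" and pos: "0 < f x $ k"
  shows "f' x $ k \<noteq> 0"
proof
  assume zero: "f' x $ k = 0"
  define U2 where "U2 = U \<inter> U'"
  have op: "openin (top_of_set M) U2" unfolding U2_def using c unfolding pl_chart_def by blast
  have c2: "pl_chart k M U2 f g" using pl_chart_restrict[OF c(1) op] by (simp add: U2_def)
  have xU: "x \<in> U2" using x by (simp add: U2_def)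
  have h: "homeomorphism U2 (f ` U2) f g" "openin (top_of_set (half_space k)) (f ` U2)"
    using c2 unfolding pl_chart_def pl_homeomorphism_def by auto
  have h': "homeomorphism U' (f' ` U') f' g'" "f' ` U' \<subseteq> half_space k"
    using c(2) openin_imp_subset unfolding pl_chart_def pl_homeomorphism_def by blast+
  obtain O1 where O1: "open O1" "f ` U2 = half_space k \<inter> O1" using h(2) openin_open by blast
  define G where "G = O1 \<inter> {v. 0 < v $ k}"
  have "open G" unfolding G_def by (intro open_Int O1(1) open_Collect_less continuous_intros)
  have Gs: "G \<subseteq> f ` U2" unfolding O1(2) G_def half_space_def by auto
  then have gG: "g v \<in> U'" if "v \<in> G" for v using homeomorphism_image2[OF h(1)] that unfolding U2_def by blast
  have "continuous_on G (\<lambda>v. f' (g v))"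
    by (rule continuous_on_compose2[OF homeomorphism_cont1[OF h'(1)] continuous_on_subset[OF homeomorphism_cont2[OF h(1)] Gs]])
      (use gG in auto)
  moreover have "inj_on (\<lambda>v. f' (g v)) G"
  proof (rule inj_onI)
    fix v w assume vw: "v \<in> G" "w \<in> G" "f' (g v) = f' (g w)"
    then have "g v = g w" using homeomorphism_apply1[OF h'(1)] gG by metis
    then show "v = w" using homeomorphism_apply2[OF h(1)] Gs vw by (metis subsetD)
  qed
  ultimately have og: "open ((\<lambda>v. f' (g v)) ` G)" using invariance_of_domain \<open>open G\<close> by blast
  have fx: "f x \<in> G" using O1(2) xU pos unfolding G_def by blast
  have "f' x \<in> (\<lambda>v. f' (g v)) ` G" by (rule image_eqI[OF _ fx]) (simp add: homeomorphism_apply1[OF h(1) xU])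
  then obtain e where e: "e > 0" "ball (f' x) e \<subseteq> (\<lambda>v. f' (g v)) ` G" using og open_contains_ball by metis
  define y where "y = f' x - (e / 2) *\<^sub>R axis k 1"
  have "y \<in> ball (f' x) e" using e(1) by (simp add: y_def dist_norm)
  then have "y \<in> f' ` U'" using e(2) gG by blast
  then have "0 \<le> y $ k" using h'(2) unfolding half_space_def by blast
  then show False using zero e(1) by (simp add: y_def)
qed

text \<open>The product chart puts the boundary coordinate of \<open>M\<close> last, and whether a
  point is on the boundary shows in any single chart. Properness of a lifting is thereby reduced to
  that of \<open>i\<close>.\<close>

lemma pl_boundary_times_line:
  fixes t :: real
  assumes M: "pl_3manifold M" and m: "m \<in> M"
  shows "(m, t) \<in> pl_boundary (4::4) (M \<times> UNIV) \<longleftrightarrow> m \<in> pl_boundary (3::3) M"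
proof -
  define \<Phi> :: "(real^3) \<times> real \<Rightarrow> real^4" where "\<Phi> = (\<lambda>z. pt4 (snd z) (fst z $ 1) (fst z $ 2) (fst z $ 3))"
  define \<Psi> :: "real^4 \<Rightarrow> (real^3) \<times> real" where "\<Psi> = (\<lambda>y. (pt (y $ 2) (y $ 3) (y $ 4), y $ 1))"
  have ps: "pl_on (\<lambda>z::(real^3) \<times> real. snd z) UNIV" "pl_on (\<lambda>z::(real^3) \<times> real. fst z $ k) UNIV" for k
    by (intro pl_on_linear, simp add: linear_iff)+
  have py: "pl_on (\<lambda>y::real^4. y $ k) UNIV" for k by (rule pl_on_linear) (simp add: linear_iff)
  have *: "pl_on \<Phi> UNIV" "pl_on \<Psi> UNIV" "\<Psi> (\<Phi> z) = z" "\<Phi> (\<Psi> y) = y" for z y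
    unfolding \<Phi>_def \<Psi>_def by (auto intro!: pl_on_pt4 pl_on_Pair pl_on_pt ps py simp: vec4_eq_iff)
  have prod: "\<exists>U' f' g'. (m, t) \<in> U' \<and> pl_chart (4::4) (M \<times> UNIV) U' f' g' \<and> f' (m, t) $ 4 = f m $ 3"
    if c: "pl_chart (3::3) M U f g" "m \<in> U" for U f g
  proof -
    have c': "openin (top_of_set M) U" "openin (top_of_set (half_space (3::3))) (f ` U)" "homeomorphism U (f ` U) f g" "pl_on f U"
      using c(1) unfolding pl_chart_def pl_homeomorphism_def by auto
    obtain V where V: "open V" "f ` U = half_space 3 \<inter> V" using c'(2) openin_open by blast
    then have "{q \<in> U. f q \<in> V} = U" by blast
    then have "openin (top_of_set M) {q \<in> U. f q \<in> V}" using c'(1) by simp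
    then have ch: "pl_chart (4::4) (M \<times> UNIV) {q. fst q \<in> U \<and> (f (fst q), snd q) \<in> V \<times> UNIV} (\<lambda>q. \<Phi> (f (fst q), snd q))
      (\<lambda>y. (g (fst (\<Psi> y)), snd (\<Psi> y)))"
    proof (rule pl_chart_times_line[OF openin_imp_subset[OF c'(1)] _ c'(3,4) *, of V "V \<times> UNIV"])
      show "open (V \<times> (UNIV :: real set))" using V(1) by (intro open_Times open_UNIV)
      show "fst z \<in> V \<and> (fst z \<in> f ` U \<longleftrightarrow> 0 \<le> \<Phi> z $ 4)" if "z \<in> V \<times> UNIV" for z
        using that unfolding V(2) by (auto simp: half_space_def \<Phi>_def)
    qed simp
    have mt: "(m, t) \<in> {q. fst q \<in> U \<and> (f (fst q), snd q) \<in> V \<times> UNIV}" using c(2) V(2) by auto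
    have "\<Phi> (f (fst (m, t)), snd (m, t)) $ 4 = f m $ 3" by (simp add: \<Phi>_def)
    then show ?thesis by (intro exI conjI) (rule mt ch)+
  qed
  show ?thesis
  proof
    assume "m \<in> pl_boundary (3::3) M"
    then obtain U f g where "m \<in> U" "pl_chart (3::3) M U f g" "f m $ 3 = 0" unfolding pl_boundary_def by auto
    then show "(m, t) \<in> pl_boundary (4::4) (M \<times> UNIV)" using prod[of U f g] m unfolding pl_boundary_def by auto
  next
    assume "(m, t) \<in> pl_boundary (4::4) (M \<times> UNIV)"
    then obtain U' f' g' where b: "(m, t) \<in> U'" "pl_chart (4::4) (M \<times> UNIV) U' f' g'" "f' (m, t) $ 4 = 0"
      unfolding pl_boundary_def by auto
    obtain U f g where c: "m \<in> U" "pl_chart (3::3) M U f g" using M m unfolding pl_manifold_def by blast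
    then have "f m \<in> half_space 3" using openin_imp_subset unfolding pl_chart_def by blast
    then have "0 \<le> f m $ 3" by (simp add: half_space_def)
    moreover have "\<not> 0 < f m $ 3"
    proof
      assume pos: "0 < f m $ 3"
      obtain U2 f2 g2 where "(m, t) \<in> U2" "pl_chart (4::4) (M \<times> UNIV) U2 f2 g2" "f2 (m, t) $ 4 = f m $ 3"
        using prod[OF c(2,1)] by blast
      then show False using chart_boundary_unique[of 4 "M \<times> UNIV" U2 f2 g2 U' f' g' "(m, t)"] b pos by simp
    qed
    ultimately have "f m $ 3 = 0" by simp
    then show "m \<in> pl_boundary (3::3) M" unfolding pl_boundary_def using c m by blast
  qed
qed

section \<open>Flatness over sheets and at branch points\<close>

context generic_map
begin

text \<open>The height on the sheet is extended to the whole coordinate space through a PL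
  retraction onto a piece of the sheet; subtracting the extension makes the lifted sheet flat. The
  rest of the lifted surface is compact and misses the point by injectivity, so it can be cut out of
  the chart.\<close>

lemma flat_at_sheet:
  assumes x: "x \<in> F" and nb: "\<not> branch_value F M i (i x)" and h: "pl_on (h :: 'b \<Rightarrow> real) F" and inj: "inj_on (\<lambda>x. (i x, h x)) F"
  shows "\<exists>U f g. (i x, h x) \<in> U \<and> pl_chart (4::4) (M \<times> UNIV) U f g \<and>
    f ` (U \<inter> (\<lambda>x. (i x, h x)) ` F) = f ` U \<inter> {v. v $ 1 = 0 \<and> v $ 2 = 0}"
proof -
  let ?S = "(\<lambda>x. (i x, h x)) ` F"
  have p: "i x \<in> i ` F" using x by blast
  obtain B K where BK: "sheet_model B K" "sheets_at F M i B K (i x)" using nonbranch_sheets[OF p nb] by blast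
  obtain N f g \<sigma> where ch: "sheet_chart F M i (i x) B K N f g \<sigma>" using sheets_at_imp_chart[OF BK(2,1)] by metis
  note mod = sheet_chart_model[OF ch] and base = sheet_chart_base[OF ch]
  have fgh: "homeomorphism N B f g" using sheet_chart_fg(1)[OF ch] .
  obtain r where r: "0 < r" "r < 1" "\<And>V. open V \<Longrightarrow> V \<subseteq> ocube r \<Longrightarrow> openin (top_of_set M) {q \<in> N. f q \<in> V}"
    using chart_core[OF base(1) fgh base(3)] by metis
  define \<rho> where "\<rho> = r / 2"
  have \<rho>: "0 < \<rho>" "\<rho> < r" "\<rho> < 1" using r by (auto simp: \<rho>_def)
  have sub: "ocube \<rho> \<subseteq> ocube r" using \<rho>(2) by (auto simp: mem_ocube_3)
  have oO: "openin (top_of_set M) {q \<in> N. f q \<in> ocube \<rho>}" using r(3)[OF open_ocube sub] .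
  have oOr: "openin (top_of_set M) {q \<in> N. f q \<in> ocube r}" using r(3)[OF open_ocube] by simp
  have f0: "f (i x) = 0" using base(3) .
  obtain k where k: "k \<in> K" "x = \<sigma> k 0" using sheet_chart_cases[OF ch x base(4)] f0 by metis
  have g0: "g 0 \<in> {q \<in> N. f q \<in> ocube \<rho>}"
    using sheet_chart_fgI(1)[OF ch base(4)] f0 base(4) \<rho>(1) by (simp add: ocube_def)
  obtain W' where W': "open W'" "x \<in> W'" "F \<inter> W' \<subseteq> \<sigma> k ` (B \<inter> coord_plane k)"
    unfolding k(2) by (rule sheet_chart_open[OF ch cont_i k(1) oO Collect_subset i_into mod(4) coord_plane_props(3) g0])
  have ih: "continuous_on F (\<lambda>x. (i x, h x))" using cont_i pl_on_continuous[OF h] by (intro continuous_intros)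
  define C where "C = (\<lambda>x. (i x, h x)) ` (F - W')"
  have "compact (F - W')" using generic_props(1) W'(1) by (simp add: compact_diff)
  then have "closed C" unfolding C_def
    by (intro compact_imp_closed compact_continuous_image continuous_on_subset[OF ih]) auto
  have xC: "(i x, h x) \<notin> C"
  proof
    assume "(i x, h x) \<in> C"
    then obtain y where "y \<in> F" "y \<notin> W'" "(i x, h x) = (i y, h y)" unfolding C_def by blast
    then show False using inj_onD[OF inj, of x y] x W'(2) by blast
  qed
  \<comment> \<open>\<open>B\<close> is a box, and \<open>lo\<close> is its lower corner: 0 instead
    of -1 in the boundary direction of the half cube.\<close>
  define lo where "lo = (\<lambda>j::3. if j = 3 \<and> B = half_cube \<and> B \<noteq> cube then 0 else -1 :: real)"
  have Bmem: "v \<in> B \<longleftrightarrow> (\<forall>j. lo j \<le> v $ j \<and> v $ j \<le> 1)" for v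
  proof (cases "B = cube")
    case True then show ?thesis by (auto simp: lo_def mem_cube abs_le_iff)
  next
    case False
    then have "B = half_cube" using BK(1) by (simp add: sheet_model_def)
    then show ?thesis using False by (force simp: lo_def half_cube_def half_space_def mem_cube abs_le_iff)
  qed
  \<comment> \<open>Coordinate \<open>k\<close> is set to 0 and the others are clamped into
    \<open>B\<close> and into radius \<open>\<rho>\<close>. The result lies on the sheet, and points
    of the sheet inside the cube of radius \<open>\<rho>\<close> stay fixed.\<close>
  define cl where "cl = (\<lambda>v j. if j = k then 0 else max (max (lo j) (- \<rho>)) (min \<rho> (v $ j)) :: real)"
  define ret where "ret = (\<lambda>v. pt (cl v 1) (cl v 2) (cl v 3))"
  have ret_nth: "ret v $ j = cl v j" for v j
    using exhaust_3[of j] by (auto simp: ret_def)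
  have lo: "lo j \<le> 0" "lo j \<le> 1" for j by (auto simp: lo_def)
  have cl: "lo j \<le> cl v j" "cl v j \<le> 1" "\<bar>cl v j\<bar> < r" for v j
    using lo(1)[of j] \<rho> unfolding cl_def by (auto simp: max_def min_def)
  then have ret_in: "ret v \<in> B \<inter> coord_plane k \<inter> ocube r" for v
    by (simp add: Bmem coord_plane_def ocube_def ret_nth) (simp add: cl_def)
  have ret_id: "ret v = v" if "v \<in> B" "v \<in> coord_plane k" "v \<in> ocube \<rho>" for v
  proof -
    have "cl v j = v $ j" for j
    proof (cases "j = k")
      case False
      have "lo j \<le> v $ j" "\<bar>v $ j\<bar> < \<rho>" using that(1,3) unfolding Bmem ocube_def by simp_all
      then show ?thesis using False by (auto simp: cl_def max_def min_def)
    qed (use that(2) in \<open>simp add: cl_def coord_plane_def\<close>)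
    then show ?thesis by (simp add: vec_eq_iff ret_nth)
  qed
  have pv: "pl_on (\<lambda>v::real^3. v $ j) UNIV" for j by (rule pl_on_linear) (simp add: linear_iff)
  have "pl_on (\<lambda>v. cl v j) UNIV" for j
    unfolding cl_def by (cases "j = k") (auto intro!: pl_on_max pl_on_min pl_on_const pv)
  then have pret: "pl_on ret UNIV" unfolding ret_def by (intro pl_on_pt)
  define D where "D = \<sigma> k ` (B \<inter> coord_plane k \<inter> ocube r)"
  have "homeomorphism (B \<inter> coord_plane k \<inter> ocube r) D (\<sigma> k) (\<lambda>x. f (i x))"
    unfolding D_def by (rule homeomorphism_of_subsets[OF sheet_chart_hom[OF ch k(1)]]) auto
  then have hs: "homeomorphism D (B \<inter> coord_plane k \<inter> ocube r) (\<lambda>x. f (i x)) (\<sigma> k)" by (rule homeomorphism_symD)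
  have DF: "D \<subseteq> F" "i ` D \<subseteq> N" using sheet_chart_preimage[OF ch] k(1) unfolding D_def by blast+
  have oD: "openin (top_of_set F) D"
  proof (subst openin_subopen, intro ballI)
    fix y assume "y \<in> D"
    then obtain v where v: "v \<in> B" "v \<in> coord_plane k" "v \<in> ocube r" "y = \<sigma> k v" unfolding D_def by blast
    have gv: "g v \<in> {q \<in> N. f q \<in> ocube r}" using sheet_chart_fgI(3,4)[OF ch v(1)] v(3) by simp
    obtain W1 where W1: "open W1" "\<sigma> k v \<in> W1" "F \<inter> W1 \<subseteq> \<sigma> k ` (B \<inter> coord_plane k)"
        "i ` (F \<inter> W1) \<subseteq> {q \<in> N. f q \<in> ocube r}"
      by (rule sheet_chart_open[OF ch cont_i k(1) oOr Collect_subset i_into v(1,2) gv])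
    have "F \<inter> W1 \<subseteq> D"
    proof
      fix y' assume y': "y' \<in> F \<inter> W1"
      then obtain v' where v': "v' \<in> B" "v' \<in> coord_plane k" "y' = \<sigma> k v'" using W1(3) by blast
      have "f (i y') \<in> ocube r" using W1(4) y' by blast
      then show "y' \<in> D" unfolding D_def using sheet_chart_inv[OF ch k(1) v'(1,2)] v' by simp
    qed
    then show "\<exists>T. openin (top_of_set F) T \<and> y \<in> T \<and> T \<subseteq> D"
      using W1(1,2) v(4) \<open>y \<in> D\<close> DF(1) by (intro exI[of _ "F \<inter> W1"]) (auto simp: openin_open_Int)
  qed
  have "pl_on (\<lambda>x. f (i x)) D" by (rule pl_on_compose[OF pl_on_open_subset[OF pl_i oD] sheet_chart_fg(2)[OF ch] DF(2)])
  then have "pl_on (\<sigma> k) (B \<inter> coord_plane k \<inter> ocube r)" by (rule pl_on_inverse[OF hs])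
  then have "pl_on (\<lambda>v. \<sigma> k (ret v)) UNIV" by (rule pl_on_compose[OF pret]) (use ret_in in blast)
  then have ps: "pl_on (\<lambda>v. h (\<sigma> k (ret v))) UNIV"
    by (rule pl_on_compose[OF _ h]) (use ret_in DF(1) in \<open>auto simp: D_def\<close>)
  define H where "H = (\<lambda>v. h (\<sigma> k (ret v)))"
  have H0: "H 0 = h x" using ret_id[OF mod(4) coord_plane_props(3)] k(2) \<rho>(1) by (simp add: H_def ocube_def)
  \<comment> \<open>For the half cube, the last coordinate of the flat chart has to be the boundary
    coordinate 3.\<close>
  obtain l m where lm: "k \<noteq> l" "k \<noteq> m" "l \<noteq> m" "\<And>j. j = k \<or> j = l \<or> j = m" "B = cube \<or> m = 3"
  proof (cases "k = 3")
    case True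
    then have "B = cube" using BK(1) k(1) by (auto simp: sheet_model_def)
    then show thesis using True exhaust_3 by (intro that[of 1 2]) auto
  next
    case False
    obtain m where "m \<noteq> k" "m \<noteq> 3" "\<forall>j. j = k \<or> j = 3 \<or> j = m" using three_other[OF False] by blast
    then show thesis using False by (intro that[of m 3]) auto
  qed
  \<comment> \<open>At an interior point, the shift by 1 keeps the chart off the boundary of the
    model half-space.\<close>
  define c where "c = (if B = cube then 1 else 0 :: real)"
  define \<Phi> :: "(real^3) \<times> real \<Rightarrow> real^4"
    where "\<Phi> = (\<lambda>z. pt4 (fst z $ k) (snd z - H (fst z)) (fst z $ l) (fst z $ m + c))"
  define w :: "real^4 \<Rightarrow> real^3" where "w = (\<lambda>y. \<chi> j. if j = k then y $ 1 else if j = l then y $ 3 else y $ 4 - c)"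
  define \<Psi> :: "real^4 \<Rightarrow> (real^3) \<times> real" where "\<Psi> = (\<lambda>y. (w y, y $ 2 + H (w y)))"
  have w_nth: "w y $ k = y $ 1" "w y $ l = y $ 3" "w y $ m = y $ 4 - c" for y using lm(1-3) by (auto simp: w_def)
  have eq3: "v = v'" if "v $ k = v' $ k" "v $ l = v' $ l" "v $ m = v' $ m" for v v' :: "real^3"
  proof -
    have "v $ j = v' $ j" for j using lm(4)[of j] that by auto
    then show ?thesis by (simp add: vec_eq_iff)
  qed
  have ww: "w (\<Phi> z) = fst z" for z by (rule eq3) (simp_all add: w_nth \<Phi>_def)
  have py: "pl_on (\<lambda>y::real^4. y $ j) UNIV" for j by (rule pl_on_linear) (simp add: linear_iff)
  have pw: "pl_on w UNIV"
  proof (rule pl_on_vec)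
    fix j
    show "pl_on (\<lambda>y. w y $ j) UNIV" unfolding w_def vec_lambda_beta
      using py pl_on_diff[OF py pl_on_const[OF py]] by (cases "j = k"; cases "j = l") simp_all
  qed
  have pz: "pl_on (\<lambda>z::(real^3) \<times> real. snd z) UNIV" "pl_on (\<lambda>z::(real^3) \<times> real. fst z) UNIV"
    by (intro pl_on_linear, simp add: linear_iff)+
  have pH: "pl_on H UNIV" using ps unfolding H_def .
  have \<Phi>: "pl_on \<Phi> UNIV" "pl_on \<Psi> UNIV" "\<Psi> (\<Phi> z) = z" "\<Phi> (\<Psi> y) = y" for z y
  proof -
    show "pl_on \<Phi> UNIV" unfolding \<Phi>_def
      by (intro pl_on_pt4 pl_on_diff pl_on_add pl_on_vec_nth[OF pz(2)] pz(1) pl_on_compose_UNIV[OF pz(2) pH] pl_on_const[OF pz(1)])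
    show "pl_on \<Psi> UNIV" unfolding \<Psi>_def by (intro pl_on_Pair pl_on_add pw py pl_on_compose_UNIV[OF pw pH])
    show "\<Psi> (\<Phi> z) = z" using ww by (simp add: \<Psi>_def prod_eq_iff) (simp add: \<Phi>_def)
    show "\<Phi> (\<Psi> y) = y" by (simp add: \<Phi>_def \<Psi>_def vec4_eq_iff w_nth)
  qed
  define W where "W = ocube \<rho> \<times> (UNIV :: real set)"
  define U0 where "U0 = {q. fst q \<in> N \<and> (f (fst q), snd q) \<in> W}"
  have oW: "open W" unfolding W_def by (intro open_Times open_ocube open_UNIV)
  have half: "fst z \<in> ocube \<rho> \<and> (fst z \<in> B \<longleftrightarrow> 0 \<le> \<Phi> z $ 4)" if z: "z \<in> W" for z
  proof -
    have v: "\<bar>fst z $ j\<bar> < 1" for j using z \<rho>(3) less_trans unfolding W_def ocube_def by fastforce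
    have "fst z \<in> B \<longleftrightarrow> 0 \<le> \<Phi> z $ 4"
    proof (cases "B = cube")
      case True
      then show ?thesis using v[of m] less_imp_le[OF v] by (simp add: mem_cube \<Phi>_def c_def)
    next
      case False
      then have "B = half_cube" "m = 3" using BK(1) lm(5) by (auto simp: sheet_model_def)
      then show ?thesis using False less_imp_le[OF v] by (simp add: mem_cube half_cube_def half_space_def \<Phi>_def c_def)
    qed
    then show ?thesis using z by (auto simp: W_def)
  qed
  let ?\<theta> = "\<lambda>q. \<Phi> (f (fst q), snd q)" and ?\<eta> = "\<lambda>y. (g (fst (\<Psi> y)), snd (\<Psi> y))"
  have c0: "pl_chart (4::4) (M \<times> UNIV) U0 ?\<theta> ?\<eta>"
    by (rule pl_chart_times_line[OF base(6) oO fgh sheet_chart_fg(2)[OF ch] \<Phi> oW half U0_def])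
  define U where "U = U0 - C"
  have oU0: "openin (top_of_set (M \<times> UNIV)) U0" using c0 unfolding pl_chart_def by blast
  then have oU: "openin (top_of_set (M \<times> UNIV)) U" unfolding U_def using \<open>closed C\<close>
    by (simp add: Diff_eq openin_Int_open open_Compl)
  have c1: "pl_chart (4::4) (M \<times> UNIV) U ?\<theta> ?\<eta>" by (rule pl_chart_restrict[OF c0 oU]) (simp add: U_def)
  have xU: "(i x, h x) \<in> U" using xC base(4) \<rho>(1) f0 by (simp add: U_def U0_def W_def ocube_def)
  have on: "q \<in> ?S \<longleftrightarrow> ?\<theta> q $ 1 = 0 \<and> ?\<theta> q $ 2 = 0" if q: "q \<in> U" for q
  proof -
    have qN: "fst q \<in> N" and qC: "q \<notin> C" and qr: "f (fst q) \<in> ocube \<rho>" using q by (auto simp: U_def U0_def W_def)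
    note vB = sheet_chart_fgI(1,2)[OF ch qN]
    show ?thesis
    proof
      assume "q \<in> ?S"
      then obtain y where y: "y \<in> F" "q = (i y, h y)" by blast
      then have "y \<in> W'" using qC unfolding C_def by blast
      then obtain v where v: "v \<in> B" "v \<in> coord_plane k" "y = \<sigma> k v" using W'(3) y(1) by blast
      have "f (i y) = v" using sheet_chart_inv[OF ch k(1) v(1,2)] v(3) by simp
      then show "?\<theta> q $ 1 = 0 \<and> ?\<theta> q $ 2 = 0"
        using v ret_id[OF v(1,2)] qr y(2) by (simp add: \<Phi>_def H_def coord_plane_def)
    next
      assume a: "?\<theta> q $ 1 = 0 \<and> ?\<theta> q $ 2 = 0"
      then have vk: "f (fst q) \<in> coord_plane k" by (simp add: \<Phi>_def coord_plane_def)
      have m: "\<sigma> k (f (fst q)) \<in> F" "i (\<sigma> k (f (fst q))) = fst q" using sheet_chart_mem[OF ch k(1) vB(2) vk] vB(1) by auto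
      have "snd q = h (\<sigma> k (f (fst q)))" using a ret_id[OF vB(2) vk qr] by (simp add: \<Phi>_def H_def)
      then show "q \<in> ?S" using m by (intro image_eqI[of _ _ "\<sigma> k (f (fst q))"]) (auto simp: prod_eq_iff)
    qed
  qed
  have "?\<theta> ` (U \<inter> ?S) = ?\<theta> ` U \<inter> {v. v $ 1 = 0 \<and> v $ 2 = 0}" using on by auto
  then show ?thesis using xU c1 by blast
qed

text \<open>Subtracting \<open>umb_y\<close> and \<open>umb_z\<close> from the second and third
  coordinates flattens the umbrella, with the fourth coordinate in the place of its parameter. As
  the height is \<open>s\<close> times the parameter, the parameter is \<open>s\<close> times the
  height.\<close>

lemma flat_at_branch:
  fixes h :: "'b \<Rightarrow> real"
  assumes x: "x \<in> F" and bv: "branch_value F M i (i x)" and core: "branch_core (i x) N f g r"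
    and e: "0 < e" "e \<le> r" and s: "s = 1 \<or> s = -1"
    and hs: "\<And>y. y \<in> nbd N f r \<Longrightarrow> f (i y) \<in> ocube e \<Longrightarrow> h y = s * ucoord N f y"
  shows "\<exists>U f g. (i x, h x) \<in> U \<and> pl_chart (4::4) (M \<times> UNIV) U f g \<and>
    f ` (U \<inter> (\<lambda>x. (i x, h x)) ` F) = f ` U \<inter> {v. v $ 1 = 0 \<and> v $ 2 = 0}"
proof -
  let ?S = "(\<lambda>x. (i x, h x)) ` F"
  note bc = core_props(1)[OF core] and r = core_props(2,3)[OF core]
  note bp = bc_props[OF bc] and nd = nbd_def[OF core]
  have "{x' \<in> F. i x' = i x} = {x}" using branch_fibre[OF bv x] x by force
  note apx = apex[OF core this]
  have hx: "h x = 0" using hs[OF apx(1)] apx(2,3) e(1) by (simp add: ocube_def)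
  have ss: "s * (s * t) = t" for t using s by auto
  have sub: "ocube e \<subseteq> ocube r" using e(2) by (auto simp: mem_ocube_3)
  define Y where "Y = (\<lambda>c d. umb_y c (s * d))"
  define Z where "Z = (\<lambda>c d. umb_z c (s * d))"
  define \<Phi> :: "(real^3) \<times> real \<Rightarrow> real^4" where
    "\<Phi> = (\<lambda>z. pt4 (fst z $ 2 - Y (fst z $ 1) (snd z)) (fst z $ 3 - Z (fst z $ 1) (snd z)) (fst z $ 1) (snd z + 1))"
  define \<Psi> :: "real^4 \<Rightarrow> (real^3) \<times> real" where
    "\<Psi> = (\<lambda>y. (pt (y $ 3) (y $ 1 + Y (y $ 3) (y $ 4 - 1)) (y $ 2 + Z (y $ 3) (y $ 4 - 1)), y $ 4 - 1))"
  have pYZ: "pl_on (\<lambda>z. Y (a z) (b z)) UNIV" "pl_on (\<lambda>z. Z (a z) (b z)) UNIV"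
    if "pl_on a UNIV" "pl_on b UNIV" for a b :: "'c::euclidean_space \<Rightarrow> real"
  proof -
    have "Y (a z) (b z) = (1/2) * (\<bar>a z + s * b z\<bar> - \<bar>a z - s * b z\<bar>)" for z by (simp add: Y_def umb_y_def)
    then show "pl_on (\<lambda>z. Y (a z) (b z)) UNIV" by (simp only:) (intro pl_on_cmult pl_on_diff pl_on_add pl_on_abs that)
    show "pl_on (\<lambda>z. Z (a z) (b z)) UNIV" unfolding Z_def umb_z_def
      by (intro pl_on_max pl_on_cmult pl_on_add pl_on_abs that)
  qed
  have ps: "pl_on (\<lambda>z::(real^3) \<times> real. snd z) UNIV" "pl_on (\<lambda>z::(real^3) \<times> real. fst z $ k) UNIV" for k
    by (intro pl_on_linear, simp add: linear_iff)+
  have py: "pl_on (\<lambda>y::real^4. y $ k) UNIV" for k by (rule pl_on_linear) (simp add: linear_iff)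
  have \<Phi>: "pl_on \<Phi> UNIV" "pl_on \<Psi> UNIV" "\<Psi> (\<Phi> z) = z" "\<Phi> (\<Psi> y) = y" for z y
  proof -
    show "pl_on \<Phi> UNIV" unfolding \<Phi>_def
      by (intro pl_on_pt4 pl_on_diff pl_on_add pYZ ps pl_on_const[OF ps(1)])
    show "pl_on \<Psi> UNIV" unfolding \<Psi>_def
      by (intro pl_on_Pair pl_on_pt pl_on_diff pl_on_add pYZ py pl_on_const[OF py])
  qed (simp_all add: \<Phi>_def \<Psi>_def prod_eq_iff vec4_eq_iff)
  \<comment> \<open>The last chart coordinate is the height plus 1. The height is 0 at the branch
    point, and restricting it to values above -1 keeps the chart in the half-space.\<close>
  define W where "W = ocube e \<times> {-1 :: real <..}"
  have oW: "open W" unfolding W_def by (intro open_Times open_ocube) simp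
  have half: "fst z \<in> ocube e \<and> (fst z \<in> cube \<longleftrightarrow> 0 \<le> \<Phi> z $ 4)" if z: "z \<in> W" for z
  proof -
    have v: "fst z \<in> ocube e" "0 \<le> \<Phi> z $ 4" using z by (auto simp: W_def \<Phi>_def)
    have "\<bar>fst z $ j\<bar> \<le> 1" for j
      using v(1) e(2) r(2) unfolding ocube_def by (metis (mono_tags, lifting) dual_order.trans less_imp_le mem_Collect_eq)
    then show ?thesis using v by (simp add: mem_cube)
  qed
  let ?\<theta> = "\<lambda>q. \<Phi> (f (fst q), snd q)" and ?\<eta> = "\<lambda>y. (g (fst (\<Psi> y)), snd (\<Psi> y))"
  define U where "U = {q. fst q \<in> N \<and> (f (fst q), snd q) \<in> W}"
  have c: "pl_chart (4::4) (M \<times> UNIV) U ?\<theta> ?\<eta>"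
    by (rule pl_chart_times_line[OF bp(7) core_props(4)[OF core open_ocube sub] bp(5,8) \<Phi> oW half U_def])
  have xU: "(i x, h x) \<in> U" using bp(6) apx(2) hx e(1) by (simp add: U_def W_def ocube_def)
  have on: "q \<in> ?S \<longleftrightarrow> ?\<theta> q $ 1 = 0 \<and> ?\<theta> q $ 2 = 0" if q: "q \<in> U" for q
  proof -
    have qN: "fst q \<in> N" and qe: "f (fst q) \<in> ocube e" using q by (auto simp: U_def W_def)
    show ?thesis
    proof
      assume "q \<in> ?S"
      then obtain y where y: "y \<in> F" "q = (i y, h y)" by blast
      then have yn: "y \<in> nbd N f r" using qN qe sub unfolding nd by auto
      have "s * h y = ucoord N f y" using hs[OF yn] qe y(2) ss by simp
      then show "?\<theta> q $ 1 = 0 \<and> ?\<theta> q $ 2 = 0"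
        using umbrella_graph[OF core bv yn] y(2) by (simp add: \<Phi>_def Y_def Z_def)
    next
      assume "?\<theta> q $ 1 = 0 \<and> ?\<theta> q $ 2 = 0"
      then have a: "f (fst q) $ 2 = umb_y (f (fst q) $ 1) (s * snd q)" "f (fst q) $ 3 = umb_z (f (fst q) $ 1) (s * snd q)"
        by (simp_all add: \<Phi>_def Y_def Z_def)
      obtain y where y: "y \<in> nbd N f r" "f (i y) = f (fst q)" "ucoord N f y = s * snd q"
        by (rule umbrella_graph_onto[OF core bv _ a]) (use qe sub in blast)
      have "i y = fst q" using nbd_g[OF core y(1)] y(2) bc_gf(1)[OF bc qN] by simp
      moreover have "h y = snd q" using hs[OF y(1)] y(2,3) qe ss by simp
      moreover have "y \<in> F" using y(1) unfolding nd by simp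
      ultimately show "q \<in> ?S" by (intro image_eqI[of _ _ y]) (auto simp: prod_eq_iff)
    qed
  qed
  have "?\<theta> ` (U \<inter> ?S) = ?\<theta> ` U \<inter> {v. v $ 1 = 0 \<and> v $ 2 = 0}" using on by auto
  then show ?thesis using xU c by (intro exI conjI)
qed

lemma height_lifting:
  fixes h :: "'b \<Rightarrow> real"
  assumes h: "pl_on h F" and sep: "\<And>z. z \<in> pairs \<Longrightarrow> h (fst z) \<noteq> h (snd z)"
    and br: "\<And>p. branch_value F M i p \<Longrightarrow> \<exists>N f g r e s. branch_core p N f g r \<and> 0 < e \<and> e \<le> r \<and> (s = 1 \<or> s = -1) \<and>
      (\<forall>x\<in>nbd N f r. f (i x) \<in> ocube e \<longrightarrow> h x = s * ucoord N f x)"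
  shows "lifting F M i h"
proof -
  have inj: "inj_on (\<lambda>x. (i x, h x)) F"
  proof (rule inj_onI, rule ccontr)
    fix x y assume "x \<in> F" "y \<in> F" "(i x, h x) = (i y, h y)" "x \<noteq> y"
    then show False using sep[of "(x, y)"] by (simp add: pairs_def)
  qed
  have "proper_pl_map (2::2) F (4::4) (M \<times> UNIV) (\<lambda>x. (i x, h x))"
  proof -
    have "{x \<in> F. (i x, h x) \<in> pl_boundary (4::4) (M \<times> UNIV)} = {x \<in> F. i x \<in> pl_boundary (3::3) M}"
      using pl_boundary_times_line[OF generic_props(3)] i_into by blast
    then show ?thesis using generic_props(4) pl_on_Pair[OF pl_i h] i_into unfolding proper_pl_map_def by auto
  qed
  moreover have "locally_flat (M \<times> UNIV) ((\<lambda>x. (i x, h x)) ` F)"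
    unfolding locally_flat_def
  proof (rule ballI)
    fix q assume "q \<in> (\<lambda>x. (i x, h x)) ` F"
    then obtain x where x: "x \<in> F" "q = (i x, h x)" by blast
    show "\<exists>U f g. q \<in> U \<and> pl_chart (4::4) (M \<times> UNIV) U f g \<and>
      f ` (U \<inter> (\<lambda>x. (i x, h x)) ` F) = f ` U \<inter> {v. v $ 1 = 0 \<and> v $ 2 = 0}"
    proof (cases "branch_value F M i (i x)")
      case True
      obtain N f g r e s where "branch_core (i x) N f g r" "0 < e" "e \<le> r" "s = 1 \<or> s = -1"
        "\<forall>y\<in>nbd N f r. f (i y) \<in> ocube e \<longrightarrow> h y = s * ucoord N f y" using br[OF True] by (elim exE conjE)
      then show ?thesis unfolding x(2) by (intro flat_at_branch[OF x(1) True]) auto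
    next
      case False
      show ?thesis unfolding x(2) by (rule flat_at_sheet[OF x(1) False h inj])
    qed
  qed
  ultimately show ?thesis unfolding lifting_def using h inj by blast
qed

end

section \<open>Liftings and lifting attempts\<close>

context generic_map
begin

lemma lifting_arc_sign:
  assumes h: "lifting F M i h" and arc: "double_arc F M i a b"
  shows "(\<forall>(x, y)\<in>strip a b. x \<noteq> y \<longrightarrow> h y < h x) \<or> (\<forall>(x, y)\<in>strip a b. x \<noteq> y \<longrightarrow> h x < h y)"
proof -
  have inj: "inj_on (\<lambda>x. (i x, h x)) F" and ph: "pl_on h F" using h unfolding lifting_def by auto
  have tr: "double_track F i a b" and ne: "\<And>t. 0 < t \<Longrightarrow> t < 1 \<Longrightarrow> a t \<noteq> b t"
    using arc unfolding double_arc_def open_double_arc_def closed_double_arc_def by force+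
  have ab: "a ` {0..1} \<subseteq> F" "b ` {0..1} \<subseteq> F" "\<And>t. t \<in> {0..1} \<Longrightarrow> i (a t) = i (b t)"
    and pab: "pl_on a {0..1}" "pl_on b {0..1}" using tr unfolding double_track_def by auto
  define d where "d = (\<lambda>t. h (a t) - h (b t))"
  have cd: "continuous_on {0..1} d" unfolding d_def
    by (intro continuous_on_diff pl_on_continuous pl_on_compose[OF pab(1) ph ab(1)] pl_on_compose[OF pab(2) ph ab(2)])
  have nz: "d t \<noteq> 0" if "t \<in> {0..1}" "a t \<noteq> b t" for t
  proof
    assume "d t = 0"
    then have "(i (a t), h (a t)) = (i (b t), h (b t))" using ab(3)[OF that(1)] by (simp add: d_def)
    then show False using inj_onD[OF inj] ab(1,2) that by blast
  qed
  have same: "0 < d u * d v" if uv: "u \<in> {0..1}" "v \<in> {0..1}" "a u \<noteq> b u" "a v \<noteq> b v" "u \<le> v" for u v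
  proof (rule ccontr)
    have mid: "d w \<noteq> 0" if w: "u \<le> w" "w \<le> v" for w
    proof (cases "w = u \<or> w = v")
      case True
      then show ?thesis using nz[OF uv(1,3)] nz[OF uv(2,4)] by blast
    next
      case False
      then have "0 < w" "w < 1" using w uv(1,2) by auto
      then show ?thesis using nz[of w] ne[of w] by simp
    qed
    have cuv: "continuous_on {u..v} d" by (rule continuous_on_subset[OF cd]) (use uv in auto)
    assume "\<not> 0 < d u * d v"
    then consider "d u \<le> 0" "0 \<le> d v" | "d v \<le> 0" "0 \<le> d u" by (metis linorder_not_le mult_neg_neg mult_pos_pos less_imp_le)
    then show False
    proof cases
      case 1 then show False using IVT'[OF 1 uv(5) cuv] mid by blast
    next
      case 2 then show False using IVT2'[OF 2 uv(5) cuv] mid by blast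
    qed
  qed
  \<comment> \<open>At the ends of an arc the two points may coincide in a branch point, so signs
    are compared with the middle parameter.\<close>
  have half: "(1/2::real) \<in> {0..1}" "a (1/2) \<noteq> b (1/2)" using ne[of "1/2"] by auto
  have sgn: "0 < d t * d (1/2)" if "t \<in> {0..1}" "a t \<noteq> b t" for t
    using same[OF that(1) half(1) that(2) half(2)] same[OF half(1) that(1) half(2) that(2)] by (cases "t \<le> 1/2") (auto simp: mult.commute)
  show ?thesis
  proof (cases "0 < d (1/2)")
    case True
    then have "0 < d t" if "t \<in> {0..1}" "a t \<noteq> b t" for t using sgn[OF that] by (simp add: zero_less_mult_iff)
    then show ?thesis unfolding strip_def d_def by (intro disjI1) auto
  next
    case False
    then have "d t < 0" if "t \<in> {0..1}" "a t \<noteq> b t" for t using sgn[OF that] by (simp add: zero_less_mult_iff)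
    then show ?thesis unfolding strip_def d_def by (intro disjI2) auto
  qed
qed

lemma arc_pair:
  assumes "double_arc F M i a b"
  shows "(a (1/2), b (1/2)) \<in> strip a b" "a (1/2) \<noteq> b (1/2)"
  using assms unfolding double_arc_def open_double_arc_def closed_double_arc_def strip_def by auto

text \<open>Going once around exchanges the two points and would thus reverse the sign of their
  height difference.\<close>

lemma lifting_no_nontrivial:
  assumes "lifting F M i h"
  shows "no_nontrivial_closed_double_arcs F M i"
  unfolding no_nontrivial_closed_double_arcs_def
proof
  assume "\<exists>a b. nontrivial_closed_double_arc F M i a b"
  then obtain a b where ab: "closed_double_arc F M i a b" "a 1 = b 0" "b 1 = a 0"
    unfolding nontrivial_closed_double_arc_def by blast
  have arc: "double_arc F M i a b" using ab(1) by (simp add: double_arc_def)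
  have ne: "a 0 \<noteq> b 0" using ab(1) unfolding closed_double_arc_def by auto
  have m: "(a 0, b 0) \<in> strip a b" "(b 0, a 0) \<in> strip a b"
    using ab(2,3) unfolding strip_def by (auto intro: image_eqI[of _ _ 0] image_eqI[of _ _ 1])
  show False using lifting_arc_sign[OF assms arc]
  proof
    assume all: "\<forall>(x, y)\<in>strip a b. x \<noteq> y \<longrightarrow> h y < h x"
    show False using bspec[OF all m(1)] bspec[OF all m(2)] ne by simp
  next
    assume all: "\<forall>(x, y)\<in>strip a b. x \<noteq> y \<longrightarrow> h x < h y"
    show False using bspec[OF all m(1)] bspec[OF all m(2)] ne by simp
  qed
qed

lemma lifting_attempt_of_lifting:
  assumes h: "lifting F M i h"
  shows "\<exists>\<A>. lifting_attempt F M i \<A> \<and> realizes h \<A>"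
proof -
  define up where "up = (\<lambda>S. \<forall>(x, y)\<in>S. x \<noteq> y \<longrightarrow> h y < h x)"
  define \<A> where "\<A> = {strip a b | a b. double_arc F M i a b \<and> up (strip a b)}"
  have mem: "strip a b \<in> \<A> \<longleftrightarrow> up (strip a b)" if "double_arc F M i a b" for a b
    unfolding \<A>_def using that by auto
  have "strip a b \<in> \<A> \<longleftrightarrow> strip b a \<notin> \<A>" if arc: "double_arc F M i a b" for a b
  proof -
    have sw: "up (strip b a) \<longleftrightarrow> (\<forall>(x, y)\<in>strip a b. x \<noteq> y \<longrightarrow> h x < h y)" unfolding up_def strip_def by auto
    have "up (strip a b) \<or> up (strip b a)" using lifting_arc_sign[OF h arc] unfolding sw unfolding up_def .
    moreover have "\<not> (up (strip a b) \<and> up (strip b a))"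
    proof
      assume both: "up (strip a b) \<and> up (strip b a)"
      have upD: "h y < h x" if "up S" "(x, y) \<in> S" "x \<noteq> y" for S x y using that unfolding up_def by fastforce
      have "(b (1/2), a (1/2)) \<in> strip b a" unfolding strip_def by auto
      then have "h (b (1/2)) < h (a (1/2))" "h (a (1/2)) < h (b (1/2))"
        using upD[OF conjunct1[OF both]] upD[OF conjunct2[OF both]] arc_pair[OF arc] by metis+
      then show False by simp
    qed
    ultimately have "up (strip a b) \<or> up (strip b a)" "\<not> (up (strip a b) \<and> up (strip b a))" by simp_all
    then show ?thesis using mem[OF arc] mem[OF double_arc_swap[OF arc]] by blast
  qed
  then have "lifting_attempt F M i \<A>" unfolding lifting_attempt_def \<A>_def by blast
  moreover have "up S" if "S \<in> \<A>" for S using that unfolding \<A>_def by auto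
  then have "realizes h \<A>" unfolding realizes_def up_def by simp
  ultimately show ?thesis by blast
qed

lemma realized_not_cyclic:
  assumes "realizes h \<A>"
  shows "\<not> cyclic_height_relation F M i \<A> p"
proof
  assume "cyclic_height_relation F M i \<A> p"
  then obtain x y z where "distinct [x, y, z]" "declared_higher \<A> y x" "declared_higher \<A> z y" "declared_higher \<A> x z"
    unfolding cyclic_height_relation_def by blast
  moreover have "h v < h u" if d: "declared_higher \<A> u v" "u \<noteq> v" for u v
  proof -
    obtain S where "S \<in> \<A>" "(u, v) \<in> S" using d(1) unfolding declared_higher_def by blast
    then show ?thesis using assms d(2) unfolding realizes_def by fastforce
  qed
  ultimately have "h x < h y" "h y < h z" "h z < h x" by auto
  then show False by simp
qed

lemma successful_attempt:
  assumes nt: "no_nontrivial_closed_double_arcs F M i" and att: "lifting_attempt F M i \<A>"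
    and nocyc: "\<not> (\<exists>p. triple_value F M i p \<and> cyclic_height_relation F M i \<A> p)"
  shows "successful F M i \<A>"
proof -
  have "\<exists>h. pl_on h F \<and> (\<forall>z\<in>pairs. declared_higher \<A> (fst z) (snd z) \<longrightarrow> h (snd z) < h (fst z)) \<and>
    (\<forall>p. branch_value F M i p \<longrightarrow> (\<exists>N f g r e s. branch_core p N f g r \<and> 0 < e \<and> e \<le> r \<and> (s = 1 \<or> s = -1) \<and>
      (\<forall>x\<in>nbd N f r. f (i x) \<in> ocube e \<longrightarrow> h x = s * ucoord N f x)))"
  \<comment> \<open>The empty surface has no bumps to be summed; a constant height does.\<close>
  proof (cases "F = {}")
    case True
    then have "\<not> branch_value F M i p" for p unfolding branch_value_def by auto
    moreover have "pairs = {}" unfolding pairs_def using True by simp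
    moreover have "pl_on (\<lambda>_. 0 :: real) F" using True by (simp add: pl_on_def)
    ultimately show ?thesis by (intro exI[of _ "\<lambda>_. 0"]) simp
  qed (rule ex_height[OF nt att nocyc])
  then obtain h where h: "pl_on h F" "\<And>z. z \<in> pairs \<Longrightarrow> declared_higher \<A> (fst z) (snd z) \<Longrightarrow> h (snd z) < h (fst z)"
    and br: "\<And>p. branch_value F M i p \<Longrightarrow> \<exists>N f g r e s. branch_core p N f g r \<and> 0 < e \<and> e \<le> r \<and> (s = 1 \<or> s = -1) \<and>
      (\<forall>x\<in>nbd N f r. f (i x) \<in> ocube e \<longrightarrow> h x = s * ucoord N f x)"
    by blast
  have "h (fst z) \<noteq> h (snd z)" if z: "z \<in> pairs" for z
    using declared_total[OF nt att z] h(2)[OF z] h(2)[OF pairs_swap[OF z]] by auto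
  then have "lifting F M i h" using height_lifting[OF h(1) _ br] by blast
  moreover have "realizes h \<A>"
    unfolding realizes_def
  proof (intro ballI, clarify)
    fix S x y assume a: "S \<in> \<A>" "(x, y) \<in> S" "x \<noteq> y"
    then have "declared_higher \<A> x y" unfolding declared_higher_def by blast
    then show "h y < h x" using h(2)[of "(x, y)"] declared_pair[OF nt att] a(3) by simp
  qed
  ultimately show ?thesis unfolding successful_def by blast
qed

end

theorem theorem3p2p5:
  fixes F :: "'b::euclidean_space set"
    and M :: "'a::euclidean_space set"
    and i :: "'b \<Rightarrow> 'a"
  assumes "generic_surface F M i"
  shows "(no_nontrivial_closed_double_arcs F M i \<longrightarrow>
            (\<forall>\<A>. lifting_attempt F M i \<A> \<longrightarrow>
               (successful F M i \<A> \<longleftrightarrow>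
                  \<not> (\<exists>p. triple_value F M i p \<and> cyclic_height_relation F M i \<A> p)))) \<and>
         (liftable F M i \<longleftrightarrow>
            no_nontrivial_closed_double_arcs F M i \<and>
            (\<exists>\<A>. lifting_attempt F M i \<A> \<and>
               \<not> (\<exists>p. triple_value F M i p \<and> cyclic_height_relation F M i \<A> p)))"
proof -
  interpret generic_map F M i by unfold_locales (rule assms)
  have one: "successful F M i \<A> \<longleftrightarrow> \<not> (\<exists>p. triple_value F M i p \<and> cyclic_height_relation F M i \<A> p)"
    if "no_nontrivial_closed_double_arcs F M i" "lifting_attempt F M i \<A>" for \<A>
    using successful_attempt[OF that] realized_not_cyclic unfolding successful_def by blast
  moreover have "liftable F M i \<longleftrightarrow>
            no_nontrivial_closed_double_arcs F M i \<and>
            (\<exists>\<A>. lifting_attempt F M i \<A> \<and>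
               \<not> (\<exists>p. triple_value F M i p \<and> cyclic_height_relation F M i \<A> p))"
  proof
    assume "liftable F M i"
    then obtain h where h: "lifting F M i h" unfolding liftable_def by blast
    obtain \<A> where "lifting_attempt F M i \<A>" "realizes h \<A>" using lifting_attempt_of_lifting[OF h] by blast
    then show "no_nontrivial_closed_double_arcs F M i \<and>
            (\<exists>\<A>. lifting_attempt F M i \<A> \<and>
               \<not> (\<exists>p. triple_value F M i p \<and> cyclic_height_relation F M i \<A> p))"
      using lifting_no_nontrivial[OF h] realized_not_cyclic by blast
  next
    assume "no_nontrivial_closed_double_arcs F M i \<and>
            (\<exists>\<A>. lifting_attempt F M i \<A> \<and>
               \<not> (\<exists>p. triple_value F M i p \<and> cyclic_height_relation F M i \<A> p))"
    then obtain \<A> where "successful F M i \<A>" using successful_attempt by blast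
    then show "liftable F M i" unfolding successful_def liftable_def by blast
  qed
  ultimately show ?thesis by blast
qed

end
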